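(* (a) There exists a Clifford inverse semigroup $S=\bigsqcup_{e\in E_S} S_e$ which has the weak containment property, although its reduced $C^*$-algebra $C^*_r(S)$ is not nuclear and not all the groups $S_e$, $e\in E_S$, are amenable. (b) There exists an inverse semigroup without zero element which is left amenable but does not have the weak containment property.
   Context: An inverse semigroup is a semigroup $S$ such that for every $s\in S$ there is a unique $s^*\in S$ with $ss^*s=s$ and $s^*ss^*=s^*$. $E_S$ denotes its set of idempotents. $S$ is a Clifford inverse semigroup if it is a disjoint union $S=\bigsqcup_{e\in E_S}S_e$ of groups (with $e$ the unit of $S_e$) and $E_S$ is contained in the center of $S$. A zero of $S$ is an element $0$ with $0s=0=s0$ for all $s\in S$. All semigroups are discrete. On $\ell^1(S)$ put $(f\star g)(t)=\sum_{uv=t}f(u)g(v)$ and $f^*(t)=\overline{f(t^* )}$; this is a Banach $*$-algebra and the full $C^*$-algebra $C^*(S)$ is its enveloping $C^*$-algebra. The left regular representation $\pi_2:S\to\mathcal B(\ell^2(S))$ is given by $\pi_2(t)\delta_u=\delta_{tu}$ if $t^*tu=u$ and $\pi_2(t)\delta_u=0$ otherwise. The reduced $C^*$-algebra $C^*_r(S)$ is the $C^*$-subalgebra of $\mathcal B(\ell^2(S))$ generated by $\pi_2(S)$, and $\pi_2$ also denotes the induced surjective homomorphism $C^*(S)\to C^*_r(S)$. $S$ has the weak containment property if $\pi_2:C^*(S)\to C^*_r(S)$ is injective (an isomorphism). $S$ is left amenable if there is a left invariant mean on $\ell^\infty(S)$, i.e. a state $m$ on $\ell^\infty(S)$ with $m(f(s\,\cdot))=m(f)$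 for all $f\in\ell^\infty(S)$, $s\in S$. *)

theory Defs
  imports "HOL-Analysis.Analysis" "HOL-Algebra.Group"
begin

section \<open>Inverse semigroups\<close>

definition semigroup_on :: "'a set \<Rightarrow> ('a \<Rightarrow> 'a \<Rightarrow> 'a) \<Rightarrow> bool" where
  "semigroup_on S mul \<longleftrightarrow>
     (\<forall>s\<in>S. \<forall>t\<in>S. mul s t \<in> S) \<and>
     (\<forall>s\<in>S. \<forall>t\<in>S. \<forall>u\<in>S. mul (mul s t) u = mul s (mul t u))"

definition inverse_semigroup :: "'a set \<Rightarrow> ('a \<Rightarrow> 'a \<Rightarrow> 'a) \<Rightarrow> bool" where
  "inverse_semigroup S mul \<longleftrightarrow>
     semigroup_on S mul \<and>
     (\<forall>s\<in>S. \<exists>!t. t \<in> S \<and> mul (mul s t) s = s \<and> mul (mul t s) t = t)"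

definition star :: "'a set \<Rightarrow> ('a \<Rightarrow> 'a \<Rightarrow> 'a) \<Rightarrow> 'a \<Rightarrow> 'a" where
  "star S mul s = (THE t. t \<in> S \<and> mul (mul s t) s = s \<and> mul (mul t s) t = t)"

definition idempotents :: "'a set \<Rightarrow> ('a \<Rightarrow> 'a \<Rightarrow> 'a) \<Rightarrow> 'a set" where
  "idempotents S mul = {e \<in> S. mul e e = e}"

definition group_on :: "'a set \<Rightarrow> ('a \<Rightarrow> 'a \<Rightarrow> 'a) \<Rightarrow> 'a \<Rightarrow> bool" where
  "group_on G mul e \<longleftrightarrow> Group.group \<lparr>carrier = G, monoid.mult = mul, one = e\<rparr>"

definition clifford_inverse_semigroup ::
    "'a set \<Rightarrow> ('a \<Rightarrow> 'a \<Rightarrow> 'a) \<Rightarrow> ('a \<Rightarrow> 'a set) \<Rightarrow> bool" where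
  "clifford_inverse_semigroup S mul G \<longleftrightarrow>
     inverse_semigroup S mul \<and>
     S = (\<Union>e\<in>idempotents S mul. G e) \<and>
     disjoint_family_on G (idempotents S mul) \<and>
     (\<forall>e\<in>idempotents S mul. group_on (G e) mul e) \<and>
     (\<forall>e\<in>idempotents S mul. \<forall>s\<in>S. mul e s = mul s e)"

definition has_zero :: "'a set \<Rightarrow> ('a \<Rightarrow> 'a \<Rightarrow> 'a) \<Rightarrow> bool" where
  "has_zero S mul \<longleftrightarrow> (\<exists>z\<in>S. \<forall>s\<in>S. mul z s = z \<and> mul s z = z)"


section \<open>Left amenability\<close>

text \<open>Functions on a set \<open>S\<close> are represented by functions on the ambient type that vanish
  off \<open>S\<close>. The same convention is used for the spaces \<open>\<ell>\<^sup>1(S)\<close> and \<open>\<ell>\<^sup>2(S)\<close> below.\<close>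

definition linf :: "'a set \<Rightarrow> ('a \<Rightarrow> complex) set" where
  "linf S = {f. (\<forall>s. s \<notin> S \<longrightarrow> f s = 0) \<and> bounded (f ` S)}"

definition state_linf :: "'a set \<Rightarrow> (('a \<Rightarrow> complex) \<Rightarrow> complex) \<Rightarrow> bool" where
  "state_linf S m \<longleftrightarrow>
     (\<forall>f\<in>linf S. \<forall>g\<in>linf S. m (\<lambda>s. f s + g s) = m f + m g) \<and>
     (\<forall>f\<in>linf S. \<forall>c. m (\<lambda>s. c * f s) = c * m f) \<and>
     (\<forall>f\<in>linf S. (\<forall>s\<in>S. f s \<in> \<real> \<and> 0 \<le> Re (f s)) \<longrightarrow> m f \<in> \<real> \<and> 0 \<le> Re (m f)) \<and>
     m (indicator S) = 1"

definition left_translate ::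
    "'a set \<Rightarrow> ('a \<Rightarrow> 'a \<Rightarrow> 'a) \<Rightarrow> 'a \<Rightarrow> ('a \<Rightarrow> complex) \<Rightarrow> 'a \<Rightarrow> complex" where
  "left_translate S mul s f = (\<lambda>t. if t \<in> S then f (mul s t) else 0)"

definition left_amenable :: "'a set \<Rightarrow> ('a \<Rightarrow> 'a \<Rightarrow> 'a) \<Rightarrow> bool" where
  "left_amenable S mul \<longleftrightarrow>
     (\<exists>m. state_linf S m \<and> (\<forall>f\<in>linf S. \<forall>s\<in>S. m (left_translate S mul s f) = m f))"


section \<open>Bounded operators on \<open>\<ell>\<^sup>2(I)\<close>\<close>

definition ell2 :: "'i set \<Rightarrow> ('i \<Rightarrow> complex) set" where
  "ell2 I = {x. (\<forall>i. i \<notin> I \<longrightarrow> x i = 0) \<and> (\<lambda>i. (cmod (x i))\<^sup>2) summable_on I}"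

definition ell2_norm :: "'i set \<Rightarrow> ('i \<Rightarrow> complex) \<Rightarrow> real" where
  "ell2_norm I x = sqrt (\<Sum>\<^sub>\<infinity>i\<in>I. (cmod (x i))\<^sup>2)"

definition ell2_inner :: "'i set \<Rightarrow> ('i \<Rightarrow> complex) \<Rightarrow> ('i \<Rightarrow> complex) \<Rightarrow> complex" where
  "ell2_inner I x y = (\<Sum>\<^sub>\<infinity>i\<in>I. x i * cnj (y i))"

type_synonym 'i oper = "('i \<Rightarrow> complex) \<Rightarrow> ('i \<Rightarrow> complex)"

text \<open>Operators are set to zero off \<open>ell2 I\<close>, so that equality of operators is equality
  in HOL.\<close>

definition bop :: "'i set \<Rightarrow> 'i oper set" where
  "bop I = {T.
     (\<forall>x\<in>ell2 I. T x \<in> ell2 I) \<and>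
     (\<forall>x\<in>ell2 I. \<forall>y\<in>ell2 I. T (\<lambda>i. x i + y i) = (\<lambda>i. T x i + T y i)) \<and>
     (\<forall>x\<in>ell2 I. \<forall>c. T (\<lambda>i. c * x i) = (\<lambda>i. c * T x i)) \<and>
     (\<exists>K. \<forall>x\<in>ell2 I. ell2_norm I (T x) \<le> K * ell2_norm I x) \<and>
     (\<forall>x. x \<notin> ell2 I \<longrightarrow> T x = (\<lambda>_. 0))}"

definition op_add :: "'i oper \<Rightarrow> 'i oper \<Rightarrow> 'i oper" where
  "op_add T U = (\<lambda>x i. T x i + U x i)"

definition op_diff :: "'i oper \<Rightarrow> 'i oper \<Rightarrow> 'i oper" where
  "op_diff T U = (\<lambda>x i. T x i - U x i)"

definition op_scale :: "complex \<Rightarrow> 'i oper \<Rightarrow> 'i oper" where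
  "op_scale c T = (\<lambda>x i. c * T x i)"

definition op_norm :: "'i set \<Rightarrow> 'i oper \<Rightarrow> real" where
  "op_norm I T = (SUP x\<in>{x \<in> ell2 I. ell2_norm I x \<le> 1}. ell2_norm I (T x))"

definition is_adjoint :: "'i set \<Rightarrow> 'i oper \<Rightarrow> 'i oper \<Rightarrow> bool" where
  "is_adjoint I T T' \<longleftrightarrow>
     (\<forall>x\<in>ell2 I. \<forall>y\<in>ell2 I. ell2_inner I (T x) y = ell2_inner I x (T' y))"

definition cstar_subalgebra :: "'i set \<Rightarrow> 'i oper set \<Rightarrow> bool" where
  "cstar_subalgebra I A \<longleftrightarrow>
     A \<subseteq> bop I \<and>
     (\<lambda>x i. 0) \<in> A \<and>
     (\<forall>T\<in>A. \<forall>U\<in>A. op_add T U \<in> A) \<and>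
     (\<forall>T\<in>A. \<forall>c. op_scale c T \<in> A) \<and>
     (\<forall>T\<in>A. \<forall>U\<in>A. T \<circ> U \<in> A) \<and>
     (\<forall>T\<in>A. \<forall>T'\<in>bop I. is_adjoint I T T' \<longrightarrow> T' \<in> A) \<and>
     (\<forall>F. \<forall>T\<in>bop I. (\<forall>n. F n \<in> A) \<longrightarrow>
        (\<lambda>n::nat. op_norm I (op_diff (F n) T)) \<longlonglongrightarrow> 0 \<longrightarrow> T \<in> A)"

definition cstar_generated :: "'i set \<Rightarrow> 'i oper set \<Rightarrow> 'i oper set" where
  "cstar_generated I X = \<Inter>{A. cstar_subalgebra I A \<and> X \<subseteq> A}"


section \<open>Nuclearity\<close>

text \<open>Positivity of the \<open>m \<times> m\<close> operator matrix \<open>a\<close>, acting on the \<open>m\<close>-fold direct sum of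
  \<open>ell2 I\<close>. It agrees with positivity in the matrix algebra over any C*-subalgebra
  containing the entries.\<close>

definition pos_matrix :: "'i set \<Rightarrow> nat \<Rightarrow> (nat \<Rightarrow> nat \<Rightarrow> 'i oper) \<Rightarrow> bool" where
  "pos_matrix I m a \<longleftrightarrow>
     (\<forall>x. (\<forall>i<m. x i \<in> ell2 I) \<longrightarrow>
        (let q = (\<Sum>i<m. \<Sum>j<m. ell2_inner I (a i j (x j)) (x i))
         in q \<in> \<real> \<and> 0 \<le> Re q))"

definition cpc_map ::
    "'i set \<Rightarrow> 'i oper set \<Rightarrow> 'j set \<Rightarrow> 'j oper set \<Rightarrow> ('i oper \<Rightarrow> 'j oper) \<Rightarrow> bool" where
  "cpc_map I A J B \<phi> \<longleftrightarrow>
     (\<forall>T\<in>A. \<phi> T \<in> B) \<and>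
     (\<forall>T\<in>A. \<forall>U\<in>A. \<phi> (op_add T U) = op_add (\<phi> T) (\<phi> U)) \<and>
     (\<forall>T\<in>A. \<forall>c. \<phi> (op_scale c T) = op_scale c (\<phi> T)) \<and>
     (\<forall>T\<in>A. op_norm J (\<phi> T) \<le> op_norm I T) \<and>
     (\<forall>m a. (\<forall>i<m. \<forall>j<m. a i j \<in> A) \<longrightarrow> pos_matrix I m a \<longrightarrow>
        pos_matrix J m (\<lambda>i j. \<phi> (a i j)))"

text \<open>Nuclearity in the form of Brown and Ozawa: the identity map is a point-norm limit of
  contractive completely positive maps factoring through full matrix algebras. The algebra
  of complex \<open>n \<times> n\<close> matrices is \<open>bop {..<n}\<close>.\<close>

definition nuclear :: "'i set \<Rightarrow> 'i oper set \<Rightarrow> bool" where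
  "nuclear I A \<longleftrightarrow>
     (\<forall>F \<epsilon>. finite F \<longrightarrow> F \<subseteq> A \<longrightarrow> 0 < \<epsilon> \<longrightarrow>
        (\<exists>(n::nat) \<phi> \<psi>.
           cpc_map I A {..<n} (bop {..<n}) \<phi> \<and>
           cpc_map {..<n} (bop {..<n}) I A \<psi> \<and>
           (\<forall>T\<in>F. op_norm I (op_diff (\<psi> (\<phi> T)) T) < \<epsilon>)))"


section \<open>The Banach *-algebra \<open>\<ell>\<^sup>1(S)\<close> and its enveloping C*-algebra\<close>

definition ell1 :: "'a set \<Rightarrow> ('a \<Rightarrow> complex) set" where
  "ell1 S = {f. (\<forall>s. s \<notin> S \<longrightarrow> f s = 0) \<and> (\<lambda>s. cmod (f s)) summable_on S}"

definition ell1_norm :: "'a set \<Rightarrow> ('a \<Rightarrow> complex) \<Rightarrow> real" where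
  "ell1_norm S f = (\<Sum>\<^sub>\<infinity>s\<in>S. cmod (f s))"

definition conv ::
    "'a set \<Rightarrow> ('a \<Rightarrow> 'a \<Rightarrow> 'a) \<Rightarrow> ('a \<Rightarrow> complex) \<Rightarrow> ('a \<Rightarrow> complex) \<Rightarrow> 'a \<Rightarrow> complex" where
  "conv S mul f g = (\<lambda>t. \<Sum>\<^sub>\<infinity>(u, v)\<in>{(u, v). u \<in> S \<and> v \<in> S \<and> mul u v = t}. f u * g v)"

definition invol ::
    "'a set \<Rightarrow> ('a \<Rightarrow> 'a \<Rightarrow> 'a) \<Rightarrow> ('a \<Rightarrow> complex) \<Rightarrow> 'a \<Rightarrow> complex" where
  "invol S mul f = (\<lambda>t. if t \<in> S then cnj (f (star S mul t)) else 0)"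

text \<open>Contractivity (the last clause) is automatic for *-homomorphisms from a Banach
  *-algebra to bounded operators; it is included so that the supremum in \<open>full_norm\<close> is
  visibly that of a bounded set.\<close>

definition star_rep ::
    "'a set \<Rightarrow> ('a \<Rightarrow> 'a \<Rightarrow> 'a) \<Rightarrow> 'i set \<Rightarrow> (('a \<Rightarrow> complex) \<Rightarrow> 'i oper) \<Rightarrow> bool" where
  "star_rep S mul I \<pi> \<longleftrightarrow>
     (\<forall>f\<in>ell1 S. \<pi> f \<in> bop I) \<and>
     (\<forall>f\<in>ell1 S. \<forall>g\<in>ell1 S. \<pi> (\<lambda>s. f s + g s) = op_add (\<pi> f) (\<pi> g)) \<and>
     (\<forall>f\<in>ell1 S. \<forall>c. \<pi> (\<lambda>s. c * f s) = op_scale c (\<pi> f)) \<and>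
     (\<forall>f\<in>ell1 S. \<forall>g\<in>ell1 S. \<pi> (conv S mul f g) = \<pi> f \<circ> \<pi> g) \<and>
     (\<forall>f\<in>ell1 S. is_adjoint I (\<pi> f) (\<pi> (invol S mul f))) \<and>
     (\<forall>f\<in>ell1 S. op_norm I (\<pi> f) \<le> ell1_norm S f)"

text \<open>The enveloping C*-norm is the supremum over all *-representations on Hilbert spaces.
  Every such representation is a direct sum of a zero representation and of cyclic ones. A
  cyclic one acts on a Hilbert space whose dimension is at most the cardinality of
  \<open>'a \<times> nat\<close>, so it embeds, as a possibly degenerate representation, into one on
  \<open>\<ell>\<^sup>2('a \<times> nat)\<close>. Hence the single Hilbert space below yields the same supremum.\<close>

definition full_norm :: "'a set \<Rightarrow> ('a \<Rightarrow> 'a \<Rightarrow> 'a) \<Rightarrow> ('a \<Rightarrow> complex) \<Rightarrow> real" where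
  "full_norm S mul f =
     (SUP \<pi>\<in>{\<pi>. star_rep S mul (UNIV :: ('a \<times> nat) set) \<pi>}.
        op_norm (UNIV :: ('a \<times> nat) set) (\<pi> f))"

text \<open>The full C*-algebra is the Hausdorff completion of \<open>\<ell>\<^sup>1(S)\<close> for this seminorm:
  Cauchy sequences modulo null sequences.\<close>

definition full_Cauchy :: "'a set \<Rightarrow> ('a \<Rightarrow> 'a \<Rightarrow> 'a) \<Rightarrow> (nat \<Rightarrow> 'a \<Rightarrow> complex) set" where
  "full_Cauchy S mul =
     {F. (\<forall>n. F n \<in> ell1 S) \<and>
         (\<forall>\<epsilon>>0. \<exists>N. \<forall>m\<ge>N. \<forall>n\<ge>N. full_norm S mul (\<lambda>s. F m s - F n s) < \<epsilon>)}"

definition full_equiv ::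
    "'a set \<Rightarrow> ('a \<Rightarrow> 'a \<Rightarrow> 'a) \<Rightarrow> ((nat \<Rightarrow> 'a \<Rightarrow> complex) \<times> (nat \<Rightarrow> 'a \<Rightarrow> complex)) set" where
  "full_equiv S mul =
     {(F, H). F \<in> full_Cauchy S mul \<and> H \<in> full_Cauchy S mul \<and>
        (\<lambda>n. full_norm S mul (\<lambda>s. F n s - H n s)) \<longlonglongrightarrow> 0}"

definition full_cstar ::
    "'a set \<Rightarrow> ('a \<Rightarrow> 'a \<Rightarrow> 'a) \<Rightarrow> (nat \<Rightarrow> 'a \<Rightarrow> complex) set set" where
  "full_cstar S mul = full_Cauchy S mul // full_equiv S mul"


section \<open>The left regular representation and weak containment\<close>

definition delta :: "'a \<Rightarrow> 'a \<Rightarrow> complex" where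
  "delta u = (\<lambda>v. if v = u then 1 else 0)"

definition lreg_basis :: "'a set \<Rightarrow> ('a \<Rightarrow> 'a \<Rightarrow> 'a) \<Rightarrow> 'a \<Rightarrow> 'a \<Rightarrow> 'a \<Rightarrow> complex" where
  "lreg_basis S mul t u =
     (if mul (mul (star S mul t) t) u = u then delta (mul t u) else (\<lambda>_. 0))"

text \<open>The bounded operator with the values \<open>lreg_basis\<close> on the canonical basis. For fixed
  \<open>t\<close> and \<open>v\<close> at most one term of the sum is nonzero, namely the one for \<open>u = t* v\<close>.\<close>

definition lreg :: "'a set \<Rightarrow> ('a \<Rightarrow> 'a \<Rightarrow> 'a) \<Rightarrow> 'a \<Rightarrow> 'a oper" where
  "lreg S mul t = (\<lambda>x. if x \<in> ell2 S
     then (\<lambda>v. \<Sum>\<^sub>\<infinity>u\<in>S. x u * lreg_basis S mul t u v) else (\<lambda>_. 0))"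

definition lreg_ell1 ::
    "'a set \<Rightarrow> ('a \<Rightarrow> 'a \<Rightarrow> 'a) \<Rightarrow> ('a \<Rightarrow> complex) \<Rightarrow> 'a oper" where
  "lreg_ell1 S mul f = (\<lambda>x v. \<Sum>\<^sub>\<infinity>t\<in>S. f t * lreg S mul t x v)"

definition reduced_cstar :: "'a set \<Rightarrow> ('a \<Rightarrow> 'a \<Rightarrow> 'a) \<Rightarrow> 'a oper set" where
  "reduced_cstar S mul = cstar_generated S (lreg S mul ` S)"

text \<open>The homomorphism induced by \<open>lreg_ell1\<close> on the completion, by continuity.\<close>

definition lreg_full ::
    "'a set \<Rightarrow> ('a \<Rightarrow> 'a \<Rightarrow> 'a) \<Rightarrow> (nat \<Rightarrow> 'a \<Rightarrow> complex) set \<Rightarrow> 'a oper" where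
  "lreg_full S mul X =
     (THE T. T \<in> bop S \<and>
        (\<forall>F\<in>X. (\<lambda>n. op_norm S (op_diff (lreg_ell1 S mul (F n)) T)) \<longlonglongrightarrow> 0))"

definition weak_containment :: "'a set \<Rightarrow> ('a \<Rightarrow> 'a \<Rightarrow> 'a) \<Rightarrow> bool" where
  "weak_containment S mul \<longleftrightarrow> inj_on (lreg_full S mul) (full_cstar S mul)"

end

theory Submission
  imports Defs "HOL-Library.Nat_Bijection" "HOL-Computational_Algebra.Polynomial"
begin

text \<open>Let \<open>\<Gamma>\<close> be the free product of five groups of order two. Below \<open>\<Gamma>\<close>, as the top group of a
  Clifford semigroup over a chain of idempotents, one places finite quotients of \<open>\<Gamma>\<close>.

  For (b) a single quotient of order two suffices: a finite group as minimal ideal makes the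
  semigroup left amenable. If \<open>e\<close> is the lower idempotent, the average of the generators times
  \<open>1 - e\<close> acts in the regular representation as on \<open>\<ell>\<^sup>2(\<Gamma>)\<close>, with norm at most \<open>4/5\<close>, but the
  trivial character of \<open>\<Gamma>\<close>, extended by zero, sends it to \<open>1\<close>.

  For (a) the \<open>n\<close>-th quotient is the image of \<open>\<Gamma>\<close> under all its actions by permutations of
  \<open>n\<close> points. Consecutive idempotents split every representation into representations of the
  finite quotients, which their regular representations dominate, and one of \<open>\<Gamma>\<close> itself.
  The latter is approximated by finite permutation representations, because unitary
  involutions of a finite-dimensional space are close to permutations of lattice points in a
  large ball; these factor through the finite quotients of large index. So weak containment
  holds although \<open>\<Gamma>\<close> is not amenable.\<close>

section \<open>The Hilbert space and its operators\<close>

text \<open>For d >= 2 generators of order two the sum of the generators has norm 2 sqrt(d - 1) on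
  the group. The first nonamenable case in which this is rational is d = 5: the norm is 4, and the
  Schur weight is a power of 1/2. That unequal norms on l1(S) destroy injectivity on the completion
  is a theorem on C*-algebras. In (b) it is bypassed by a concrete kernel element: polynomials in
  the square of a self-adjoint element, approximating a function that vanishes on its spectrum in
  the regular representation but not at 1. Moments and Bernstein polynomials replace the spectral
  theorem. In (a) finitely supported f suffice. Such an f meets finitely many levels, and on any
  larger level only its elements from the top group act; the others act as zero there. So the finite
  quotients see the top part of f in isolation, although they lie below it. Bounding that part needs
  only the Gram matrix of a finite piece of one orbit, hence finite-dimensional geometry.
  Non-nuclearity is read off the approximating maps themselves, not deduced from nonamenability of
  the group.\<close>

lemma ell2_intro:
  assumes "\<And>i. i \<notin> I \<Longrightarrow> x i = 0"
    and "\<And>A. finite A \<Longrightarrow> A \<subseteq> I \<Longrightarrow> L2_set (\<lambda>i. cmod (x i)) A \<le> B"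
  shows "x \<in> ell2 I" "ell2_norm I x \<le> B"
proof -
  have B0: "0 \<le> B" using assms(2)[of "{}"] by simp
  have *: "(\<Sum>i\<in>A. (cmod (x i))\<^sup>2) \<le> B\<^sup>2" if "finite A" "A \<subseteq> I" for A
  proof -
    have "sqrt (\<Sum>i\<in>A. (cmod (x i))\<^sup>2) \<le> B"
      using assms(2)[OF that] by (simp add: L2_set_def)
    then show ?thesis using real_sqrt_le_iff[of "\<Sum>i\<in>A. (cmod (x i))\<^sup>2" "B\<^sup>2"] B0 by simp
  qed
  have s: "(\<lambda>i. (cmod (x i))\<^sup>2) summable_on I"
    by (rule nonneg_bdd_above_summable_on) (auto intro!: bdd_aboveI[where M = "B\<^sup>2"] *)
  then show "x \<in> ell2 I" using assms(1) by (simp add: ell2_def)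
  have "(\<Sum>\<^sub>\<infinity>i\<in>I. (cmod (x i))\<^sup>2) \<le> B\<^sup>2"
    by (rule infsum_le_finite_sums[OF s]) (auto intro: *)
  then show "ell2_norm I x \<le> B"
    unfolding ell2_norm_def using B0 by (simp add: real_le_lsqrt)
qed

lemma ell2_norm_nonneg [simp]: "0 \<le> ell2_norm I x"
  by (simp add: ell2_norm_def infsum_nonneg)

lemma ell2_finite_le:
  assumes "x \<in> ell2 I" "finite A" "A \<subseteq> I"
  shows "L2_set (\<lambda>i. cmod (x i)) A \<le> ell2_norm I x"
  unfolding ell2_norm_def L2_set_def
  using assms by (intro real_sqrt_le_mono finite_sum_le_infsum) (auto simp: ell2_def)

lemma ell2_finite_sq_le:
  assumes "x \<in> ell2 I" "finite A" "A \<subseteq> I"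
  shows "(\<Sum>i\<in>A. (cmod (x i))\<^sup>2) \<le> (ell2_norm I x)\<^sup>2"
  using ell2_finite_le[OF assms] unfolding L2_set_def
  by (metis ell2_norm_nonneg real_sqrt_le_iff real_sqrt_unique)

lemma ell2_norm_sq: "(ell2_norm I x)\<^sup>2 = (\<Sum>\<^sub>\<infinity>i\<in>I. (cmod (x i))\<^sup>2)"
  by (simp add: ell2_norm_def infsum_nonneg)

lemma ell2_zero_off: "x \<in> ell2 I \<Longrightarrow> i \<notin> I \<Longrightarrow> x i = 0"
  by (simp add: ell2_def)

lemma ell2_add:
  assumes "x \<in> ell2 I" "y \<in> ell2 I"
  shows "(\<lambda>i. x i + y i) \<in> ell2 I"
    and "ell2_norm I (\<lambda>i. x i + y i) \<le> ell2_norm I x + ell2_norm I y"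
proof -
  have "L2_set (\<lambda>i. cmod (x i + y i)) A \<le> ell2_norm I x + ell2_norm I y"
    if "finite A" "A \<subseteq> I" for A
  proof -
    have "L2_set (\<lambda>i. cmod (x i + y i)) A \<le> L2_set (\<lambda>i. cmod (x i) + cmod (y i)) A"
      by (rule L2_set_mono) (auto intro: norm_triangle_ineq)
    also have "\<dots> \<le> L2_set (\<lambda>i. cmod (x i)) A + L2_set (\<lambda>i. cmod (y i)) A"
      by (rule L2_set_triangle_ineq)
    finally show ?thesis
      using ell2_finite_le[OF assms(1) that] ell2_finite_le[OF assms(2) that] by linarith
  qed
  note * = ell2_intro[of I "\<lambda>i. x i + y i", OF _ this]
  show "(\<lambda>i. x i + y i) \<in> ell2 I" "ell2_norm I (\<lambda>i. x i + y i) \<le> ell2_norm I x + ell2_norm I y"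
    by (rule *; use assms in \<open>simp add: ell2_def\<close>)+
qed

lemma ell2_zero [simp]: "(\<lambda>i. 0) \<in> ell2 I" "ell2_norm I (\<lambda>i. 0) = 0"
  by (auto simp: ell2_def ell2_norm_def)

lemma ell2_scale:
  assumes "x \<in> ell2 I"
  shows "(\<lambda>i. c * x i) \<in> ell2 I" "ell2_norm I (\<lambda>i. c * x i) = cmod c * ell2_norm I x"
proof -
  have s: "(\<lambda>i. (cmod (x i))\<^sup>2) summable_on I" using assms by (simp add: ell2_def)
  have eq: "(cmod (c * x i))\<^sup>2 = (cmod c)\<^sup>2 * (cmod (x i))\<^sup>2" for i
    by (simp add: norm_mult power_mult_distrib)
  show "(\<lambda>i. c * x i) \<in> ell2 I"
    using assms summable_on_cmult_right[OF s, of "(cmod c)\<^sup>2"] by (simp add: ell2_def eq)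
  show "ell2_norm I (\<lambda>i. c * x i) = cmod c * ell2_norm I x"
    unfolding ell2_norm_def eq
    by (subst infsum_cmult_right) (auto simp: s real_sqrt_mult)
qed

lemma ell2_diff:
  assumes "x \<in> ell2 I" "y \<in> ell2 I"
  shows "(\<lambda>i. x i - y i) \<in> ell2 I"
    and "ell2_norm I (\<lambda>i. x i - y i) \<le> ell2_norm I x + ell2_norm I y"
  using ell2_add[OF assms(1) ell2_scale(1)[OF assms(2), of "-1"]] ell2_scale(2)[OF assms(2), of "-1"]
  by simp_all

lemma ell2_norm_minus_commute:
  "ell2_norm I (\<lambda>i. x i - y i) = ell2_norm I (\<lambda>i. y i - x i)"
  by (simp add: ell2_norm_def norm_minus_commute)

lemma ell2_sum:
  assumes "\<And>k. k \<in> K \<Longrightarrow> x k \<in> ell2 I"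
  shows "(\<lambda>i. \<Sum>k\<in>K. x k i) \<in> ell2 I"
    and "ell2_norm I (\<lambda>i. \<Sum>k\<in>K. x k i) \<le> (\<Sum>k\<in>K. ell2_norm I (x k))"
proof -
  have "(\<lambda>i. \<Sum>k\<in>K. x k i) \<in> ell2 I \<and> ell2_norm I (\<lambda>i. \<Sum>k\<in>K. x k i) \<le> (\<Sum>k\<in>K. ell2_norm I (x k))"
    if "finite K" using that assms
  proof (induction K rule: finite_induct)
    case (insert a K)
    have *: "(\<lambda>i. \<Sum>k\<in>K. x k i) \<in> ell2 I" "ell2_norm I (\<lambda>i. \<Sum>k\<in>K. x k i) \<le> (\<Sum>k\<in>K. ell2_norm I (x k))"
      using insert by auto
    from ell2_add[OF _ *(1), of "x a"] insert * show ?case by force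
  qed auto
  then show "(\<lambda>i. \<Sum>k\<in>K. x k i) \<in> ell2 I" "ell2_norm I (\<lambda>i. \<Sum>k\<in>K. x k i) \<le> (\<Sum>k\<in>K. ell2_norm I (x k))"
    by (cases "finite K"; simp)+
qed

lemma ell2_coord_le: "x \<in> ell2 I \<Longrightarrow> cmod (x i) \<le> ell2_norm I x"
  using ell2_finite_le[of x I "{i}"] by (cases "i \<in> I") (auto simp: ell2_zero_off)

lemma ell2_norm_eq_0: "x \<in> ell2 I \<Longrightarrow> ell2_norm I x = 0 \<longleftrightarrow> x = (\<lambda>i. 0)"
  using ell2_coord_le[of x I] by auto

lemma ell2_finite: 
  assumes "finite A" "A \<subseteq> I" "\<And>i. i \<notin> A \<Longrightarrow> x i = 0"
  shows "x \<in> ell2 I" "(ell2_norm I x)\<^sup>2 = (\<Sum>i\<in>A. (cmod (x i))\<^sup>2)"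
proof -
  have h: "((\<lambda>i. (cmod (x i))\<^sup>2) has_sum (\<Sum>i\<in>A. (cmod (x i))\<^sup>2)) I"
    using assms by (intro has_sum_finite_neutralI) auto
  then show "x \<in> ell2 I" using assms by (auto simp: ell2_def has_sum_imp_summable)
  show "(ell2_norm I x)\<^sup>2 = (\<Sum>i\<in>A. (cmod (x i))\<^sup>2)"
    using h by (simp add: ell2_norm_sq infsumI)
qed

lemma delta_ell2 [simp]: "u \<in> I \<Longrightarrow> delta u \<in> ell2 I"
  by (rule ell2_finite[of "{u}"]) (auto simp: delta_def)

lemma delta_norm [simp]: "u \<in> I \<Longrightarrow> ell2_norm I (delta u) = 1"
proof -
  assume "u \<in> I"
  then have "(ell2_norm I (delta u))\<^sup>2 = 1"
    using ell2_finite(2)[of "{u}" I "delta u"] by (simp add: delta_def)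
  then show ?thesis using ell2_norm_nonneg[of I "delta u"] power2_eq_1_iff[of "ell2_norm I (delta u)"]
    by linarith
qed

lemma ell2_prod_summable:
  assumes "x \<in> ell2 I" "y \<in> ell2 I"
  shows "(\<lambda>i. norm (x i * cnj (y i))) summable_on I"
    and "(\<Sum>\<^sub>\<infinity>i\<in>I. norm (x i * cnj (y i))) \<le> ell2_norm I x * ell2_norm I y"
proof -
  have *: "(\<Sum>i\<in>A. norm (x i * cnj (y i))) \<le> ell2_norm I x * ell2_norm I y" if "finite A" "A \<subseteq> I" for A
  proof -
    have "(\<Sum>i\<in>A. norm (x i * cnj (y i))) \<le> L2_set (\<lambda>i. cmod (x i)) A * L2_set (\<lambda>i. cmod (y i)) A"
      using L2_set_mult_ineq[of "\<lambda>i. cmod (x i)" "\<lambda>i. cmod (y i)" A] by (simp add: norm_mult)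
    also have "\<dots> \<le> ell2_norm I x * ell2_norm I y"
      by (intro mult_mono ell2_finite_le assms that) auto
    finally show ?thesis .
  qed
  show s: "(\<lambda>i. norm (x i * cnj (y i))) summable_on I"
    by (rule nonneg_bdd_above_summable_on)
      (auto intro!: bdd_aboveI[where M = "ell2_norm I x * ell2_norm I y"] *)
  show "(\<Sum>\<^sub>\<infinity>i\<in>I. norm (x i * cnj (y i))) \<le> ell2_norm I x * ell2_norm I y"
    by (rule infsum_le_finite_sums[OF s]) (auto intro: *)
qed

lemma ell2_prod_summable': 
  assumes "x \<in> ell2 I" "y \<in> ell2 I"
  shows "(\<lambda>i. x i * cnj (y i)) summable_on I"
  using abs_summable_summable[OF ell2_prod_summable(1)[OF assms]] .

lemma ell2_cauchy_schwarz:
  assumes "x \<in> ell2 I" "y \<in> ell2 I"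
  shows "cmod (ell2_inner I x y) \<le> ell2_norm I x * ell2_norm I y"
  unfolding ell2_inner_def
  using norm_infsum_bound[OF ell2_prod_summable(1)[OF assms]] ell2_prod_summable(2)[OF assms]
  by linarith

lemma ell2_inner_add_left:
  assumes "x \<in> ell2 I" "y \<in> ell2 I" "z \<in> ell2 I"
  shows "ell2_inner I (\<lambda>i. x i + y i) z = ell2_inner I x z + ell2_inner I y z"
  unfolding ell2_inner_def
  by (simp add: distrib_right infsum_add ell2_prod_summable' assms)

lemma ell2_inner_scale_left: "ell2_inner I (\<lambda>i. c * x i) z = c * ell2_inner I x z"
  unfolding ell2_inner_def by (simp add: mult.assoc infsum_cmult_right')

lemma ell2_inner_cnj: "ell2_inner I x y = cnj (ell2_inner I y x)"
  unfolding ell2_inner_def by (subst infsum_cnj[symmetric]) (simp add: mult.commute)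

lemma ell2_inner_add_right:
  assumes "x \<in> ell2 I" "y \<in> ell2 I" "z \<in> ell2 I"
  shows "ell2_inner I z (\<lambda>i. x i + y i) = ell2_inner I z x + ell2_inner I z y"
  by (subst (1 2 3) ell2_inner_cnj) (simp add: ell2_inner_add_left assms)

lemma ell2_inner_scale_right: "ell2_inner I z (\<lambda>i. c * x i) = cnj c * ell2_inner I z x"
  by (subst (1 2) ell2_inner_cnj) (simp add: ell2_inner_scale_left)

lemma ell2_inner_diff_left:
  assumes "x \<in> ell2 I" "y \<in> ell2 I" "z \<in> ell2 I"
  shows "ell2_inner I (\<lambda>i. x i - y i) z = ell2_inner I x z - ell2_inner I y z"
  using ell2_inner_add_left[OF assms(1) ell2_scale(1)[OF assms(2), of "-1"] assms(3)]
    ell2_inner_scale_left[of I "-1" y z] by simp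

lemma ell2_inner_diff_right:
  assumes "x \<in> ell2 I" "y \<in> ell2 I" "z \<in> ell2 I"
  shows "ell2_inner I z (\<lambda>i. x i - y i) = ell2_inner I z x - ell2_inner I z y"
  by (subst (1 2 3) ell2_inner_cnj) (simp add: ell2_inner_diff_left assms)

lemma ell2_inner_zero [simp]: "ell2_inner I (\<lambda>i. 0) z = 0" "ell2_inner I z (\<lambda>i. 0) = 0"
  by (simp_all add: ell2_inner_def)

lemma ell2_inner_sum_left:
  assumes "\<And>k. k \<in> K \<Longrightarrow> x k \<in> ell2 I" "z \<in> ell2 I"
  shows "ell2_inner I (\<lambda>i. \<Sum>k\<in>K. x k i) z = (\<Sum>k\<in>K. ell2_inner I (x k) z)"
proof (cases "finite K")
  case True
  then show ?thesis using assms
    by (induction K rule: finite_induct) (simp_all add: ell2_inner_add_left ell2_sum(1))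
qed simp

lemma ell2_inner_sum_right:
  assumes "\<And>k. k \<in> K \<Longrightarrow> x k \<in> ell2 I" "z \<in> ell2 I"
  shows "ell2_inner I z (\<lambda>i. \<Sum>k\<in>K. x k i) = (\<Sum>k\<in>K. ell2_inner I z (x k))"
  by (subst (1 2) ell2_inner_cnj) (simp add: ell2_inner_sum_left assms)

lemma ell2_inner_self:
  assumes "x \<in> ell2 I"
  shows "ell2_inner I x x = of_real ((ell2_norm I x)\<^sup>2)"
proof -
  have "((\<lambda>i. (cmod (x i))\<^sup>2) has_sum ((ell2_norm I x)\<^sup>2)) I"
    unfolding ell2_norm_sq using assms by (intro has_sum_infsum) (simp add: ell2_def)
  from has_sum_of_real[OF this]
  have "((\<lambda>i. complex_of_real ((cmod (x i))\<^sup>2)) has_sum complex_of_real ((ell2_norm I x)\<^sup>2)) I" .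
  moreover have "complex_of_real ((cmod (x i))\<^sup>2) = x i * cnj (x i)" for i
    by (rule complex_norm_square)
  ultimately show ?thesis unfolding ell2_inner_def by (simp only: infsumI)
qed

lemma ell2_inner_delta:
  assumes "u \<in> I"
  shows "ell2_inner I x (delta u) = x u" "ell2_inner I (delta u) x = cnj (x u)"
proof -
  have "((\<lambda>i. x i * cnj (delta u i)) has_sum (\<Sum>i\<in>{u}. x i * cnj (delta u i))) I"
    using assms by (intro has_sum_finite_neutralI[of "{u}"]) (auto simp: delta_def)
  then show "ell2_inner I x (delta u) = x u" by (simp add: ell2_inner_def infsumI delta_def)
  then show "ell2_inner I (delta u) x = cnj (x u)" using ell2_inner_cnj[of I "delta u" x] by simp
qed

lemma ell2_norm_add_sq:
  assumes "x \<in> ell2 I" "y \<in> ell2 I"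
  shows "(ell2_norm I (\<lambda>i. x i + y i))\<^sup>2
      = (ell2_norm I x)\<^sup>2 + 2 * Re (ell2_inner I x y) + (ell2_norm I y)\<^sup>2"
proof -
  let ?z = "\<lambda>i. x i + y i"
  have z: "?z \<in> ell2 I" using ell2_add(1)[OF assms] .
  have "ell2_inner I ?z ?z = ell2_inner I x x + ell2_inner I x y + (ell2_inner I y x + ell2_inner I y y)"
    unfolding ell2_inner_add_left[OF assms z] ell2_inner_add_right[OF assms assms(1)]
      ell2_inner_add_right[OF assms assms(2)] ..
  then have "Re (ell2_inner I ?z ?z)
     = Re (ell2_inner I x x + ell2_inner I x y + (ell2_inner I y x + ell2_inner I y y))"
    by simp
  moreover have "Re (ell2_inner I y x) = Re (ell2_inner I x y)"
    using ell2_inner_cnj[of I y x] by simp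
  ultimately show ?thesis
    by (simp add: ell2_inner_self[OF z] ell2_inner_self[OF assms(1)] ell2_inner_self[OF assms(2)] del: of_real_power)
qed

lemma ell2_pythagoras:
  assumes "x \<in> ell2 I" "y \<in> ell2 I" "ell2_inner I x y = 0"
  shows "(ell2_norm I (\<lambda>i. x i + y i))\<^sup>2 = (ell2_norm I x)\<^sup>2 + (ell2_norm I y)\<^sup>2"
  by (simp add: ell2_norm_add_sq assms)


subsection \<open>Bounded operators\<close>

lemma bop_ell2: "T \<in> bop I \<Longrightarrow> x \<in> ell2 I \<Longrightarrow> T x \<in> ell2 I"
  by (simp add: bop_def)

lemma bop_add: "T \<in> bop I \<Longrightarrow> x \<in> ell2 I \<Longrightarrow> y \<in> ell2 I \<Longrightarrow> T (\<lambda>i. x i + y i) = (\<lambda>i. T x i + T y i)"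
  by (simp add: bop_def)

lemma bop_scale: "T \<in> bop I \<Longrightarrow> x \<in> ell2 I \<Longrightarrow> T (\<lambda>i. c * x i) = (\<lambda>i. c * T x i)"
  by (simp add: bop_def)

lemma bop_off: "T \<in> bop I \<Longrightarrow> x \<notin> ell2 I \<Longrightarrow> T x = (\<lambda>i. 0)"
  by (simp add: bop_def)

lemma bop_zero: "T \<in> bop I \<Longrightarrow> T (\<lambda>i. 0) = (\<lambda>i. 0)"
  using bop_scale[of T I "\<lambda>i. 0" 0] by simp

lemma bop_diff: "T \<in> bop I \<Longrightarrow> x \<in> ell2 I \<Longrightarrow> y \<in> ell2 I \<Longrightarrow> T (\<lambda>i. x i - y i) = (\<lambda>i. T x i - T y i)"
  using bop_add[of T I x "\<lambda>i. -1 * y i"] bop_scale[of T I y "-1"] ell2_scale(1)[of y I "-1"] by simp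

lemma bop_sum:
  assumes T: "T \<in> bop I" and "\<And>k. k \<in> K \<Longrightarrow> x k \<in> ell2 I"
  shows "T (\<lambda>i. \<Sum>k\<in>K. x k i) = (\<lambda>i. \<Sum>k\<in>K. T (x k) i)"
proof (cases "finite K")
  case True
  then show ?thesis using assms(2)
  proof (induction K rule: finite_induct)
    case (insert a K)
    then show ?case using bop_add[OF T, of "x a" "\<lambda>i. \<Sum>k\<in>K. x k i"] by (simp add: ell2_sum(1))
  qed (simp add: bop_zero[OF T])
qed (simp add: bop_zero[OF T])

text \<open>A real \<open>SUP\<close> carries no information over an unbounded set; the bounds by
  \<open>op_norm\<close> below rest on this.\<close>

lemma op_norm_bdd:
  assumes "T \<in> bop I"
  shows "bdd_above ((\<lambda>x. ell2_norm I (T x)) ` {x \<in> ell2 I. ell2_norm I x \<le> 1})"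
proof -
  obtain K where K: "\<And>x. x \<in> ell2 I \<Longrightarrow> ell2_norm I (T x) \<le> K * ell2_norm I x"
    using assms unfolding bop_def by blast
  show ?thesis
  \<comment> \<open>The constant in \<open>bop\<close> is not assumed nonnegative, hence the
    absolute value.\<close>
  proof (rule bdd_aboveI2[where M = "\<bar>K\<bar>"])
    fix x assume "x \<in> {x \<in> ell2 I. ell2_norm I x \<le> 1}"
    then have x: "x \<in> ell2 I" "ell2_norm I x \<le> 1" by auto
    have "ell2_norm I (T x) \<le> \<bar>K\<bar> * ell2_norm I x"
      using K[OF x(1)] mult_right_mono[OF abs_ge_self[of K] ell2_norm_nonneg[of I x]] by linarith
    moreover have "\<bar>K\<bar> * ell2_norm I x \<le> \<bar>K\<bar> * 1"
      by (rule mult_left_mono) (use x in auto)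
    ultimately
    show "ell2_norm I (T x) \<le> \<bar>K\<bar>" by simp
  qed
qed

lemma op_norm_nonneg [simp]: "T \<in> bop I \<Longrightarrow> 0 \<le> op_norm I T"
  unfolding op_norm_def
  by (rule order_trans[OF _ cSUP_upper[OF _ op_norm_bdd, of "\<lambda>i. 0"]]) auto

lemma op_norm_bound:
  assumes "T \<in> bop I" "x \<in> ell2 I"
  shows "ell2_norm I (T x) \<le> op_norm I T * ell2_norm I x"
proof (cases "x = (\<lambda>i. 0)")
  case True
  then show ?thesis using bop_zero[OF assms(1)] by simp
next
  case False
  then have pos: "ell2_norm I x > 0" 
    using assms(2) ell2_norm_eq_0 ell2_norm_nonneg by (metis order_le_less)
  define c where "c = complex_of_real (1 / ell2_norm I x)"
  have c: "cmod c = 1 / ell2_norm I x" using pos by (simp add: c_def norm_divide)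
  have "ell2_norm I (T (\<lambda>i. c * x i)) \<le> op_norm I T"
    unfolding op_norm_def
    by (rule cSUP_upper[OF _ op_norm_bdd[OF assms(1)]])
       (use pos assms c in \<open>auto simp: ell2_scale\<close>)
  then have "ell2_norm I (T x) / ell2_norm I x \<le> op_norm I T"
    using assms by (simp add: bop_scale ell2_scale bop_ell2 c)
  then show ?thesis using pos by (simp add: pos_divide_le_eq)
qed

lemma op_norm_le:
  assumes "0 \<le> K" "\<And>x. x \<in> ell2 I \<Longrightarrow> ell2_norm I (T x) \<le> K * ell2_norm I x"
  shows "op_norm I T \<le> K"
  unfolding op_norm_def
proof (rule cSUP_least)
  have "(\<lambda>i. 0) \<in> {x \<in> ell2 I. ell2_norm I x \<le> 1}" by simp
  then show "{x \<in> ell2 I. ell2_norm I x \<le> 1} \<noteq> {}" by blast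
  fix x assume x: "x \<in> {x \<in> ell2 I. ell2_norm I x \<le> 1}"
  then have "ell2_norm I (T x) \<le> K * ell2_norm I x" using assms(2) by blast
  moreover have "K * ell2_norm I x \<le> K * 1"
    by (rule mult_left_mono) (use x assms in auto)
  ultimately show "ell2_norm I (T x) \<le> K" by simp
qed

lemma bopI:
  assumes "\<And>x. x \<in> ell2 I \<Longrightarrow> T x \<in> ell2 I"
    "\<And>x y. x \<in> ell2 I \<Longrightarrow> y \<in> ell2 I \<Longrightarrow> T (\<lambda>i. x i + y i) = (\<lambda>i. T x i + T y i)"
    "\<And>x c. x \<in> ell2 I \<Longrightarrow> T (\<lambda>i. c * x i) = (\<lambda>i. c * T x i)"
    "\<And>x. x \<in> ell2 I \<Longrightarrow> ell2_norm I (T x) \<le> K * ell2_norm I x"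
    "\<And>x. x \<notin> ell2 I \<Longrightarrow> T x = (\<lambda>_. 0)"
  shows "T \<in> bop I"
  using assms unfolding bop_def by blast

lemma bop_op_add: 
  assumes "T \<in> bop I" "U \<in> bop I"
  shows "op_add T U \<in> bop I" "op_norm I (op_add T U) \<le> op_norm I T + op_norm I U"
proof -
  have *: "ell2_norm I (op_add T U x) \<le> (op_norm I T + op_norm I U) * ell2_norm I x" if "x \<in> ell2 I" for x
    using ell2_add(2)[OF bop_ell2[OF assms(1) that] bop_ell2[OF assms(2) that]]
      op_norm_bound[OF assms(1) that] op_norm_bound[OF assms(2) that]
    by (simp add: op_add_def distrib_right)
  show "op_add T U \<in> bop I"
    by (rule bopI[where K = "op_norm I T + op_norm I U"])
      (use * in \<open>simp_all add: op_add_def bop_add[OF assms(1)] bop_add[OF assms(2)] bop_scale[OF assms(1)]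
        bop_scale[OF assms(2)] bop_off[OF assms(1)] bop_off[OF assms(2)] algebra_simps ell2_add(1)
        bop_ell2[OF assms(1)] bop_ell2[OF assms(2)]\<close>)
  show "op_norm I (op_add T U) \<le> op_norm I T + op_norm I U"
    by (rule op_norm_le) (use * in \<open>simp_all add: assms\<close>)
qed

lemma bop_op_scale: 
  assumes "T \<in> bop I"
  shows "op_scale c T \<in> bop I" "op_norm I (op_scale c T) \<le> cmod c * op_norm I T"
proof -
  have *: "ell2_norm I (op_scale c T x) \<le> (cmod c * op_norm I T) * ell2_norm I x" if "x \<in> ell2 I" for x
    using op_norm_bound[OF assms(1) that] ell2_scale(2)[of "T x" I c] assms that
    by (simp add: op_scale_def bop_ell2[OF assms] mult.assoc mult_left_mono)
  show "op_scale c T \<in> bop I"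
    by (rule bopI[where K = "cmod c * op_norm I T"])
      (use * in \<open>simp_all add: op_scale_def bop_add[OF assms] bop_scale[OF assms] bop_off[OF assms]
        algebra_simps ell2_scale(1) bop_ell2[OF assms]\<close>)
  show "op_norm I (op_scale c T) \<le> cmod c * op_norm I T"
    by (rule op_norm_le) (use * in \<open>simp_all add: assms\<close>)
qed

lemma op_diff_eq: "op_diff T U = op_add T (op_scale (-1) U)"
  by (simp add: op_diff_def op_add_def op_scale_def)

lemma bop_op_diff: 
  assumes "T \<in> bop I" "U \<in> bop I"
  shows "op_diff T U \<in> bop I" "op_norm I (op_diff T U) \<le> op_norm I T + op_norm I U"
  unfolding op_diff_eq
  using bop_op_add[OF assms(1) bop_op_scale(1)[OF assms(2), of "-1"]] bop_op_scale(2)[OF assms(2), of "-1"]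
  by simp_all

lemma op_norm_minus_commute: "op_norm I (op_diff T U) = op_norm I (op_diff U T)"
  unfolding op_norm_def op_diff_def by (subst ell2_norm_minus_commute) (rule refl)

lemma op_diff_triangle:
  assumes "T \<in> bop I" "U \<in> bop I" "V \<in> bop I"
  shows "op_norm I (op_diff T V) \<le> op_norm I (op_diff T U) + op_norm I (op_diff U V)"
proof -
  have "op_diff T V = op_add (op_diff T U) (op_diff U V)" by (simp add: op_diff_def op_add_def)
  then show ?thesis
    using bop_op_add(2)[OF bop_op_diff(1)[OF assms(1,2)] bop_op_diff(1)[OF assms(2,3)]] by simp
qed

lemma bop_comp: 
  assumes "T \<in> bop I" "U \<in> bop I"
  shows "T \<circ> U \<in> bop I"
proof (rule bopI[where K = "op_norm I T * op_norm I U"])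
  fix x assume x: "x \<in> ell2 I"
  have "ell2_norm I (T (U x)) \<le> op_norm I T * ell2_norm I (U x)"
    using op_norm_bound[OF assms(1) bop_ell2[OF assms(2) x]] .
  also have "\<dots> \<le> op_norm I T * (op_norm I U * ell2_norm I x)"
    by (rule mult_left_mono) (use op_norm_bound[OF assms(2) x] assms(1) in simp_all)
  finally show "ell2_norm I ((T \<circ> U) x) \<le> op_norm I T * op_norm I U * ell2_norm I x"
    by (simp add: mult.assoc)
qed (simp_all add: bop_add[OF assms(1)] bop_add[OF assms(2)] bop_scale[OF assms(1)] bop_scale[OF assms(2)]
  bop_off[OF assms(2)] bop_zero[OF assms(1)] bop_ell2[OF assms(1)] bop_ell2[OF assms(2)])

lemma bop_zero_op: "(\<lambda>x i. 0) \<in> bop I" "op_norm I (\<lambda>x i. 0) = 0"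
proof -
  show b: "(\<lambda>x i. 0) \<in> bop I" by (rule bopI[where K = 0]) auto
  show "op_norm I (\<lambda>x i. 0) = 0"
    using op_norm_le[of 0 I "\<lambda>x i. 0"] op_norm_nonneg[OF b] by simp
qed

text \<open>Relies on the convention that operators vanish off \<open>ell2 I\<close>; norm zero
  alone only gives agreement on \<open>ell2 I\<close>.\<close>

lemma bop_eqI:
  assumes "T \<in> bop I" "U \<in> bop I" "op_norm I (op_diff T U) \<le> 0"
  shows "T = U"
proof (rule ext)
  fix x
  show "T x = U x"
  proof (cases "x \<in> ell2 I")
    case True
    have "ell2_norm I (op_diff T U x) \<le> op_norm I (op_diff T U) * ell2_norm I x"
      using op_norm_bound[OF bop_op_diff(1)[OF assms(1,2)] True] .
    also have "\<dots> \<le> 0" using assms(3) by (simp add: mult_nonpos_nonneg)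
    finally have "ell2_norm I (op_diff T U x) = 0" using ell2_norm_nonneg[of I "op_diff T U x"] by simp
    then have "op_diff T U x = (\<lambda>i. 0)"
      using ell2_norm_eq_0[of "op_diff T U x" I] bop_ell2[OF bop_op_diff(1)[OF assms(1,2)] True] by simp
    then show ?thesis by (auto simp: op_diff_def fun_eq_iff)
  qed (simp add: bop_off[OF assms(1)] bop_off[OF assms(2)])
qed

text \<open>The limit is formed coordinatewise; the uniform Cauchy estimate then passes to it
  through finite partial sums, which also shows that the limit is bounded.\<close>

lemma bop_complete:
  fixes A :: "nat \<Rightarrow> 'i oper"
  assumes A: "\<And>n. A n \<in> bop I"
    and C: "\<And>\<epsilon>. \<epsilon> > 0 \<Longrightarrow> \<exists>N. \<forall>m\<ge>N. \<forall>n\<ge>N. op_norm I (op_diff (A m) (A n)) < \<epsilon>"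
  shows "\<exists>T\<in>bop I. (\<lambda>n. op_norm I (op_diff (A n) T)) \<longlonglongrightarrow> 0"
proof -
  have close: "ell2_norm I (\<lambda>i. A m x i - A n x i) \<le> op_norm I (op_diff (A m) (A n)) * ell2_norm I x"
    if "x \<in> ell2 I" for m n x
    using op_norm_bound[OF bop_op_diff(1)[OF A A] that] by (simp add: op_diff_def)
  have dd: "(\<lambda>i. A m x i - A n x i) \<in> ell2 I" if "x \<in> ell2 I" for m n x
    using ell2_diff(1)[OF bop_ell2[OF A that] bop_ell2[OF A that]] .
  have conv: "convergent (\<lambda>n. A n x i)" if x: "x \<in> ell2 I" for x i
  proof (rule Cauchy_convergent, rule metric_CauchyI)
    fix e :: real assume "0 < e"
    then have "0 < e / (ell2_norm I x + 1)"
      by (simp add: add_nonneg_pos)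
    from C[OF this] obtain N where N: "\<And>m n. m \<ge> N \<Longrightarrow> n \<ge> N \<Longrightarrow> op_norm I (op_diff (A m) (A n)) < e / (ell2_norm I x + 1)" by blast
    have "dist (A m x i) (A n x i) < e" if "m \<ge> N" "n \<ge> N" for m n
    proof -
      have "cmod (A m x i - A n x i) \<le> op_norm I (op_diff (A m) (A n)) * ell2_norm I x"
        using ell2_coord_le[OF dd[OF x, of m n], of i] close[OF x, of m n] by linarith
      also have "\<dots> \<le> e / (ell2_norm I x + 1) * ell2_norm I x"
        using N[OF that] by (intro mult_right_mono) auto
      also have "\<dots> < e" using \<open>0 < e\<close> 
        by (simp add: pos_divide_less_eq add_nonneg_pos)
      finally show ?thesis by (simp add: dist_norm)
    qed
    then show "\<exists>M. \<forall>m\<ge>M. \<forall>n\<ge>M. dist (A m x i) (A n x i) < e" by blast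
  qed
  define T where "T = (\<lambda>x i. if x \<in> ell2 I then lim (\<lambda>n. A n x i) else 0)"
  have T: "(\<lambda>n. A n x i) \<longlonglongrightarrow> T x i" if "x \<in> ell2 I" for x i
    using conv[OF that] that by (simp add: T_def convergent_LIMSEQ_iff)
  \<comment> \<open>A Fatou argument: on finitely many coordinates the limit in n may be taken
    inside the norm.\<close>
  have bound: "(\<lambda>i. A m x i - T x i) \<in> ell2 I \<and> ell2_norm I (\<lambda>i. A m x i - T x i) \<le> e * ell2_norm I x"
    if x: "x \<in> ell2 I" and e: "\<And>n. n \<ge> N \<Longrightarrow> op_norm I (op_diff (A m) (A n)) \<le> e" for x m N e
  proof -
    have 1: "L2_set (\<lambda>i. cmod (A m x i - T x i)) F \<le> e * ell2_norm I x" if F: "finite F" "F \<subseteq> I" for F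
    proof (rule tendsto_upperbound)
      show "(\<lambda>n. L2_set (\<lambda>i. cmod (A m x i - A n x i)) F) \<longlonglongrightarrow> L2_set (\<lambda>i. cmod (A m x i - T x i)) F"
        unfolding L2_set_def by (intro tendsto_intros T x)
      have "L2_set (\<lambda>i. cmod (A m x i - A n x i)) F \<le> e * ell2_norm I x" if "n \<ge> N" for n
      proof -
        have "L2_set (\<lambda>i. cmod (A m x i - A n x i)) F \<le> ell2_norm I (\<lambda>i. A m x i - A n x i)"
          using ell2_finite_le[OF dd[OF x] F] .
        also note close[OF x, of m n]
        also have "op_norm I (op_diff (A m) (A n)) * ell2_norm I x \<le> e * ell2_norm I x"
          using e[OF that] by (intro mult_right_mono) auto
        finally show ?thesis .
      qed
      then show "\<forall>\<^sub>F n in sequentially. L2_set (\<lambda>i. cmod (A m x i - A n x i)) F \<le> e * ell2_norm I x"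
        using eventually_sequentially by blast
    qed simp
    have 2: "A m x i - T x i = 0" if "i \<notin> I" for i
    proof -
      have "A n x i = 0" for n using bop_ell2[OF A x] that by (simp add: ell2_def)
      then have "(\<lambda>n. A n x i) \<longlonglongrightarrow> 0" by simp
      then have "T x i = 0" using T[OF x, of i] LIMSEQ_unique by blast
      then show ?thesis using \<open>\<And>n. A n x i = 0\<close> by simp
    qed
    show ?thesis using ell2_intro[of I "\<lambda>i. A m x i - T x i", OF 2 1] by blast
  qed
  obtain N1 where N1: "\<And>m n. m \<ge> N1 \<Longrightarrow> n \<ge> N1 \<Longrightarrow> op_norm I (op_diff (A m) (A n)) < 1"
    using C[of 1] by auto
  have Tb: "T \<in> bop I"
  proof (rule bopI[where K = "op_norm I (A N1) + 1"])
    fix x assume x: "x \<in> ell2 I"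
    have b: "(\<lambda>i. A N1 x i - T x i) \<in> ell2 I" "ell2_norm I (\<lambda>i. A N1 x i - T x i) \<le> 1 * ell2_norm I x"
      using bound[OF x, of N1 N1 1] N1 by (auto simp: less_imp_le)
    have eq: "T x = (\<lambda>i. A N1 x i - (A N1 x i - T x i))" by simp
    show "T x \<in> ell2 I" by (subst eq) (rule ell2_diff(1)[OF bop_ell2[OF A x] b(1)])
    have "ell2_norm I (T x) \<le> ell2_norm I (A N1 x) + ell2_norm I (\<lambda>i. A N1 x i - T x i)"
      by (subst eq) (rule ell2_diff(2)[OF bop_ell2[OF A x] b(1)])
    then show "ell2_norm I (T x) \<le> (op_norm I (A N1) + 1) * ell2_norm I x"
      using b op_norm_bound[OF A x, of N1] by (simp add: distrib_right)
  next
    fix x y assume x: "x \<in> ell2 I" and y: "y \<in> ell2 I"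
    show "T (\<lambda>i. x i + y i) = (\<lambda>i. T x i + T y i)"
    proof
      fix i
      have "(\<lambda>n. A n (\<lambda>i. x i + y i) i) \<longlonglongrightarrow> T x i + T y i"
        using tendsto_add[OF T[OF x] T[OF y]] by (simp add: bop_add[OF A x y])
      then show "T (\<lambda>i. x i + y i) i = T x i + T y i"
        using T[OF ell2_add(1)[OF x y], of i] LIMSEQ_unique by blast
    qed
  next
    fix x c assume x: "x \<in> ell2 I"
    show "T (\<lambda>i. c * x i) = (\<lambda>i. c * T x i)"
    proof
      fix i
      have "(\<lambda>n. A n (\<lambda>i. c * x i) i) \<longlonglongrightarrow> c * T x i"
        using tendsto_mult_left[OF T[OF x]] by (simp add: bop_scale[OF A x])
      then show "T (\<lambda>i. c * x i) i = c * T x i"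
        using T[OF ell2_scale(1)[OF x, of c], of i] LIMSEQ_unique by blast
    qed
  qed (simp add: T_def)
  have "(\<lambda>n. op_norm I (op_diff (A n) T)) \<longlonglongrightarrow> 0"
  proof (rule LIMSEQ_I)
    fix r :: real assume "0 < r"
    then obtain N where N: "\<And>m n. m \<ge> N \<Longrightarrow> n \<ge> N \<Longrightarrow> op_norm I (op_diff (A m) (A n)) < r/2"
      using C[of "r/2"] by auto
    have "norm (op_norm I (op_diff (A m) T) - 0) < r" if "m \<ge> N" for m
    proof -
      have "op_norm I (op_diff (A m) T) \<le> r/2"
        by (rule op_norm_le) (use bound[of _ N m "r/2"] N[OF that] \<open>0 < r\<close> in \<open>auto simp: op_diff_def less_imp_le\<close>)
      then show ?thesis using op_norm_nonneg[OF bop_op_diff(1)[OF A Tb]] \<open>0 < r\<close> by simp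
    qed
    then show "\<exists>no. \<forall>n\<ge>no. norm (op_norm I (op_diff (A n) T) - 0) < r" by blast
  qed
  with Tb show ?thesis by blast
qed


no_notation Infinite_Set_Sum.abs_summable_on (infix "abs'_summable'_on" 50)

section \<open>Representations by partial permutations of a basis\<close>

lemma ell1_abs: "f \<in> ell1 S \<Longrightarrow> f abs_summable_on S"
  by (simp add: ell1_def)

lemma ell1_norm_nonneg [simp]: "0 \<le> ell1_norm S f"
  by (simp add: ell1_norm_def infsum_nonneg)

lemma ell1_sum_le: "f \<in> ell1 S \<Longrightarrow> finite B \<Longrightarrow> B \<subseteq> S \<Longrightarrow> (\<Sum>s\<in>B. cmod (f s)) \<le> ell1_norm S f"
  unfolding ell1_norm_def by (rule finite_sum_le_infsum) (auto simp: ell1_def)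

text \<open>\<open>\<beta> s\<close> is the partial bijection by which the inverse of
  \<open>s\<close> acts on the basis; operators pull functions back along it, so each value of
  \<open>s x\<close> is a single value of \<open>x\<close> and no basis sum is needed. Pulling back
  reverses composition, which is why \<open>\<beta>_mul\<close> applies \<open>s\<close> before
  \<open>t\<close>. The regular representation and all test representations have this form.\<close>

locale pp_rep =
  fixes S :: "'a set" and mul :: "'a \<Rightarrow> 'a \<Rightarrow> 'a" and I :: "'i set" and \<beta> :: "'a \<Rightarrow> 'i \<Rightarrow> 'i option"
  assumes mul_closed: "s \<in> S \<Longrightarrow> t \<in> S \<Longrightarrow> mul s t \<in> S"
    and star_closed: "s \<in> S \<Longrightarrow> star S mul s \<in> S"
    and star_star: "s \<in> S \<Longrightarrow> star S mul (star S mul s) = s"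
    and \<beta>_in: "s \<in> S \<Longrightarrow> v \<in> I \<Longrightarrow> \<beta> s v = Some w \<Longrightarrow> w \<in> I"
    and \<beta>_mul: "s \<in> S \<Longrightarrow> t \<in> S \<Longrightarrow> v \<in> I \<Longrightarrow> \<beta> (mul s t) v = Option.bind (\<beta> s v) (\<beta> t)"
    and \<beta>_star: "s \<in> S \<Longrightarrow> v \<in> I \<Longrightarrow> w \<in> I \<Longrightarrow> \<beta> s v = Some w \<Longrightarrow> \<beta> (star S mul s) w = Some v"
begin

definition pv :: "('i \<Rightarrow> complex) \<Rightarrow> 'i option \<Rightarrow> complex" where
  "pv x o' = (case o' of None \<Rightarrow> 0 | Some w \<Rightarrow> x w)"

definition ppop :: "'a \<Rightarrow> 'i oper" where
  "ppop s x = (\<lambda>v. if x \<in> ell2 I \<and> v \<in> I then pv x (\<beta> s v) else 0)"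

definition pp :: "('a \<Rightarrow> complex) \<Rightarrow> 'i oper" where
  "pp f x = (\<lambda>v. \<Sum>\<^sub>\<infinity>s\<in>S. f s * ppop s x v)"

lemma \<beta>_inj: "s \<in> S \<Longrightarrow> v \<in> I \<Longrightarrow> v' \<in> I \<Longrightarrow> \<beta> s v = Some w \<Longrightarrow> \<beta> s v' = Some w \<Longrightarrow> v = v'"
  using \<beta>_star[of s v w] \<beta>_star[of s v' w] \<beta>_in by fastforce

lemma ppop_ell2:
  assumes s: "s \<in> S" and x: "x \<in> ell2 I"
  shows "ppop s x \<in> ell2 I" "ell2_norm I (ppop s x) \<le> ell2_norm I x"
proof -
  have 1: "ppop s x v = 0" if "v \<notin> I" for v using that by (simp add: ppop_def)
  have 2: "L2_set (\<lambda>v. cmod (ppop s x v)) A \<le> ell2_norm I x" if A: "finite A" "A \<subseteq> I" for A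
  proof -
    define D where "D = {v \<in> A. \<beta> s v \<noteq> None}"
    have D: "finite D" "D \<subseteq> A" using A by (auto simp: D_def)
    have inj: "inj_on (\<lambda>v. the (\<beta> s v)) D"
      using \<beta>_inj[OF s] A by (fastforce simp: inj_on_def D_def)
    have "(\<Sum>v\<in>A. (cmod (ppop s x v))\<^sup>2) = (\<Sum>v\<in>D. (cmod (ppop s x v))\<^sup>2)"
      by (rule sum.mono_neutral_right) (use A D in \<open>auto simp: D_def ppop_def pv_def\<close>)
    also have "\<dots> = (\<Sum>v\<in>D. (cmod (x (the (\<beta> s v))))\<^sup>2)"
      by (rule sum.cong) (use A x in \<open>auto simp: D_def ppop_def pv_def\<close>)
    also have "\<dots> = (\<Sum>w\<in>(\<lambda>v. the (\<beta> s v)) ` D. (cmod (x w))\<^sup>2)"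
      by (simp add: sum.reindex[OF inj])
    also have "\<dots> \<le> (ell2_norm I x)\<^sup>2"
      by (rule ell2_finite_sq_le[OF x]) (use A D \<beta>_in[OF s] in \<open>auto simp: D_def\<close>)
    finally show ?thesis unfolding L2_set_def by (simp add: real_le_lsqrt)
  qed
  show "ppop s x \<in> ell2 I" "ell2_norm I (ppop s x) \<le> ell2_norm I x"
    using ell2_intro[of I "ppop s x", OF 1 2] by blast+
qed

lemma ppop_bop:
  assumes s: "s \<in> S" shows "ppop s \<in> bop I"
proof (rule bopI[where K = 1])
  show "ppop s (\<lambda>i. x i + y i) = (\<lambda>i. ppop s x i + ppop s y i)" if "x \<in> ell2 I" "y \<in> ell2 I" for x y
    using ell2_add(1)[OF that] that by (auto simp: ppop_def pv_def fun_eq_iff split: option.split)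
  show "ppop s (\<lambda>i. c * x i) = (\<lambda>i. c * ppop s x i)" if "x \<in> ell2 I" for x c
    using ell2_scale(1)[OF that] that by (auto simp: ppop_def pv_def fun_eq_iff split: option.split)
qed (use ppop_ell2[OF s] in \<open>simp_all add: ppop_def\<close>)

lemma ppop_mul:
  assumes "s \<in> S" "t \<in> S"
  shows "ppop (mul s t) x = ppop s (ppop t x)"
proof (cases "x \<in> ell2 I")
  case True
  then have "ppop t x \<in> ell2 I" using ppop_ell2 assms by blast
  then show ?thesis using True assms \<beta>_in[OF assms(1)]
    by (auto simp: ppop_def pv_def fun_eq_iff \<beta>_mul split: option.split)
next
  case False
  then have "ppop t x = (\<lambda>v. 0)" by (simp add: ppop_def)
  then have "ppop s (ppop t x) = (\<lambda>v. 0)" by (auto simp: ppop_def pv_def fun_eq_iff split: option.split)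
  then show ?thesis using False by (simp add: ppop_def)
qed

lemma ppop_abs_summable:
  assumes f: "f \<in> ell1 S" and x: "x \<in> ell2 I"
  shows "(\<lambda>s. f s * ppop s x v) abs_summable_on S"
proof (rule Infinite_Sum.abs_summable_on_comparison_test)
  show "(\<lambda>s. f s * of_real (ell2_norm I x)) abs_summable_on S"
    using summable_on_cmult_left[OF ell1_abs[OF f], of "ell2_norm I x"] by (simp add: norm_mult)
  show "norm (f s * ppop s x v) \<le> norm (f s * of_real (ell2_norm I x))" if "s \<in> S" for s
    using order_trans[OF ell2_coord_le[OF ppop_ell2(1)[OF that x], of v] ppop_ell2(2)[OF that x]]
    by (simp add: norm_mult mult_left_mono)
qed

lemma pp_off: "x \<notin> ell2 I \<Longrightarrow> pp f x = (\<lambda>_. 0)"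
  by (simp add: pp_def ppop_def)

text \<open>The triangle inequality for finite subsets of S passes to the limit on each finite set
  of coordinates.\<close>

lemma pp_ell2:
  assumes f: "f \<in> ell1 S" and x: "x \<in> ell2 I"
  shows "pp f x \<in> ell2 I" "ell2_norm I (pp f x) \<le> ell1_norm S f * ell2_norm I x"
proof -
  have 1: "pp f x v = 0" if "v \<notin> I" for v using that by (simp add: ppop_def pp_def)
  have 2: "L2_set (\<lambda>v. cmod (pp f x v)) A \<le> ell1_norm S f * ell2_norm I x" if A: "finite A" "A \<subseteq> I" for A
  proof (rule tendsto_upperbound)
    show "((\<lambda>B. L2_set (\<lambda>v. cmod (\<Sum>s\<in>B. f s * ppop s x v)) A) \<longlongrightarrow> L2_set (\<lambda>v. cmod (pp f x v)) A)
        (finite_subsets_at_top S)"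
      unfolding L2_set_def pp_def
      by (intro tendsto_intros infsum_tendsto abs_summable_summable[OF ppop_abs_summable[OF f x]])
    have "L2_set (\<lambda>v. cmod (\<Sum>s\<in>B. f s * ppop s x v)) A \<le> ell1_norm S f * ell2_norm I x"
      if B: "finite B" "B \<subseteq> S" for B
    proof -
      have m: "(\<lambda>v. f s * ppop s x v) \<in> ell2 I" if "s \<in> B" for s
        using that B ppop_ell2(1)[OF _ x] ell2_scale(1) by blast
      have "L2_set (\<lambda>v. cmod (\<Sum>s\<in>B. f s * ppop s x v)) A \<le> ell2_norm I (\<lambda>v. \<Sum>s\<in>B. f s * ppop s x v)"
        using ell2_finite_le[OF ell2_sum(1)[OF m] A] .
      also have "\<dots> \<le> (\<Sum>s\<in>B. ell2_norm I (\<lambda>v. f s * ppop s x v))"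
        by (rule ell2_sum(2)[OF m])
      also have "\<dots> \<le> (\<Sum>s\<in>B. cmod (f s) * ell2_norm I x)"
      proof (rule sum_mono)
        fix s assume "s \<in> B"
        then have "s \<in> S" using B by auto
        from ell2_scale(2)[OF ppop_ell2(1)[OF this x], of "f s"] ppop_ell2(2)[OF this x]
        show "ell2_norm I (\<lambda>v. f s * ppop s x v) \<le> cmod (f s) * ell2_norm I x"
          by (simp add: mult_left_mono)
      qed
      also have "\<dots> \<le> ell1_norm S f * ell2_norm I x"
        by (simp add: sum_distrib_right[symmetric] mult_right_mono ell1_sum_le[OF f B])
      finally show ?thesis .
    qed
    then show "\<forall>\<^sub>F B in finite_subsets_at_top S.
        L2_set (\<lambda>v. cmod (\<Sum>s\<in>B. f s * ppop s x v)) A \<le> ell1_norm S f * ell2_norm I x"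
      by (intro eventually_finite_subsets_at_top_weakI) auto
  qed simp
  show "pp f x \<in> ell2 I" "ell2_norm I (pp f x) \<le> ell1_norm S f * ell2_norm I x"
    using ell2_intro[of I "pp f x", OF 1 2] by blast+
qed

lemma pp_bop:
  assumes f: "f \<in> ell1 S"
  shows "pp f \<in> bop I" "op_norm I (pp f) \<le> ell1_norm S f"
proof -
  show "pp f \<in> bop I"
  proof (rule bopI[where K = "ell1_norm S f"])
    show "pp f (\<lambda>i. x i + y i) = (\<lambda>i. pp f x i + pp f y i)" if x: "x \<in> ell2 I" and y: "y \<in> ell2 I" for x y
    proof
      fix v
      have "pp f (\<lambda>i. x i + y i) v = (\<Sum>\<^sub>\<infinity>s\<in>S. f s * ppop s x v + f s * ppop s y v)"
        unfolding pp_def by (rule infsum_cong) (simp add: bop_add[OF ppop_bop x y] distrib_left)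
      also have "\<dots> = pp f x v + pp f y v"
        unfolding pp_def by (intro infsum_add abs_summable_summable[OF ppop_abs_summable[OF f]] x y)
      finally show "pp f (\<lambda>i. x i + y i) v = pp f x v + pp f y v" .
    qed
    show "pp f (\<lambda>i. c * x i) = (\<lambda>i. c * pp f x i)" if x: "x \<in> ell2 I" for x c
    proof
      fix v
      have "pp f (\<lambda>i. c * x i) v = (\<Sum>\<^sub>\<infinity>s\<in>S. c * (f s * ppop s x v))"
        unfolding pp_def by (rule infsum_cong) (simp add: bop_scale[OF ppop_bop x] mult.left_commute)
      also have "\<dots> = c * pp f x v" unfolding pp_def by (rule infsum_cmult_right')
      finally show "pp f (\<lambda>i. c * x i) v = c * pp f x v" .
    qed
  qed (use pp_ell2[OF f] pp_off in simp_all)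
  show "op_norm I (pp f) \<le> ell1_norm S f"
    by (rule op_norm_le) (use pp_ell2[OF f] in simp_all)
qed

lemma pp_add:
  assumes "f \<in> ell1 S" "g \<in> ell1 S"
  shows "pp (\<lambda>s. f s + g s) = op_add (pp f) (pp g)"
proof (intro ext)
  fix x v
  show "pp (\<lambda>s. f s + g s) x v = op_add (pp f) (pp g) x v"
  proof (cases "x \<in> ell2 I")
    case True
    have "(\<Sum>\<^sub>\<infinity>s\<in>S. (f s + g s) * ppop s x v) = (\<Sum>\<^sub>\<infinity>s\<in>S. f s * ppop s x v + g s * ppop s x v)"
      by (simp add: distrib_right)
    also have "\<dots> = (\<Sum>\<^sub>\<infinity>s\<in>S. f s * ppop s x v) + (\<Sum>\<^sub>\<infinity>s\<in>S. g s * ppop s x v)"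
      by (intro infsum_add abs_summable_summable[OF ppop_abs_summable] assms True)
    finally show ?thesis by (simp add: pp_def op_add_def)
  qed (simp add: pp_off op_add_def)
qed

lemma pp_scale: "pp (\<lambda>s. c * f s) = op_scale c (pp f)"
proof (intro ext)
  fix x v
  have "(\<Sum>\<^sub>\<infinity>s\<in>S. c * f s * ppop s x v) = (\<Sum>\<^sub>\<infinity>s\<in>S. c * (f s * ppop s x v))"
    by (simp add: mult.assoc)
  also have "\<dots> = c * (\<Sum>\<^sub>\<infinity>s\<in>S. f s * ppop s x v)" by (rule infsum_cmult_right')
  finally show "pp (\<lambda>s. c * f s) x v = op_scale c (pp f) x v" by (simp add: pp_def op_scale_def)
qed

text \<open>Fubini on S x S, after the pairs have been sorted by their product.\<close>

lemma pp_conv: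
  assumes f: "f \<in> ell1 S" and g: "g \<in> ell1 S"
  shows "pp (conv S mul f g) = pp f \<circ> pp g"
proof (intro ext)
  fix x v
  show "pp (conv S mul f g) x v = (pp f \<circ> pp g) x v"
  proof (cases "x \<in> ell2 I \<and> v \<in> I")
    case False
    then consider "x \<notin> ell2 I" | "x \<in> ell2 I" "v \<notin> I" by blast
    then show ?thesis
    proof cases
      case 1
      then show ?thesis by (simp add: pp_off bop_zero[OF pp_bop(1)[OF f]])
    next
      case 2
      then show ?thesis by (simp add: pp_def ppop_def)
    qed
  next
    case True
    then have x: "x \<in> ell2 I" and v: "v \<in> I" by auto
    define h where "h = (\<lambda>(s,t). f s * g t * ppop (mul s t) x v)"
    have hs: "h abs_summable_on (S \<times> S)"
    proof (rule Infinite_Sum.abs_summable_on_comparison_test)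
      have "(\<lambda>p. f (fst p) * g (snd p) * of_real (ell2_norm I x)) abs_summable_on (S \<times> S)"
      proof (subst Infinite_Sum.abs_summable_on_Sigma_iff, intro conjI ballI)
        fix s
        show "(\<lambda>y. f (fst (s, y)) * g (snd (s, y)) * of_real (ell2_norm I x)) abs_summable_on S"
          using summable_on_cmult_right[OF ell1_abs[OF g], of "cmod (f s) * ell2_norm I x"]
          by (simp add: norm_mult mult_ac)
      next
        have "(\<Sum>\<^sub>\<infinity>y\<in>S. norm (f s * g y * of_real (ell2_norm I x))) = cmod (f s) * (ell1_norm S g * ell2_norm I x)" for s
        proof -
          have "(\<Sum>\<^sub>\<infinity>y\<in>S. norm (f s * g y * of_real (ell2_norm I x)))
            = (\<Sum>\<^sub>\<infinity>y\<in>S. (cmod (f s) * ell2_norm I x) * cmod (g y))"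
            by (simp add: norm_mult mult_ac)
          then show ?thesis by (simp add: infsum_cmult_right' ell1_norm_def mult_ac)
        qed
        then show "(\<lambda>s. \<Sum>\<^sub>\<infinity>y\<in>S. norm (f (fst (s, y)) * g (snd (s, y)) * of_real (ell2_norm I x))) abs_summable_on S"
          using summable_on_cmult_left[OF ell1_abs[OF f], of "ell1_norm S g * ell2_norm I x"]
          by simp
      qed
      then show "(\<lambda>(s,t). f s * g t * of_real (ell2_norm I x)) abs_summable_on (S \<times> S)"
        by (simp add: case_prod_unfold)
      show "norm (h p) \<le> norm (case p of (s, t) \<Rightarrow> f s * g t * of_real (ell2_norm I x))" if "p \<in> S \<times> S" for p
        using that order_trans[OF ell2_coord_le[OF ppop_ell2(1)[OF mul_closed x]] ppop_ell2(2)[OF mul_closed x]]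
        by (auto simp: h_def norm_mult intro!: mult_left_mono)
    qed
    have hs': "h summable_on (S \<times> S)" using hs by (rule abs_summable_summable)
    define Fb where "Fb = (\<lambda>t. {(u, w). u \<in> S \<and> w \<in> S \<and> mul u w = t})"
    \<comment> \<open>Tagging a pair with its product turns the fibres of the multiplication into a
      \<open>Sigma\<close> set.\<close>
    have bij: "bij_betw snd (Sigma S Fb) (S \<times> S)"
      by (rule bij_betw_byWitness[where f' = "\<lambda>p. (mul (fst p) (snd p), p)"])
         (auto simp: Fb_def mul_closed)
    have "pp (conv S mul f g) x v = (\<Sum>\<^sub>\<infinity>t\<in>S. \<Sum>\<^sub>\<infinity>p\<in>Fb t. h p)"
      unfolding pp_def
    proof (rule infsum_cong)
      fix t assume "t \<in> S"
      have "conv S mul f g t * ppop t x v = (\<Sum>\<^sub>\<infinity>p\<in>Fb t. (case p of (u, w) \<Rightarrow> f u * g w) * ppop t x v)"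
        unfolding conv_def Fb_def by (rule infsum_cmult_left'[symmetric])
      also have "\<dots> = (\<Sum>\<^sub>\<infinity>p\<in>Fb t. h p)"
        by (rule infsum_cong) (auto simp: Fb_def h_def)
      finally show "conv S mul f g t * ppop t x v = (\<Sum>\<^sub>\<infinity>p\<in>Fb t. h p)" .
    qed
    also have "\<dots> = (\<Sum>\<^sub>\<infinity>q\<in>Sigma S Fb. h (snd q))"
      using infsum_Sigma_banach[of "\<lambda>q. h (snd q)" S Fb] summable_on_reindex_bij_betw[OF bij, of h] hs' by simp
    also have "\<dots> = (\<Sum>\<^sub>\<infinity>p\<in>S \<times> S. h p)" by (rule infsum_reindex_bij_betw[OF bij])
    also have "\<dots> = (\<Sum>\<^sub>\<infinity>s\<in>S. \<Sum>\<^sub>\<infinity>t\<in>S. h (s, t))"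
      by (rule infsum_Sigma_banach[OF hs', symmetric])
    also have "\<dots> = (\<Sum>\<^sub>\<infinity>s\<in>S. f s * ppop s (pp g x) v)"
    proof (rule infsum_cong)
      fix s assume s: "s \<in> S"
      have "(\<Sum>\<^sub>\<infinity>t\<in>S. h (s, t)) = (\<Sum>\<^sub>\<infinity>t\<in>S. f s * (g t * ppop s (ppop t x) v))"
        by (rule infsum_cong) (simp add: h_def ppop_mul s mult.assoc)
      also have "\<dots> = f s * (\<Sum>\<^sub>\<infinity>t\<in>S. g t * ppop s (ppop t x) v)" by (rule infsum_cmult_right')
      also have "(\<Sum>\<^sub>\<infinity>t\<in>S. g t * ppop s (ppop t x) v) = ppop s (pp g x) v"
      proof (cases "\<beta> s v")
        case None
        then have z: "ppop s y v = 0" for y by (simp add: ppop_def pv_def)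
        show ?thesis by (simp add: z)
      next
        case (Some w)
        have "ppop s (pp g x) v = pp g x w" using Some v pp_ell2(1)[OF g x] by (simp add: ppop_def pv_def)
        also have "\<dots> = (\<Sum>\<^sub>\<infinity>t\<in>S. g t * ppop s (ppop t x) v)"
          unfolding pp_def
        proof (rule infsum_cong)
          fix t assume "t \<in> S"
          then show "g t * ppop t x w = g t * ppop s (ppop t x) v"
            using Some v ppop_ell2(1)[OF _ x, of t] by (simp add: ppop_def[of s] pv_def)
        qed
        finally show ?thesis by simp
      qed
      finally show "(\<Sum>\<^sub>\<infinity>t\<in>S. h (s, t)) = f s * ppop s (pp g x) v" .
    qed
    also have "\<dots> = (pp f \<circ> pp g) x v" by (simp add: pp_def)
    finally show ?thesis .
  qed
qed

lemma ppop_adjoint: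
  assumes s: "s \<in> S" and x: "x \<in> ell2 I" and y: "y \<in> ell2 I"
  shows "ell2_inner I (ppop s x) y = ell2_inner I x (ppop (star S mul s) y)"
proof -
  let ?t = "star S mul s"
  have t: "?t \<in> S" using star_closed s by blast
  define D where "D = {v \<in> I. \<beta> s v \<noteq> None}"
  define E where "E = {v \<in> I. \<beta> ?t v \<noteq> None}"
  have st: "\<beta> ?t w = Some v" if "v \<in> I" "\<beta> s v = Some w" for v w
    using \<beta>_star[OF s that(1) \<beta>_in[OF s that] that(2)] .
  have ts: "\<beta> s w = Some v" if "v \<in> I" "\<beta> ?t v = Some w" for v w
    using \<beta>_star[OF t that(1) \<beta>_in[OF t that] that(2)] star_star[OF s] by simp
  have "ell2_inner I (ppop s x) y = (\<Sum>\<^sub>\<infinity>v\<in>D. x (the (\<beta> s v)) * cnj (y v))"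
    unfolding ell2_inner_def
    by (rule infsum_cong_neutral) (auto simp: D_def ppop_def pv_def x)
  also have "\<dots> = (\<Sum>\<^sub>\<infinity>w\<in>E. x w * cnj (y (the (\<beta> ?t w))))"
  proof (rule infsum_reindex_bij_witness[of _ "\<lambda>w. the (\<beta> ?t w)" "\<lambda>v. the (\<beta> s v)"])
    fix v assume "v \<in> D"
    then obtain w where w: "v \<in> I" "\<beta> s v = Some w" by (auto simp: D_def)
    from st[OF w] \<beta>_in[OF s w] w
    show "the (\<beta> ?t (the (\<beta> s v))) = v" "the (\<beta> s v) \<in> E"
      "x (the (\<beta> s v)) * cnj (y (the (\<beta> ?t (the (\<beta> s v))))) = x (the (\<beta> s v)) * cnj (y v)"
      by (simp_all add: E_def)
  next
    fix v assume "v \<in> E"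
    then obtain w where w: "v \<in> I" "\<beta> ?t v = Some w" by (auto simp: E_def)
    from ts[OF w] \<beta>_in[OF t w] w
    show "the (\<beta> s (the (\<beta> ?t v))) = v" "the (\<beta> ?t v) \<in> D" by (simp_all add: D_def)
  qed
  also have "\<dots> = ell2_inner I x (ppop ?t y)"
    unfolding ell2_inner_def
    by (rule infsum_cong_neutral) (auto simp: E_def ppop_def pv_def y)
  finally show ?thesis .
qed

text \<open>Exchanging the two sums reduces the adjoint relation for \<open>pp f\<close> to single
  semigroup elements.\<close>

lemma pp_inner:
  assumes f: "f \<in> ell1 S" and x: "x \<in> ell2 I" and y: "y \<in> ell2 I"
  shows "ell2_inner I (pp f x) y = (\<Sum>\<^sub>\<infinity>s\<in>S. f s * ell2_inner I (ppop s x) y)"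
proof -
  define h where "h = (\<lambda>s v. f s * ppop s x v * cnj (y v))"
  have hs: "(\<lambda>(s,v). h s v) abs_summable_on (S \<times> I)"
  proof (subst Infinite_Sum.abs_summable_on_Sigma_iff, intro conjI ballI)
    fix s assume s: "s \<in> S"
    show "(\<lambda>v. case (s, v) of (s, v) \<Rightarrow> h s v) abs_summable_on I"
      using summable_on_cmult_right[OF ell2_prod_summable(1)[OF ppop_ell2(1)[OF s x] y], of "cmod (f s)"]
      by (simp add: h_def norm_mult mult.assoc)
  next
    let ?N = "\<lambda>s. \<Sum>\<^sub>\<infinity>v\<in>I. norm (case (s, v) of (s, v) \<Rightarrow> h s v)"
    have le: "?N s \<le> cmod (f s) * (ell2_norm I x * ell2_norm I y)" if s: "s \<in> S" for s
    proof -
      have "?N s = (\<Sum>\<^sub>\<infinity>v\<in>I. cmod (f s) * norm (ppop s x v * cnj (y v)))"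
        by (simp add: h_def norm_mult mult.assoc)
      also have "\<dots> = cmod (f s) * (\<Sum>\<^sub>\<infinity>v\<in>I. norm (ppop s x v * cnj (y v)))" by (rule infsum_cmult_right')
      also have "\<dots> \<le> cmod (f s) * (ell2_norm I x * ell2_norm I y)"
        using ell2_prod_summable(2)[OF ppop_ell2(1)[OF s x] y]
          mult_right_mono[OF ppop_ell2(2)[OF s x] ell2_norm_nonneg[of I y]]
        by (intro mult_left_mono) auto
      finally show ?thesis .
    qed
    show "?N abs_summable_on S"
    proof (rule Infinite_Sum.abs_summable_on_comparison_test)
      show "(\<lambda>s. cmod (f s) * (ell2_norm I x * ell2_norm I y)) abs_summable_on S"
        using summable_on_cmult_left[OF ell1_abs[OF f], of "ell2_norm I x * ell2_norm I y"] by simp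
      show "norm (?N s) \<le> norm (cmod (f s) * (ell2_norm I x * ell2_norm I y))" if "s \<in> S" for s
        using le[OF that] infsum_nonneg[of I "\<lambda>v. norm (h s v)"] by simp
    qed
  qed
  have "ell2_inner I (pp f x) y = (\<Sum>\<^sub>\<infinity>v\<in>I. \<Sum>\<^sub>\<infinity>s\<in>S. h s v)"
    unfolding ell2_inner_def pp_def h_def by (simp add: infsum_cmult_left')
  also have "\<dots> = (\<Sum>\<^sub>\<infinity>s\<in>S. \<Sum>\<^sub>\<infinity>v\<in>I. h s v)"
    by (rule infsum_swap_banach[OF abs_summable_summable[OF hs], symmetric])
  also have "\<dots> = (\<Sum>\<^sub>\<infinity>s\<in>S. f s * ell2_inner I (ppop s x) y)"
    unfolding h_def ell2_inner_def by (simp add: infsum_cmult_right' mult.assoc)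
  finally show ?thesis .
qed

lemma invol_ell1:
  assumes f: "f \<in> ell1 S" shows "invol S mul f \<in> ell1 S"
proof -
  have "(\<lambda>s. cmod (invol S mul f s)) summable_on S \<longleftrightarrow> (\<lambda>s. cmod (f s)) summable_on S"
    by (rule summable_on_reindex_bij_witness[of _ "star S mul" "star S mul"])
       (auto simp: invol_def star_star star_closed)
  then show ?thesis using f by (auto simp: ell1_def invol_def)
qed

lemma pp_adjoint:
  assumes f: "f \<in> ell1 S"
  shows "is_adjoint I (pp f) (pp (invol S mul f))"
  unfolding is_adjoint_def
proof (intro ballI)
  fix x y assume x: "x \<in> ell2 I" and y: "y \<in> ell2 I"
  have "ell2_inner I x (pp (invol S mul f) y) = cnj (\<Sum>\<^sub>\<infinity>s\<in>S. invol S mul f s * ell2_inner I (ppop s y) x)"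
    by (subst ell2_inner_cnj) (simp add: pp_inner[OF invol_ell1[OF f] y x])
  also have "\<dots> = (\<Sum>\<^sub>\<infinity>s\<in>S. f (star S mul s) * ell2_inner I x (ppop s y))"
    unfolding infsum_cnj[symmetric]
  proof (rule infsum_cong)
    fix s assume "s \<in> S"
    then show "cnj (invol S mul f s * ell2_inner I (ppop s y) x) = f (star S mul s) * ell2_inner I x (ppop s y)"
      by (simp add: invol_def ell2_inner_cnj[of I x "ppop s y"])
  qed
  also have "\<dots> = (\<Sum>\<^sub>\<infinity>s\<in>S. f s * ell2_inner I (ppop s x) y)"
    by (rule infsum_reindex_bij_witness[of _ "star S mul" "star S mul"])
       (auto simp: star_star star_closed ppop_adjoint[OF _ x y])
  also have "\<dots> = ell2_inner I (pp f x) y" by (rule pp_inner[OF f x y, symmetric])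
  finally show "ell2_inner I (pp f x) y = ell2_inner I x (pp (invol S mul f) y)" by simp
qed

lemma pp_star_rep: "star_rep S mul I pp"
  unfolding star_rep_def
  by (intro conjI ballI allI pp_bop pp_add pp_scale pp_conv pp_adjoint)

end


section \<open>The full and the reduced norm\<close>

lemma ell1_add: "f \<in> ell1 S \<Longrightarrow> g \<in> ell1 S \<Longrightarrow> (\<lambda>s. f s + g s) \<in> ell1 S"
proof -
  assume f: "f \<in> ell1 S" and g: "g \<in> ell1 S"
  have "(\<lambda>s. f s + g s) abs_summable_on S"
  proof (rule Infinite_Sum.abs_summable_on_comparison_test)
    show "(\<lambda>s. cmod (f s) + cmod (g s)) abs_summable_on S"
      using summable_on_add[OF ell1_abs[OF f] ell1_abs[OF g]] by simp
  qed (use norm_triangle_ineq in auto)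
  then show ?thesis using f g by (simp add: ell1_def)
qed

lemma ell1_scale: "f \<in> ell1 S \<Longrightarrow> (\<lambda>s. c * f s) \<in> ell1 S"
  using summable_on_cmult_right[of "\<lambda>s. cmod (f s)" S "cmod c"] by (simp add: ell1_def norm_mult)

lemma ell1_diff: "f \<in> ell1 S \<Longrightarrow> g \<in> ell1 S \<Longrightarrow> (\<lambda>s. f s - g s) \<in> ell1 S"
  using ell1_add[of f S "\<lambda>s. -1 * g s"] ell1_scale[of g S "-1"] by simp

lemma ell1_zero [simp]: "(\<lambda>s. 0) \<in> ell1 S"
  by (simp add: ell1_def)

lemma star_repD:
  assumes "star_rep S mul I \<pi>"
  shows "f \<in> ell1 S \<Longrightarrow> \<pi> f \<in> bop I"
    and "f \<in> ell1 S \<Longrightarrow> g \<in> ell1 S \<Longrightarrow> \<pi> (\<lambda>s. f s + g s) = op_add (\<pi> f) (\<pi> g)"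
    and "f \<in> ell1 S \<Longrightarrow> \<pi> (\<lambda>s. c * f s) = op_scale c (\<pi> f)"
    and "f \<in> ell1 S \<Longrightarrow> g \<in> ell1 S \<Longrightarrow> \<pi> (conv S mul f g) = \<pi> f \<circ> \<pi> g"
    and "f \<in> ell1 S \<Longrightarrow> is_adjoint I (\<pi> f) (\<pi> (invol S mul f))"
    and "f \<in> ell1 S \<Longrightarrow> op_norm I (\<pi> f) \<le> ell1_norm S f"
  using assms by (simp_all add: star_rep_def)

lemma star_rep_diff:
  assumes "star_rep S mul I \<pi>" "f \<in> ell1 S" "g \<in> ell1 S"
  shows "\<pi> (\<lambda>s. f s - g s) = op_diff (\<pi> f) (\<pi> g)"
proof -
  have "\<pi> (\<lambda>s. f s + -1 * g s) = op_add (\<pi> f) (\<pi> (\<lambda>s. -1 * g s))"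
    by (rule star_repD(2)[OF assms(1,2) ell1_scale[OF assms(3)]])
  also have "\<pi> (\<lambda>s. -1 * g s) = op_scale (-1) (\<pi> g)"
    by (rule star_repD(3)[OF assms(1,3)])
  finally show ?thesis by (simp add: op_diff_eq)
qed

lemma zero_star_rep: "star_rep S mul I (\<lambda>f x i. 0)"
  unfolding star_rep_def
  by (auto simp: bop_zero_op op_add_def op_scale_def is_adjoint_def fun_eq_iff)

lemma full_norm_ge:
  fixes S :: "'a set" and \<pi> :: "('a \<Rightarrow> complex) \<Rightarrow> ('a \<times> nat) oper"
  assumes "star_rep S mul UNIV \<pi>" "f \<in> ell1 S"
  shows "op_norm UNIV (\<pi> f) \<le> full_norm S mul f"
  unfolding full_norm_def
proof (rule cSUP_upper)
  show "bdd_above ((\<lambda>\<pi>. op_norm (UNIV :: ('a \<times> nat) set) (\<pi> f)) ` {\<pi>. star_rep S mul UNIV \<pi>})"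
    by (rule bdd_aboveI2[where M = "ell1_norm S f"]) (use assms(2) in \<open>auto simp: star_rep_def\<close>)
qed (use assms(1) in simp)

lemma full_norm_le:
  fixes S :: "'a set"
  assumes "\<And>\<pi>. star_rep S mul (UNIV :: ('a \<times> nat) set) \<pi> \<Longrightarrow> op_norm (UNIV :: ('a \<times> nat) set) (\<pi> f) \<le> K"
  shows "full_norm S mul f \<le> K"
  unfolding full_norm_def
proof (rule cSUP_least)
  show "{\<pi>. star_rep S mul (UNIV :: ('a \<times> nat) set) \<pi>} \<noteq> {}"
    using zero_star_rep[of S mul "UNIV :: ('a \<times> nat) set"] by blast
qed (use assms in simp)

lemma full_norm_nonneg: "f \<in> ell1 S \<Longrightarrow> 0 \<le> full_norm S mul f"
  using full_norm_ge[OF zero_star_rep, of f S mul] by (simp add: bop_zero_op)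

lemma full_norm_le_ell1: "f \<in> ell1 S \<Longrightarrow> full_norm S mul f \<le> ell1_norm S f"
  by (rule full_norm_le) (simp add: star_rep_def)

lemma full_norm_diff_triangle:
  fixes S :: "'a set"
  assumes "f \<in> ell1 S" "g \<in> ell1 S" "h \<in> ell1 S"
  shows "full_norm S mul (\<lambda>s. f s - h s) \<le> full_norm S mul (\<lambda>s. f s - g s) + full_norm S mul (\<lambda>s. g s - h s)"
proof (rule full_norm_le)
  fix \<pi> :: "('a \<Rightarrow> complex) \<Rightarrow> ('a \<times> nat) oper" assume \<pi>: "star_rep S mul UNIV \<pi>"
  have "op_norm UNIV (op_diff (\<pi> f) (\<pi> h)) \<le> op_norm UNIV (op_diff (\<pi> f) (\<pi> g)) + op_norm UNIV (op_diff (\<pi> g) (\<pi> h))"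
    by (rule op_diff_triangle) (use assms star_repD(1)[OF \<pi>] in auto)
  then show "op_norm UNIV (\<pi> (\<lambda>s. f s - h s)) \<le> full_norm S mul (\<lambda>s. f s - g s) + full_norm S mul (\<lambda>s. g s - h s)"
    using full_norm_ge[OF \<pi> ell1_diff[OF assms(1,2)]] full_norm_ge[OF \<pi> ell1_diff[OF assms(2,3)]]
      star_rep_diff[OF \<pi> assms(1,2)] star_rep_diff[OF \<pi> assms(2,3)] star_rep_diff[OF \<pi> assms(1,3)]
    by simp
qed

lemma full_norm_minus_commute:
  fixes S :: "'a set"
  assumes "f \<in> ell1 S" "g \<in> ell1 S"
  shows "full_norm S mul (\<lambda>s. f s - g s) = full_norm S mul (\<lambda>s. g s - f s)"
proof -
  have "full_norm S mul (\<lambda>s. f s - g s) \<le> full_norm S mul (\<lambda>s. g s - f s)"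
    if f: "f \<in> ell1 S" and g: "g \<in> ell1 S" for f g
  proof (rule full_norm_le)
    fix \<pi> :: "('a \<Rightarrow> complex) \<Rightarrow> ('a \<times> nat) oper" assume \<pi>: "star_rep S mul UNIV \<pi>"
    show "op_norm UNIV (\<pi> (\<lambda>s. f s - g s)) \<le> full_norm S mul (\<lambda>s. g s - f s)"
      using full_norm_ge[OF \<pi> ell1_diff[OF g f]]
      by (simp add: star_rep_diff[OF \<pi> f g] star_rep_diff[OF \<pi> g f] op_norm_minus_commute[of _ "\<pi> f"])
  qed
  from this[OF assms] this[OF assms(2,1)] show ?thesis by (rule antisym)
qed

section \<open>Passing to the completion and the injectivity criteria\<close>

lemma full_equiv_equiv: "equiv (full_Cauchy S mul) (full_equiv S mul)"
proof (rule equivI)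
  show "full_equiv S mul \<subseteq> full_Cauchy S mul \<times> full_Cauchy S mul" by (auto simp: full_equiv_def)
  have z: "full_norm S mul (\<lambda>s. 0) = 0"
    using full_norm_le_ell1[of "\<lambda>s. 0" S mul] full_norm_nonneg[of "\<lambda>s. 0" S mul]
    by (simp add: ell1_norm_def)
  show "refl_on (full_Cauchy S mul) (full_equiv S mul)"
    by (auto simp: refl_on_def full_equiv_def z)
  show "sym (full_equiv S mul)"
  proof (rule symI)
    fix F H assume "(F, H) \<in> full_equiv S mul"
    then have *: "F \<in> full_Cauchy S mul" "H \<in> full_Cauchy S mul"
      "(\<lambda>n. full_norm S mul (\<lambda>s. F n s - H n s)) \<longlonglongrightarrow> 0" by (auto simp: full_equiv_def)
    have "full_norm S mul (\<lambda>s. F n s - H n s) = full_norm S mul (\<lambda>s. H n s - F n s)" for n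
      by (rule full_norm_minus_commute) (use * in \<open>auto simp: full_Cauchy_def\<close>)
    with * show "(H, F) \<in> full_equiv S mul" by (simp add: full_equiv_def)
  qed
  show "trans (full_equiv S mul)"
  proof (rule transI)
    fix F G H assume "(F, G) \<in> full_equiv S mul" "(G, H) \<in> full_equiv S mul"
    then have *: "F \<in> full_Cauchy S mul" "G \<in> full_Cauchy S mul" "H \<in> full_Cauchy S mul"
      "(\<lambda>n. full_norm S mul (\<lambda>s. F n s - G n s)) \<longlonglongrightarrow> 0"
      "(\<lambda>n. full_norm S mul (\<lambda>s. G n s - H n s)) \<longlonglongrightarrow> 0" by (auto simp: full_equiv_def)
    then have e: "F n \<in> ell1 S" "G n \<in> ell1 S" "H n \<in> ell1 S" for n by (auto simp: full_Cauchy_def)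
    have "(\<lambda>n. full_norm S mul (\<lambda>s. F n s - H n s)) \<longlonglongrightarrow> 0"
    proof (rule tendsto_sandwich[OF _ _ tendsto_const])
      show "\<forall>\<^sub>F n in sequentially. 0 \<le> full_norm S mul (\<lambda>s. F n s - H n s)"
        using full_norm_nonneg[OF ell1_diff[OF e(1) e(3)]] by auto
      show "\<forall>\<^sub>F n in sequentially. full_norm S mul (\<lambda>s. F n s - H n s)
          \<le> full_norm S mul (\<lambda>s. F n s - G n s) + full_norm S mul (\<lambda>s. G n s - H n s)"
        using full_norm_diff_triangle[OF e] by auto
      show "(\<lambda>n. full_norm S mul (\<lambda>s. F n s - G n s) + full_norm S mul (\<lambda>s. G n s - H n s)) \<longlonglongrightarrow> 0"
        using tendsto_add[OF *(4,5)] by simp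
    qed
    with * show "(F, H) \<in> full_equiv S mul" by (simp add: full_equiv_def)
  qed
qed

locale lreg_rep = pp_rep S mul S \<beta> for S :: "'a set" and mul \<beta> +
  assumes lreg_eq: "s \<in> S \<Longrightarrow> lreg S mul s = ppop s"
begin

lemma lreg_ell1_eq: "lreg_ell1 S mul f = pp f"
  unfolding lreg_ell1_def pp_def by (intro ext infsum_cong) (simp add: lreg_eq)

lemma lreg_star_rep: "star_rep S mul S (lreg_ell1 S mul)"
  using pp_star_rep by (simp add: lreg_ell1_eq[abs_def])

lemma lreg_bop: "f \<in> ell1 S \<Longrightarrow> lreg_ell1 S mul f \<in> bop S"
  using star_repD(1)[OF lreg_star_rep] .

abbreviation red :: "('a \<Rightarrow> complex) \<Rightarrow> real" where
  "red f \<equiv> op_norm S (lreg_ell1 S mul f)"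

text \<open>\<open>full_norm\<close> tests representations on the Hilbert space over
  \<open>'a \<times> nat\<close>; the copy with index 0 hosts the regular representation.\<close>

definition emb :: "('a \<Rightarrow> complex) \<Rightarrow> 'a \<times> nat \<Rightarrow> complex" where
  "emb x = (\<lambda>(v, k). if k = 0 then x v else 0)"

lemma emb_ell2:
  assumes x: "x \<in> ell2 S"
  shows "emb x \<in> ell2 UNIV" "ell2_norm UNIV (emb x) = ell2_norm S x"
proof -
  have bij: "bij_betw (\<lambda>v. (v, 0::nat)) S (S \<times> {0})"
    by (auto simp: bij_betw_def inj_on_def)
  have nz: "x a \<noteq> 0 \<Longrightarrow> a \<in> S" for a using ell2_zero_off[OF x] by blast
  have h: "((\<lambda>i. (cmod (x i))\<^sup>2) has_sum (ell2_norm S x)\<^sup>2) S"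
    unfolding ell2_norm_sq using x by (intro has_sum_infsum) (simp add: ell2_def)
  then have "((\<lambda>p. (cmod (emb x p))\<^sup>2) has_sum (ell2_norm S x)\<^sup>2) (S \<times> {0})"
    by (subst has_sum_reindex_bij_betw[OF bij, symmetric]) (simp add: emb_def)
  then have h': "((\<lambda>p. (cmod (emb x p))\<^sup>2) has_sum (ell2_norm S x)\<^sup>2) UNIV"
    by (rule has_sum_cong_neutral[THEN iffD1, rotated -1])
      (auto simp: emb_def dest: nz split: if_splits)
  then show e: "emb x \<in> ell2 UNIV" by (auto simp: ell2_def has_sum_imp_summable)
  have "(ell2_norm UNIV (emb x))\<^sup>2 = (ell2_norm S x)\<^sup>2"
    using h' by (simp add: ell2_norm_sq[of UNIV] infsumI)
  then show "ell2_norm UNIV (emb x) = ell2_norm S x"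
    by (simp add: power2_eq_iff_nonneg)
qed

text \<open>Letting S act by zero off the copy with index 0 makes the regular representation one of
  those in \<open>full_norm\<close>.\<close>

lemma red_le_full:
  assumes f: "f \<in> ell1 S"
  shows "red f \<le> full_norm S mul f"
proof -
  define \<gamma> :: "'a \<Rightarrow> 'a \<times> nat \<Rightarrow> ('a \<times> nat) option" where
    "\<gamma> = (\<lambda>s (v, k). if k = 0 \<and> v \<in> S then map_option (\<lambda>w. (w, 0)) (\<beta> s v) else None)"
  interpret E: pp_rep S mul UNIV \<gamma>
  proof
    show "\<gamma> (mul s t) p = Option.bind (\<gamma> s p) (\<gamma> t)" if "s \<in> S" "t \<in> S" for s t p
      using that \<beta>_mul[OF that] \<beta>_in[OF that(1)] by (cases p; cases "\<beta> s (fst p)") (auto simp: \<gamma>_def)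
    show "\<gamma> (star S mul s) w = Some v" if "s \<in> S" "\<gamma> s v = Some w" for s v w
      using that \<beta>_star[OF that(1)] \<beta>_in[OF that(1)] by (auto simp: \<gamma>_def split: if_splits prod.splits)
  qed (auto simp: mul_closed star_closed star_star)
  have \<gamma>0: "v \<in> S \<Longrightarrow> \<gamma> s (v, 0) = map_option (\<lambda>w. (w, 0)) (\<beta> s v)" for s v
    by (simp add: \<gamma>_def)
  have E: "E.pp f (emb x) (v, 0) = pp f x v" if x: "x \<in> ell2 S" and v: "v \<in> S" for x v
    unfolding E.pp_def pp_def
  proof (rule infsum_cong)
    fix s assume s: "s \<in> S"
    have "E.ppop s (emb x) (v, 0) = ppop s x v"
      using v x emb_ell2(1)[OF x] unfolding E.ppop_def ppop_def E.pv_def pv_def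
      by (cases "\<beta> s v") (simp_all add: emb_def \<gamma>0)
    then show "f s * E.ppop s (emb x) (v, 0) = f s * ppop s x v" by simp
  qed
  have "red f \<le> op_norm UNIV (E.pp f)"
    unfolding lreg_ell1_eq
  proof (rule op_norm_le)
    show "0 \<le> op_norm UNIV (E.pp f)" using op_norm_nonneg[OF E.pp_bop(1)[OF f]] .
    fix x assume x: "x \<in> ell2 S"
    have "ell2_norm S (pp f x) \<le> ell2_norm UNIV (E.pp f (emb x))"
    proof (rule ell2_intro(2))
      show "pp f x i = 0" if "i \<notin> S" for i using that by (simp add: pp_def ppop_def)
      fix A assume A: "finite A" "A \<subseteq> S"
      have "L2_set (\<lambda>i. cmod (pp f x i)) A = L2_set (\<lambda>p. cmod (E.pp f (emb x) p)) ((\<lambda>v. (v, 0)) ` A)"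
        unfolding L2_set_def using A
        by (subst sum.reindex) (auto simp: inj_on_def E[OF x] subset_iff intro!: arg_cong[where f = sqrt] sum.cong)
      also have "\<dots> \<le> ell2_norm UNIV (E.pp f (emb x))"
        by (rule ell2_finite_le) (use A E.pp_ell2(1)[OF f emb_ell2(1)[OF x]] in auto)
      finally show "L2_set (\<lambda>i. cmod (pp f x i)) A \<le> ell2_norm UNIV (E.pp f (emb x))" .
    qed
    also have "\<dots> \<le> op_norm UNIV (E.pp f) * ell2_norm S x"
      using op_norm_bound[OF E.pp_bop(1)[OF f] emb_ell2(1)[OF x]] by (simp add: emb_ell2(2)[OF x])
    finally show "ell2_norm S (pp f x) \<le> op_norm UNIV (E.pp f) * ell2_norm S x" .
  qed
  also have "\<dots> \<le> full_norm S mul f" by (rule full_norm_ge[OF E.pp_star_rep f])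
  finally show ?thesis .
qed

lemma full_Cauchy_ell1: "F \<in> full_Cauchy S mul \<Longrightarrow> F n \<in> ell1 S"
  by (simp add: full_Cauchy_def)

lemma red_diff: "f \<in> ell1 S \<Longrightarrow> g \<in> ell1 S \<Longrightarrow>
    red (\<lambda>s. f s - g s) = op_norm S (op_diff (lreg_ell1 S mul f) (lreg_ell1 S mul g))"
  by (simp add: star_rep_diff[OF lreg_star_rep])

text \<open>Resolves the definite description in \<open>lreg_full\<close>: the limit does not depend
  on the representative because \<open>red\<close> is below the full norm, and it is unique because
  norm zero forces equality in \<open>bop\<close>.\<close>

lemma lreg_full_class:
  assumes F: "F \<in> full_Cauchy S mul" and T: "T \<in> bop S"
    and lim: "(\<lambda>n. op_norm S (op_diff (lreg_ell1 S mul (F n)) T)) \<longlonglongrightarrow> 0"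
  shows "lreg_full S mul (full_equiv S mul `` {F}) = T"
  unfolding lreg_full_def
proof (rule the_equality)
  have "(\<lambda>n. op_norm S (op_diff (lreg_ell1 S mul (H n)) T)) \<longlonglongrightarrow> 0" if "H \<in> full_equiv S mul `` {F}" for H
  proof (rule tendsto_sandwich[OF _ _ tendsto_const])
    have H: "H \<in> full_Cauchy S mul" and FH: "(\<lambda>n. full_norm S mul (\<lambda>s. F n s - H n s)) \<longlonglongrightarrow> 0"
      using that by (auto simp: full_equiv_def)
    note e = full_Cauchy_ell1[OF F] full_Cauchy_ell1[OF H]
    show "\<forall>\<^sub>F n in sequentially. 0 \<le> op_norm S (op_diff (lreg_ell1 S mul (H n)) T)"
      using op_norm_nonneg[OF bop_op_diff(1)[OF lreg_bop[OF e(2)] T]] by auto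
    have "op_norm S (op_diff (lreg_ell1 S mul (H n)) T)
      \<le> full_norm S mul (\<lambda>s. F n s - H n s) + op_norm S (op_diff (lreg_ell1 S mul (F n)) T)" for n
      using op_diff_triangle[OF lreg_bop[OF e(2)] lreg_bop[OF e(1)] T, of n n]
        red_le_full[OF ell1_diff[OF e(1) e(2)], of n n] red_diff[OF e(1) e(2), of n n]
        op_norm_minus_commute[of S "lreg_ell1 S mul (F n)" "lreg_ell1 S mul (H n)"]
      by linarith
    then show "\<forall>\<^sub>F n in sequentially. op_norm S (op_diff (lreg_ell1 S mul (H n)) T)
      \<le> full_norm S mul (\<lambda>s. F n s - H n s) + op_norm S (op_diff (lreg_ell1 S mul (F n)) T)"
      by auto
    show "(\<lambda>n. full_norm S mul (\<lambda>s. F n s - H n s) + op_norm S (op_diff (lreg_ell1 S mul (F n)) T)) \<longlonglongrightarrow> 0"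
      using tendsto_add[OF FH lim] by simp
  qed
  with T show "T \<in> bop S \<and> (\<forall>H\<in>full_equiv S mul `` {F}.
      (\<lambda>n. op_norm S (op_diff (lreg_ell1 S mul (H n)) T)) \<longlonglongrightarrow> 0)" by blast
next
  fix U assume U: "U \<in> bop S \<and> (\<forall>H\<in>full_equiv S mul `` {F}.
      (\<lambda>n. op_norm S (op_diff (lreg_ell1 S mul (H n)) U)) \<longlonglongrightarrow> 0)"
  have "F \<in> full_equiv S mul `` {F}" using equiv_class_self[OF full_equiv_equiv F] .
  with U have limU: "(\<lambda>n. op_norm S (op_diff (lreg_ell1 S mul (F n)) U)) \<longlonglongrightarrow> 0" and Ub: "U \<in> bop S" by auto
  have "op_norm S (op_diff U T) \<le> 0"
  proof (rule tendsto_lowerbound)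
    show "(\<lambda>n. op_norm S (op_diff (lreg_ell1 S mul (F n)) U) + op_norm S (op_diff (lreg_ell1 S mul (F n)) T)) \<longlonglongrightarrow> 0"
      using tendsto_add[OF limU lim] by simp
    have "op_norm S (op_diff U T) \<le> op_norm S (op_diff (lreg_ell1 S mul (F n)) U) + op_norm S (op_diff (lreg_ell1 S mul (F n)) T)" for n
      using op_diff_triangle[OF Ub lreg_bop[OF full_Cauchy_ell1[OF F]] T, of n]
        op_norm_minus_commute[of S U "lreg_ell1 S mul (F n)"] by linarith
    then show "\<forall>\<^sub>F n in sequentially. op_norm S (op_diff U T)
      \<le> op_norm S (op_diff (lreg_ell1 S mul (F n)) U) + op_norm S (op_diff (lreg_ell1 S mul (F n)) T)" by auto
  qed simp
  then show "U = T" by (rule bop_eqI[OF Ub T])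
qed

lemma lreg_full_exists:
  assumes F: "F \<in> full_Cauchy S mul"
  shows "\<exists>T\<in>bop S. (\<lambda>n. op_norm S (op_diff (lreg_ell1 S mul (F n)) T)) \<longlonglongrightarrow> 0"
proof (rule bop_complete)
  note e = full_Cauchy_ell1[OF F]
  show "lreg_ell1 S mul (F n) \<in> bop S" for n by (rule lreg_bop[OF e])
  fix \<epsilon> :: real assume "\<epsilon> > 0"
  then obtain N where N: "\<And>m n. m \<ge> N \<Longrightarrow> n \<ge> N \<Longrightarrow> full_norm S mul (\<lambda>s. F m s - F n s) < \<epsilon>"
    using F unfolding full_Cauchy_def by blast
  have "op_norm S (op_diff (lreg_ell1 S mul (F m)) (lreg_ell1 S mul (F n))) < \<epsilon>" if "m \<ge> N" "n \<ge> N" for m n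
    using N[OF that] red_le_full[OF ell1_diff[OF e e], of m n] red_diff[OF e e, of m n] by linarith
  then show "\<exists>N. \<forall>m\<ge>N. \<forall>n\<ge>N. op_norm S (op_diff (lreg_ell1 S mul (F m)) (lreg_ell1 S mul (F n))) < \<epsilon>"
    by blast
qed

text \<open>If two classes have the same limit operator, \<open>red\<close> of the difference of
  representatives tends to 0, and the hypothesis turns this into equality of the classes.\<close>

theorem weak_containmentI:
  assumes le: "\<And>f. f \<in> ell1 S \<Longrightarrow> full_norm S mul f \<le> red f"
  shows "weak_containment S mul"
  unfolding weak_containment_def
proof (rule inj_onI)
  fix X Y assume "X \<in> full_cstar S mul" "Y \<in> full_cstar S mul" and eq: "lreg_full S mul X = lreg_full S mul Y"
  then obtain F H where F: "F \<in> full_Cauchy S mul" "X = full_equiv S mul `` {F}"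
    and H: "H \<in> full_Cauchy S mul" "Y = full_equiv S mul `` {H}"
    unfolding full_cstar_def by (auto elim!: quotientE)
  note e = full_Cauchy_ell1[OF F(1)] full_Cauchy_ell1[OF H(1)]
  obtain T where T: "T \<in> bop S" "(\<lambda>n. op_norm S (op_diff (lreg_ell1 S mul (F n)) T)) \<longlonglongrightarrow> 0"
    using lreg_full_exists[OF F(1)] by blast
  obtain U where U: "U \<in> bop S" "(\<lambda>n. op_norm S (op_diff (lreg_ell1 S mul (H n)) U)) \<longlonglongrightarrow> 0"
    using lreg_full_exists[OF H(1)] by blast
  have "T = U" using eq lreg_full_class[OF F(1) T] lreg_full_class[OF H(1) U] F H by simp
  have "(\<lambda>n. full_norm S mul (\<lambda>s. F n s - H n s)) \<longlonglongrightarrow> 0"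
  proof (rule tendsto_sandwich[OF _ _ tendsto_const])
    show "\<forall>\<^sub>F n in sequentially. 0 \<le> full_norm S mul (\<lambda>s. F n s - H n s)"
      using full_norm_nonneg[OF ell1_diff[OF e(1) e(2)]] by auto
    have "full_norm S mul (\<lambda>s. F n s - H n s)
      \<le> op_norm S (op_diff (lreg_ell1 S mul (F n)) T) + op_norm S (op_diff (lreg_ell1 S mul (H n)) T)" for n
      using le[OF ell1_diff[OF e(1) e(2)], of n n] red_diff[OF e(1) e(2), of n n]
        op_diff_triangle[OF lreg_bop[OF e(1)] T(1) lreg_bop[OF e(2)], of n n]
        op_norm_minus_commute[of S T "lreg_ell1 S mul (H n)"] by linarith
    then show "\<forall>\<^sub>F n in sequentially. full_norm S mul (\<lambda>s. F n s - H n s)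
      \<le> op_norm S (op_diff (lreg_ell1 S mul (F n)) T) + op_norm S (op_diff (lreg_ell1 S mul (H n)) T)" by auto
    show "(\<lambda>n. op_norm S (op_diff (lreg_ell1 S mul (F n)) T) + op_norm S (op_diff (lreg_ell1 S mul (H n)) T)) \<longlonglongrightarrow> 0"
      using tendsto_add[OF T(2) U(2)] \<open>T = U\<close> by simp
  qed
  then have "(F, H) \<in> full_equiv S mul" using F H by (simp add: full_equiv_def)
  then show "X = Y" using equiv_class_eq[OF full_equiv_equiv] F H by simp
qed

text \<open>The class of \<open>F\<close> is a nonzero element of the kernel: its image agrees with
  that of the zero sequence.\<close>

theorem not_weak_containmentI:
  assumes F: "F \<in> full_Cauchy S mul" and red0: "(\<lambda>n. red (F n)) \<longlonglongrightarrow> 0"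
    and full: "\<not> (\<lambda>n. full_norm S mul (F n)) \<longlonglongrightarrow> 0"
  shows "\<not> weak_containment S mul"
proof
  assume "weak_containment S mul"
  then have inj: "inj_on (lreg_full S mul) (full_cstar S mul)" by (simp add: weak_containment_def)
  let ?Z = "\<lambda>(n::nat) (s::'a). 0 :: complex"
  have z: "full_norm S mul (\<lambda>s. 0) = 0"
    using full_norm_le_ell1[of "\<lambda>s. 0" S mul] full_norm_nonneg[of "\<lambda>s. 0" S mul]
    by (simp add: ell1_norm_def)
  have Z: "?Z \<in> full_Cauchy S mul" by (auto simp: full_Cauchy_def z)
  let ?O = "\<lambda>(x :: 'a \<Rightarrow> complex) (i :: 'a). 0 :: complex"
  have d: "op_diff T ?O = T" for T :: "'a oper" by (simp add: op_diff_def)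
  have "lreg_full S mul (full_equiv S mul `` {F}) = ?O"
    by (rule lreg_full_class[OF F bop_zero_op(1)]) (simp add: d red0)
  moreover have "lreg_ell1 S mul (\<lambda>s. 0) = ?O" by (simp add: lreg_ell1_def)
  then have "lreg_full S mul (full_equiv S mul `` {?Z}) = ?O"
    by (intro lreg_full_class[OF Z bop_zero_op(1)]) (simp add: d bop_zero_op(2))
  moreover have "full_equiv S mul `` {F} \<in> full_cstar S mul" "full_equiv S mul `` {?Z} \<in> full_cstar S mul"
    unfolding full_cstar_def using F Z by (auto intro: quotientI)
  ultimately have "full_equiv S mul `` {F} = full_equiv S mul `` {?Z}"
    using inj_onD[OF inj] by simp
  then have "(F, ?Z) \<in> full_equiv S mul"
    using eq_equiv_class[OF _ full_equiv_equiv Z] by simp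
  with full show False by (simp add: full_equiv_def)
qed

end


section \<open>The free product of five groups of order two\<close>

text \<open>Each generator is its own inverse, so a word is reduced as soon as no two neighbours
  agree, and inversion is \<open>rev\<close>.\<close>

definition Red :: "nat list set" where
  "Red = {w. set w \<subseteq> {..<5} \<and> distinct_adj w}"

text \<open>Left multiplication by a generator on normal forms. Building the product from these
  involutions, as in van der Waerden's proof of the normal form theorem, avoids a quotient by
  rewriting.\<close>

definition push :: "nat \<Rightarrow> nat list \<Rightarrow> nat list" where
  "push s w = (case w of [] \<Rightarrow> [s] | t # w' \<Rightarrow> if s = t then w' else s # w)"

definition wmul :: "nat list \<Rightarrow> nat list \<Rightarrow> nat list" where
  "wmul u v = foldr push u v"

lemma Red_Nil [simp]: "[] \<in> Red"
  by (simp add: Red_def)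

lemma Red_Cons: "s # w \<in> Red \<longleftrightarrow> s < 5 \<and> w \<in> Red \<and> (w = [] \<or> hd w \<noteq> s)"
  by (cases w) (auto simp: Red_def)

lemma push_simps: "push s [] = [s]" "push s (t # w) = (if s = t then w else s # t # w)"
  by (auto simp: push_def)

lemma push_Red: "s < 5 \<Longrightarrow> w \<in> Red \<Longrightarrow> push s w \<in> Red"
  by (cases w) (auto simp: push_simps Red_Cons)

lemma push_push: "w \<in> Red \<Longrightarrow> push s (push s w) = w"
  by (cases w; cases "tl w") (auto simp: push_simps Red_Cons)

lemma push_hd: "s # w \<in> Red \<Longrightarrow> push s w = s # w"
  by (cases w) (auto simp: push_simps Red_Cons)

lemma foldr_push_Red: "set u \<subseteq> {..<5} \<Longrightarrow> v \<in> Red \<Longrightarrow> foldr push u v \<in> Red"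
  by (induction u) (auto simp: push_Red)

lemma Red_set: "w \<in> Red \<Longrightarrow> set w \<subseteq> {..<5}"
  by (simp add: Red_def)

lemma wmul_Red [simp]: "u \<in> Red \<Longrightarrow> v \<in> Red \<Longrightarrow> wmul u v \<in> Red"
  by (simp add: wmul_def foldr_push_Red Red_set)

lemma rev_Red [simp]: "rev w \<in> Red \<longleftrightarrow> w \<in> Red"
  by (simp add: Red_def distinct_adj_rev)

lemma wmul_Nil [simp]: "wmul [] v = v"
  by (simp add: wmul_def)

lemma wmul_Nil2 [simp]: "w \<in> Red \<Longrightarrow> wmul w [] = w"
  unfolding wmul_def by (induction w) (auto simp: Red_Cons push_hd)

text \<open>Associativity for one generator: both the cancelling and the prolonging case of
  \<open>push\<close> come down to \<open>push s\<close> being an involution on reduced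
  words.\<close>

lemma foldr_push_push: "v \<in> Red \<Longrightarrow> w \<in> Red \<Longrightarrow> foldr push (push s v) w = push s (foldr push v w)"
  by (cases v) (auto simp: push_simps push_push foldr_push_Red Red_set Red_Cons)

lemma foldr_push_assoc:
  "set u \<subseteq> {..<5} \<Longrightarrow> v \<in> Red \<Longrightarrow> w \<in> Red \<Longrightarrow> foldr push (foldr push u v) w = foldr push u (foldr push v w)"
  by (induction u) (auto simp: foldr_push_push foldr_push_Red)

lemma wmul_assoc: "u \<in> Red \<Longrightarrow> v \<in> Red \<Longrightarrow> w \<in> Red \<Longrightarrow> wmul (wmul u v) w = wmul u (wmul v w)"
  by (simp add: wmul_def foldr_push_assoc Red_set)

lemma foldr_push_rev: "set u \<subseteq> {..<5} \<Longrightarrow> v \<in> Red \<Longrightarrow> foldr push (rev u) (foldr push u v) = v"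
  by (induction u) (auto simp: push_push foldr_push_Red)

lemma wmul_rev_left: "u \<in> Red \<Longrightarrow> v \<in> Red \<Longrightarrow> wmul (rev u) (wmul u v) = v"
  by (simp add: wmul_def foldr_push_rev Red_set)

lemma wmul_rev_left2: "u \<in> Red \<Longrightarrow> v \<in> Red \<Longrightarrow> wmul u (wmul (rev u) v) = v"
  using wmul_rev_left[of "rev u" v] by simp

lemma wmul_rev1 [simp]: "u \<in> Red \<Longrightarrow> wmul (rev u) u = []"
  using wmul_rev_left[of u "[]"] by simp

lemma wmul_rev2 [simp]: "u \<in> Red \<Longrightarrow> wmul u (rev u) = []"
  using wmul_rev1[of "rev u"] by simp

lemma rev_wmul: "u \<in> Red \<Longrightarrow> v \<in> Red \<Longrightarrow> rev (wmul u v) = wmul (rev v) (rev u)"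
proof -
  assume uv: "u \<in> Red" "v \<in> Red"
  have "wmul (wmul u v) (wmul (rev v) (rev u)) = []"
    using uv by (simp add: wmul_assoc wmul_rev_left2)
  then show ?thesis using wmul_rev_left[of "wmul u v" "wmul (rev v) (rev u)"] uv by simp
qed


section \<open>Clifford semigroups from a chain of congruences\<close>

text \<open>Level \<open>0\<close> is the top idempotent, and the positive levels increase towards it.\<close>

definition lle :: "nat \<Rightarrow> nat \<Rightarrow> bool" where
  "lle n m \<longleftrightarrow> m = 0 \<or> (0 < n \<and> n \<le> m)"

definition lmeet :: "nat \<Rightarrow> nat \<Rightarrow> nat" where
  "lmeet n m = (if n = 0 then m else if m = 0 then n else min n m)"

lemma lmeet_simps [simp]: "lmeet n n = n" "lmeet 0 n = n" "lmeet n 0 = n"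
  by (auto simp: lmeet_def)

lemma lmeet_comm: "lmeet n m = lmeet m n"
  by (auto simp: lmeet_def)

lemma lmeet_assoc: "lmeet (lmeet n m) k = lmeet n (lmeet m k)"
  by (auto simp: lmeet_def)

lemma lle_refl [simp]: "lle n n" "lle n 0"
  by (auto simp: lle_def)

lemma lmeet_lle: "lle (lmeet n m) n" "lle (lmeet n m) m"
  by (auto simp: lmeet_def lle_def)

lemma lle_lmeet_iff: "lle k (lmeet n m) \<longleftrightarrow> lle k n \<and> lle k m"
  by (auto simp: lmeet_def lle_def)

lemma lmeet_eq_iff: "lmeet n m = m \<longleftrightarrow> lle m n"
  by (auto simp: lmeet_def lle_def)

text \<open>\<open>rp n\<close> selects a representative from each class of the congruence at level
  \<open>n\<close>, so equality of representatives is the congruence. By \<open>rp_rp\<close> a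
  lower level has a coarser congruence, which yields the connecting homomorphisms of the Clifford
  semigroup.\<close>

locale cliff =
  fixes L :: "nat set" and rp :: "nat \<Rightarrow> nat list \<Rightarrow> nat list"
  assumes L0: "0 \<in> L"
    and rp0: "u \<in> Red \<Longrightarrow> rp 0 u = u"
    and rp_Red: "n \<in> L \<Longrightarrow> u \<in> Red \<Longrightarrow> rp n u \<in> Red"
    and rp_cong: "n \<in> L \<Longrightarrow> u \<in> Red \<Longrightarrow> u' \<in> Red \<Longrightarrow> v \<in> Red \<Longrightarrow> v' \<in> Red \<Longrightarrow>
      rp n u = rp n u' \<Longrightarrow> rp n v = rp n v' \<Longrightarrow> rp n (wmul u v) = rp n (wmul u' v')"
    and rp_rp: "n \<in> L \<Longrightarrow> m \<in> L \<Longrightarrow> lle n m \<Longrightarrow> u \<in> Red \<Longrightarrow> rp n (rp m u) = rp n u"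
begin

text \<open>Levels and representatives are coded by numbers, so that both examples live on the type
  \<open>nat\<close>.\<close>

definition en :: "nat \<Rightarrow> nat list \<Rightarrow> nat" where
  "en n w = prod_encode (n, list_encode (rp n w))"

definition S :: "nat set" where
  "S = {en n w |n w. n \<in> L \<and> w \<in> Red}"

definition lv :: "nat \<Rightarrow> nat" where
  "lv s = fst (prod_decode s)"

definition wd :: "nat \<Rightarrow> nat list" where
  "wd s = list_decode (snd (prod_decode s))"

definition mul :: "nat \<Rightarrow> nat \<Rightarrow> nat" where
  "mul s t = en (lmeet (lv s) (lv t)) (wmul (wd s) (wd t))"

text \<open>Left multiplication by the inverse of \<open>s\<close>, defined on the levels at or
  below that of \<open>s\<close>: the pull-back form of the regular representation.\<close>

definition \<beta> :: "nat \<Rightarrow> nat \<Rightarrow> nat option" where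
  "\<beta> s v = (if lle (lv v) (lv s) then Some (en (lv v) (wmul (rev (wd s)) (wd v))) else None)"

lemma lv_en [simp]: "lv (en n w) = n"
  by (simp add: lv_def en_def)

lemma wd_en: "wd (en n w) = rp n w"
  by (simp add: wd_def en_def)

lemma en_eq: "en n u = en m v \<longleftrightarrow> n = m \<and> rp n u = rp n v"
  by (auto simp: en_def list_encode_eq)

lemma lmeet_L: "n \<in> L \<Longrightarrow> m \<in> L \<Longrightarrow> lmeet n m \<in> L"
  by (auto simp: lmeet_def min_def)

lemma en_S [simp]: "n \<in> L \<Longrightarrow> w \<in> Red \<Longrightarrow> en n w \<in> S"
  by (auto simp: S_def)

lemma S_cases:
  assumes "s \<in> S" obtains n w where "n \<in> L" "w \<in> Red" "s = en n w"
  using assms by (auto simp: S_def)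

lemma rp_rp_same: "n \<in> L \<Longrightarrow> u \<in> Red \<Longrightarrow> rp n (rp n u) = rp n u"
  by (simp add: rp_rp)

lemma rp_rev:
  assumes "n \<in> L" "u \<in> Red" "v \<in> Red" "rp n u = rp n v"
  shows "rp n (rev u) = rp n (rev v)"
proof -
  have "rp n (wmul (rev u) (wmul u (rev v))) = rp n (wmul (rev u) (wmul v (rev v)))"
    using assms by (intro rp_cong) auto
  then show ?thesis using assms by (simp add: wmul_rev_left)
qed

lemma mul_en:
  assumes "n \<in> L" "m \<in> L" "u \<in> Red" "v \<in> Red"
  shows "mul (en n u) (en m v) = en (lmeet n m) (wmul u v)"
proof -
  have "rp (lmeet n m) (wmul (rp n u) (rp m v)) = rp (lmeet n m) (wmul u v)"
    using assms by (intro rp_cong) (auto simp: lmeet_L rp_Red rp_rp lmeet_lle)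
  then show ?thesis by (simp add: mul_def en_eq wd_en)
qed

lemma \<beta>_en:
  assumes "n \<in> L" "m \<in> L" "u \<in> Red" "v \<in> Red"
  shows "\<beta> (en n u) (en m v) = (if lle m n then Some (en m (wmul (rev u) v)) else None)"
proof -
  have "rp m (wmul (rev (rp n u)) (rp m v)) = rp m (wmul (rev u) v)" if "lle m n"
    using assms that by (intro rp_cong rp_rev) (auto simp: rp_Red rp_rp)
  then show ?thesis by (simp add: \<beta>_def en_eq wd_en)
qed

text \<open>The two equations force the levels to agree; what is left is uniqueness of inverses in a
  quotient group, by cancellation modulo the congruence.\<close>

lemma inverse_iff:
  assumes "n \<in> L" "m \<in> L" "u \<in> Red" "v \<in> Red"
  shows "mul (mul (en n u) (en m v)) (en n u) = en n u \<and> mul (mul (en m v) (en n u)) (en m v) = en m v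
    \<longleftrightarrow> en m v = en n (rev u)"
proof
  assume *: "mul (mul (en n u) (en m v)) (en n u) = en n u \<and> mul (mul (en m v) (en n u)) (en m v) = en m v"
  have e: "mul (mul (en n u) (en m v)) (en n u) = en (lmeet (lmeet n m) n) (wmul (wmul u v) u)"
    "mul (mul (en m v) (en n u)) (en m v) = en (lmeet (lmeet m n) m) (wmul (wmul v u) v)"
    using assms by (simp_all add: mul_en lmeet_L)
  from * have "en (lmeet (lmeet n m) n) (wmul (wmul u v) u) = en n u"
    "en (lmeet (lmeet m n) m) (wmul (wmul v u) v) = en m v" unfolding e by blast+
  from this[unfolded en_eq] have 1: "lmeet (lmeet n m) n = n" and 2: "lmeet (lmeet m n) m = m"
    and 3: "rp (lmeet (lmeet n m) n) (wmul (wmul u v) u) = rp (lmeet (lmeet n m) n) u" by blast+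
  have 4: "rp n (wmul (wmul u v) u) = rp n u" using 3 unfolding 1 .
  have nm: "n = m" using 1 2 by (metis lmeet_assoc lmeet_comm lmeet_simps(1))
  \<comment> \<open>Multiply the congruence \<open>4\<close> by the inverse of \<open>u\<close> on
    both sides.\<close>
  have "rp n (wmul (rev u) (wmul (wmul (wmul u v) u) (rev u))) = rp n (wmul (rev u) (wmul u (rev u)))"
    using assms 4 by (intro rp_cong) auto
  then have "rp n v = rp n (rev u)" using assms by (simp add: wmul_assoc wmul_rev_left)
  with nm show "en m v = en n (rev u)" by (simp add: en_eq)
next
  assume e: "en m v = en n (rev u)"
  show "mul (mul (en n u) (en m v)) (en n u) = en n u \<and> mul (mul (en m v) (en n u)) (en m v) = en m v"
    unfolding e using assms by (simp add: mul_en)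
qed

lemma mul_S [simp]: "s \<in> S \<Longrightarrow> t \<in> S \<Longrightarrow> mul s t \<in> S"
  by (elim S_cases) (simp add: mul_en lmeet_L)

lemma mul_assoc: "s \<in> S \<Longrightarrow> t \<in> S \<Longrightarrow> r \<in> S \<Longrightarrow> mul (mul s t) r = mul s (mul t r)"
  by (elim S_cases) (simp add: mul_en lmeet_L lmeet_assoc wmul_assoc)

lemma inverse_semigroup: "inverse_semigroup S mul"
  unfolding inverse_semigroup_def semigroup_on_def
proof (intro conjI ballI)
  fix s assume "s \<in> S"
  then obtain n u where s: "n \<in> L" "u \<in> Red" "s = en n u" by (rule S_cases)
  show "\<exists>!t. t \<in> S \<and> mul (mul s t) s = s \<and> mul (mul t s) t = t"
  proof (rule ex1I[of _ "en n (rev u)"])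
    show "en n (rev u) \<in> S \<and> mul (mul s (en n (rev u))) s = s \<and> mul (mul (en n (rev u)) s) (en n (rev u)) = en n (rev u)"
      using s inverse_iff[of n n u "rev u"] by simp
    fix t assume t: "t \<in> S \<and> mul (mul s t) s = s \<and> mul (mul t s) t = t"
    then obtain m v where "m \<in> L" "v \<in> Red" "t = en m v" by (auto elim: S_cases)
    then show "t = en n (rev u)" using t s inverse_iff[of n m u v] by simp
  qed
qed (simp_all add: mul_assoc)

lemma star_en:
  assumes "n \<in> L" "u \<in> Red" shows "star S mul (en n u) = en n (rev u)"
  unfolding star_def
proof (rule the_equality)
  show "en n (rev u) \<in> S \<and> mul (mul (en n u) (en n (rev u))) (en n u) = en n u \<and>
     mul (mul (en n (rev u)) (en n u)) (en n (rev u)) = en n (rev u)"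
    using assms inverse_iff[of n n u "rev u"] by simp
  fix t assume t: "t \<in> S \<and> mul (mul (en n u) t) (en n u) = en n u \<and> mul (mul t (en n u)) t = t"
  then obtain m v where "m \<in> L" "v \<in> Red" "t = en m v" by (auto elim: S_cases)
  then show "t = en n (rev u)" using t assms inverse_iff[of n m u v] by simp
qed

section \<open>Idempotents and the decomposition into groups\<close>

lemma idempotents_eq: "idempotents S mul = {en n [] |n. n \<in> L}"
proof (intro equalityI subsetI)
  fix s assume "s \<in> idempotents S mul"
  then obtain n u where s: "n \<in> L" "u \<in> Red" "s = en n u" and "mul s s = s"
    by (auto simp: idempotents_def elim: S_cases)
  then have e: "rp n (wmul u u) = rp n u" by (simp add: mul_en en_eq)
  have "rp n (wmul (rev u) (wmul u u)) = rp n (wmul (rev u) u)"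
    using s e by (intro rp_cong) auto
  then show "s \<in> {en n [] |n. n \<in> L}" using s by (auto simp: wmul_rev_left en_eq)
next
  fix s assume "s \<in> {en n [] |n. n \<in> L}"
  then show "s \<in> idempotents S mul" by (auto simp: idempotents_def mul_en)
qed

definition G :: "nat \<Rightarrow> nat set" where
  "G e = {s \<in> S. lv s = lv e}"

lemma group_on_G:
  assumes n: "n \<in> L" shows "group_on (G (en n [])) mul (en n [])"
  unfolding group_on_def
proof (rule groupI, simp_all)
  show "en n [] \<in> G (en n [])" using n by (simp add: G_def)
  fix x assume x: "x \<in> G (en n [])"
  then obtain u where u: "u \<in> Red" "x = en n u" by (auto simp: G_def elim: S_cases)
  then show "mul (en n []) x = x" using n by (simp add: mul_en)
  show "\<exists>y\<in>G (en n []). mul y x = en n []"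
    by (rule bexI[of _ "en n (rev u)"]) (use n u in \<open>simp_all add: mul_en G_def\<close>)
  fix y assume y: "y \<in> G (en n [])"
  then obtain v where v: "v \<in> Red" "y = en n v" by (auto simp: G_def elim: S_cases)
  show "mul x y \<in> G (en n [])" using u v n by (simp add: G_def mul_en)
  fix z assume "z \<in> G (en n [])"
  then show "mul (mul x y) z = mul x (mul y z)" using x y by (simp add: G_def mul_assoc)
qed

lemma clifford: "clifford_inverse_semigroup S mul G"
  unfolding clifford_inverse_semigroup_def idempotents_eq
proof (intro conjI ballI)
  show "inverse_semigroup S mul" by (rule inverse_semigroup)
  show "S = (\<Union>e\<in>{en n [] |n. n \<in> L}. G e)"
    by (auto simp: G_def elim!: S_cases)
  show "disjoint_family_on G {en n [] |n. n \<in> L}"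
    by (auto simp: disjoint_family_on_def G_def)
  show "group_on (G e) mul e" if "e \<in> {en n [] |n. n \<in> L}" for e
    using that group_on_G by auto
  show "mul e s = mul s e" if "e \<in> {en n [] |n. n \<in> L}" "s \<in> S" for e s
    using that by (auto simp: mul_en lmeet_comm elim!: S_cases)
qed

section \<open>The regular representation as a pull-back\<close>

sublocale pp_rep S mul S \<beta>
proof
  show "star S mul s \<in> S" "star S mul (star S mul s) = s" if "s \<in> S" for s
    using that by (auto elim!: S_cases simp: star_en)
  show "w \<in> S" if "s \<in> S" "v \<in> S" "\<beta> s v = Some w" for s v w
    using that by (auto elim!: S_cases simp: \<beta>_en split: if_splits)
  show "\<beta> (mul s t) v = Option.bind (\<beta> s v) (\<beta> t)" if "s \<in> S" "t \<in> S" "v \<in> S" for s t v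
    using that by (auto elim!: S_cases simp: \<beta>_en mul_en lmeet_L lle_lmeet_iff rev_wmul wmul_assoc)
  show "\<beta> (star S mul s) w = Some v" if "s \<in> S" "v \<in> S" "\<beta> s v = Some w" for s v w
    using that by (auto elim!: S_cases simp: \<beta>_en star_en wmul_rev_left2 split: if_splits)
qed simp

lemma lreg_basis_en:
  assumes n: "n \<in> L" "a \<in> Red" and m: "m \<in> L" "b \<in> Red"
  shows "lreg_basis S mul (en n a) (en m b) = (if lle m n then delta (en m (wmul a b)) else (\<lambda>_. 0))"
proof (cases "lle m n")
  case True
  then have "lmeet n m = m" by (simp add: lmeet_eq_iff)
  with True show ?thesis using assms by (simp add: lreg_basis_def star_en mul_en)
next
  case False
  then have "lmeet n m \<noteq> m" by (simp add: lmeet_eq_iff)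
  with False show ?thesis using assms by (simp add: lreg_basis_def star_en mul_en en_eq)
qed

text \<open>For a given \<open>v\<close> the only possibly nonzero term of the sum in
  \<open>lreg\<close> is the one indexed by the value of \<open>\<beta> s v\<close>.\<close>

lemma lreg_ppop:
  assumes "s \<in> S" shows "lreg S mul s = ppop s"
proof (intro ext)
  fix x v
  obtain n a where s: "n \<in> L" "a \<in> Red" "s = en n a" using assms by (rule S_cases)
  have b0: "lreg_basis S mul s u v = 0" if "u \<in> S" "\<beta> s v \<noteq> Some u \<or> v \<notin> S" for u
  proof -
    obtain m b where u: "m \<in> L" "b \<in> Red" "u = en m b" using \<open>u \<in> S\<close> by (rule S_cases)
    have "v \<noteq> en m (wmul a b)" if "lle m n"
    proof
      assume v: "v = en m (wmul a b)"
      then have "\<beta> s v = Some u" using s u that by (simp add: \<beta>_en wmul_rev_left)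
      with v that s u \<open>\<beta> s v \<noteq> Some u \<or> v \<notin> S\<close> show False by simp
    qed
    then show ?thesis by (simp add: s u lreg_basis_en delta_def)
  qed
  have b1: "lreg_basis S mul s u v = 1" if "v \<in> S" "\<beta> s v = Some u" for u
  proof -
    obtain m c where v: "m \<in> L" "c \<in> Red" "v = en m c" using \<open>v \<in> S\<close> by (rule S_cases)
    then show ?thesis using that s
      by (auto simp: \<beta>_en lreg_basis_en wmul_rev_left2 delta_def split: if_splits)
  qed
  show "lreg S mul s x v = ppop s x v"
  proof (cases "x \<in> ell2 S \<and> v \<in> S \<and> \<beta> s v \<noteq> None")
    case True
    then obtain u where u: "\<beta> s v = Some u" by auto
    have uS: "u \<in> S" using \<beta>_in[OF assms _ u] True by blast
    have "(\<Sum>\<^sub>\<infinity>u'\<in>S. x u' * lreg_basis S mul s u' v) = (\<Sum>u'\<in>{u}. x u' * lreg_basis S mul s u' v)"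
      by (rule infsumI, rule has_sum_finite_neutralI[of "{u}"]) (use uS b0 u in auto)
    then show ?thesis using True u b1[OF _ u] by (simp add: lreg_def ppop_def pv_def)
  next
    case False
    have "(\<Sum>\<^sub>\<infinity>u'\<in>S. x u' * lreg_basis S mul s u' v) = 0" if "x \<in> ell2 S"
      by (rule infsum_0) (use that b0 False in auto)
    then show ?thesis using False by (auto simp: lreg_def ppop_def pv_def)
  qed
qed

sublocale lreg_rep S mul \<beta>
  by unfold_locales (rule lreg_ppop)

end


section \<open>Representations of the semigroup\<close>

lemma ell1_finite:
  assumes "finite A" "A \<subseteq> S" "\<And>s. s \<notin> A \<Longrightarrow> f s = 0"
  shows "f \<in> ell1 S" "ell1_norm S f = (\<Sum>s\<in>A. cmod (f s))"
proof -
  have h: "((\<lambda>s. cmod (f s)) has_sum (\<Sum>s\<in>A. cmod (f s))) S"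
    using assms by (intro has_sum_finite_neutralI[of A]) auto
  then show "f \<in> ell1 S" using assms by (auto simp: ell1_def has_sum_imp_summable)
  show "ell1_norm S f = (\<Sum>s\<in>A. cmod (f s))" using h by (simp add: ell1_norm_def infsumI)
qed

lemma delta_ell1 [simp]: "s \<in> S \<Longrightarrow> delta s \<in> ell1 S"
  by (rule ell1_finite[of "{s}"]) (auto simp: delta_def)

lemma delta_ell1_norm: "s \<in> S \<Longrightarrow> ell1_norm S (delta s) = 1"
  using ell1_finite(2)[of "{s}" S "delta s"] by (simp add: delta_def)

lemma ell1_sum:
  assumes "\<And>k. k \<in> K \<Longrightarrow> f k \<in> ell1 S"
  shows "(\<lambda>s. \<Sum>k\<in>K. f k s) \<in> ell1 S"
proof (cases "finite K")
  case True
  then show ?thesis using assms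
  proof (induction K rule: finite_induct)
    case (insert a K)
    then show ?case using ell1_add[of "f a" S "\<lambda>s. \<Sum>k\<in>K. f k s"] by simp
  qed simp
qed simp

lemma star_rep_sum:
  assumes \<pi>: "star_rep S mul I \<pi>" and "finite K" and "\<And>k. k \<in> K \<Longrightarrow> f k \<in> ell1 S"
  shows "\<pi> (\<lambda>s. \<Sum>k\<in>K. c k * f k s) x = (\<lambda>i. \<Sum>k\<in>K. c k * \<pi> (f k) x i)"
  using assms(2,3)
proof (induction K rule: finite_induct)
  case empty
  have "\<pi> (\<lambda>s. 0 * 0) = op_scale 0 (\<pi> (\<lambda>s. 0))"
    by (rule star_repD(3)[OF \<pi>]) simp
  then show ?case by (simp add: op_scale_def)
next
  case (insert a K)
  have e: "(\<lambda>s. c a * f a s) \<in> ell1 S" "(\<lambda>s. \<Sum>k\<in>K. c k * f k s) \<in> ell1 S"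
    using insert by (auto intro!: ell1_scale ell1_sum)
  have "\<pi> (\<lambda>s. c a * f a s + (\<Sum>k\<in>K. c k * f k s)) = op_add (\<pi> (\<lambda>s. c a * f a s)) (\<pi> (\<lambda>s. \<Sum>k\<in>K. c k * f k s))"
    by (rule star_repD(2)[OF \<pi> e])
  also have "\<pi> (\<lambda>s. c a * f a s) = op_scale (c a) (\<pi> (f a))"
    by (rule star_repD(3)[OF \<pi>]) (use insert in auto)
  finally show ?case using insert by (simp add: op_add_def op_scale_def)
qed

lemma star_rep_finite:
  assumes \<pi>: "star_rep S mul I \<pi>" and A: "finite A" "A \<subseteq> S" "\<And>s. s \<notin> A \<Longrightarrow> f s = 0"
  shows "\<pi> f x = (\<lambda>i. \<Sum>s\<in>A. f s * \<pi> (delta s) x i)"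
proof -
  have "f = (\<lambda>t. \<Sum>s\<in>A. f s * delta s t)"
  proof
    fix t
    have "(\<Sum>s\<in>A. f s * delta s t) = (\<Sum>s\<in>A. if s = t then f s else 0)"
      by (rule sum.cong) (auto simp: delta_def)
    also have "\<dots> = (if t \<in> A then f t else 0)" using A(1) by simp
    also have "\<dots> = f t" using A(3) by auto
    finally show "f t = (\<Sum>s\<in>A. f s * delta s t)" by simp
  qed
  moreover have "\<pi> (\<lambda>t. \<Sum>s\<in>A. f s * delta s t) x = (\<lambda>i. \<Sum>s\<in>A. f s * \<pi> (delta s) x i)"
    by (rule star_rep_sum[OF \<pi> A(1)]) (use A in auto)
  ultimately show ?thesis by simp
qed

lemma conv_delta:
  assumes "s \<in> S" "t \<in> S"
  shows "conv S mul (delta s) (delta t) = delta (mul s t)"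
proof
  fix r
  let ?P = "{(u, v). u \<in> S \<and> v \<in> S \<and> mul u v = r}"
  have "(\<Sum>\<^sub>\<infinity>(u, v)\<in>?P. delta s u * delta t v) = (\<Sum>(u, v)\<in>{(s, t)} \<inter> ?P. delta s u * delta t v)"
    by (rule infsumI, rule has_sum_finite_neutralI[of "{(s, t)} \<inter> ?P"])
      (use assms in \<open>auto simp: delta_def split: if_splits\<close>)
  also have "\<dots> = delta (mul s t) r"
    using assms by (cases "mul s t = r") (auto simp: delta_def Int_insert_left)
  finally show "conv S mul (delta s) (delta t) r = delta (mul s t) r" by (simp add: conv_def)
qed

context pp_rep
begin

lemma invol_delta: "s \<in> S \<Longrightarrow> invol S mul (delta s) = delta (star S mul s)"
  using star_star star_closed by (fastforce simp: invol_def delta_def fun_eq_iff)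

context
  fixes J :: "'j set" and \<pi> assumes \<pi>: "star_rep S mul J \<pi>"
begin

lemma rep_bop: "s \<in> S \<Longrightarrow> \<pi> (delta s) \<in> bop J"
  by (rule star_repD(1)[OF \<pi>]) simp

lemma rep_ell2: "s \<in> S \<Longrightarrow> x \<in> ell2 J \<Longrightarrow> \<pi> (delta s) x \<in> ell2 J"
  by (rule bop_ell2[OF rep_bop])

lemma rep_mul: "s \<in> S \<Longrightarrow> t \<in> S \<Longrightarrow> \<pi> (delta (mul s t)) x = \<pi> (delta s) (\<pi> (delta t) x)"
  using star_repD(4)[OF \<pi>, of "delta s" "delta t"] by (simp add: conv_delta)

lemma rep_adjoint:
  "s \<in> S \<Longrightarrow> x \<in> ell2 J \<Longrightarrow> y \<in> ell2 J \<Longrightarrow>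
    ell2_inner J (\<pi> (delta s) x) y = ell2_inner J x (\<pi> (delta (star S mul s)) y)"
  using star_repD(5)[OF \<pi>, of "delta s"] by (simp add: is_adjoint_def invol_delta)

lemma rep_contr:
  assumes "s \<in> S" "x \<in> ell2 J" shows "ell2_norm J (\<pi> (delta s) x) \<le> ell2_norm J x"
proof -
  have "op_norm J (\<pi> (delta s)) \<le> 1"
    using star_repD(6)[OF \<pi>, of "delta s"] assms by (simp add: delta_ell1_norm)
  then have "op_norm J (\<pi> (delta s)) * ell2_norm J x \<le> 1 * ell2_norm J x"
    by (rule mult_right_mono) simp
  with op_norm_bound[OF rep_bop assms(2), of s] assms(1) show ?thesis by simp
qed

end
end

lemma ell1_approx:
  assumes f: "f \<in> ell1 S" and e: "\<epsilon> > 0"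
  obtains A where "finite A" "A \<subseteq> S" "ell1_norm S (\<lambda>s. f s - (if s \<in> A then f s else 0)) \<le> \<epsilon>"
proof -
  have s: "(\<lambda>s. cmod (f s)) summable_on S" using f by (simp add: ell1_def)
  from infsum_finite_approximation[OF s e] obtain A where A: "finite A" "A \<subseteq> S"
    and d: "dist (sum (\<lambda>s. cmod (f s)) A) (infsum (\<lambda>s. cmod (f s)) S) \<le> \<epsilon>" by auto
  have "infsum (\<lambda>s. cmod (f s)) S = infsum (\<lambda>s. cmod (f s)) A + infsum (\<lambda>s. cmod (f s)) (S - A)"
    using infsum_Un_disjoint[of "\<lambda>s. cmod (f s)" A "S - A"] A s
    by (auto simp: Un_absorb1 intro: summable_on_subset_banach)
  then have "infsum (\<lambda>s. cmod (f s)) (S - A) \<le> \<epsilon>" using d A by (simp add: dist_real_def)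
  moreover have "ell1_norm S (\<lambda>s. f s - (if s \<in> A then f s else 0)) = infsum (\<lambda>s. cmod (f s)) (S - A)"
    unfolding ell1_norm_def by (rule infsum_cong_neutral) auto
  ultimately show ?thesis using A that by simp
qed

context lreg_rep
begin

text \<open>Both norms are dominated by the l1 norm, so truncating \<open>f\<close> costs little.
  Finite support is what will confine \<open>f\<close> to finitely many levels.\<close>

theorem weak_containmentI_finite:
  assumes le: "\<And>f A. finite A \<Longrightarrow> A \<subseteq> S \<Longrightarrow> (\<And>s. s \<notin> A \<Longrightarrow> f s = 0) \<Longrightarrow> full_norm S mul f \<le> red f"
  shows "weak_containment S mul"
proof (rule weak_containmentI)
  fix f assume f: "f \<in> ell1 S"
  show "full_norm S mul f \<le> red f"
  proof (rule field_le_epsilon)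
    fix e :: real assume "0 < e"
    then obtain A where A: "finite A" "A \<subseteq> S" "ell1_norm S (\<lambda>s. f s - (if s \<in> A then f s else 0)) \<le> e / 2"
      using ell1_approx[OF f, of "e / 2"] by auto
    define g where "g = (\<lambda>s. if s \<in> A then f s else 0)"
    have g: "g \<in> ell1 S" using ell1_finite(1)[OF A(1,2), of g] by (simp add: g_def)
    have d: "(\<lambda>s. f s - g s) \<in> ell1 S" by (rule ell1_diff[OF f g])
    have n: "ell1_norm S (\<lambda>s. f s - g s) \<le> e / 2" using A(3) by (simp add: g_def)
    have 1: "full_norm S mul f \<le> full_norm S mul (\<lambda>s. f s - g s) + full_norm S mul g"
      using full_norm_diff_triangle[OF f g ell1_zero, of mul] by simp
    have 2: "full_norm S mul g \<le> red g" by (rule le[OF A(1,2)]) (simp add: g_def)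
    have "lreg_ell1 S mul g = op_diff (lreg_ell1 S mul f) (lreg_ell1 S mul (\<lambda>s. f s - g s))"
      using star_rep_diff[OF lreg_star_rep f d] by simp
    then have 3: "red g \<le> red f + red (\<lambda>s. f s - g s)"
      using bop_op_diff(2)[OF lreg_bop[OF f] lreg_bop[OF d]] by simp
    have 4: "red (\<lambda>s. f s - g s) \<le> e / 2" "full_norm S mul (\<lambda>s. f s - g s) \<le> e / 2"
      using red_le_full[OF d] full_norm_le_ell1[OF d, of mul] n by auto
    show "full_norm S mul f \<le> red f + e" using 1 2 3 4 by linarith
  qed
qed

end


section \<open>Polynomials in a self-adjoint contraction\<close>

text \<open>The linear functional on polynomials with moment sequence \<open>m\<close>, a stand-in
  for integration against a spectral measure.\<close>

definition mom :: "(nat \<Rightarrow> real) \<Rightarrow> real poly \<Rightarrow> real" where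
  "mom m p = (\<Sum>j\<le>degree p. coeff p j * m j)"

lemma mom_eq: "degree p \<le> N \<Longrightarrow> mom m p = (\<Sum>j\<le>N. coeff p j * m j)"
  unfolding mom_def by (rule sum.mono_neutral_left) (auto simp: coeff_eq_0)

lemma mom_add: "mom m (p + q) = mom m p + mom m q"
proof -
  let ?N = "max (degree p) (degree q)"
  have "mom m (p + q) = (\<Sum>j\<le>?N. coeff (p + q) j * m j)" by (rule mom_eq) (rule degree_add_le_max)
  also have "\<dots> = (\<Sum>j\<le>?N. coeff p j * m j) + (\<Sum>j\<le>?N. coeff q j * m j)"
    by (simp add: distrib_right sum.distrib)
  finally show ?thesis by (simp add: mom_eq[of p ?N] mom_eq[of q ?N])
qed

lemma mom_smult: "mom m (smult c p) = c * mom m p"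
proof -
  have "mom m (smult c p) = (\<Sum>j\<le>degree p. coeff (smult c p) j * m j)"
    by (rule mom_eq) (rule degree_smult_le)
  then show ?thesis by (simp add: mom_def sum_distrib_left mult.assoc)
qed

lemma mom_sum: "mom m (\<Sum>k\<in>K. f k) = (\<Sum>k\<in>K. mom m (f k))"
  by (induction K rule: infinite_finite_induct) (simp_all add: mom_add, simp_all add: mom_def)

lemma mom_pCons: "mom m (pCons 0 p) = mom (\<lambda>j. m (Suc j)) p"
proof -
  have "mom m (pCons 0 p) = (\<Sum>j\<le>Suc (degree p). coeff (pCons 0 p) j * m j)"
    by (rule mom_eq) (rule degree_pCons_le)
  also have "\<dots> = (\<Sum>j\<le>degree p. coeff p j * m (Suc j))"
    by (subst sum.atMost_Suc_shift) simp
  finally show ?thesis by (simp add: mom_def)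
qed

lemma mom_lin: "mom (\<lambda>j. a * m j + b * m' j) p = a * mom m p + b * mom m' p"
  by (simp add: mom_def sum.distrib sum_distrib_left algebra_simps)

lemma mom_one: "mom m 1 = m 0"
  by (simp add: mom_def)

lemma smult_sum_right: "smult c (\<Sum>k\<in>K. f k) = (\<Sum>k\<in>K. smult c (f k))"
  by (induction K rule: infinite_finite_induct) (simp_all add: smult_add_right)

text \<open>The expansion of a polynomial in the Bernstein basis of a large degree has coefficients
  close to its values, because \<open>(k choose j) / (n choose j)\<close> is close to \<open>(k / n)^j\<close>.\<close>

lemma Bernstein_monom:
  assumes "j \<le> n"
  shows "(\<Sum>k\<le>n. smult (real (k choose j) / real (n choose j) * real (n choose k)) (monom 1 k * [:1, -1:] ^ (n - k)))
    = (monom 1 j :: real poly)"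
proof -
  have "(\<Sum>k\<le>n. smult (real (k choose j) / real (n choose j) * real (n choose k)) (monom 1 k * [:1, -1:] ^ (n - k)))
     = (\<Sum>k\<in>{j..n}. smult (real ((n - j) choose (k - j))) (monom 1 k * [:1, -1:] ^ (n - k)))"
  proof (rule sum.mono_neutral_cong_right)
    fix k assume k: "k \<in> {j..n}"
    have "(n choose k) * (k choose j) = (n choose j) * ((n - j) choose (k - j))"
      using k by (intro choose_mult) auto
    then have "real (n choose k) * real (k choose j) = real (n choose j) * real ((n - j) choose (k - j))"
      by (metis of_nat_mult)
    then have "real (k choose j) / real (n choose j) * real (n choose k) = real ((n - j) choose (k - j))"
      using assms by (simp add: field_simps)
    then show "smult (real (k choose j) / real (n choose j) * real (n choose k)) (monom 1 k * [:1, -1:] ^ (n - k))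
       = smult (real ((n - j) choose (k - j))) (monom 1 k * [:1, -1:] ^ (n - k))" by simp
  qed auto
  also have "\<dots> = (\<Sum>i\<le>n - j. smult (real ((n - j) choose i)) (monom 1 (i + j) * [:1, -1:] ^ (n - j - i)))"
    by (rule sum.reindex_bij_witness[of _ "\<lambda>i. i + j" "\<lambda>k. k - j"]) (use assms in auto)
  also have "\<dots> = monom 1 j * (\<Sum>i\<le>n - j. of_nat ((n - j) choose i) * [:0, 1:] ^ i * [:1, -1:] ^ (n - j - i))"
    unfolding sum_distrib_left
  proof (rule sum.cong[OF refl])
    fix i
    have "monom 1 (i + j) = monom 1 j * ([:0, 1:] ^ i :: real poly)"
      by (simp add: monom_altdef power_add mult.commute)
    moreover have "smult (real ((n - j) choose i)) p = of_nat ((n - j) choose i) * p" for p :: "real poly"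
      by (simp add: of_nat_poly)
    ultimately show "smult (real ((n - j) choose i)) (monom 1 (i + j) * [:1, -1:] ^ (n - j - i))
       = monom 1 j * (of_nat ((n - j) choose i) * [:0, 1:] ^ i * [:1, -1:] ^ (n - j - i))"
      by (simp add: mult_ac)
  qed
  also have "(\<Sum>i\<le>n - j. of_nat ((n - j) choose i) * [:0, 1:] ^ i * [:1, -1:] ^ (n - j - i)) = ([:0, 1:] + [:1, -1:] :: real poly) ^ (n - j)"
    by (simp only: binomial_ring)
  also have "[:0, 1:] + [:1, -1:] = (1 :: real poly)" by simp
  finally show ?thesis by simp
qed

text \<open>Passing from j to j + 1 multiplies the ratio by (k - j) / (n - j), which is within j /
  (n - j) of k / n; the errors add up because j + j^2 <= (j + 1)^2. The \<open>+ 1\<close> in the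
  denominator makes the bound at \<open>Suc j\<close> have the denominator of the new
  factor.\<close>

lemma choose_ratio_close:
  fixes n k :: nat
  assumes "k \<le> n" "j \<le> n"
  shows "\<bar>real (k choose j) / real (n choose j) - (real k / real n) ^ j\<bar> \<le> real j ^ 2 / real (n - j + 1)"
  using assms(2)
proof (induction j)
  case 0
  then show ?case by simp
next
  case (Suc j)
  let ?r = "real (k choose j) / real (n choose j)"
  let ?q = "real (k - j) / real (n - j)"
  have nj: "j < n" using Suc by simp
  have c: "real (m choose Suc j) = real (m choose j) * real (m - j) / real (Suc j)" for m
  proof -
    have "Suc j * (m choose Suc j) = (m - j) * (m choose j)"
      by (cases m) (metis Suc_diff_le binomial_absorb_comp binomial_absorption diff_Suc_Suc mult.commute mult_0 mult_0_right zero_diff binomial_eq_0 not_less_eq not_le_imp_less, metis binomial_absorb_comp binomial_absorption Suc_times_binomial_eq mult.commute)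
    then have "real (Suc j) * real (m choose Suc j) = real (m - j) * real (m choose j)"
      by (metis of_nat_mult)
    then show ?thesis by (simp add: field_simps)
  qed
  have r: "real (k choose Suc j) / real (n choose Suc j) = ?r * ?q"
  proof -
    have "A * x / z / (B * y / z) = A / B * (x / y)" if "z \<noteq> 0" for A B x y z :: real
      using that by simp
    then show ?thesis unfolding c by (metis nat.distinct(1) of_nat_eq_0_iff)
  qed
  have r01: "0 \<le> ?r" "?r \<le> 1"
    using assms(1) nj by (auto simp: binomial_right_mono divide_le_eq_1)
  have x01: "0 \<le> (real k / real n) ^ j" "0 \<le> real k / real n" "real k / real n \<le> 1"
    using assms(1) by (auto simp: divide_le_eq_1)
  have q: "\<bar>?q - real k / real n\<bar> \<le> real j / real (n - j)"
  proof (cases "j \<le> k")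
    case True
    have "real k / real n - ?q = real j * (real n - real k) / (real n * real (n - j))"
      using True nj by (simp add: of_nat_diff field_simps)
    moreover have "\<dots> \<le> real j * real n / (real n * real (n - j))"
      by (intro divide_right_mono mult_left_mono) auto
    moreover have "0 \<le> real j * (real n - real k) / (real n * real (n - j))"
      using assms(1) by auto
    ultimately show ?thesis using nj by simp
  next
    case False
    \<comment> \<open>Here \<open>k - j\<close> is truncated to 0, so only k / n itself has to be
      small.\<close>
    then have "real k / real n \<le> real j / real (n - j)"
      by (intro frac_le) (use nj in auto)
    then show ?thesis using False by simp
  qed
  have "\<bar>?r * ?q - (real k / real n) ^ Suc j\<bar>
      = \<bar>?r * (?q - real k / real n) + (?r - (real k / real n) ^ j) * (real k / real n)\<bar>"
    by (simp add: algebra_simps)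
  also have "\<dots> \<le> \<bar>?r\<bar> * \<bar>?q - real k / real n\<bar> + \<bar>?r - (real k / real n) ^ j\<bar> * \<bar>real k / real n\<bar>"
    using abs_triangle_ineq[of "?r * (?q - real k / real n)" "(?r - (real k / real n) ^ j) * (real k / real n)"]
    by (simp only: abs_mult)
  also have "\<dots> \<le> 1 * (real j / real (n - j)) + (real j ^ 2 / real (n - j + 1)) * 1"
    by (intro add_mono mult_mono) (use r01 x01 q Suc in auto)
  also have "\<dots> \<le> real j / real (n - j) + real j ^ 2 / real (n - j)"
    using nj by (simp add: frac_le)
  also have "\<dots> \<le> real (Suc j) ^ 2 / real (n - Suc j + 1)"
  proof -
    have "n - Suc j + 1 = n - j" using nj by simp
    moreover have "(real j + real j ^ 2) / real (n - j) \<le> real (Suc j) ^ 2 / real (n - j)"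
      by (intro divide_right_mono) (simp_all add: power2_eq_square algebra_simps)
    ultimately show ?thesis by (simp only: add_divide_distrib)
  qed
  finally show ?case unfolding r .
qed

text \<open>Hausdorff's argument: positivity is known only for the products t^k (1 - t)^l. Expand
  \<open>p\<close> in such products; its coefficients relative to those of the constant 1 are close
  to values of \<open>p\<close> on the unit interval, hence at most M up to a small error.\<close>

lemma mom_bound:
  fixes m :: "nat \<Rightarrow> real"
  assumes pos: "\<And>k l. 0 \<le> mom m (monom 1 k * [:1, -1:] ^ l)"
    and M: "\<And>t. 0 \<le> t \<Longrightarrow> t \<le> 1 \<Longrightarrow> \<bar>poly p t\<bar> \<le> M"
  shows "mom m p \<le> M * m 0"
proof (rule field_le_epsilon)
  fix e :: real assume e: "0 < e"
  have m0: "0 \<le> m 0" using pos[of 0 0] by (simp add: mom_one)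
  \<comment> \<open>Collects the errors of all coefficients of \<open>p\<close>. The factor
    \<open>m 0 + 1\<close> stands in for \<open>m 0\<close>, which may vanish.\<close>
  define C where "C = (\<Sum>j\<le>degree p. \<bar>coeff p j\<bar> * real j ^ 2) * (m 0 + 1)"
  have C0: "0 \<le> C" unfolding C_def using m0 by (intro mult_nonneg_nonneg sum_nonneg) auto
  obtain n0 :: nat where n0: "C / e < real n0" using reals_Archimedean2 by blast
  define n where "n = n0 + degree p + 1"
  define \<beta> where "\<beta> k = (\<Sum>j\<le>degree p. coeff p j * (real (k choose j) / real (n choose j)))" for k
  let ?B = "\<lambda>k. monom 1 k * [:1, -1:] ^ (n - k) :: real poly"
  have p: "p = (\<Sum>k\<le>n. smult (\<beta> k * real (n choose k)) (?B k))"
  proof -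
    have "p = (\<Sum>j\<le>degree p. smult (coeff p j) (monom 1 j))"
      by (subst poly_as_sum_of_monoms[of p, symmetric]) (simp add: smult_monom)
    also have "\<dots> = (\<Sum>j\<le>degree p. \<Sum>k\<le>n. smult (coeff p j * (real (k choose j) / real (n choose j)) * real (n choose k)) (?B k))"
    proof (rule sum.cong[OF refl])
      fix j assume "j \<in> {..degree p}"
      then have "j \<le> n" by (simp add: n_def)
      show "smult (coeff p j) (monom 1 j) = (\<Sum>k\<le>n. smult (coeff p j * (real (k choose j) / real (n choose j)) * real (n choose k)) (?B k))"
        by (subst Bernstein_monom[OF \<open>j \<le> n\<close>, symmetric])
          (simp only: smult_sum_right smult_smult mult.assoc)
    qed
    also have "\<dots> = (\<Sum>k\<le>n. \<Sum>j\<le>degree p. smult (coeff p j * (real (k choose j) / real (n choose j)) * real (n choose k)) (?B k))"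
      by (rule sum.swap)
    also have "\<dots> = (\<Sum>k\<le>n. smult (\<beta> k * real (n choose k)) (?B k))"
      by (simp only: \<beta>_def sum_distrib_right smult_sum)
    finally show ?thesis .
  qed
  have one: "(1 :: real poly) = (\<Sum>k\<le>n. smult (real (n choose k)) (?B k))"
    using Bernstein_monom[of 0 n] by (simp add: monom_0 one_pCons)
  define \<delta> where "\<delta> = C / (m 0 + 1) / real (n0 + 1)"
  have \<beta>: "\<beta> k \<le> M + \<delta>" if "k \<le> n" for k
  proof -
    have "\<beta> k - poly p (real k / real n) = (\<Sum>j\<le>degree p. coeff p j * (real (k choose j) / real (n choose j) - (real k / real n) ^ j))"
      by (simp add: \<beta>_def poly_altdef sum_subtractf right_diff_distrib)
    also have "\<dots> \<le> (\<Sum>j\<le>degree p. \<bar>coeff p j\<bar> * (real j ^ 2 / real (n0 + 1)))"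
    proof (rule sum_mono)
      fix j assume j: "j \<in> {..degree p}"
      have "\<bar>real (k choose j) / real (n choose j) - (real k / real n) ^ j\<bar> \<le> real j ^ 2 / real (n - j + 1)"
        by (rule choose_ratio_close[OF that]) (use j n_def in auto)
      also have "\<dots> \<le> real j ^ 2 / real (n0 + 1)"
        by (intro divide_left_mono) (use j n_def in auto)
      finally have *: "\<bar>real (k choose j) / real (n choose j) - (real k / real n) ^ j\<bar> \<le> real j ^ 2 / real (n0 + 1)" .
      have "coeff p j * (real (k choose j) / real (n choose j) - (real k / real n) ^ j)
         \<le> \<bar>coeff p j\<bar> * \<bar>real (k choose j) / real (n choose j) - (real k / real n) ^ j\<bar>"
        by (metis abs_ge_self abs_mult)
      also have "\<dots> \<le> \<bar>coeff p j\<bar> * (real j ^ 2 / real (n0 + 1))"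
        by (intro mult_left_mono *) simp
      finally show "coeff p j * (real (k choose j) / real (n choose j) - (real k / real n) ^ j)
         \<le> \<bar>coeff p j\<bar> * (real j ^ 2 / real (n0 + 1))" .
    qed
    also have "\<dots> = \<delta>" using m0 by (simp add: \<delta>_def C_def sum_divide_distrib[symmetric])
    finally have "\<beta> k \<le> poly p (real k / real n) + \<delta>" by simp
    moreover have "poly p (real k / real n) \<le> M"
      using M[of "real k / real n"] that by (auto simp: divide_le_eq_1 abs_le_iff n_def)
    ultimately show ?thesis by simp
  qed
  have "mom m p = (\<Sum>k\<le>n. \<beta> k * real (n choose k) * mom m (?B k))"
    by (subst p) (simp only: mom_sum mom_smult)
  also have "\<dots> \<le> (\<Sum>k\<le>n. (M + \<delta>) * real (n choose k) * mom m (?B k))"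
    by (intro sum_mono mult_right_mono) (use \<beta> pos in auto)
  also have "\<dots> = (M + \<delta>) * mom m 1"
    by (subst one) (simp only: mom_sum mom_smult sum_distrib_left mult.assoc)
  also have "\<dots> = M * m 0 + \<delta> * m 0" by (simp add: mom_one distrib_right)
  also have "\<delta> * m 0 \<le> \<delta> * (m 0 + 1)"
    using C0 m0 by (intro mult_left_mono) (auto simp: \<delta>_def)
  also have "\<delta> * (m 0 + 1) = C / real (n0 + 1)" using m0 by (simp add: \<delta>_def)
  also have "\<dots> \<le> e"
  proof -
    have "C < e * real n0" using n0 e by (simp add: field_simps)
    then show ?thesis using e by (simp add: field_simps)
  qed
  finally show "mom m p \<le> M * m 0 + e" by simp
qed


section \<open>Moments of the square of a bounded self-adjoint operator\<close>

locale contraction =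
  fixes I :: "'i set" and Z :: "'i oper" and c :: real
  assumes Z: "Z \<in> bop I"
    and adj: "x \<in> ell2 I \<Longrightarrow> y \<in> ell2 I \<Longrightarrow> ell2_inner I (Z x) y = ell2_inner I x (Z y)"
    and contr: "x \<in> ell2 I \<Longrightarrow> ell2_norm I (Z x) \<le> c * ell2_norm I x"
    and c: "c > 0"
begin

lemma pow_ell2: "x \<in> ell2 I \<Longrightarrow> (Z ^^ j) x \<in> ell2 I"
  by (induction j) (auto simp: bop_ell2[OF Z])

lemma pow_adj: "x \<in> ell2 I \<Longrightarrow> y \<in> ell2 I \<Longrightarrow> ell2_inner I ((Z ^^ j) x) y = ell2_inner I x ((Z ^^ j) y)"
proof (induction j arbitrary: y)
  case (Suc j)
  then show ?case using adj[OF pow_ell2[OF Suc.prems(1)] Suc.prems(2), of j] Suc.IH[OF _ bop_ell2[OF Z Suc.prems(2)]]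
    by (simp add: funpow_swap1)
qed simp

lemma pow_add: "x \<in> ell2 I \<Longrightarrow> y \<in> ell2 I \<Longrightarrow> (Z ^^ j) (\<lambda>i. x i + y i) = (\<lambda>i. (Z ^^ j) x i + (Z ^^ j) y i)"
  by (induction j) (simp_all add: bop_add[OF Z] pow_ell2)

lemma pow_scale: "x \<in> ell2 I \<Longrightarrow> (Z ^^ j) (\<lambda>i. a * x i) = (\<lambda>i. a * (Z ^^ j) x i)"
  by (induction j) (simp_all add: bop_scale[OF Z] pow_ell2)

text \<open>Only even powers occur: these are the moments of Z^2 / c^2, which lies between 0 and 1
  and so fits the unit interval of \<open>mom_bound\<close>. The scale \<open>c\<close> will be 1 in
  an arbitrary representation and 4/5 in the regular one.\<close>

definition mm :: "('i \<Rightarrow> complex) \<Rightarrow> nat \<Rightarrow> real" where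
  "mm x j = Re (ell2_inner I ((Z ^^ (2 * j)) x) x) / c ^ (2 * j)"

lemma mm_0: "x \<in> ell2 I \<Longrightarrow> mm x 0 = (ell2_norm I x)\<^sup>2"
  by (simp add: mm_def ell2_inner_self del: of_real_power)

lemma mm_Z: "x \<in> ell2 I \<Longrightarrow> mm (Z x) j = c ^ 2 * mm x (Suc j)"
  using adj[of "(Z ^^ (2 * j)) (Z x)" x] pow_ell2[of "Z x" "2 * j"] c
  by (simp add: mm_def bop_ell2[OF Z] funpow_swap1 power2_eq_square)

text \<open>The vector is (1 - Z^2 / c^2) x, so its moments carry the extra weight (1 -
  t)^2.\<close>

lemma mm_Y:
  assumes x: "x \<in> ell2 I"
  shows "mm (\<lambda>i. x i + of_real (- 1 / c ^ 2) * (Z ^^ 2) x i) j = mm x j - 2 * mm x (Suc j) + mm x (Suc (Suc j))"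
proof -
  let ?b = "complex_of_real (- 1 / c ^ 2)"
  define y where "y = (\<lambda>i. ?b * (Z ^^ 2) x i)"
  have x2: "(Z ^^ 2) x \<in> ell2 I" by (rule pow_ell2[OF x])
  have y: "y \<in> ell2 I" unfolding y_def by (rule ell2_scale(1)[OF x2])
  note z = pow_ell2[OF x, of "2 * j"] pow_ell2[OF y, of "2 * j"]
  have zy: "(Z ^^ (2 * j)) y = (\<lambda>i. ?b * (Z ^^ (2 * j + 2)) x i)"
    unfolding y_def pow_scale[OF x2] by (simp only: funpow_add o_apply)
  have A: "ell2_inner I ((Z ^^ (2 * j)) x) y = ?b * ell2_inner I ((Z ^^ (2 * j + 2)) x) x"
  proof -
    have "(Z ^^ 2) ((Z ^^ (2 * j)) x) = (Z ^^ (2 * j + 2)) x"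
      using funpow_add[of 2 "2 * j" Z] by (simp only: add.commute[of "2 * j" 2] o_apply)
    then show ?thesis
      unfolding y_def ell2_inner_scale_right pow_adj[OF z(1) x, symmetric] by simp
  qed
  have B: "ell2_inner I ((Z ^^ (2 * j)) y) x = ?b * ell2_inner I ((Z ^^ (2 * j + 2)) x) x"
    unfolding zy by (rule ell2_inner_scale_left)
  have C: "ell2_inner I ((Z ^^ (2 * j)) y) y = ?b * (?b * ell2_inner I ((Z ^^ (2 * j + 4)) x) x)"
  proof -
    have "ell2_inner I ((Z ^^ (2 * j)) y) y = ?b * (cnj ?b * ell2_inner I ((Z ^^ (2 * j + 2)) x) ((Z ^^ 2) x))"
      unfolding zy ell2_inner_scale_left by (simp only: y_def ell2_inner_scale_right)
    also have "ell2_inner I ((Z ^^ (2 * j + 2)) x) ((Z ^^ 2) x) = ell2_inner I ((Z ^^ 2) ((Z ^^ (2 * j + 2)) x)) x"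
      by (rule pow_adj[OF pow_ell2[OF x] x, symmetric])
    also have "(Z ^^ 2) ((Z ^^ (2 * j + 2)) x) = (Z ^^ (2 * j + 4)) x"
      by (simp add: numeral_eq_Suc)
    finally show ?thesis by simp
  qed
  have "ell2_inner I ((Z ^^ (2 * j)) (\<lambda>i. x i + y i)) (\<lambda>i. x i + y i)
     = ell2_inner I ((Z ^^ (2 * j)) x) x + ell2_inner I ((Z ^^ (2 * j)) x) y
       + (ell2_inner I ((Z ^^ (2 * j)) y) x + ell2_inner I ((Z ^^ (2 * j)) y) y)"
    unfolding pow_add[OF x y] ell2_inner_add_left[OF z ell2_add(1)[OF x y]]
      ell2_inner_add_right[OF x y z(1)] ell2_inner_add_right[OF x y z(2)] by simp
  then have "Re (ell2_inner I ((Z ^^ (2 * j)) (\<lambda>i. x i + y i)) (\<lambda>i. x i + y i))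
     = Re (ell2_inner I ((Z ^^ (2 * j)) x) x) - 2 / c ^ 2 * Re (ell2_inner I ((Z ^^ (2 * j + 2)) x) x)
       + 1 / c ^ 4 * Re (ell2_inner I ((Z ^^ (2 * j + 4)) x) x)"
    unfolding A B C by (simp add: power2_eq_square numeral_eq_Suc)
  then show ?thesis unfolding mm_def y_def using c
    by (simp add: field_simps power_add numeral_eq_Suc)
qed

lemma mom_monom_pow: "mom m (monom 1 (Suc k) * p) = mom (\<lambda>j. m (Suc j)) (monom 1 k * p)"
proof -
  have "monom 1 (Suc k) * p = pCons 0 (monom 1 k * p)" by (simp add: monom_Suc)
  then show ?thesis by (simp only: mom_pCons)
qed

text \<open>A factor t is absorbed by passing from x to Z x, a factor (1 - t)^2 by passing to (1 -
  Z^2 / c^2) x. This leaves the constant 1, which gives the squared norm of x, and 1 - t, where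
  positivity is the norm bound on Z.\<close>

lemma mm_pos: "x \<in> ell2 I \<Longrightarrow> 0 \<le> mom (mm x) (monom 1 k * [:1, -1:] ^ l)"
proof (induction k arbitrary: x)
  case (Suc k)
  have "mom (mm x) (monom 1 (Suc k) * [:1, -1:] ^ l) = mom (\<lambda>j. 1 / c ^ 2 * mm (Z x) j + 0 * mm x j) (monom 1 k * [:1, -1:] ^ l)"
    unfolding mom_monom_pow using mm_Z[OF Suc.prems] c by simp
  also have "\<dots> = 1 / c ^ 2 * mom (mm (Z x)) (monom 1 k * [:1, -1:] ^ l)"
    unfolding mom_lin by simp
  also have "\<dots> \<ge> 0" using Suc.IH[OF bop_ell2[OF Z Suc.prems]] by simp
  finally show ?case .
next
  case 0
  then show ?case
  proof (induction l arbitrary: x rule: less_induct)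
    case (less l)
    consider "l = 0" | "l = 1" | l' where "l = Suc (Suc l')" by (metis One_nat_def not0_implies_Suc)
    then show ?case
    proof cases
      case 1
      then show ?thesis using less.prems by (simp add: monom_0 mom_one mm_0 flip: one_pCons)
    next
      case 2
      have "mom (mm x) [:1, -1:] = mm x 0 - mm x 1"
        by (simp add: mom_def)
      moreover have "mm x 1 \<le> mm x 0"
      proof -
        have "mm x 1 = (ell2_norm I (Z x))\<^sup>2 / c ^ 2"
          using mm_Z[OF less.prems, of 0] mm_0[OF bop_ell2[OF Z less.prems]] c by simp
        also have "\<dots> \<le> (c * ell2_norm I x)\<^sup>2 / c ^ 2"
          by (intro divide_right_mono power_mono contr less.prems) auto
        finally show ?thesis using c mm_0[OF less.prems] by (simp add: power_mult_distrib)
      qed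
      moreover have "monom 1 0 * [:1, -1:] ^ l = ([:1, -1:] :: real poly)"
        using 2 by (simp add: monom_0)
      ultimately show ?thesis by simp
    next
      case 3
      let ?y = "\<lambda>i. x i + of_real (- 1 / c ^ 2) * (Z ^^ 2) x i"
      let ?p = "[:1, -1:] ^ l' :: real poly"
      have y: "?y \<in> ell2 I" by (intro ell2_add(1) ell2_scale(1) pow_ell2 less.prems)
      have eq: "[:1, -1:] ^ l = ?p + (smult (-2) (pCons 0 ?p) + pCons 0 (pCons 0 ?p))"
        unfolding 3 power_Suc by (rule poly_eqI) (simp add: coeff_pCons split: nat.split)
      have "mom (mm x) ([:1, -1:] ^ l) = mom (mm x) ?p - 2 * mom (\<lambda>j. mm x (Suc j)) ?p + mom (\<lambda>j. mm x (Suc (Suc j))) ?p"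
        unfolding eq mom_add mom_smult mom_pCons by simp
      also have "\<dots> = mom (mm ?y) ?p"
        unfolding mm_Y[OF less.prems] mom_def
        by (simp add: sum_subtractf sum.distrib sum_distrib_left algebra_simps)
      also have "\<dots> \<ge> 0"
        using less.IH[of l', OF _ y] 3 by (simp add: monom_0 flip: one_pCons)
      finally show ?thesis by (simp add: monom_0 flip: one_pCons)
    qed
  qed
qed

text \<open>The argument of the polynomial is Z^2, not Z, in accordance with
  \<open>mm\<close>.\<close>

definition ev :: "real poly \<Rightarrow> 'i oper" where
  "ev p x = (\<lambda>i. \<Sum>j\<le>degree p. of_real (coeff p j) * (Z ^^ (2 * j)) x i)"

lemma ev_ell2: "x \<in> ell2 I \<Longrightarrow> ev p x \<in> ell2 I"
  unfolding ev_def by (intro ell2_sum ell2_scale(1) pow_ell2)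

lemma mom_mult: "mom m (p * q) = (\<Sum>i\<le>degree p. \<Sum>j\<le>degree q. coeff p i * coeff q j * m (i + j))"
proof -
  have *: "mom m (monom a i * q) = (\<Sum>j\<le>degree q. a * coeff q j * m (i + j))" for a i
  proof -
    have "mom m (monom a i * q) = a * mom m (monom 1 i * q)"
      using mom_smult[of m a "monom 1 i * q"] by (simp add: smult_monom flip: mult_smult_left)
    also have "mom m (monom 1 i * q) = mom (\<lambda>j. m (i + j)) q"
    proof (induction i arbitrary: m)
      case (Suc i)
      show ?case unfolding mom_monom_pow Suc.IH by simp
    qed (simp add: monom_0 flip: one_pCons)
    finally show ?thesis by (simp add: mom_def sum_distrib_left mult.assoc)
  qed
  have "mom m (p * q) = mom m (\<Sum>i\<le>degree p. monom (coeff p i) i * q)"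
    by (simp only: sum_distrib_right[symmetric] poly_as_sum_of_monoms)
  then show ?thesis by (simp add: mom_sum *)
qed

text \<open>The moments are those of a positive measure on \<open>[0,1]\<close>, so a bound of the polynomial on
  \<open>[0,c\<^sup>2]\<close> bounds the operator.\<close>

lemma ev_bound:
  assumes x: "x \<in> ell2 I" and M: "0 \<le> M" "\<And>t. 0 \<le> t \<Longrightarrow> t \<le> c ^ 2 \<Longrightarrow> \<bar>poly p t\<bar> \<le> M"
  shows "ell2_norm I (ev p x) \<le> M * ell2_norm I x"
proof -
  \<comment> \<open>The substitution that rescales the interval [0, c^2] to [0, 1].\<close>
  define q where "q = pcompose p [:0, c ^ 2:]"
  have cq: "coeff q j = (c ^ 2) ^ j * coeff p j" for j
    unfolding q_def by (rule coeff_pcompose_linear)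
  have dq: "degree q = degree p" unfolding q_def using c by (simp add: degree_pcompose)
  have "ell2_inner I (ev p x) (ev p x)
    = (\<Sum>i\<le>degree p. \<Sum>j\<le>degree p. of_real (coeff p i * coeff p j) * ell2_inner I ((Z ^^ (2 * (i + j))) x) x)"
  proof -
    have e: "(\<lambda>k. of_real (coeff p i) * (Z ^^ (2 * i)) x k) \<in> ell2 I" for i
      by (intro ell2_scale(1) pow_ell2 x)
    have "ell2_inner I (ev p x) (ev p x) = (\<Sum>i\<le>degree p. \<Sum>j\<le>degree p.
       ell2_inner I (\<lambda>k. of_real (coeff p i) * (Z ^^ (2 * i)) x k) (\<lambda>k. of_real (coeff p j) * (Z ^^ (2 * j)) x k))"
      unfolding ev_def
      by (subst ell2_inner_sum_left[OF e ell2_sum(1)[OF e]], rule sum.cong[OF refl], rule ell2_inner_sum_right[OF e e])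
    also have "\<dots> = (\<Sum>i\<le>degree p. \<Sum>j\<le>degree p. of_real (coeff p i * coeff p j) * ell2_inner I ((Z ^^ (2 * (i + j))) x) x)"
    proof (intro sum.cong refl)
      fix i j
      have "ell2_inner I ((Z ^^ (2 * i)) x) ((Z ^^ (2 * j)) x) = ell2_inner I ((Z ^^ (2 * j)) ((Z ^^ (2 * i)) x)) x"
        by (rule pow_adj[OF pow_ell2[OF x] x, symmetric])
      also have "(Z ^^ (2 * j)) ((Z ^^ (2 * i)) x) = (Z ^^ (2 * (i + j))) x"
        by (simp add: distrib_left add.commute[of "2 * i"] funpow_add)
      finally show "ell2_inner I (\<lambda>k. of_real (coeff p i) * (Z ^^ (2 * i)) x k) (\<lambda>k. of_real (coeff p j) * (Z ^^ (2 * j)) x k)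
        = of_real (coeff p i * coeff p j) * ell2_inner I ((Z ^^ (2 * (i + j))) x) x"
        by (simp add: ell2_inner_scale_left ell2_inner_scale_right)
    qed
    finally show ?thesis .
  qed
  then have "(ell2_norm I (ev p x))\<^sup>2
    = Re (\<Sum>i\<le>degree p. \<Sum>j\<le>degree p. of_real (coeff p i * coeff p j) * ell2_inner I ((Z ^^ (2 * (i + j))) x) x)"
    using ell2_inner_self[OF ev_ell2[OF x], of p] by (metis Re_complex_of_real)
  also have "\<dots> = (\<Sum>i\<le>degree p. \<Sum>j\<le>degree p. coeff q i * coeff q j * mm x (i + j))"
    using c by (simp add: Re_sum cq mm_def power_add power_mult distrib_left mult.assoc)
  also have "\<dots> = mom (mm x) (q * q)"
    by (simp add: mom_mult dq)
  also have "\<dots> \<le> M\<^sup>2 * mm x 0"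
  proof (rule mom_bound[OF mm_pos[OF x]])
    fix t :: real assume "0 \<le> t" "t \<le> 1"
    then have "\<bar>poly p (c ^ 2 * t)\<bar> \<le> M" by (intro M) (auto simp: mult_left_le)
    from mult_mono[OF this this] M(1) have "\<bar>poly p (c ^ 2 * t) * poly p (c ^ 2 * t)\<bar> \<le> M * M"
      by (simp add: abs_mult)
    moreover have "poly q t = poly p (c ^ 2 * t)" by (simp add: q_def poly_pcompose mult.commute)
    ultimately show "\<bar>poly (q * q) t\<bar> \<le> M\<^sup>2" by (simp add: power2_eq_square[of M])
  qed
  also have "\<dots> = (M * ell2_norm I x)\<^sup>2" by (simp add: mm_0 x power_mult_distrib)
  finally have "(ell2_norm I (ev p x))\<^sup>2 \<le> (M * ell2_norm I x)\<^sup>2" .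
  then show ?thesis by (rule power2_le_imp_le) (simp add: M(1))
qed

end


section \<open>The norm of the generators in the regular representation\<close>

text \<open>A Schur test: \<open>2 powr (- length)\<close> is superharmonic for the sum of the five generators.\<close>

lemma weight_superharmonic:
  assumes b: "b \<in> Red"
  shows "(\<Sum>k<5. (1/2::real) ^ length (push k b)) \<le> 4 * (1/2) ^ length b"
proof (cases b)
  case Nil
  then show ?thesis by (simp add: push_simps)
next
  case (Cons t w)
  then have t: "t < 5" using b by (simp add: Red_Cons)
  \<comment> \<open>A nonempty reduced word has one shorter and four longer neighbours: 2 + 4 / 2 =
    4.\<close>
  have "(\<Sum>k<5. (1/2::real) ^ length (push k b)) = (\<Sum>k<5. if k = t then 2 * (1/2) ^ length b else (1/2) ^ length b / 2)"
    by (rule sum.cong) (auto simp: Cons push_simps)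
  also have "\<dots> = 2 * (1/2) ^ length b + (\<Sum>k\<in>{..<5} - {t}. (1/2) ^ length b / 2)"
    using t by (subst sum.remove[of _ t]) auto
  also have "\<dots> = 4 * (1/2) ^ length b" using t by simp
  finally show ?thesis by simp
qed

text \<open>Weighted Cauchy-Schwarz at each \<open>b\<close>, then the same weight inequality seen
  from the neighbours \<open>c\<close>; each use of superharmonicity contributes a factor 4.
  Restricting to finite sets, with the neighbourhood of \<open>B\<close> on the right, avoids
  convergence questions.\<close>

lemma Kesten_bound:
  fixes y :: "nat list \<Rightarrow> complex"
  assumes B: "finite B" "B \<subseteq> Red"
  shows "(\<Sum>b\<in>B. (cmod (\<Sum>k<5. y (push k b)))\<^sup>2) \<le> 16 * (\<Sum>c\<in>(\<Union>k<5. push k ` B). (cmod (y c))\<^sup>2)"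
proof -
  let ?h = "\<lambda>b :: nat list. (1/2 :: real) ^ length b"
  let ?C = "\<Union>k<5. push k ` B"
  have CR: "?C \<subseteq> Red" using B push_Red by auto
  have finC: "finite ?C" using B by auto
  have 1: "(cmod (\<Sum>k<5. y (push k b)))\<^sup>2 \<le> 4 * (\<Sum>k<5. ?h b * (cmod (y (push k b)))\<^sup>2 / ?h (push k b))" if b: "b \<in> B" for b
  proof -
    have "cmod (\<Sum>k<5. y (push k b)) \<le> (\<Sum>k<5. \<bar>sqrt (?h (push k b))\<bar> * \<bar>cmod (y (push k b)) / sqrt (?h (push k b))\<bar>)"
      by (rule order_trans[OF norm_sum]) (rule sum_mono, simp)
    also have "\<dots> \<le> L2_set (\<lambda>k. sqrt (?h (push k b))) {..<5} * L2_set (\<lambda>k. cmod (y (push k b)) / sqrt (?h (push k b))) {..<5}"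
      by (rule L2_set_mult_ineq)
    finally have "(cmod (\<Sum>k<5. y (push k b)))\<^sup>2
       \<le> (L2_set (\<lambda>k. sqrt (?h (push k b))) {..<5} * L2_set (\<lambda>k. cmod (y (push k b)) / sqrt (?h (push k b))) {..<5})\<^sup>2"
      by (rule power_mono) simp
    also have "\<dots> = (\<Sum>k<5. ?h (push k b)) * (\<Sum>k<5. (cmod (y (push k b)))\<^sup>2 / ?h (push k b))"
      by (simp add: power_mult_distrib L2_set_def sum_nonneg power_divide)
    also have "\<dots> \<le> (4 * ?h b) * (\<Sum>k<5. (cmod (y (push k b)))\<^sup>2 / ?h (push k b))"
      using b B by (intro mult_right_mono weight_superharmonic sum_nonneg) auto
    finally show ?thesis by (simp only: sum_distrib_left mult.assoc times_divide_eq_right)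
  qed
  have "(\<Sum>b\<in>B. (cmod (\<Sum>k<5. y (push k b)))\<^sup>2)
     \<le> (\<Sum>b\<in>B. 4 * (\<Sum>k<5. ?h b * (cmod (y (push k b)))\<^sup>2 / ?h (push k b)))"
    by (rule sum_mono[OF 1])
  also have "\<dots> = 4 * (\<Sum>k<5. \<Sum>b\<in>B. ?h b * (cmod (y (push k b)))\<^sup>2 / ?h (push k b))"
    by (subst sum.swap) (simp only: sum_distrib_left)
  also have "(\<Sum>k<5. \<Sum>b\<in>B. ?h b * (cmod (y (push k b)))\<^sup>2 / ?h (push k b))
      \<le> (\<Sum>k<5. \<Sum>c\<in>?C. ?h (push k c) * (cmod (y c))\<^sup>2 / ?h c)"
  proof (rule sum_mono)
    fix k :: nat assume k: "k \<in> {..<5}"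
    have inj: "inj_on (push k) B" using push_push B by (metis inj_onI subsetD)
    have "(\<Sum>b\<in>B. ?h b * (cmod (y (push k b)))\<^sup>2 / ?h (push k b))
      = (\<Sum>c\<in>push k ` B. ?h (push k c) * (cmod (y c))\<^sup>2 / ?h c)"
      unfolding sum.reindex[OF inj] by (rule sum.cong) (use B push_push in \<open>auto simp: subset_iff\<close>)
    also have "\<dots> \<le> (\<Sum>c\<in>?C. ?h (push k c) * (cmod (y c))\<^sup>2 / ?h c)"
      by (rule sum_mono2[OF finC]) (use k in auto)
    finally show "(\<Sum>b\<in>B. ?h b * (cmod (y (push k b)))\<^sup>2 / ?h (push k b))
      \<le> (\<Sum>c\<in>?C. ?h (push k c) * (cmod (y c))\<^sup>2 / ?h c)" .
  qed
  also have "\<dots> = (\<Sum>c\<in>?C. (\<Sum>k<5. ?h (push k c)) * ((cmod (y c))\<^sup>2 / ?h c))"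
    by (subst sum.swap) (simp only: sum_distrib_right times_divide_eq_right sum_divide_distrib)
  also have "\<dots> \<le> (\<Sum>c\<in>?C. (4 * ?h c) * ((cmod (y c))\<^sup>2 / ?h c))"
    by (intro sum_mono mult_right_mono weight_superharmonic) (use CR in auto)
  also have "\<dots> = 4 * (\<Sum>c\<in>?C. (cmod (y c))\<^sup>2)"
    by (simp add: sum_distrib_left)
  finally show ?thesis by simp
qed


section \<open>A left amenable semigroup without weak containment\<close>

definition fin_supp :: "'a set \<Rightarrow> ('a \<Rightarrow> complex) \<Rightarrow> bool" where
  "fin_supp S f \<longleftrightarrow> (\<exists>A. finite A \<and> A \<subseteq> S \<and> (\<forall>s. s \<notin> A \<longrightarrow> f s = 0))"

lemma fin_supp_ell1: "fin_supp S f \<Longrightarrow> f \<in> ell1 S"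
  unfolding fin_supp_def using ell1_finite(1) by blast

lemma conv_fin_supp:
  assumes f: "fin_supp S f" and g: "fin_supp S g" and cl: "\<And>s t. s \<in> S \<Longrightarrow> t \<in> S \<Longrightarrow> mul s t \<in> S"
  shows "fin_supp S (conv S mul f g)"
proof -
  obtain A B where A: "finite A" "A \<subseteq> S" "\<And>s. s \<notin> A \<Longrightarrow> f s = 0" and B: "finite B" "B \<subseteq> S" "\<And>s. s \<notin> B \<Longrightarrow> g s = 0"
    using f g unfolding fin_supp_def by metis
  show ?thesis unfolding fin_supp_def
  proof (intro exI conjI allI impI)
    show "finite ((\<lambda>(s, t). mul s t) ` (A \<times> B))" using A B by auto
    show "(\<lambda>(s, t). mul s t) ` (A \<times> B) \<subseteq> S" using A B by (fastforce intro: cl)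
    fix r assume r: "r \<notin> (\<lambda>(s, t). mul s t) ` (A \<times> B)"
    show "conv S mul f g r = 0" unfolding conv_def
    proof (rule infsum_0)
      fix p assume "p \<in> {(u, v). u \<in> S \<and> v \<in> S \<and> mul u v = r}"
      then have "fst p \<notin> A \<or> snd p \<notin> B" using r by force
      then show "(case p of (u, v) \<Rightarrow> f u * g v) = 0" using A B by (cases p) auto
    qed
  qed
qed

lemma (in pp_rep) pp_delta:
  assumes "s \<in> S" shows "pp (delta s) = ppop s"
proof (intro ext)
  fix x v
  have "(\<Sum>\<^sub>\<infinity>t\<in>S. delta s t * ppop t x v) = (\<Sum>t\<in>{s}. delta s t * ppop t x v)"
    by (rule infsumI, rule has_sum_finite_neutralI[of "{s}"]) (use assms in \<open>auto simp: delta_def\<close>)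
  then show "pp (delta s) x v = ppop s x v" by (simp add: pp_def delta_def)
qed

text \<open>At level 1 only the parity of the length survives: the quotient of order two in which
  all generators have the same nontrivial image, represented by \<open>[0]\<close>.\<close>

definition parity_rep :: "nat \<Rightarrow> nat list \<Rightarrow> nat list" where
  "parity_rep n u = (if n = 0 then u else if even (length u) then [] else [0])"

lemma even_length_push: "even (length (push s w)) \<longleftrightarrow> odd (length w)"
  by (cases w) (auto simp: push_simps)

lemma even_length_wmul: "even (length (wmul u v)) \<longleftrightarrow> (even (length u) \<longleftrightarrow> even (length v))"
  unfolding wmul_def by (induction u) (auto simp: even_length_push)

definition parity_levels :: "nat set" where
  "parity_levels = {0, 1}"

lemma parity_levels_simps [simp]: "0 \<in> parity_levels" "Suc 0 \<in> parity_levels"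
  by (simp_all add: parity_levels_def)

interpretation parity: cliff parity_levels parity_rep
proof
  show "parity_rep n u \<in> Red" if "n \<in> parity_levels" "u \<in> Red" for n u
    using that by (auto simp: parity_levels_def parity_rep_def Red_Cons)
  show "parity_rep n (wmul u v) = parity_rep n (wmul u' v')"
    if "n \<in> parity_levels" "parity_rep n u = parity_rep n u'" "parity_rep n v = parity_rep n v'" for n u u' v v'
    using that by (auto simp: parity_levels_def parity_rep_def even_length_wmul split: if_splits)
  show "parity_rep n (parity_rep m u) = parity_rep n u"
    if "n \<in> parity_levels" "m \<in> parity_levels" "lle n m" for n m u
    using that by (auto simp: parity_levels_def parity_rep_def lle_def)
qed (simp_all add: parity_rep_def)

lemma Red_single [simp]: "k < 5 \<Longrightarrow> [k] \<in> Red"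
  by (simp add: Red_Cons)

lemma parity_en1: "parity.en 1 u = (if even (length u) then parity.en 1 [] else parity.en 1 [0])"
  by (auto simp: parity.en_eq parity_rep_def)

text \<open>Multiplying by the odd element of the lower group moves every element: it changes the
  level of a top element and the parity of a lower one.\<close>

lemma parity_no_zero: "\<not> has_zero parity.S parity.mul"
proof
  assume "has_zero parity.S parity.mul"
  then obtain z where z: "z \<in> parity.S" "\<forall>s\<in>parity.S. parity.mul z s = z" by (auto simp: has_zero_def)
  obtain n w where w: "n \<in> parity_levels" "w \<in> Red" "z = parity.en n w" using z(1) by (rule parity.S_cases)
  have "parity.mul z (parity.en 1 [0]) = z" using z(2) by simp
  then have "parity.en 1 (wmul w [0]) = parity.en n w"
    using w parity.mul_en[of n 1 w "[0]"] by (auto simp: lmeet_def parity_levels_def)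
  then show False by (auto simp: parity.en_eq parity_rep_def even_length_wmul split: if_splits)
qed

lemma parity_left_amenable: "left_amenable parity.S parity.mul"
proof -
  define m :: "(nat \<Rightarrow> complex) \<Rightarrow> complex" where "m f = (f (parity.en 1 []) + f (parity.en 1 [0])) / 2" for f
  have S: "parity.en (Suc 0) [] \<in> parity.S" "parity.en (Suc 0) [0] \<in> parity.S"
    using parity.en_S[of 1 "[]"] parity.en_S[of 1 "[0]"] by simp_all
  have st: "state_linf parity.S m"
    unfolding state_linf_def m_def using S by (auto simp: field_simps indicator_def)
  have "m (left_translate parity.S parity.mul s f) = m f" if s: "s \<in> parity.S" for s f
  proof -
    obtain n w where w: "n \<in> parity_levels" "w \<in> Red" "s = parity.en n w" using s by (rule parity.S_cases)
    have "parity.mul s (parity.en 1 v) = parity.en 1 (wmul w v)" if "v \<in> Red" for v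
      using w that parity.mul_en[of n 1 w v] by (auto simp: lmeet_def parity_levels_def)
    from this[of "[]"] this[of "[0]"] show ?thesis
      using S parity_en1[of w] parity_en1[of "wmul w [0]"] w(2)
      by (auto simp: m_def left_translate_def even_length_wmul)
  qed
  then show ?thesis unfolding left_amenable_def using st by blast
qed

text \<open>Index 5 is the odd element of the lower group, the common product of all generators with
  the lower idempotent.\<close>

definition gen_elt :: "nat \<Rightarrow> nat" where
  "gen_elt k = (if k < 5 then parity.en 0 [k] else parity.en 1 [0])"

text \<open>The five products with the lower idempotent coincide, so their coefficients -1/5 add up
  to -1.\<close>

definition gen_coef :: "nat \<Rightarrow> complex" where
  "gen_coef k = (if k < 5 then 1 / 5 else - 1)"

text \<open>The average of the generators times \<open>1 - e\<close>, where \<open>e\<close> is the lower idempotent.\<close>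

definition hh :: "nat \<Rightarrow> complex" where
  "hh s = (\<Sum>k\<le>5. gen_coef k * delta (gen_elt k) s)"

text \<open>\<open>hpow n\<close> is the power with exponent n + 1; there is no zeroth power, since
  a representation may be degenerate.\<close>

primrec hpow :: "nat \<Rightarrow> nat \<Rightarrow> complex" where
  "hpow 0 = hh"
| "hpow (Suc n) = conv parity.S parity.mul hh (hpow n)"

lemma gen_elt_S [simp]: "gen_elt k \<in> parity.S"
  by (auto simp: gen_elt_def)

lemma star_gen_elt: "star parity.S parity.mul (gen_elt k) = gen_elt k"
  by (auto simp: gen_elt_def parity.star_en)

lemma hh_fin: "fin_supp parity.S hh"
  unfolding fin_supp_def
  by (rule exI[of _ "gen_elt ` {..5}"]) (auto simp: hh_def delta_def intro!: sum.neutral)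

lemma hpow_fin: "fin_supp parity.S (hpow n)"
  by (induction n) (simp_all add: hh_fin conv_fin_supp)

lemma invol_hh: "invol parity.S parity.mul hh = hh"
proof
  fix t
  show "invol parity.S parity.mul hh t = hh t"
  proof (cases "t \<in> parity.S")
    case True
    have "delta (gen_elt k) (star parity.S parity.mul t) = delta (gen_elt k) t" for k
      using parity.star_star[OF True] star_gen_elt[of k] by (auto simp: delta_def)
    moreover have "cnj (gen_coef k) = gen_coef k" "cnj (delta s t) = delta s t" for k and s t :: nat
      by (auto simp: gen_coef_def delta_def)
    ultimately show ?thesis using True by (simp add: invol_def hh_def)
  next
    case False
    then have "t \<noteq> gen_elt k" for k using gen_elt_S by blast
    then show ?thesis using False by (simp add: invol_def hh_def delta_def)
  qed
qed

lemma rep_hh: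
  assumes \<pi>: "star_rep parity.S parity.mul I \<pi>"
  shows "\<pi> hh x = (\<lambda>i. \<Sum>k\<le>5. gen_coef k * \<pi> (delta (gen_elt k)) x i)"
proof -
  have "hh = (\<lambda>s. \<Sum>k\<le>5. gen_coef k * delta (gen_elt k) s)" by (simp add: hh_def fun_eq_iff)
  then show ?thesis using star_rep_sum[OF \<pi>, of "{..5}" "\<lambda>k. delta (gen_elt k)" gen_coef x] by simp
qed

lemma rep_hh_adj:
  assumes "star_rep parity.S parity.mul I \<pi>" "x \<in> ell2 I" "y \<in> ell2 I"
  shows "ell2_inner I (\<pi> hh x) y = ell2_inner I x (\<pi> hh y)"
  using star_repD(5)[OF assms(1) fin_supp_ell1[OF hh_fin]] assms(2,3)
  by (simp add: is_adjoint_def invol_hh)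

lemma rep_hpow:
  assumes \<pi>: "star_rep parity.S parity.mul I \<pi>"
  shows "\<pi> (hpow n) x = (\<pi> hh ^^ Suc n) x"
  by (induction n) (simp_all add: star_repD(4)[OF \<pi> fin_supp_ell1[OF hh_fin] fin_supp_ell1[OF hpow_fin]])

text \<open>The lower idempotent e acts as an orthogonal projection, and \<open>hh\<close> acts as
  an average of five contractions applied to (1 - e) x.\<close>

lemma rep_hh_contr:
  assumes \<pi>: "star_rep parity.S parity.mul I \<pi>" and x: "x \<in> ell2 I"
  shows "ell2_norm I (\<pi> hh x) \<le> ell2_norm I x"
proof -
  let ?u = "\<lambda>s. \<pi> (delta s)"
  let ?e = "parity.en 1 []"
  have eS: "?e \<in> parity.S" using parity.en_S[of 1 "[]"] by simp
  define z where "z = (\<lambda>i. x i - ?u ?e x i)"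
  have ex: "?u ?e x \<in> ell2 I" by (rule parity.rep_ell2[OF \<pi> eS x])
  have z: "z \<in> ell2 I" unfolding z_def by (rule ell2_diff(1)[OF x ex])
  have uz: "?u (gen_elt k) z = (\<lambda>i. ?u (gen_elt k) x i - ?u (gen_elt 5) x i)" if "k < 5" for k
  proof -
    have "parity.mul (gen_elt k) ?e = gen_elt 5"
      using that parity.mul_en[of 0 1 "[k]" "[]"] parity_en1[of "[k]"] by (simp add: gen_elt_def)
    then have "?u (gen_elt k) (?u ?e x) = ?u (gen_elt 5) x"
      using parity.rep_mul[OF \<pi> gen_elt_S eS, of k x] by simp
    then show ?thesis unfolding z_def
      using bop_diff[OF parity.rep_bop[OF \<pi> gen_elt_S] x ex, of k] by simp
  qed
  have "\<pi> hh x = (\<lambda>i. \<Sum>k<5. (1/5) * ?u (gen_elt k) z i)"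
  proof
    fix i
    have "{..5::nat} = insert 5 {..<5}" by auto
    then have "\<pi> hh x i = (\<Sum>k<5. gen_coef k * ?u (gen_elt k) x i) - ?u (gen_elt 5) x i"
      unfolding rep_hh[OF \<pi>] by (simp add: gen_coef_def)
    also have "\<dots> = (\<Sum>k<5. (1/5) * ?u (gen_elt k) z i)"
      by (simp add: uz gen_coef_def right_diff_distrib sum_subtractf)
    finally show "\<pi> hh x i = (\<Sum>k<5. (1/5) * ?u (gen_elt k) z i)" .
  qed
  then have "ell2_norm I (\<pi> hh x) \<le> (\<Sum>k<5. ell2_norm I (\<lambda>i. (1/5) * ?u (gen_elt k) z i))"
    by (simp only:) (rule ell2_sum(2), rule ell2_scale(1)[OF parity.rep_ell2[OF \<pi> gen_elt_S z]])
  also have "\<dots> \<le> (\<Sum>k<5::nat. (1/5) * ell2_norm I z)"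
  proof (rule sum_mono)
    fix k
    show "ell2_norm I (\<lambda>i. (1/5) * ?u (gen_elt k) z i) \<le> (1/5) * ell2_norm I z"
      using ell2_scale(2)[OF parity.rep_ell2[OF \<pi> gen_elt_S z], of "1/5" k]
        parity.rep_contr[OF \<pi> gen_elt_S z, of k] by (simp add: norm_divide)
  qed
  also have "\<dots> = ell2_norm I z" by simp
  also have "\<dots> \<le> ell2_norm I x"
  proof -
    have ee: "?u ?e (?u ?e x) = ?u ?e x"
      using parity.rep_mul[OF \<pi> eS eS, of x] parity.mul_en[of 1 1 "[]" "[]"] by simp
    have "ell2_inner I z (?u ?e x) = ell2_inner I (?u ?e z) x"
      using parity.rep_adjoint[OF \<pi> eS z x] parity.star_en[of 1 "[]"] by simp
    also have "?u ?e z = (\<lambda>i. 0)"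
      unfolding z_def using bop_diff[OF parity.rep_bop[OF \<pi> eS] x ex] ee by simp
    finally have "ell2_inner I z (?u ?e x) = 0" by simp
    from ell2_pythagoras[OF z ex this] have "(ell2_norm I x)\<^sup>2 = (ell2_norm I z)\<^sup>2 + (ell2_norm I (?u ?e x))\<^sup>2"
      by (simp add: z_def)
    then have "(ell2_norm I z)\<^sup>2 \<le> (ell2_norm I x)\<^sup>2" by simp
    then show ?thesis by (rule power2_le_imp_le) simp
  qed
  finally show ?thesis .
qed

text \<open>On the lower level the generators and the odd element act in the same way and cancel. On
  the top level the odd element acts as zero, and \<open>Kesten_bound\<close> gives the square of
  4/5.\<close>

lemma lreg_hh_bound:
  assumes x: "x \<in> ell2 parity.S"
  shows "ell2_norm parity.S (lreg_ell1 parity.S parity.mul hh x) \<le> 4 / 5 * ell2_norm parity.S x"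
proof (rule ell2_intro(2))
  let ?T = "lreg_ell1 parity.S parity.mul hh x"
  have T: "?T v = (\<Sum>k\<le>5. gen_coef k * parity.ppop (gen_elt k) x v)" for v
    unfolding parity.lreg_ell1_eq rep_hh[OF parity.pp_star_rep] by (simp add: parity.pp_delta)
  have ins: "{..5::nat} = insert 5 {..<5}" by auto
  show "?T v = 0" if "v \<notin> parity.S" for v using that by (simp add: T parity.ppop_def)
  have T0: "?T (parity.en 0 b) = (\<Sum>k<5. x (parity.en 0 (push k b))) / 5" if b: "b \<in> Red" for b
  proof -
    have "parity.ppop (gen_elt k) x (parity.en 0 b) = x (parity.en 0 (push k b))" if "k < 5" for k
      using that b x parity.\<beta>_en[of 0 0 "[k]" b]
      by (simp add: parity.ppop_def parity.pv_def gen_elt_def wmul_def)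
    moreover have "parity.ppop (gen_elt 5) x (parity.en 0 b) = 0"
      using b x parity.\<beta>_en[of 1 0 "[0]" b]
      by (simp add: parity.ppop_def parity.pv_def gen_elt_def lle_def)
    ultimately show ?thesis unfolding T ins by (simp add: gen_coef_def sum_divide_distrib)
  qed
  have T1: "?T (parity.en 1 b) = 0" if b: "b \<in> Red" for b
  proof -
    have bS: "parity.en 1 b \<in> parity.S" using parity.en_S[of 1 b] b by simp
    have e: "parity.en 1 (push k b) = parity.en 1 (push 0 b)" for k
      using parity_en1[of "push k b"] parity_en1[of "push 0 b"] by (simp add: even_length_push)
    have "parity.ppop (gen_elt k) x (parity.en 1 b) = x (parity.en 1 (push 0 b))" if "k < 5" for k
      unfolding e[of k, symmetric] using that bS b x parity.\<beta>_en[of 0 1 "[k]" b]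
      by (simp add: parity.ppop_def parity.pv_def gen_elt_def wmul_def)
    moreover have "parity.ppop (gen_elt 5) x (parity.en 1 b) = x (parity.en 1 (push 0 b))"
      using bS b x parity.\<beta>_en[of 1 1 "[0]" b]
      by (simp add: parity.ppop_def parity.pv_def gen_elt_def wmul_def)
    ultimately show ?thesis unfolding T ins by (simp add: gen_coef_def)
  qed
  fix A assume A: "finite A" "A \<subseteq> parity.S"
  define B where "B = {b \<in> Red. parity.en 0 b \<in> A}"
  have inj: "inj_on (parity.en 0) X" for X by (auto simp: inj_on_def parity.en_eq parity_rep_def)
  have finB: "finite B"
    using finite_vimage_IntI[OF A(1) inj, of Red] by (auto simp: B_def vimage_def Collect_conj_eq Int_commute)
  let ?C = "\<Union>k<5. push k ` B"
  have CR: "?C \<subseteq> Red" using push_Red by (auto simp: B_def)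
  have "(\<Sum>v\<in>A. (cmod (?T v))\<^sup>2) = (\<Sum>v\<in>parity.en 0 ` B. (cmod (?T v))\<^sup>2)"
  proof (rule sum.mono_neutral_right[OF A(1)])
    show "parity.en 0 ` B \<subseteq> A" by (auto simp: B_def)
    show "\<forall>v\<in>A - parity.en 0 ` B. (cmod (?T v))\<^sup>2 = 0"
    proof
      fix v assume v: "v \<in> A - parity.en 0 ` B"
      then have "v \<in> parity.S" using A by auto
      then obtain n w where w: "n \<in> parity_levels" "w \<in> Red" "v = parity.en n w" by (rule parity.S_cases)
      then have "n = 1" using v by (auto simp: B_def parity_levels_def)
      then show "(cmod (?T v))\<^sup>2 = 0" using T1 w by simp
    qed
  qed
  also have "\<dots> = (\<Sum>b\<in>B. (cmod (\<Sum>k<5. x (parity.en 0 (push k b))))\<^sup>2 / 25)"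
    unfolding sum.reindex[OF inj] by (rule sum.cong) (auto simp: T0 B_def norm_divide power_divide)
  also have "\<dots> \<le> 16 / 25 * (\<Sum>c\<in>?C. (cmod (x (parity.en 0 c)))\<^sup>2)"
    using Kesten_bound[of B "\<lambda>c. x (parity.en 0 c)"] finB by (simp add: B_def sum_divide_distrib[symmetric] Collect_restrict)
  also have "(\<Sum>c\<in>?C. (cmod (x (parity.en 0 c)))\<^sup>2) = (\<Sum>v\<in>parity.en 0 ` ?C. (cmod (x v))\<^sup>2)"
    unfolding sum.reindex[OF inj] by simp
  also have "\<dots> \<le> (ell2_norm parity.S x)\<^sup>2"
  proof (rule ell2_finite_sq_le[OF x])
    show "finite (parity.en 0 ` ?C)" using finB by simp
    show "parity.en 0 ` ?C \<subseteq> parity.S" by (intro image_subsetI parity.en_S) (use CR in auto)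
  qed
  finally have le: "(\<Sum>v\<in>A. (cmod (?T v))\<^sup>2) \<le> (4 / 5 * ell2_norm parity.S x)\<^sup>2"
    by (simp add: power_mult_distrib power2_eq_square)
  have nn: "0 \<le> 4 / 5 * ell2_norm parity.S x" by simp
  show "L2_set (\<lambda>v. cmod (?T v)) A \<le> 4 / 5 * ell2_norm parity.S x"
    using real_sqrt_le_mono[OF le] unfolding L2_set_def real_sqrt_abs abs_of_nonneg[OF nn] .
qed


section \<open>A polynomial calculus that separates the two norms\<close>

definition cutoff :: "real \<Rightarrow> real" where
  "cutoff t = max 0 (t - 16 / 25)"

text \<open>Bernstein polynomials of \<open>cutoff\<close>, kept as formal polynomials because their
  coefficients are to be applied to powers in l1(S).\<close>

definition bpoly :: "nat \<Rightarrow> real poly" where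
  "bpoly n = (\<Sum>k\<le>n. smult (cutoff (real k / real n) * real (n choose k)) (monom 1 k * [:1, -1:] ^ (n - k)))"

lemma poly_bpoly: "poly (bpoly n) t = (\<Sum>k\<le>n. cutoff (real k / real n) * Bernstein n k t)"
  by (simp add: bpoly_def poly_sum poly_monom poly_power Bernstein_def mult.assoc)

lemma bpoly_approx:
  assumes "e > 0"
  shows "\<exists>N. \<forall>n\<ge>N. \<forall>t. 0 \<le> t \<longrightarrow> t \<le> 1 \<longrightarrow> \<bar>cutoff t - poly (bpoly n) t\<bar> < e"
proof -
  have "continuous_on {0..1} cutoff" unfolding cutoff_def by (intro continuous_intros)
  from Bernstein_Weierstrass[OF this assms] obtain N where
    "\<And>n x. N \<le> n \<and> x \<in> {0..1} \<Longrightarrow> \<bar>cutoff x - (\<Sum>k\<le>n. cutoff (real k / real n) * Bernstein n k x)\<bar> < e" by blast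
  then show ?thesis by (intro exI[of _ N]) (simp add: poly_bpoly)
qed

text \<open>There is no constant term because \<open>cutoff\<close> vanishes at 0; this allows
  evaluation without a unit.\<close>

lemma coeff_bpoly_0: "coeff (bpoly n) 0 = 0"
proof -
  have "poly (bpoly n) 0 = 0"
    unfolding poly_bpoly
  proof (rule sum.neutral, rule ballI)
    fix k show "cutoff (real k / real n) * Bernstein n k 0 = 0"
      by (cases "k = 0") (simp_all add: cutoff_def Bernstein_def)
  qed
  then show ?thesis by (simp add: poly_0_coeff_0)
qed

lemma (in contraction) ev_diff: "ev (p - q) x = (\<lambda>i. ev p x i - ev q x i)"
proof
  fix i
  let ?N = "max (degree p) (degree q)"
  have e: "ev r x i = (\<Sum>j\<le>?N. of_real (coeff r j) * (Z ^^ (2 * j)) x i)" if "degree r \<le> ?N" for r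
    unfolding ev_def by (rule sum.mono_neutral_left) (use that in \<open>auto simp: coeff_eq_0\<close>)
  show "ev (p - q) x i = ev p x i - ev q x i"
    using degree_diff_le_max[of p q] by (simp add: e left_diff_distrib sum_subtractf)
qed

text \<open>\<open>bpoly n\<close> evaluated at the square of \<open>hh\<close>: with the shift in
  \<open>hpow\<close>, index \<open>2 * j - 1\<close> is the power with exponent 2j.\<close>

definition FF :: "nat \<Rightarrow> nat \<Rightarrow> complex" where
  "FF n s = (\<Sum>j\<in>{1..degree (bpoly n)}. of_real (coeff (bpoly n) j) * hpow (2 * j - 1) s)"

lemma FF_ell1: "FF n \<in> ell1 parity.S"
  unfolding FF_def by (intro ell1_sum ell1_scale fin_supp_ell1 hpow_fin)

lemma hh_contraction:
  "star_rep parity.S parity.mul I \<pi> \<Longrightarrow> contraction I (\<pi> hh) 1"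
  by unfold_locales
    (simp_all add: rep_hh_adj rep_hh_contr star_repD(1)[OF _ fin_supp_ell1[OF hh_fin]])

lemma lreg_hh_contraction: "contraction parity.S (lreg_ell1 parity.S parity.mul hh) (4 / 5)"
proof
  show "lreg_ell1 parity.S parity.mul hh \<in> bop parity.S"
    by (rule star_repD(1)[OF parity.lreg_star_rep fin_supp_ell1[OF hh_fin]])
qed (rule rep_hh_adj[OF parity.lreg_star_rep] lreg_hh_bound | assumption | simp)+

lemma rep_FF:
  assumes \<pi>: "star_rep parity.S parity.mul I \<pi>"
  shows "\<pi> (FF n) x = (\<lambda>i. \<Sum>j\<le>degree (bpoly n). of_real (coeff (bpoly n) j) * (\<pi> hh ^^ (2 * j)) x i)"
proof -
  have "\<pi> (FF n) x = (\<lambda>i. \<Sum>j\<in>{1..degree (bpoly n)}. of_real (coeff (bpoly n) j) * \<pi> (hpow (2 * j - 1)) x i)"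
    unfolding FF_def[abs_def] by (rule star_rep_sum[OF \<pi>]) (simp_all add: fin_supp_ell1 hpow_fin)
  also have "\<dots> = (\<lambda>i. \<Sum>j\<in>{1..degree (bpoly n)}. of_real (coeff (bpoly n) j) * (\<pi> hh ^^ (2 * j)) x i)"
  proof (intro ext sum.cong refl)
    fix i j assume "j \<in> {1..degree (bpoly n)}"
    then have "Suc (2 * j - 1) = 2 * j" by auto
    then show "of_real (coeff (bpoly n) j) * \<pi> (hpow (2 * j - 1)) x i = of_real (coeff (bpoly n) j) * (\<pi> hh ^^ (2 * j)) x i"
      by (simp only: rep_hpow[OF \<pi>])
  qed
  also have "\<dots> = (\<lambda>i. \<Sum>j\<le>degree (bpoly n). of_real (coeff (bpoly n) j) * (\<pi> hh ^^ (2 * j)) x i)"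
    by (intro ext sum.mono_neutral_left) (auto simp: coeff_bpoly_0 not_less_eq_eq)
  finally show ?thesis .
qed

lemma FF_diff_bound:
  assumes \<pi>: "star_rep parity.S parity.mul I \<pi>" and M: "0 \<le> M"
    "\<And>t. 0 \<le> t \<Longrightarrow> t \<le> 1 \<Longrightarrow> \<bar>poly (bpoly m) t - poly (bpoly n) t\<bar> \<le> M"
  shows "op_norm I (\<pi> (\<lambda>s. FF m s - FF n s)) \<le> M"
  unfolding star_rep_diff[OF \<pi> FF_ell1 FF_ell1]
proof (rule op_norm_le[OF M(1)])
  fix x assume x: "x \<in> ell2 I"
  interpret contraction I "\<pi> hh" 1 by (rule hh_contraction[OF \<pi>])
  have "op_diff (\<pi> (FF m)) (\<pi> (FF n)) x = (\<lambda>i. ev (bpoly m) x i - ev (bpoly n) x i)"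
    unfolding op_diff_def rep_FF[OF \<pi>] ev_def ..
  also have "\<dots> = ev (bpoly m - bpoly n) x" by (simp only: ev_diff)
  finally show "ell2_norm I (op_diff (\<pi> (FF m)) (\<pi> (FF n)) x) \<le> M * ell2_norm I x"
    using ev_bound[OF x M(1), of "bpoly m - bpoly n"] M(2) by simp
qed

text \<open>In the regular representation \<open>hh\<close> has norm at most 4/5, so its square only
  sees [0, 16/25], where \<open>cutoff\<close> vanishes.\<close>

lemma FF_red:
  assumes M: "0 \<le> M" "\<And>t. 0 \<le> t \<Longrightarrow> t \<le> 16 / 25 \<Longrightarrow> \<bar>poly (bpoly n) t\<bar> \<le> M"
  shows "parity.red (FF n) \<le> M"
proof (rule op_norm_le[OF M(1)])
  fix x assume x: "x \<in> ell2 parity.S"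
  interpret contraction parity.S "lreg_ell1 parity.S parity.mul hh" "4 / 5" by (rule lreg_hh_contraction)
  have "lreg_ell1 parity.S parity.mul (FF n) x = ev (bpoly n) x"
    unfolding rep_FF[OF parity.lreg_star_rep] ev_def ..
  then show "ell2_norm parity.S (lreg_ell1 parity.S parity.mul (FF n) x) \<le> M * ell2_norm parity.S x"
    using ev_bound[OF x M(1), of "bpoly n"] M(2) by (simp add: power2_eq_square)
qed

text \<open>The trivial character of the top group, extended by zero to the lower level.\<close>

lemma FF_full: "\<bar>poly (bpoly n) 1\<bar> \<le> full_norm parity.S parity.mul (FF n)"
proof -
  let ?o = "(0, 0) :: nat \<times> nat"
  define \<gamma> :: "nat \<Rightarrow> nat \<times> nat \<Rightarrow> (nat \<times> nat) option" where
    "\<gamma> s p = (if parity.lv s = 0 \<and> p = ?o then Some p else None)" for s p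
  interpret E: pp_rep parity.S parity.mul UNIV \<gamma>
  proof
    show "\<gamma> (parity.mul s t) p = Option.bind (\<gamma> s p) (\<gamma> t)" if "s \<in> parity.S" "t \<in> parity.S" for s t p
    proof -
      have "parity.lv (parity.mul s t) = lmeet (parity.lv s) (parity.lv t)" by (simp add: parity.mul_def)
      then show ?thesis by (simp add: \<gamma>_def lmeet_def min_def)
    qed
    show "\<gamma> (star parity.S parity.mul s) w = Some v" if "s \<in> parity.S" "\<gamma> s v = Some w" for s v w
    proof -
      have "parity.lv (star parity.S parity.mul s) = parity.lv s"
        using that(1) by (auto elim!: parity.S_cases simp: parity.star_en)
      then show ?thesis using that by (auto simp: \<gamma>_def split: if_splits)
    qed
  qed (auto simp: parity.star_closed parity.star_star)
  let ?d = "delta ?o"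
  have d: "?d \<in> ell2 UNIV" by simp
  \<comment> \<open>Only the five top terms act on \<open>?d\<close>, each as the identity with
    coefficient 1/5.\<close>
  have "E.pp hh ?d = ?d"
  proof
    fix i
    have dz: "?d i = 0" if "i \<noteq> ?o" using that by (simp add: delta_def)
    have "E.ppop (gen_elt k) ?d i = (if k < 5 then ?d i else 0)" for k
      using d dz by (auto simp: E.ppop_def E.pv_def \<gamma>_def gen_elt_def)
    moreover have "{..5::nat} = insert 5 {..<5}" by auto
    ultimately show "E.pp hh ?d i = ?d i"
      unfolding rep_hh[OF E.pp_star_rep] by (simp add: E.pp_delta gen_coef_def)
  qed
  then have pw: "(E.pp hh ^^ j) ?d = ?d" for j by (induction j) simp_all
  have "E.pp (FF n) ?d = (\<lambda>i. of_real (poly (bpoly n) 1) * ?d i)"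
    unfolding rep_FF[OF E.pp_star_rep] pw by (simp add: poly_altdef sum_distrib_right)
  then have "\<bar>poly (bpoly n) 1\<bar> = ell2_norm UNIV (E.pp (FF n) ?d)"
    using ell2_scale(2)[OF d, of "of_real (poly (bpoly n) 1)"] by simp
  also have "\<dots> \<le> op_norm UNIV (E.pp (FF n))"
    using op_norm_bound[OF E.pp_bop(1)[OF FF_ell1] d, of n] by simp
  also have "\<dots> \<le> full_norm parity.S parity.mul (FF n)"
    by (rule full_norm_ge[OF E.pp_star_rep FF_ell1])
  finally show ?thesis .
qed

lemma parity_not_weak_containment: "\<not> weak_containment parity.S parity.mul"
proof (rule parity.not_weak_containmentI)
  show "FF \<in> full_Cauchy parity.S parity.mul"
    unfolding full_Cauchy_def
  proof (intro CollectI conjI allI impI FF_ell1)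
    fix \<epsilon> :: real assume e: "\<epsilon> > 0"
    obtain N where N: "\<And>n t. n \<ge> N \<Longrightarrow> 0 \<le> t \<Longrightarrow> t \<le> 1 \<Longrightarrow> \<bar>cutoff t - poly (bpoly n) t\<bar> < \<epsilon> / 4"
      using bpoly_approx[of "\<epsilon> / 4"] e by auto
    have "full_norm parity.S parity.mul (\<lambda>s. FF m s - FF n s) < \<epsilon>" if "m \<ge> N" "n \<ge> N" for m n
    proof -
      have "full_norm parity.S parity.mul (\<lambda>s. FF m s - FF n s) \<le> \<epsilon> / 2"
      proof (rule full_norm_le, rule FF_diff_bound)
        fix t :: real assume t: "0 \<le> t" "t \<le> 1"
        show "\<bar>poly (bpoly m) t - poly (bpoly n) t\<bar> \<le> \<epsilon> / 2"
          using N[OF that(1) t] N[OF that(2) t] by linarith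
      qed (use e in auto)
      then show ?thesis using e by simp
    qed
    then show "\<exists>N. \<forall>m\<ge>N. \<forall>n\<ge>N. full_norm parity.S parity.mul (\<lambda>s. FF m s - FF n s) < \<epsilon>" by blast
  qed
  show "(\<lambda>n. parity.red (FF n)) \<longlonglongrightarrow> 0"
  proof (rule LIMSEQ_I)
    fix \<epsilon> :: real assume e: "0 < \<epsilon>"
    obtain N where N: "\<And>n t. n \<ge> N \<Longrightarrow> 0 \<le> t \<Longrightarrow> t \<le> 1 \<Longrightarrow> \<bar>cutoff t - poly (bpoly n) t\<bar> < \<epsilon> / 2"
      using bpoly_approx[of "\<epsilon> / 2"] e by auto
    have "norm (parity.red (FF n) - 0) < \<epsilon>" if "n \<ge> N" for n
    proof -
      have "parity.red (FF n) \<le> \<epsilon> / 2"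
      proof (rule FF_red)
        fix t :: real assume t: "0 \<le> t" "t \<le> 16 / 25"
        then have "cutoff t = 0" by (simp add: cutoff_def)
        then show "\<bar>poly (bpoly n) t\<bar> \<le> \<epsilon> / 2" using N[OF that t(1)] t(2) by simp
      qed (use e in auto)
      then show ?thesis using e op_norm_nonneg[OF parity.lreg_bop[OF FF_ell1]] by simp
    qed
    then show "\<exists>no. \<forall>n\<ge>no. norm (parity.red (FF n) - 0) < \<epsilon>" by blast
  qed
  show "\<not> (\<lambda>n. full_norm parity.S parity.mul (FF n)) \<longlonglongrightarrow> 0"
  proof
    assume "(\<lambda>n. full_norm parity.S parity.mul (FF n)) \<longlonglongrightarrow> 0"
    then obtain N where N: "\<And>n. n \<ge> N \<Longrightarrow> \<bar>full_norm parity.S parity.mul (FF n)\<bar> < 1 / 10"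
      using LIMSEQ_D[of "\<lambda>n. full_norm parity.S parity.mul (FF n)" 0 "1 / 10"] by auto
    obtain N' where N': "\<And>n t. n \<ge> N' \<Longrightarrow> 0 \<le> t \<Longrightarrow> t \<le> 1 \<Longrightarrow> \<bar>cutoff t - poly (bpoly n) t\<bar> < 1 / 10"
      using bpoly_approx[of "1 / 10"] by auto
    \<comment> \<open>The value 9/25 exceeds the sum of the two tolerances 1/10.\<close>
    have "cutoff 1 = 9 / 25" by (simp add: cutoff_def)
    then show False using N[of "max N N'"] N'[of "max N N'" 1] FF_full[of "max N N'"] by auto
  qed
qed

theorem left_amenable_not_weak_containment:
  "\<exists>(S :: nat set) mul. inverse_semigroup S mul \<and> \<not> has_zero S mul \<and> left_amenable S mul \<and> \<not> weak_containment S mul"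
  using parity.inverse_semigroup parity_no_zero parity_left_amenable parity_not_weak_containment by blast


section \<open>The chain of finite quotients\<close>

text \<open>All actions of the free product on M points, one involution per generator. Extending
  them by the identity outside the range makes equality of actions plain equality of
  functions.\<close>

definition Sig :: "nat \<Rightarrow> (nat \<Rightarrow> nat \<Rightarrow> nat) set" where
  "Sig M = {\<sigma>. (\<forall>s k. \<sigma> s (\<sigma> s k) = k) \<and> (\<forall>s k. M \<le> k \<or> 5 \<le> s \<longrightarrow> \<sigma> s k = k)}"

lemma foldr_push_act: "(\<And>s k. \<sigma> s (\<sigma> s k) = k) \<Longrightarrow> foldr \<sigma> (push s w) k = \<sigma> s (foldr \<sigma> w k)"
  by (cases w) (auto simp: push_simps)

lemma foldr_wmul: "(\<And>s k. \<sigma> s (\<sigma> s k) = k) \<Longrightarrow> foldr \<sigma> (wmul u v) k = foldr \<sigma> u (foldr \<sigma> v k)"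
  unfolding wmul_def by (induction u) (simp_all add: foldr_push_act)

definition eqv :: "nat \<Rightarrow> nat list \<Rightarrow> nat list \<Rightarrow> bool" where
  "eqv M u v \<longleftrightarrow> (\<forall>\<sigma>\<in>Sig M. foldr \<sigma> u = foldr \<sigma> v)"

text \<open>Level 0 is treated apart: it is the top group, whereas \<open>eqv 0\<close> would
  identify all words, \<open>Sig 0\<close> containing only the trivial action.\<close>

definition qrep :: "nat \<Rightarrow> nat list \<Rightarrow> nat list" where
  "qrep n u = (if n = 0 then u else SOME v. v \<in> Red \<and> eqv n v u)"

lemma Sig_mono: "n \<le> m \<Longrightarrow> Sig n \<subseteq> Sig m"
  unfolding Sig_def by (auto intro: order_trans)

lemma qrep_props:
  assumes "u \<in> Red" shows "qrep n u \<in> Red" "eqv n (qrep n u) u"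
proof -
  have "qrep n u \<in> Red \<and> eqv n (qrep n u) u"
  proof (cases "n = 0")
    case False
    then show ?thesis unfolding qrep_def
      using someI[of "\<lambda>v. v \<in> Red \<and> eqv n v u" u] assms by (simp add: eqv_def)
  qed (simp add: qrep_def assms eqv_def)
  then show "qrep n u \<in> Red" "eqv n (qrep n u) u" by auto
qed

lemma qrep_eq:
  assumes "u \<in> Red" "v \<in> Red" "n \<noteq> 0"
  shows "qrep n u = qrep n v \<longleftrightarrow> eqv n u v"
proof
  assume "qrep n u = qrep n v"
  then show "eqv n u v" using qrep_props(2)[OF assms(1), of n] qrep_props(2)[OF assms(2), of n]
    by (simp add: eqv_def)
next
  assume "eqv n u v"
  then have "eqv n w u \<longleftrightarrow> eqv n w v" for w by (simp add: eqv_def)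
  then show "qrep n u = qrep n v" using assms(3) by (simp add: qrep_def)
qed

lemma eqv_wmul: "eqv n u u' \<Longrightarrow> eqv n v v' \<Longrightarrow> eqv n (wmul u v) (wmul u' v')"
  unfolding eqv_def by (intro ballI ext) (auto simp: foldr_wmul Sig_def)

interpretation fq: cliff UNIV qrep
proof
  show "qrep n (wmul u v) = qrep n (wmul u' v')"
    if "u \<in> Red" "u' \<in> Red" "v \<in> Red" "v' \<in> Red" "qrep n u = qrep n u'" "qrep n v = qrep n v'" for n u u' v v'
  proof (cases "n = 0")
    case True
    then show ?thesis using that by (simp add: qrep_def)
  next
    case False
    then show ?thesis using that by (simp add: qrep_eq eqv_wmul)
  qed
  show "qrep n (qrep m u) = qrep n u" if "lle n m" "u \<in> Red" for n m u
  proof (cases "m = 0")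
    case True
    then show ?thesis by (simp add: qrep_def)
  next
    case False
    then have nm: "n \<noteq> 0" "n \<le> m" using that(1) by (auto simp: lle_def)
    have "eqv n (qrep m u) u" using qrep_props(2)[OF that(2), of m] Sig_mono[OF nm(2)] by (auto simp: eqv_def)
    then show ?thesis using qrep_eq[OF qrep_props(1)[OF that(2)] that(2) nm(1)] by simp
  qed
qed (auto simp: qrep_props(1), simp add: qrep_def)

lemma Sig_less:
  assumes "\<sigma> \<in> Sig M" "k < M" shows "\<sigma> s k < M"
proof (rule ccontr)
  have h: "M \<le> l \<Longrightarrow> \<sigma> s l = l" "\<sigma> s (\<sigma> s l) = l" for l
    using assms(1) by (simp_all add: Sig_def)
  assume "\<not> \<sigma> s k < M"
  then show False using h(1)[of "\<sigma> s k"] h(2)[of k] assms(2) by simp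
qed

lemma foldr_Sig_less: "\<sigma> \<in> Sig M \<Longrightarrow> k < M \<Longrightarrow> foldr \<sigma> w k < M"
  by (induction w) (auto simp: Sig_less)

lemma foldr_Sig_ge: "\<sigma> \<in> Sig M \<Longrightarrow> M \<le> k \<Longrightarrow> foldr \<sigma> w k = k"
  by (induction w) (auto simp: Sig_def)

lemma finite_Sig: "finite (Sig M)"
proof (rule finite_subset)
  let ?P = "PiE ({..<5::nat} \<times> {..<M}) (\<lambda>_. {..<M})"
  let ?F = "\<lambda>\<tau> s k. if s < 5 \<and> k < M then \<tau> (s, k) else k"
  show "Sig M \<subseteq> ?F ` ?P"
  proof
    fix \<sigma> assume \<sigma>: "\<sigma> \<in> Sig M"
    have "\<sigma> = ?F (restrict (\<lambda>(s, k). \<sigma> s k) ({..<5} \<times> {..<M}))"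
      using \<sigma> by (auto simp: fun_eq_iff Sig_def)
    moreover have "restrict (\<lambda>(s, k). \<sigma> s k) ({..<5} \<times> {..<M}) \<in> ?P"
      using Sig_less[OF \<sigma>] by (auto simp: restrict_PiE_iff)
    ultimately show "\<sigma> \<in> ?F ` ?P" by blast
  qed
  show "finite (?F ` ?P)" by (intro finite_imageI finite_PiE) auto
qed

text \<open>A class is determined by the permutations that it induces in finitely many actions on
  finitely many points.\<close>

lemma finite_quotient:
  assumes "n \<noteq> 0" shows "finite (qrep n ` Red)"
proof (rule finite_imageD)
  let ?F = "\<lambda>u. restrict (\<lambda>\<sigma>. restrict (foldr \<sigma> u) {..<n}) (Sig n)"
  have "?F ` (qrep n ` Red) \<subseteq> PiE (Sig n) (\<lambda>_. PiE {..<n} (\<lambda>_. {..<n}))"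
    by (intro image_subsetI) (simp add: restrict_PiE_iff foldr_Sig_less)
  moreover have "finite (PiE (Sig n) (\<lambda>_. PiE {..<n} (\<lambda>_. {..<n})))"
    by (intro finite_PiE finite_Sig) auto
  ultimately show "finite (?F ` (qrep n ` Red))" by (rule finite_subset)
  show "inj_on ?F (qrep n ` Red)"
  proof (rule inj_onI)
    fix u v assume "u \<in> qrep n ` Red" "v \<in> qrep n ` Red" and e: "?F u = ?F v"
    then obtain u' v' where u: "u' \<in> Red" "u = qrep n u'" and v: "v' \<in> Red" "v = qrep n v'" by auto
    have "foldr \<sigma> u = foldr \<sigma> v" if \<sigma>: "\<sigma> \<in> Sig n" for \<sigma>
    proof
      fix k
      have "restrict (foldr \<sigma> u) {..<n} = restrict (foldr \<sigma> v) {..<n}"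
        using fun_cong[OF e, of \<sigma>] \<sigma> by simp
      from fun_cong[OF this, of k] show "foldr \<sigma> u k = foldr \<sigma> v k"
        using foldr_Sig_ge[OF \<sigma>] by (cases "k < n") auto
    qed
    then have "eqv n u v" by (simp add: eqv_def)
    then have "qrep n u = qrep n v" using qrep_eq[of u v n] u v qrep_props(1) assms by simp
    then show "u = v" using u v fq.rp_rp_same by simp
  qed
qed


section \<open>The top group is not amenable\<close>

text \<open>If \<open>W s\<close> is the set of words starting with \<open>s\<close>, then \<open>s\<close> exchanges \<open>W s\<close> with its
  complement, so an invariant mean gives weight \<open>1/2\<close> to each of the disjoint sets \<open>W s\<close>.\<close>

lemma fq_top_not_amenable: "\<not> left_amenable (fq.G (fq.en 0 [])) fq.mul"
proof
  let ?G = "fq.G (fq.en 0 [])"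
  assume "left_amenable ?G fq.mul"
  then obtain m where m: "state_linf ?G m" and inv: "\<And>f s. f \<in> linf ?G \<Longrightarrow> s \<in> ?G \<Longrightarrow> m (left_translate ?G fq.mul s f) = m f"
    unfolding left_amenable_def by blast
  have add: "m (\<lambda>s. f s + g s) = m f + m g" if "f \<in> linf ?G" "g \<in> linf ?G" for f g
    using m that unfolding state_linf_def by (elim conjE) blast
  have scale: "m (\<lambda>s. c * f s) = c * m f" if "f \<in> linf ?G" for f c
    using m that unfolding state_linf_def by (elim conjE) blast
  have pos: "0 \<le> Re (m f)" if "f \<in> linf ?G" "\<forall>s\<in>?G. f s \<in> \<real> \<and> 0 \<le> Re (f s)" for f
    using m that unfolding state_linf_def by (elim conjE) blast
  have one: "m (indicator ?G) = 1" using m unfolding state_linf_def by blast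
  define f :: "nat \<Rightarrow> nat \<Rightarrow> complex" where
    "f k t = (if t \<in> ?G \<and> fq.wd t \<noteq> [] \<and> hd (fq.wd t) = k then 1 else 0)" for k t
  have lin: "g \<in> linf ?G" if "\<And>s. s \<notin> ?G \<Longrightarrow> g s = 0" "\<And>s. g s \<in> {-2, -1, 0, 1, 2}" for g :: "nat \<Rightarrow> complex"
  proof -
    have "g ` ?G \<subseteq> {-2, -1, 0, 1, 2}" using that(2) by blast
    then have "bounded (g ` ?G)" by (rule bounded_subset[rotated]) (simp add: finite_imp_bounded)
    then show ?thesis using that(1) by (simp add: linf_def)
  qed
  have f: "f k \<in> linf ?G" for k by (rule lin) (auto simp: f_def)
  have i: "indicator ?G \<in> linf ?G" by (rule lin) (auto simp: indicator_def)
  have neg: "m (\<lambda>s. g s - h s) = m g - m h" if "g \<in> linf ?G" "h \<in> linf ?G" for g h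
  proof -
    have "(\<lambda>s. -1 * h s) \<in> linf ?G"
      using that(2) bounded_scaleR_comp[of h ?G "-1"] by (simp add: linf_def)
    from add[OF that(1) this] scale[OF that(2), of "-1"] show ?thesis by simp
  qed
  have half: "m (f k) = 1 / 2" if k: "k < 5" for k
  proof -
    have kG: "fq.en 0 [k] \<in> ?G" using k by (simp add: fq.G_def)
    have "left_translate ?G fq.mul (fq.en 0 [k]) (f k) = (\<lambda>s. indicator ?G s - f k s)"
    proof
      fix t
      show "left_translate ?G fq.mul (fq.en 0 [k]) (f k) t = indicator ?G t - f k t"
      proof (cases "t \<in> ?G")
        case True
        then obtain w where w: "w \<in> Red" "t = fq.en 0 w" by (auto simp: fq.G_def elim: fq.S_cases)
        have wd: "fq.wd (fq.en 0 v) = v" for v by (simp add: fq.wd_en qrep_def)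
        have mul: "fq.mul (fq.en 0 [k]) t = fq.en 0 (push k w)"
          using w k fq.mul_en[of 0 0 "[k]" w] by (simp add: wmul_def)
        have in_G: "fq.en 0 (push k w) \<in> ?G" using w k by (simp add: fq.G_def push_Red)
        have fk: "f k (fq.en 0 v) = (if v \<noteq> [] \<and> hd v = k then 1 else 0)" if "fq.en 0 v \<in> ?G" for v
          using that by (simp add: f_def wd)
        have "left_translate ?G fq.mul (fq.en 0 [k]) (f k) t = f k (fq.en 0 (push k w))"
          using True by (simp add: left_translate_def mul)
        also have "\<dots> = 1 - f k (fq.en 0 w)"
          unfolding fk[OF in_G] fk[OF True[unfolded w(2)]] using w(1)
          by (cases w; cases "tl w") (auto simp: push_simps Red_Cons)
        finally show ?thesis using True w(2) by simp
      qed (simp add: left_translate_def f_def)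
    qed
    then have "m (f k) = 1 - m (f k)" using inv[OF f kG, of k] neg[OF i f, of k] one by simp
    then show ?thesis by (simp add: field_simps eq_divide_eq)
  qed
  have d: "(\<lambda>s. indicator ?G s - f 0 s) \<in> linf ?G" by (rule lin) (auto simp: f_def indicator_def)
  have d2: "(\<lambda>s. indicator ?G s - f 0 s - f 1 s) \<in> linf ?G" by (rule lin) (auto simp: f_def indicator_def)
  have d3: "(\<lambda>s. indicator ?G s - f 0 s - f 1 s - f 2 s) \<in> linf ?G" by (rule lin) (auto simp: f_def indicator_def)
  \<comment> \<open>Three of the five disjoint sets already have total weight 3/2 > 1.\<close>
  have "m (\<lambda>s. indicator ?G s - f 0 s - f 1 s - f 2 s) = 1 - 1/2 - 1/2 - 1/2"
    using neg[OF d2 f, of 2] neg[OF d f, of 1] neg[OF i f, of 0] one by (simp add: half)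
  moreover have "0 \<le> Re (m (\<lambda>s. indicator ?G s - f 0 s - f 1 s - f 2 s))"
    by (rule pos[OF d3]) (auto simp: f_def)
  ultimately show False by simp
qed


section \<open>The reduced algebra is not nuclear\<close>

context cliff
begin

text \<open>Right translation by the top group; it acts on every level and commutes with the regular
  representation. Its use is to turn matrix entries of an operator into a function of one group
  element.\<close>

definition rmul :: "nat list \<Rightarrow> nat oper" where
  "rmul h x = (\<lambda>v. if v \<in> S then x (mul v (en 0 (rev h))) else 0)"

lemma en0_S [simp]: "w \<in> Red \<Longrightarrow> en 0 w \<in> S"
  by (simp add: L0)

lemma mul_cancel:
  assumes "v \<in> S" "h \<in> Red"
  shows "mul (mul v (en 0 h)) (en 0 (rev h)) = v" "mul (mul v (en 0 (rev h))) (en 0 h) = v"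
  using assms L0 by (auto elim!: S_cases simp: mul_en wmul_assoc)

lemma rmul_ell2:
  assumes "x \<in> ell2 S" "h \<in> Red"
  shows "rmul h x \<in> ell2 S"
proof -
  have "(\<lambda>v. (cmod (rmul h x v))\<^sup>2) summable_on S \<longleftrightarrow> (\<lambda>v. (cmod (x v))\<^sup>2) summable_on S"
    by (rule summable_on_reindex_bij_witness[of _ "\<lambda>v. mul v (en 0 h)" "\<lambda>v. mul v (en 0 (rev h))"])
      (use assms in \<open>simp_all add: mul_cancel rmul_def\<close>)
  then show ?thesis using assms(1) by (simp add: ell2_def rmul_def)
qed

lemma rmul_adjoint:
  assumes "h \<in> Red"
  shows "ell2_inner S (rmul h x) y = ell2_inner S x (rmul (rev h) y)"
  unfolding ell2_inner_def
  by (rule infsum_reindex_bij_witness[of _ "\<lambda>v. mul v (en 0 h)" "\<lambda>v. mul v (en 0 (rev h))"])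
    (use assms in \<open>simp_all add: mul_cancel rmul_def\<close>)

lemma ppop_rmul:
  assumes "s \<in> S" "x \<in> ell2 S" "h \<in> Red"
  shows "ppop s (rmul h x) = rmul h (ppop s x)"
proof
  fix v
  show "ppop s (rmul h x) v = rmul h (ppop s x) v"
  proof (cases "v \<in> S")
    case True
    obtain n u where s: "n \<in> L" "u \<in> Red" "s = en n u" using assms(1) by (rule S_cases)
    obtain m w where v: "m \<in> L" "w \<in> Red" "v = en m w" using True by (rule S_cases)
    have "\<beta> s (mul v (en 0 (rev h))) = map_option (\<lambda>u. mul u (en 0 (rev h))) (\<beta> s v)"
      using s v assms(3) L0 by (simp add: mul_en \<beta>_en wmul_assoc)
    then show ?thesis using True assms rmul_ell2[OF assms(2,3)] \<beta>_in[OF assms(1) True]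
      by (cases "\<beta> s v") (simp_all add: ppop_def pv_def rmul_def)
  qed (simp add: ppop_def rmul_def)
qed

lemma rmul_delta:
  assumes "u \<in> S" "h \<in> Red"
  shows "rmul h (delta u) = delta (mul u (en 0 h))"
  using assms mul_cancel[OF _ assms(2)] by (fastforce simp: rmul_def delta_def fun_eq_iff)

text \<open>The commutant of the right translations. As a C*-algebra containing the generators it
  contains \<open>reduced_cstar\<close>, which is only given as an intersection and whose elements
  are otherwise unknown.\<close>

definition comm_alg :: "nat oper set" where
  "comm_alg = {T \<in> bop S. \<forall>h\<in>Red. \<forall>x\<in>ell2 S. T (rmul h x) = rmul h (T x)}"

lemma op_lim_coord:
  assumes "\<And>n. F n \<in> bop S" "T \<in> bop S" "(\<lambda>n. op_norm S (op_diff (F n) T)) \<longlonglongrightarrow> 0" "x \<in> ell2 S"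
  shows "(\<lambda>n. F n x v) \<longlonglongrightarrow> T x v"
proof (rule LIM_zero_cancel, rule Lim_null_comparison)
  show "(\<lambda>n. op_norm S (op_diff (F n) T) * ell2_norm S x) \<longlonglongrightarrow> 0"
    using tendsto_mult_right[OF assms(3), of "ell2_norm S x"] by simp
  have "norm (F n x v - T x v) \<le> op_norm S (op_diff (F n) T) * ell2_norm S x" for n
  proof -
    have d: "op_diff (F n) T \<in> bop S" by (rule bop_op_diff(1)[OF assms(1,2)])
    have "norm (op_diff (F n) T x v) \<le> ell2_norm S (op_diff (F n) T x)"
      by (rule ell2_coord_le[OF bop_ell2[OF d assms(4)]])
    also have "\<dots> \<le> op_norm S (op_diff (F n) T) * ell2_norm S x" by (rule op_norm_bound[OF d assms(4)])
    finally show ?thesis by (simp add: op_diff_def)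
  qed
  then show "\<forall>\<^sub>F n in sequentially. norm (F n x v - T x v) \<le> op_norm S (op_diff (F n) T) * ell2_norm S x"
    by simp
qed

lemma comm_alg_cstar: "cstar_subalgebra S comm_alg"
  unfolding cstar_subalgebra_def
proof (intro conjI ballI allI impI)
  show "comm_alg \<subseteq> bop S" by (auto simp: comm_alg_def)
  show "(\<lambda>x i. 0) \<in> comm_alg" by (simp add: comm_alg_def bop_zero_op rmul_def)
  fix T assume T: "T \<in> comm_alg"
  then have Tb: "T \<in> bop S" and Tc: "\<And>h x. h \<in> Red \<Longrightarrow> x \<in> ell2 S \<Longrightarrow> T (rmul h x) = rmul h (T x)"
    by (auto simp: comm_alg_def)
  show "op_scale c T \<in> comm_alg" for c
  proof -
    have "op_scale c T (rmul h x) = rmul h (op_scale c T x)" if "h \<in> Red" "x \<in> ell2 S" for h x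
      unfolding op_scale_def Tc[OF that] by (simp add: rmul_def fun_eq_iff)
    then show ?thesis using bop_op_scale(1)[OF Tb] by (simp add: comm_alg_def)
  qed
  fix U assume U: "U \<in> comm_alg"
  then have Ub: "U \<in> bop S" and Uc: "\<And>h x. h \<in> Red \<Longrightarrow> x \<in> ell2 S \<Longrightarrow> U (rmul h x) = rmul h (U x)"
    by (auto simp: comm_alg_def)
  show "op_add T U \<in> comm_alg"
  proof -
    have "op_add T U (rmul h x) = rmul h (op_add T U x)" if "h \<in> Red" "x \<in> ell2 S" for h x
      unfolding op_add_def Tc[OF that] Uc[OF that] by (simp add: rmul_def fun_eq_iff)
    then show ?thesis using bop_op_add(1)[OF Tb Ub] by (simp add: comm_alg_def)
  qed
  show "T \<circ> U \<in> comm_alg"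
    using bop_comp[OF Tb Ub] by (auto simp: comm_alg_def Tc Uc bop_ell2[OF Ub])
next
  fix T T' assume T: "T \<in> comm_alg" and T': "T' \<in> bop S" and adj: "is_adjoint S T T'"
  have Tb: "T \<in> bop S" and Tc: "\<And>h x. h \<in> Red \<Longrightarrow> x \<in> ell2 S \<Longrightarrow> T (rmul h x) = rmul h (T x)"
    using T by (auto simp: comm_alg_def)
  have ad: "ell2_inner S (T x) y = ell2_inner S x (T' y)" if "x \<in> ell2 S" "y \<in> ell2 S" for x y
    using adj that by (simp add: is_adjoint_def)
  have "T' (rmul h x) v = rmul h (T' x) v" if h: "h \<in> Red" and x: "x \<in> ell2 S" for h x v
  proof (cases "v \<in> S")
    case True
    have hx: "rmul h x \<in> ell2 S" and hd: "rmul (rev h) (delta v) \<in> ell2 S"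
      using rmul_ell2 h x True by simp_all
    have "ell2_inner S (delta v) (T' (rmul h x)) = ell2_inner S (T (delta v)) (rmul h x)"
      using ad[OF delta_ell2[OF True] hx] by simp
    also have "\<dots> = ell2_inner S (rmul (rev h) (T (delta v))) x"
      using rmul_adjoint[of "rev h" "T (delta v)" x] h by simp
    also have "\<dots> = ell2_inner S (T (rmul (rev h) (delta v))) x"
      using Tc[of "rev h" "delta v"] h True by simp
    also have "\<dots> = ell2_inner S (rmul (rev h) (delta v)) (T' x)" by (rule ad[OF hd x])
    also have "\<dots> = ell2_inner S (delta v) (rmul h (T' x))"
      using rmul_adjoint[of "rev h" "delta v" "T' x"] h by simp
    finally show ?thesis using True by (simp add: ell2_inner_delta)
  next
    case False
    then show ?thesis using ell2_zero_off[OF bop_ell2[OF T' rmul_ell2[OF x h]]] by (simp add: rmul_def)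
  qed
  then show "T' \<in> comm_alg" using T' by (auto simp: comm_alg_def)
next
  fix F T assume T: "T \<in> bop S" and F: "\<forall>n. F n \<in> comm_alg"
    and lim: "(\<lambda>n::nat. op_norm S (op_diff (F n) T)) \<longlonglongrightarrow> 0"
  have Fb: "F n \<in> bop S" for n using F by (simp add: comm_alg_def)
  have "T (rmul h x) v = rmul h (T x) v" if h: "h \<in> Red" and x: "x \<in> ell2 S" for h x v
  proof (rule LIMSEQ_unique)
    show "(\<lambda>n. F n (rmul h x) v) \<longlonglongrightarrow> T (rmul h x) v"
      by (rule op_lim_coord[OF Fb T lim rmul_ell2[OF x h]])
    have "F n (rmul h x) v = rmul h (F n x) v" for n using F h x by (simp add: comm_alg_def)
    moreover have "(\<lambda>n. rmul h (F n x) v) \<longlonglongrightarrow> rmul h (T x) v"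
      unfolding rmul_def using op_lim_coord[OF Fb T lim x] by (cases "v \<in> S") simp_all
    ultimately show "(\<lambda>n. F n (rmul h x) v) \<longlonglongrightarrow> rmul h (T x) v" by simp
  qed
  then show "T \<in> comm_alg" using T by (auto simp: comm_alg_def)
qed

lemma lreg_reduced: "s \<in> S \<Longrightarrow> ppop s \<in> reduced_cstar S mul"
  unfolding reduced_cstar_def cstar_generated_def using lreg_eq by (auto simp: image_subset_iff)

lemma reduced_comm: "reduced_cstar S mul \<subseteq> comm_alg"
proof -
  have "lreg S mul ` S \<subseteq> comm_alg"
    using lreg_eq ppop_bop ppop_rmul by (auto simp: comm_alg_def)
  then show ?thesis unfolding reduced_cstar_def cstar_generated_def using comm_alg_cstar by blast
qed

abbreviation U :: "nat list \<Rightarrow> nat oper" where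
  "U g \<equiv> ppop (en 0 g)"

lemma U_norm: "g \<in> Red \<Longrightarrow> op_norm S (U g) \<le> 1"
  by (rule op_norm_le) (simp_all add: ppop_ell2)

lemma U_mul: "g \<in> Red \<Longrightarrow> h \<in> Red \<Longrightarrow> U (wmul g h) x = U g (U h x)"
  using ppop_mul[of "en 0 g" "en 0 h" x] by (simp add: mul_en L0)

lemma U_adj: "g \<in> Red \<Longrightarrow> x \<in> ell2 S \<Longrightarrow> y \<in> ell2 S \<Longrightarrow> ell2_inner S (U g x) y = ell2_inner S x (U (rev g) y)"
  using ppop_adjoint[of "en 0 g" x y] by (simp add: star_en L0)

lemma U_delta: "g \<in> Red \<Longrightarrow> h \<in> Red \<Longrightarrow> U g (delta (en 0 h)) = delta (en 0 (wmul g h))"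
proof
  fix v assume g: "g \<in> Red" and h: "h \<in> Red"
  show "U g (delta (en 0 h)) v = delta (en 0 (wmul g h)) v"
  proof (cases "v \<in> S")
    case True
    obtain m w where v: "m \<in> L" "w \<in> Red" "v = en m w" using True by (rule S_cases)
    have "en m (wmul (rev g) w) = en 0 h \<longleftrightarrow> en m w = en 0 (wmul g h)"
    proof (cases "m = 0")
      case True
      have "wmul (rev g) w = h \<longleftrightarrow> w = wmul g h"
        using wmul_rev_left[OF g h] wmul_rev_left2[OF g v(2)] by auto
      then show ?thesis using True g h v by (simp add: en_eq rp0)
    qed (simp add: en_eq)
    moreover have "U g (delta (en 0 h)) v = delta (en 0 h) (en m (wmul (rev g) w))"
      using True g h v L0 by (simp add: ppop_def pv_def \<beta>_en)
    ultimately show ?thesis using v by (simp add: delta_def)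
  next
    case False
    then have "v \<noteq> en 0 (wmul g h)" using g h by auto
    then show ?thesis using False by (simp add: ppop_def delta_def)
  qed
qed

text \<open>The quadratic form is the squared norm of the sum of the vectors
  \<open>U (gs i) (x i)\<close>.\<close>

lemma pos_matrix_U:
  assumes gs: "\<And>i. i < m \<Longrightarrow> gs i \<in> Red"
  shows "pos_matrix S m (\<lambda>i j. U (wmul (rev (gs i)) (gs j)))"
  unfolding pos_matrix_def
proof (intro allI impI)
  fix x assume x: "\<forall>i<m. x i \<in> ell2 S"
  define y where "y i = U (gs i) (x i)" for i
  have y: "y i \<in> ell2 S" if "i < m" for i
    unfolding y_def by (rule ppop_ell2(1)) (use that gs x in auto)
  let ?z = "\<lambda>v. \<Sum>i<m. y i v"
  have "(\<Sum>i<m. \<Sum>j<m. ell2_inner S (U (wmul (rev (gs i)) (gs j)) (x j)) (x i)) = (\<Sum>i<m. \<Sum>j<m. ell2_inner S (y j) (y i))"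
  proof (intro sum.cong refl)
    fix i j assume ij: "i \<in> {..<m}" "j \<in> {..<m}"
    then have "ell2_inner S (U (wmul (rev (gs i)) (gs j)) (x j)) (x i) = ell2_inner S (U (rev (gs i)) (y j)) (x i)"
      by (simp add: U_mul gs y_def)
    also have "\<dots> = ell2_inner S (y j) (y i)"
      using U_adj[of "rev (gs i)" "y j" "x i"] ij gs y x by (simp add: y_def[of i])
    finally show "ell2_inner S (U (wmul (rev (gs i)) (gs j)) (x j)) (x i) = ell2_inner S (y j) (y i)" .
  qed
  also have "\<dots> = (\<Sum>j<m. \<Sum>i<m. ell2_inner S (y j) (y i))" by (rule sum.swap)
  also have "\<dots> = (\<Sum>j<m. ell2_inner S (y j) ?z)"
    by (intro sum.cong refl ell2_inner_sum_right[symmetric]) (use y in auto)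
  also have "\<dots> = ell2_inner S ?z ?z"
    by (rule ell2_inner_sum_left[symmetric]) (use y ell2_sum(1)[of "{..<m}" y S] in auto)
  also have "\<dots> = of_real ((ell2_norm S ?z)\<^sup>2)"
    by (rule ell2_inner_self) (use y ell2_sum(1)[of "{..<m}" y S] in auto)
  finally show "let q = \<Sum>i<m. \<Sum>j<m. ell2_inner S (U (wmul (rev (gs i)) (gs j)) (x j)) (x i) in q \<in> \<real> \<and> 0 \<le> Re q"
    by (simp add: Let_def del: of_real_power)
qed

lemma row_bound:
  assumes T: "T \<in> bop S" and F: "finite F" "F \<subseteq> S"
  shows "L2_set (\<lambda>u. cmod (T (delta u) e)) F \<le> op_norm S T"
proof -
  let ?x = "\<lambda>v. \<Sum>u\<in>F. cnj (T (delta u) e) * delta u v"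
  let ?Q = "\<Sum>u\<in>F. (cmod (T (delta u) e))\<^sup>2"
  have e: "(\<lambda>v. cnj (T (delta u) e) * delta u v) \<in> ell2 S" if "u \<in> F" for u
    by (rule ell2_scale(1)) (use that F in auto)
  have x: "?x \<in> ell2 S" by (rule ell2_sum(1)[OF e])
  have xv: "?x v = (if v \<in> F then cnj (T (delta v) e) else 0)" for v
    using F(1) by (simp add: delta_def if_distrib cong: if_cong)
  have "(ell2_norm S ?x)\<^sup>2 = ?Q"
    using ell2_finite(2)[OF F, of ?x] by (simp add: xv)
  from real_sqrt_unique[OF this ell2_norm_nonneg]
  have nx: "ell2_norm S ?x = L2_set (\<lambda>u. cmod (T (delta u) e)) F" by (simp only: L2_set_def)
  have "T ?x = (\<lambda>v. \<Sum>u\<in>F. T (\<lambda>v. cnj (T (delta u) e) * delta u v) v)" by (rule bop_sum[OF T e])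
  also have "\<dots> = (\<lambda>v. \<Sum>u\<in>F. cnj (T (delta u) e) * T (delta u) v)"
    by (intro ext sum.cong refl) (use F in \<open>simp add: bop_scale[OF T] subset_iff\<close>)
  finally have "T ?x e = (\<Sum>u\<in>F. cnj (T (delta u) e) * T (delta u) e)" by (rule fun_cong)
  also have "\<dots> = of_real ?Q"
    unfolding of_real_sum by (rule sum.cong[OF refl]) (simp only: complex_norm_square mult.commute)
  finally have "cmod (T ?x e) = \<bar>?Q\<bar>" by (simp only: norm_of_real)
  then have "?Q = cmod (T ?x e)" by (simp add: sum_nonneg)
  also have "\<dots> \<le> op_norm S T * ell2_norm S ?x"
    using ell2_coord_le[OF bop_ell2[OF T x], of e] op_norm_bound[OF T x] by linarith
  finally have "(L2_set (\<lambda>u. cmod (T (delta u) e)) F)\<^sup>2 \<le> op_norm S T * L2_set (\<lambda>u. cmod (T (delta u) e)) F"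
    unfolding nx by (simp add: L2_set_def sum_nonneg)
  then have *: "L2_set (\<lambda>u. cmod (T (delta u) e)) F * L2_set (\<lambda>u. cmod (T (delta u) e)) F
      \<le> op_norm S T * L2_set (\<lambda>u. cmod (T (delta u) e)) F" by (simp only: power2_eq_square)
  show ?thesis
  proof (cases "L2_set (\<lambda>u. cmod (T (delta u) e)) F = 0")
    case False
    then have "0 < L2_set (\<lambda>u. cmod (T (delta u) e)) F"
      using L2_set_nonneg[of "\<lambda>u. cmod (T (delta u) e)" F] by linarith
    then show ?thesis by (rule mult_right_le_imp_le[OF *])
  qed (use T in simp)
qed

end


section \<open>Unreduced words and the number of walks with a given endpoint\<close>

definition wprod :: "nat list \<Rightarrow> nat list" where
  "wprod l = foldr push l []"

definition Lam :: "nat \<Rightarrow> nat list set" where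
  "Lam n = {l. set l \<subseteq> {..<5} \<and> length l = n}"

lemma finite_Lam [simp]: "finite (Lam n)"
  unfolding Lam_def by (rule finite_lists_length_eq) simp

lemma wprod_Red [simp]: "l \<in> Lam n \<Longrightarrow> wprod l \<in> Red"
  by (simp add: wprod_def Lam_def foldr_push_Red)

lemma Lam_0 [simp]: "Lam 0 = {[]}"
  by (auto simp: Lam_def)

lemma Lam_Suc: "bij_betw (\<lambda>(k, l). k # l) ({..<5} \<times> Lam n) (Lam (Suc n))"
  by (rule bij_betw_byWitness[where f' = "\<lambda>l. (hd l, tl l)"])
    (auto simp: Lam_def length_Suc_conv)

lemma sum_Lam_Suc: "(\<Sum>l\<in>Lam (Suc n). f l) = (\<Sum>k<5. \<Sum>l\<in>Lam n. f (k # l))"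
  by (subst sum.reindex_bij_betw[OF Lam_Suc, symmetric]) (simp add: sum.cartesian_product case_prod_unfold)

lemma Lam_append: "bij_betw (\<lambda>(l, l'). rev l @ l') (Lam n \<times> Lam n) (Lam (2 * n))"
proof (rule bij_betw_byWitness[where f' = "\<lambda>l. (rev (take n l), drop n l)"])
  show "\<forall>a\<in>Lam n \<times> Lam n. (rev (take n (case a of (l, l') \<Rightarrow> rev l @ l')), drop n (case a of (l, l') \<Rightarrow> rev l @ l')) = a"
    by (auto simp: Lam_def)
  show "(\<lambda>(l, l'). rev l @ l') ` (Lam n \<times> Lam n) \<subseteq> Lam (2 * n)"
    by (auto simp: Lam_def)
  show "(\<lambda>l. (rev (take n l), drop n l)) ` Lam (2 * n) \<subseteq> Lam n \<times> Lam n"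
    using set_take_subset set_drop_subset by (fastforce simp: Lam_def)
qed auto

lemma Lam_rev: "bij_betw rev (Lam n) (Lam n)"
  by (rule bij_betw_byWitness[where f' = rev]) (auto simp: Lam_def)

lemma wprod_append: "l \<in> Lam n \<Longrightarrow> l' \<in> Lam n' \<Longrightarrow> wprod (l @ l') = wmul (wprod l) (wprod l')"
  using foldr_push_assoc[of l "[]" "wprod l'"] by (simp add: wprod_def wmul_def Lam_def foldr_push_Red)

lemma wprod_rev: "l \<in> Lam n \<Longrightarrow> wprod (rev l) = rev (wprod l)"
proof -
  assume l: "l \<in> Lam n"
  then have r: "rev l \<in> Lam n" by (simp add: Lam_def)
  have "wmul (wprod (rev l)) (wprod l) = []"
    using foldr_push_rev[of l "[]"] foldr_push_assoc[of "rev l" "[]" "wprod l"] l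
    by (simp add: wprod_def wmul_def Lam_def foldr_push_Red)
  then have "wmul (wmul (wprod (rev l)) (wprod l)) (rev (wprod l)) = rev (wprod l)" by simp
  then show ?thesis using l r by (simp add: wmul_assoc)
qed

definition walks :: "nat \<Rightarrow> nat list \<Rightarrow> nat" where
  "walks n g = card {l \<in> Lam n. wprod l = g}"

lemma walks_Suc:
  assumes g: "g \<in> Red"
  shows "walks (Suc n) g = (\<Sum>k<5. walks n (push k g))"
proof -
  have "real (walks (Suc n) g) = (\<Sum>l\<in>Lam (Suc n). if wprod l = g then 1 else 0)"
    unfolding walks_def by (subst sum.If_cases) (auto simp: Int_def)
  also have "\<dots> = (\<Sum>k<5. \<Sum>l\<in>Lam n. if wprod l = push k g then 1 else 0)"
    unfolding sum_Lam_Suc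
  proof (intro sum.cong refl if_cong)
    fix k l assume "k \<in> {..<5::nat}" "l \<in> Lam n"
    then show "(wprod (k # l) = g) = (wprod l = push k g)"
      using push_push[OF g, of k] push_push[OF wprod_Red[of l n], of k] by (auto simp: wprod_def)
  qed
  also have "\<dots> = (\<Sum>k<5. real (walks n (push k g)))"
    unfolding walks_def by (intro sum.cong refl, subst sum.If_cases) (auto simp: Int_def)
  finally show ?thesis by (simp only: of_nat_sum[symmetric] of_nat_eq_iff)
qed

text \<open>The counts arise from the unit mass at the identity by applying the sum of the
  generators n times, so \<open>Kesten_bound\<close> can be iterated. The induction varies
  \<open>F\<close>, since each step passes to its neighbourhood.\<close>

lemma walks_bound:
  assumes "finite F" "F \<subseteq> Red"
  shows "(\<Sum>g\<in>F. (real (walks n g))\<^sup>2) \<le> 16 ^ n"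
  using assms
proof (induction n arbitrary: F)
  case 0
  have "walks 0 g = (if g = [] then 1 else 0)" for g
    by (auto simp: walks_def wprod_def Collect_conv_if)
  then have "(\<Sum>g\<in>F. (real (walks 0 g))\<^sup>2) = (\<Sum>g\<in>F. if g = [] then 1 else 0)" by (auto intro: sum.cong)
  also have "\<dots> \<le> 1" using 0(1) by simp
  finally show ?case by simp
next
  case (Suc n)
  have "(\<Sum>g\<in>F. (real (walks (Suc n) g))\<^sup>2) = (\<Sum>b\<in>F. (cmod (\<Sum>k<5. of_nat (walks n (push k b))))\<^sup>2)"
    by (rule sum.cong) (use Suc.prems in \<open>auto simp: walks_Suc norm_of_nat simp flip: of_nat_sum\<close>)
  also have "\<dots> \<le> 16 * (\<Sum>c\<in>(\<Union>k<5. push k ` F). (cmod (of_nat (walks n c)))\<^sup>2)"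
    by (rule Kesten_bound[OF Suc.prems])
  also have "\<dots> = 16 * (\<Sum>c\<in>(\<Union>k<5. push k ` F). (real (walks n c))\<^sup>2)" by (simp add: norm_of_nat)
  also have "\<dots> \<le> 16 * 16 ^ n"
    by (intro mult_left_mono Suc.IH) (use Suc.prems push_Red in auto)
  finally show ?case by simp
qed

text \<open>A positive definite function close to \<open>1\<close> on the generators is not square summable:
  its values summed over walks of length \<open>2^k\<close> grow by Cauchy-Schwarz at rate close to \<open>5\<close>,
  while the \<open>\<ell>\<^sup>2\<close> norm of the walk count only grows at rate \<open>4\<close>.\<close>

lemma no_pd_function:
  fixes \<omega> :: "nat list \<Rightarrow> complex"
  assumes pd: "\<And>m gs (c :: nat \<Rightarrow> real). (\<And>i. i < m \<Longrightarrow> gs i \<in> Red) \<Longrightarrow>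
      (\<Sum>i<m. \<Sum>j<m. of_real (c i * c j) * \<omega> (wmul (rev (gs i)) (gs j))) \<in> \<real> \<and>
      0 \<le> Re (\<Sum>i<m. \<Sum>j<m. of_real (c i * c j) * \<omega> (wmul (rev (gs i)) (gs j)))"
    and l2: "\<And>n. cmod (\<Sum>l\<in>Lam n. \<omega> (wprod l)) \<le> C * 4 ^ n"
    and one: "cmod (\<omega> [] - 1) \<le> 1 / 20" and gen: "\<And>k. k < 5 \<Longrightarrow> cmod (\<omega> [k] - 1) \<le> 1 / 20"
  shows False
proof -
  define W where "W n = (\<Sum>l\<in>Lam n. \<omega> (wprod l))" for n
  \<comment> \<open>Positive definiteness for the family of all words of length n with weight 1,
    together with the identity with weight z.\<close>
  have quad: "of_real (z\<^sup>2) * \<omega> [] + of_real (2 * z) * W n + W (2 * n) \<in> \<real> \<and>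
      0 \<le> Re (of_real (z\<^sup>2) * \<omega> [] + of_real (2 * z) * W n + W (2 * n))" for z :: real and n
  proof -
    define N where "N = card (Lam n)"
    obtain f where f: "bij_betw f {..<N} (Lam n)"
      using ex_bij_betw_nat_finite[of "Lam n"] by (auto simp: N_def atLeast0LessThan)
    define gs where "gs i = (if i < N then wprod (f i) else [])" for i
    define c where "c i = (if i < N then 1 else z)" for i :: nat
    have fL: "f i \<in> Lam n" if "i < N" for i using f that by (auto simp: bij_betw_def)
    have gR: "gs i \<in> Red" for i using fL by (simp add: gs_def wprod_Red[of _ n])
    have sf: "(\<Sum>i<N. h (f i)) = (\<Sum>l\<in>Lam n. h l)" for h :: "nat list \<Rightarrow> complex"
      by (rule sum.reindex_bij_betw[OF f])
    let ?t = "\<lambda>i j. complex_of_real (c i * c j) * \<omega> (wmul (rev (gs i)) (gs j))"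
    have A: "(\<Sum>i<N. ?t i N) = of_real z * W n"
    proof -
      have "(\<Sum>i<N. ?t i N) = (\<Sum>i<N. of_real z * \<omega> (wprod (rev (f i))))"
        by (rule sum.cong) (simp_all add: c_def gs_def wprod_rev[OF fL] wprod_Red[OF fL])
      also have "\<dots> = (\<Sum>l\<in>Lam n. of_real z * \<omega> (wprod (rev l)))" by (rule sf)
      also have "\<dots> = of_real z * W n"
        unfolding W_def sum_distrib_left by (rule sum.reindex_bij_betw[OF Lam_rev])
      finally show ?thesis .
    qed
    have B: "(\<Sum>j<N. ?t N j) = of_real z * W n"
    proof -
      have "(\<Sum>j<N. ?t N j) = (\<Sum>i<N. of_real z * \<omega> (wprod (f i)))"
        by (rule sum.cong) (simp_all add: c_def gs_def)
      then show ?thesis unfolding W_def sum_distrib_left sf[of "\<lambda>l. of_real z * \<omega> (wprod l)"] .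
    qed
    have D: "(\<Sum>i<N. \<Sum>j<N. ?t i j) = W (2 * n)"
    proof -
      have "(\<Sum>i<N. \<Sum>j<N. ?t i j) = (\<Sum>i<N. \<Sum>j<N. \<omega> (wprod (rev (f i) @ f j)))"
      proof (intro sum.cong refl)
        fix i j assume ij: "i \<in> {..<N}" "j \<in> {..<N}"
        then have "rev (f i) \<in> Lam n" using fL[of i] by (simp add: Lam_def)
        then have "wprod (rev (f i) @ f j) = wmul (rev (wprod (f i))) (wprod (f j))"
          using wprod_append[of "rev (f i)" n "f j" n] wprod_rev[OF fL, of i] fL ij by simp
        then show "?t i j = \<omega> (wprod (rev (f i) @ f j))" using ij by (simp add: c_def gs_def)
      qed
      also have "\<dots> = (\<Sum>i<N. \<Sum>l\<in>Lam n. \<omega> (wprod (rev (f i) @ l)))"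
        by (intro sum.cong refl sf)
      also have "\<dots> = (\<Sum>l'\<in>Lam n. \<Sum>l\<in>Lam n. \<omega> (wprod (rev l' @ l)))"
        by (rule sf[of "\<lambda>l'. \<Sum>l\<in>Lam n. \<omega> (wprod (rev l' @ l))"])
      also have "\<dots> = (\<Sum>p\<in>Lam n \<times> Lam n. \<omega> (wprod (case p of (l', l) \<Rightarrow> rev l' @ l)))"
        by (simp add: sum.cartesian_product case_prod_unfold)
      also have "\<dots> = W (2 * n)" unfolding W_def by (rule sum.reindex_bij_betw[OF Lam_append])
      finally show ?thesis .
    qed
    have E: "?t N N = of_real (z\<^sup>2) * \<omega> []" by (simp add: c_def gs_def power2_eq_square)
    have "(\<Sum>i<Suc N. \<Sum>j<Suc N. ?t i j) = of_real (z\<^sup>2) * \<omega> [] + of_real (2 * z) * W n + W (2 * n)"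
      unfolding sum.lessThan_Suc sum.distrib A B D E by simp
    then show ?thesis using pd[of "Suc N" gs c] gR by simp
  qed
  \<comment> \<open>The choices z = 0 and z = 1 isolate the terms of the quadratic form.\<close>
  have real: "W n \<in> \<real>" "\<omega> [] \<in> \<real>" "W (2 * n) \<in> \<real>" for n
  proof -
    have 0: "W (2 * n) \<in> \<real>" for n using quad[of 0 n] by simp
    have W0: "W 0 = \<omega> []" by (simp add: W_def wprod_def)
    show "W (2 * n) \<in> \<real>" "\<omega> [] \<in> \<real>" using 0[of n] 0[of 0] W0 by simp_all
    have "of_real 2 * W n = (of_real (1\<^sup>2) * \<omega> [] + of_real (2 * 1) * W n + W (2 * n)) - \<omega> [] - W (2 * n)" by simp
    also have "\<dots> \<in> \<real>" using quad[of 1 n] 0[of n] 0[of 0] W0 by (intro Reals_diff) auto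
    finally have "of_real 2 * W n \<in> \<real>" .
    then have h: "(1 / 2) * (of_real 2 * W n) \<in> \<real>" by (rule Reals_mult[rotated]) auto
    have "W n = (1 / 2) * (of_real 2 * W n)" by simp
    then show "W n \<in> \<real>" using h by (rule ssubst[where P = "\<lambda>w. w \<in> \<real>"])
  qed
  define w where "w n = Re (W n)" for n
  define b where "b = Re (\<omega> [])"
  have b: "19 / 20 \<le> b" "b \<le> 21 / 20"
    using one abs_Re_le_cmod[of "\<omega> [] - 1"] by (auto simp: b_def abs_le_iff)
  have cs: "(w n)\<^sup>2 \<le> b * w (2 * n)" for n
  proof -
    \<comment> \<open>The minimizer z = - w n / b of the quadratic form.\<close>
    have "0 \<le> (- w n / b)\<^sup>2 * b + 2 * (- w n / b) * w n + w (2 * n)"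
      using quad[of "- w n / b" n] by (simp add: w_def b_def)
    also have "\<dots> = w (2 * n) - (w n)\<^sup>2 / b" using b by (simp add: power2_eq_square field_simps)
    finally show ?thesis using b by (simp add: field_simps)
  qed
  have w1: "19 / 4 \<le> w 1"
  proof -
    have "W 1 = (\<Sum>k<5. \<omega> [k])"
      using sum_Lam_Suc[of "\<lambda>l. \<omega> (wprod l)" 0] by (simp add: W_def wprod_def push_simps)
    then have "w 1 = (\<Sum>k<5. Re (\<omega> [k]))" by (simp add: w_def)
    also have "\<dots> \<ge> (\<Sum>k<5::nat. 19 / 20)"
    proof (rule sum_mono)
      fix k :: nat assume "k \<in> {..<5}"
      then show "19 / 20 \<le> Re (\<omega> [k])"
        using gen[of k] abs_Re_le_cmod[of "\<omega> [k] - 1"] by (auto simp: abs_le_iff)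
    qed
    finally show ?thesis by simp
  qed
  define r where "r = w 1 / b"
  \<comment> \<open>5 * 19/20 = 19/4 against 9/2 * 21/20 < 19/4: the tolerance 1/20 keeps the growth
    rate above 4.\<close>
  have r: "9 / 2 \<le> r"
  proof -
    have "9 / 2 * b \<le> w 1" using b w1 by linarith
    then show ?thesis using b by (simp add: r_def field_simps)
  qed
  have grow: "b * r ^ (2 ^ k) \<le> w (2 ^ k)" for k :: nat
  proof (induction k)
    case 0
    then show ?case using b by (simp add: r_def)
  next
    case (Suc k)
    have "b * (b * r ^ (2 ^ Suc k)) = (b * r ^ (2 ^ k))\<^sup>2" by (simp add: power2_eq_square power_add mult_2)
    also have "\<dots> \<le> (w (2 ^ k))\<^sup>2" using Suc b r by (intro power_mono) auto
    also have "\<dots> \<le> b * w (2 ^ Suc k)" using cs[of "2 ^ k"] by simp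
    finally show ?case using b by simp
  qed
  have up: "w n \<le> C * 4 ^ n" for n
    using l2[of n] complex_Re_le_cmod[of "W n"] by (simp add: w_def W_def)
  \<comment> \<open>9/8 is the quotient of the growth rates 9/2 and 4. Lowering the exponent
    \<open>2 ^ k\<close> to \<open>k\<close> leaves a plain geometric sequence.\<close>
  have "(9 / 8) ^ k \<le> C / b" for k :: nat
  proof -
    have "b * (9 / 2) ^ (2 ^ k) \<le> b * r ^ (2 ^ k)" using b r by (intro mult_left_mono power_mono) auto
    also have "\<dots> \<le> C * 4 ^ (2 ^ k)" using grow[of k] up[of "2 ^ k"] by linarith
    finally have "b * ((9 / 2) ^ (2 ^ k) / 4 ^ (2 ^ k)) \<le> C" by (simp add: field_simps)
    then have "b * (9 / 8) ^ (2 ^ k) \<le> C" by (simp add: power_divide[symmetric])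
    moreover have "(9 / 8 :: real) ^ k \<le> (9 / 8) ^ (2 ^ k)"
      by (rule power_increasing) (auto intro: less_imp_le less_exp)
    ultimately have "b * (9 / 8) ^ k \<le> C"
      using mult_left_mono[of "(9 / 8 :: real) ^ k" "(9 / 8) ^ (2 ^ k)" b] b by linarith
    moreover have "0 < b" using b by simp
    ultimately show ?thesis by (simp only: pos_le_divide_eq mult.commute)
  qed
  then show False using real_arch_pow[of "9 / 8" "C / b"] by (auto simp: not_le[symmetric])
qed


section \<open>Matrix units and maps out of a matrix algebra\<close>

definition unit_op :: "nat \<Rightarrow> nat \<Rightarrow> nat \<Rightarrow> nat oper" where
  "unit_op n i j x = (\<lambda>k. if x \<in> ell2 {..<n} \<and> k = i then x j else 0)"

lemma unit_op_bop:
  assumes "i < n" shows "unit_op n i j \<in> bop {..<n}"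
proof (rule bopI[where K = 1])
  fix x assume x: "x \<in> ell2 {..<n}"
  have fin: "unit_op n i j x k = 0" if "k \<notin> {i}" for k using that by (simp add: unit_op_def)
  show "unit_op n i j x \<in> ell2 {..<n}"
    by (rule ell2_finite(1)[of "{i}"]) (use assms fin in auto)
  have "(ell2_norm {..<n} (unit_op n i j x))\<^sup>2 = (cmod (x j))\<^sup>2"
    using ell2_finite(2)[of "{i}" "{..<n}" "unit_op n i j x"] assms fin x by (simp add: unit_op_def)
  also have "\<dots> \<le> (ell2_norm {..<n} x)\<^sup>2" by (intro power_mono ell2_coord_le x) simp
  finally show "ell2_norm {..<n} (unit_op n i j x) \<le> 1 * ell2_norm {..<n} x"
    using power2_le_imp_le[OF _ ell2_norm_nonneg] by simp
qed (simp_all add: unit_op_def fun_eq_iff ell2_add(1) ell2_scale(1))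

lemma matrix_expand:
  assumes T: "T \<in> bop {..<n}"
  shows "T = (\<lambda>x k. \<Sum>(i, j)\<in>{..<n} \<times> {..<n}. T (delta j) i * unit_op n i j x k)"
proof (intro ext)
  fix x k
  have eq: "(\<Sum>(i, j)\<in>{..<n} \<times> {..<n}. T (delta j) i * unit_op n i j x k)
     = (\<Sum>i<n. \<Sum>j<n. T (delta j) i * unit_op n i j x k)"
    by (rule sum.cartesian_product[symmetric])
  show "T x k = (\<Sum>(i, j)\<in>{..<n} \<times> {..<n}. T (delta j) i * unit_op n i j x k)"
  proof (cases "x \<in> ell2 {..<n}")
    case False
    then show ?thesis by (simp add: unit_op_def bop_off[OF T] case_prod_unfold)
  next
    case True
    have xe: "x = (\<lambda>v. \<Sum>j<n. x j * delta j v)"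
      using ell2_zero_off[OF True] by (auto simp: delta_def fun_eq_iff if_distrib cong: if_cong)
    have e: "(\<lambda>v. x j * delta j v) \<in> ell2 {..<n}" if "j \<in> {..<n}" for j
      by (rule ell2_scale(1)) (use that in simp)
    have "T x = T (\<lambda>v. \<Sum>j<n. x j * delta j v)" by (rule arg_cong[OF xe])
    also have "\<dots> = (\<lambda>v. \<Sum>j<n. T (\<lambda>v. x j * delta j v) v)" by (rule bop_sum[OF T e])
    also have "\<dots> = (\<lambda>v. \<Sum>j<n. x j * T (delta j) v)"
      by (intro ext sum.cong refl) (simp add: bop_scale[OF T])
    finally have Tx: "T x = (\<lambda>v. \<Sum>j<n. x j * T (delta j) v)" .
    show ?thesis
    proof (cases "k < n")
      case kn: True
      have "(\<Sum>i<n. \<Sum>j<n. T (delta j) i * unit_op n i j x k) = (\<Sum>i<n. if i = k then \<Sum>j<n. x j * T (delta j) k else 0)"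
        by (rule sum.cong) (use True in \<open>auto simp: unit_op_def mult.commute\<close>)
      then show ?thesis unfolding eq Tx using kn by simp
    next
      case False
      then have "T x k = 0" using ell2_zero_off[OF bop_ell2[OF T True]] by simp
      then show ?thesis unfolding eq using False by (simp add: unit_op_def)
    qed
  qed
qed

lemma cpc_sum:
  assumes \<psi>: "cpc_map I (bop I) J B \<psi>" and "finite K" "\<And>k. k \<in> K \<Longrightarrow> V k \<in> bop I"
  shows "(\<lambda>x i. \<Sum>k\<in>K. c k * V k x i) \<in> bop I \<and>
    \<psi> (\<lambda>x i. \<Sum>k\<in>K. c k * V k x i) = (\<lambda>x i. \<Sum>k\<in>K. c k * \<psi> (V k) x i)"
  using assms(2,3)
proof (induction K rule: finite_induct)
  case empty
  have "\<psi> (op_scale 0 (\<lambda>x i. 0)) = op_scale 0 (\<psi> (\<lambda>x i. 0))"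
    using \<psi> bop_zero_op(1)[of I] unfolding cpc_map_def by blast
  then show ?case using bop_zero_op(1)[of I] by (simp add: op_scale_def)
next
  case (insert a K)
  let ?V = "\<lambda>x i. \<Sum>k\<in>K. c k * V k x i"
  have b: "?V \<in> bop I" and IH: "\<psi> ?V = (\<lambda>x i. \<Sum>k\<in>K. c k * \<psi> (V k) x i)" using insert by auto
  have a: "V a \<in> bop I" "op_scale (c a) (V a) \<in> bop I" using insert bop_op_scale(1) by auto
  have eq: "(\<lambda>x i. \<Sum>k\<in>insert a K. c k * V k x i) = op_add (op_scale (c a) (V a)) ?V"
    using insert(1,2) by (simp add: op_add_def op_scale_def)
  have "\<psi> (op_add (op_scale (c a) (V a)) ?V) = op_add (\<psi> (op_scale (c a) (V a))) (\<psi> ?V)"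
    using \<psi> a b unfolding cpc_map_def by (elim conjE) blast
  also have "\<psi> (op_scale (c a) (V a)) = op_scale (c a) (\<psi> (V a))"
    using \<psi> a unfolding cpc_map_def by (elim conjE) blast
  finally show ?case unfolding eq using bop_op_add(1)[OF a(2) b] insert(1,2) IH
    by (simp add: op_add_def op_scale_def)
qed

context cliff
begin

text \<open>Group the words by their product and apply Cauchy-Schwarz to the walk counts, of l2 norm
  at most 4^m, and to a row of \<open>T\<close>, bounded by \<open>row_bound\<close>.\<close>

lemma walk_sum_bound:
  assumes T: "T \<in> bop S"
  shows "(\<Sum>l\<in>Lam m. cmod (T (delta (en 0 (rev (wprod l)))) e)) \<le> 4 ^ m * op_norm S T"
proof -
  let ?G = "wprod ` Lam m"
  define b where "b g = cmod (T (delta (en 0 (rev g))) e)" for g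
  have G: "finite ?G" "?G \<subseteq> Red" by (auto simp: wprod_Red)
  have "(\<Sum>l\<in>Lam m. b (wprod l)) = (\<Sum>g\<in>?G. \<Sum>l\<in>{l \<in> Lam m. wprod l = g}. b (wprod l))"
    by (rule sum.image_gen) simp
  also have "\<dots> = (\<Sum>g\<in>?G. \<bar>real (walks m g)\<bar> * \<bar>b g\<bar>)"
    by (rule sum.cong) (simp_all add: walks_def b_def)
  also have "\<dots> \<le> L2_set (\<lambda>g. real (walks m g)) ?G * L2_set b ?G" by (rule L2_set_mult_ineq)
  also have "\<dots> \<le> 4 ^ m * op_norm S T"
  proof (intro mult_mono)
    have "L2_set (\<lambda>g. real (walks m g)) ?G \<le> sqrt (16 ^ m)"
      unfolding L2_set_def by (rule real_sqrt_le_mono[OF walks_bound[OF G]])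
    also have "sqrt (16 ^ m) = 4 ^ m" by (simp add: real_sqrt_power)
    finally show "L2_set (\<lambda>g. real (walks m g)) ?G \<le> 4 ^ m" .
    have inj: "inj_on (\<lambda>g. en 0 (rev g)) ?G"
      using G by (auto simp: inj_on_def en_eq rp0 subset_iff)
    have "L2_set b ?G = L2_set (\<lambda>u. cmod (T (delta u) e)) ((\<lambda>g. en 0 (rev g)) ` ?G)"
      unfolding L2_set_def sum.reindex[OF inj] by (simp add: b_def)
    also have "\<dots> \<le> op_norm S T"
      by (rule row_bound[OF T]) (use G in auto)
    finally show "L2_set b ?G \<le> op_norm S T" .
  qed auto
  finally show ?thesis by (simp add: b_def)
qed

text \<open>A finite-dimensional completely positive factorization gives the positive definite function
  \<open>\<langle>\<psi>(\<phi>(u\<^sub>g)) \<delta>\<^sub>h, \<delta>\<^sub>1\<rangle>\<close>, \<open>h = g\<inverse>\<close>, positive because the range of \<open>\<psi>\<close> commutes with right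
  translations, and square summable because \<open>\<psi>\<close> has finite rank.\<close>

theorem not_nuclear: "\<not> nuclear S (reduced_cstar S mul)"
proof
  let ?A = "reduced_cstar S mul"
  assume nuc: "nuclear S ?A"
  have UA: "U g \<in> ?A" if "g \<in> Red" for g by (rule lreg_reduced) (simp add: that)
  \<comment> \<open>The identity and the generators are the only elements at which
    \<open>no_pd_function\<close> needs closeness; the tolerance 1/20 is taken from there.\<close>
  let ?F = "insert (U []) ((\<lambda>k. U [k]) ` {..<5})"
  have F: "finite ?F" "?F \<subseteq> ?A" using UA by auto
  from nuc[unfolded nuclear_def, rule_format, OF F, of "1 / 20"]
  obtain n \<phi> \<psi> where \<phi>: "cpc_map S ?A {..<n::nat} (bop {..<n}) \<phi>"
    and \<psi>: "cpc_map {..<n} (bop {..<n}) S ?A \<psi>"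
    and close: "\<forall>T\<in>?F. op_norm S (op_diff (\<psi> (\<phi> T)) T) < 1 / 20" by auto
  have \<phi>b: "\<phi> T \<in> bop {..<n}" if "T \<in> ?A" for T
    using \<phi> that unfolding cpc_map_def by blast
  have \<phi>n: "op_norm {..<n} (\<phi> T) \<le> op_norm S T" if "T \<in> ?A" for T
    using \<phi> that unfolding cpc_map_def by (elim conjE) blast
  have \<phi>p: "pos_matrix {..<n} m (\<lambda>i j. \<phi> (a i j))" if "\<forall>i<m. \<forall>j<m. a i j \<in> ?A" "pos_matrix S m a" for m a
    using \<phi> that unfolding cpc_map_def by (elim conjE) blast
  have \<psi>A: "\<psi> T \<in> ?A" if "T \<in> bop {..<n}" for T
    using \<psi> that unfolding cpc_map_def by blast
  have \<psi>p: "pos_matrix S m (\<lambda>i j. \<psi> (a i j))" if "\<forall>i<m. \<forall>j<m. a i j \<in> bop {..<n}" "pos_matrix {..<n} m a" for m a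
    using \<psi> that unfolding cpc_map_def by (elim conjE) blast
  define \<Psi> where "\<Psi> g = \<psi> (\<phi> (U g))" for g
  have \<Psi>A: "\<Psi> g \<in> ?A" if "g \<in> Red" for g unfolding \<Psi>_def by (intro \<psi>A \<phi>b UA that)
  have \<Psi>b: "\<Psi> g \<in> bop S" if "g \<in> Red" for g
    using \<Psi>A[OF that] reduced_comm by (auto simp: comm_alg_def)
  have \<Psi>c: "\<Psi> g (rmul h x) = rmul h (\<Psi> g x)" if "g \<in> Red" "h \<in> Red" "x \<in> ell2 S" for g h x
    using \<Psi>A[OF that(1)] reduced_comm that(2,3) by (auto simp: comm_alg_def)
  define \<omega> where "\<omega> g = \<Psi> g (delta (en 0 (rev g))) (en 0 [])" for g
  show False
  proof (rule no_pd_function[of \<omega> "\<Sum>(i, j)\<in>{..<n} \<times> {..<n}. op_norm S (\<psi> (unit_op n i j))"])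
    fix m :: nat and gs :: "nat \<Rightarrow> nat list" and c :: "nat \<Rightarrow> real"
    assume gs: "\<And>i. i < m \<Longrightarrow> gs i \<in> Red"
    let ?g = "\<lambda>i j. wmul (rev (gs i)) (gs j)"
    let ?x = "\<lambda>i v. complex_of_real (c i) * delta (en 0 (rev (gs i))) v"
    have gR: "?g i j \<in> Red" if "i < m" "j < m" for i j using gs that by simp
    have pm: "pos_matrix S m (\<lambda>i j. \<Psi> (?g i j))"
      unfolding \<Psi>_def by (intro \<psi>p \<phi>p pos_matrix_U gs) (use gR UA \<phi>b in auto)
    have "?x i \<in> ell2 S" if "i < m" for i
      by (rule ell2_scale(1)) (use gs that in simp)
    then have "\<forall>i<m. ?x i \<in> ell2 S" by simp
    from pm[unfolded pos_matrix_def Let_def, THEN spec[where x = ?x], THEN mp, OF this]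
    have q: "(\<Sum>i<m. \<Sum>j<m. ell2_inner S (\<Psi> (?g i j) (?x j)) (?x i)) \<in> \<real> \<and>
        0 \<le> Re (\<Sum>i<m. \<Sum>j<m. ell2_inner S (\<Psi> (?g i j) (?x j)) (?x i))"
      .
    have "ell2_inner S (\<Psi> (?g i j) (?x j)) (?x i) = of_real (c i * c j) * \<omega> (?g i j)" if ij: "i < m" "j < m" for i j
    proof -
      let ?d = "delta (en 0 (rev (gs j)))"
      have d: "?d \<in> ell2 S" using gs ij by simp
      have "ell2_inner S (\<Psi> (?g i j) (?x j)) (?x i) = of_real (c i * c j) * \<Psi> (?g i j) ?d (en 0 (rev (gs i)))"
        using gs ij unfolding bop_scale[OF \<Psi>b[OF gR[OF ij]] d] ell2_inner_scale_left ell2_inner_scale_right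
        by (simp add: ell2_inner_delta)
      \<comment> \<open>Right translation by \<open>gs i\<close> moves the entry in the row of the
        identity to the entry in the row of the inverse of \<open>gs i\<close> and the column of the
        inverse of \<open>gs j\<close>.\<close>
      moreover have "\<omega> (?g i j) = \<Psi> (?g i j) ?d (en 0 (rev (gs i)))"
      proof -
        have "delta (en 0 (rev (?g i j))) = rmul (gs i) ?d"
          using gs ij L0 by (simp add: rmul_delta rev_wmul mul_en)
        then have "\<omega> (?g i j) = rmul (gs i) (\<Psi> (?g i j) ?d) (en 0 [])"
          unfolding \<omega>_def using \<Psi>c[OF gR[OF ij] gs[OF ij(1)] d] by simp
        also have "\<dots> = \<Psi> (?g i j) ?d (en 0 (rev (gs i)))"
          using gs ij L0 by (simp add: rmul_def mul_en)
        finally show ?thesis .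
      qed
      ultimately show ?thesis by simp
    qed
    then have "(\<Sum>i<m. \<Sum>j<m. ell2_inner S (\<Psi> (?g i j) (?x j)) (?x i))
        = (\<Sum>i<m. \<Sum>j<m. of_real (c i * c j) * \<omega> (?g i j))"
      by (intro sum.cong refl) auto
    with q show "(\<Sum>i<m. \<Sum>j<m. of_real (c i * c j) * \<omega> (?g i j)) \<in> \<real> \<and>
        0 \<le> Re (\<Sum>i<m. \<Sum>j<m. of_real (c i * c j) * \<omega> (?g i j))" by simp
  next
    fix m
    let ?K = "{..<n} \<times> {..<n}"
    let ?b = "\<lambda>p l. cmod (\<psi> (unit_op n (fst p) (snd p)) (delta (en 0 (rev (wprod l)))) (en 0 []))"
    have E: "unit_op n (fst p) (snd p) \<in> bop {..<n}" if "p \<in> ?K" for p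
      by (rule unit_op_bop) (use that in auto)
    have Eb: "\<psi> (unit_op n (fst p) (snd p)) \<in> bop S" if "p \<in> ?K" for p
      using \<psi>A[OF E[OF that]] reduced_comm by (auto simp: comm_alg_def)
    \<comment> \<open>Finite rank: \<open>\<phi>\<close> only contributes matrix coefficients of
      modulus at most 1, so \<omega> is dominated by rows of n^2 fixed operators.\<close>
    have "cmod (\<omega> (wprod l)) \<le> (\<Sum>p\<in>?K. ?b p l)" if l: "l \<in> Lam m" for l
    proof -
      let ?g = "wprod l"
      define T where "T = \<phi> (U ?g)"
      have g: "?g \<in> Red" using l by simp
      have T: "T \<in> bop {..<n}" unfolding T_def by (intro \<phi>b UA g)
      have "T = (\<lambda>x k. \<Sum>p\<in>?K. T (delta (snd p)) (fst p) * unit_op n (fst p) (snd p) x k)"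
        by (subst matrix_expand[OF T]) (simp add: case_prod_unfold)
      then have "\<psi> T = \<psi> (\<lambda>x k. \<Sum>p\<in>?K. T (delta (snd p)) (fst p) * unit_op n (fst p) (snd p) x k)"
        by (rule arg_cong)
      also have "\<dots> = (\<lambda>x k. \<Sum>p\<in>?K. T (delta (snd p)) (fst p) * \<psi> (unit_op n (fst p) (snd p)) x k)"
        by (rule cpc_sum[OF \<psi>, THEN conjunct2]) (use E in auto)
      finally have "\<omega> ?g = (\<Sum>p\<in>?K. T (delta (snd p)) (fst p) *
          \<psi> (unit_op n (fst p) (snd p)) (delta (en 0 (rev ?g))) (en 0 []))"
        by (simp add: \<omega>_def \<Psi>_def T_def)
      then have "cmod (\<omega> ?g) \<le> (\<Sum>p\<in>?K. cmod (T (delta (snd p)) (fst p)) * ?b p l)"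
        by (simp only:) (rule order_trans[OF norm_sum], simp add: norm_mult)
      also have "\<dots> \<le> (\<Sum>p\<in>?K. 1 * ?b p l)"
      proof (intro sum_mono mult_right_mono)
        fix p assume "p \<in> ?K"
        then have d: "delta (snd p) \<in> ell2 {..<n}" "ell2_norm {..<n} (delta (snd p)) = 1" by auto
        have "cmod (T (delta (snd p)) (fst p)) \<le> op_norm {..<n} T"
          using ell2_coord_le[OF bop_ell2[OF T d(1)], of "fst p"] op_norm_bound[OF T d(1)] d(2) by simp
        also have "\<dots> \<le> 1" unfolding T_def using \<phi>n[OF UA[OF g]] U_norm[OF g] by simp
        finally show "cmod (T (delta (snd p)) (fst p)) \<le> 1" .
      qed simp
      finally show ?thesis by simp
    qed
    then have "cmod (\<Sum>l\<in>Lam m. \<omega> (wprod l)) \<le> (\<Sum>l\<in>Lam m. \<Sum>p\<in>?K. ?b p l)"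
      by (intro order_trans[OF norm_sum] sum_mono)
    also have "\<dots> = (\<Sum>p\<in>?K. \<Sum>l\<in>Lam m. ?b p l)" by (rule sum.swap)
    also have "\<dots> \<le> (\<Sum>p\<in>?K. 4 ^ m * op_norm S (\<psi> (unit_op n (fst p) (snd p))))"
      by (intro sum_mono walk_sum_bound Eb)
    also have "\<dots> = (\<Sum>(i, j)\<in>?K. op_norm S (\<psi> (unit_op n i j))) * 4 ^ m"
      by (simp add: sum_distrib_left[symmetric] case_prod_unfold mult.commute)
    finally show "cmod (\<Sum>l\<in>Lam m. \<omega> (wprod l)) \<le> (\<Sum>(i, j)\<in>?K. op_norm S (\<psi> (unit_op n i j))) * 4 ^ m" .
  next
    have *: "cmod (\<omega> g - 1) \<le> 1 / 20" if g: "g \<in> Red" and F: "op_norm S (op_diff (\<Psi> g) (U g)) < 1 / 20" for g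
    proof -
      have gS: "en 0 (rev g) \<in> S" using g by simp
      have D: "op_diff (\<Psi> g) (U g) \<in> bop S" by (intro bop_op_diff(1) \<Psi>b ppop_bop g) (use g in simp)
      have "U g (delta (en 0 (rev g))) (en 0 []) = 1" using U_delta[of g "rev g"] g by (simp add: delta_def)
      then have "cmod (\<omega> g - 1) = cmod (op_diff (\<Psi> g) (U g) (delta (en 0 (rev g))) (en 0 []))"
        by (simp add: op_diff_def \<omega>_def)
      also have "\<dots> \<le> op_norm S (op_diff (\<Psi> g) (U g))"
        using ell2_coord_le[OF bop_ell2[OF D delta_ell2[OF gS]], of "en 0 []"]
          op_norm_bound[OF D delta_ell2[OF gS]] gS by simp
      finally show ?thesis using F by simp
    qed
    show "cmod (\<omega> [] - 1) \<le> 1 / 20" by (rule *) (use close in \<open>simp_all add: \<Psi>_def\<close>)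
    show "cmod (\<omega> [k] - 1) \<le> 1 / 20" if "k < 5" for k
      by (rule *) (use close that in \<open>simp_all add: \<Psi>_def\<close>)
  qed
qed

end


section \<open>Approximating unitary involutions by permutations of lattice points\<close>

text \<open>If every enlargement by \<open>s\<close> gained a factor 1 + \<epsilon>, then
  \<open>a\<close> would grow exponentially along multiples of \<open>s\<close>. This supplies radii
  at which enlarging a ball costs little.\<close>

lemma polynomial_growth_step:
  fixes a :: "nat \<Rightarrow> real"
  assumes bound: "\<And>n. a n \<le> C * (real n + 1) ^ k" and pos: "\<And>n. n0 \<le> n \<Longrightarrow> 0 < a n"
    and \<epsilon>: "0 < \<epsilon>"
  shows "\<exists>n\<ge>n1. a (n + s) \<le> (1 + \<epsilon>) * a n"
proof (rule ccontr)
  assume "\<not> ?thesis"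
  then have step: "(1 + \<epsilon>) * a n \<le> a (n + s)" if "n \<ge> n1" for n using that by force
  define m where "m = max n0 n1"
  have am: "0 < a m" using pos by (simp add: m_def)
  have grow: "(1 + \<epsilon>) ^ j * a m \<le> a (m + j * s)" for j
  proof (induction j)
    case (Suc j)
    have "(1 + \<epsilon>) ^ Suc j * a m \<le> (1 + \<epsilon>) * a (m + j * s)" using Suc \<epsilon> by (simp add: mult.assoc)
    also have "\<dots> \<le> a (m + j * s + s)" by (rule step) (simp add: m_def)
    finally show ?case by (simp add: algebra_simps)
  qed simp
  define u where "u = ln (1 + \<epsilon>)"
  have u: "0 < u" using \<epsilon> by (simp add: u_def)
  have e: "exp (u * real j) = (1 + \<epsilon>) ^ j" for j
    unfolding u_def exp_of_nat2_mult using \<epsilon> by simp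
  \<comment> \<open>Chosen so that m + j s + 1 <= D u (j + 1), which turns the comparison into x^k /
    exp x at x = u (j + 1).\<close>
  define D where "D = (real m + real s + 1) / u"
  have D: "0 < D" using u by (simp add: D_def)
  have C: "0 < C"
  proof -
    have "0 < C * (real m + 1) ^ k" using am bound[of m] by linarith
    then show ?thesis by (simp add: zero_less_mult_iff)
  qed
  define \<delta> where "\<delta> = a m / ((1 + \<epsilon>) * C * D ^ k)"
  have \<delta>: "0 < \<delta>" using am \<epsilon> C D by (simp add: \<delta>_def)
  have big: "\<delta> \<le> (u * (real j + 1)) ^ k / exp (u * (real j + 1))" for j
  proof -
    have "real (m + j * s) + 1 \<le> (real m + real s + 1) * (real j + 1)"
      by (simp add: algebra_simps)
    also have "\<dots> = D * (u * (real j + 1))" using u by (simp add: D_def)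
    finally have "(real (m + j * s) + 1) ^ k \<le> (D * (u * (real j + 1))) ^ k" by (intro power_mono) auto
    then have "(1 + \<epsilon>) ^ j * a m \<le> C * (D * (u * (real j + 1))) ^ k"
      using grow[of j] bound[of "m + j * s"] C by (smt (verit) mult_left_mono)
    then have "exp (u * real j) * a m \<le> C * D ^ k * (u * (real j + 1)) ^ k"
      by (simp add: e power_mult_distrib mult.assoc)
    moreover have "exp (u * (real j + 1)) = exp (u * real j) * (1 + \<epsilon>)"
      using \<epsilon> by (simp add: distrib_left exp_add u_def)
    ultimately have "exp (u * (real j + 1)) * a m \<le> (1 + \<epsilon>) * (C * D ^ k * (u * (real j + 1)) ^ k)"
      using \<epsilon> by (simp add: mult_ac)
    then have *: "a m * exp (u * (real j + 1)) \<le> (u * (real j + 1)) ^ k * ((1 + \<epsilon>) * C * D ^ k)"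
      by (simp add: mult_ac)
    have "x / q \<le> z / y" if "0 < q" "0 < y" "x * y \<le> z * q" for x q y z :: real
      using that by (simp add: field_simps)
    from this[OF _ _ *] show ?thesis unfolding \<delta>_def using \<epsilon> C D by simp
  qed
  have "((\<lambda>x. x ^ k / exp x) \<longlongrightarrow> 0) (at_top :: real filter)" by (rule tendsto_power_div_exp_0)
  then have "\<forall>\<^sub>F x in at_top. (x :: real) ^ k / exp x < \<delta>" using \<delta> by (rule order_tendstoD)
  then obtain x0 where x0: "\<And>x :: real. x \<ge> x0 \<Longrightarrow> x ^ k / exp x < \<delta>" by (auto simp: eventually_at_top_linorder)
  obtain j :: nat where "x0 / u < real j" using reals_Archimedean2 by blast
  then have "x0 \<le> u * (real j + 1)" using u by (simp add: field_simps)
  from x0[OF this] big[of j] show False by simp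
qed

locale lattice =
  fixes e :: nat
  assumes e: "0 < e"
begin

abbreviation V :: "(nat \<Rightarrow> complex) set" where "V \<equiv> ell2 {..<e}"
abbreviation N :: "(nat \<Rightarrow> complex) \<Rightarrow> real" where "N \<equiv> ell2_norm {..<e}"

lemma V_iff: "x \<in> V \<longleftrightarrow> (\<forall>i\<ge>e. x i = 0)"
  using ell2_finite(1)[of "{..<e}" "{..<e}" x] ell2_zero_off[of x "{..<e}"] by auto

lemma N_sq: "(N x)\<^sup>2 = (\<Sum>i<e. (cmod (x i))\<^sup>2)"
  by (simp add: ell2_norm_sq)

lemma N_tri: "x \<in> V \<Longrightarrow> y \<in> V \<Longrightarrow> z \<in> V \<Longrightarrow> N (\<lambda>i. x i - z i) \<le> N (\<lambda>i. x i - y i) + N (\<lambda>i. y i - z i)"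
  using ell2_add(2)[OF ell2_diff(1)[of x "{..<e}" y] ell2_diff(1)[of y "{..<e}" z]] by simp

text \<open>The vectors of Gaussian integers, a lattice in the complex space of dimension
  \<open>e\<close>.\<close>

definition Z :: "(nat \<Rightarrow> complex) set" where
  "Z = {x \<in> V. \<forall>i. Re (x i) \<in> \<int> \<and> Im (x i) \<in> \<int>}"

definition B :: "nat \<Rightarrow> (nat \<Rightarrow> complex) set" where
  "B n = {x \<in> Z. N x \<le> real n}"

lemma Z_V: "x \<in> Z \<Longrightarrow> x \<in> V"
  by (simp add: Z_def)

lemma Z_add: "x \<in> Z \<Longrightarrow> y \<in> Z \<Longrightarrow> (\<lambda>i. x i + y i) \<in> Z"
  by (simp add: Z_def ell2_add(1))

lemma Z_diff: "x \<in> Z \<Longrightarrow> y \<in> Z \<Longrightarrow> (\<lambda>i. x i - y i) \<in> Z"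
  by (simp add: Z_def ell2_diff(1))

lemma B_finite_card: "finite (B n)" "real (card (B n)) \<le> 2 ^ (2 * e) * (real n + 1) ^ (2 * e)"
proof -
  let ?I = "{- int n..int n}"
  let ?P = "PiE {..<e} (\<lambda>_. ?I \<times> ?I)"
  let ?F = "\<lambda>q i. if i < e then Complex (of_int (fst (q i))) (of_int (snd (q i))) else 0"
  have sub: "B n \<subseteq> ?F ` ?P"
  proof
    fix x assume x: "x \<in> B n"
    define q where "q = restrict (\<lambda>i. (\<lfloor>Re (x i)\<rfloor>, \<lfloor>Im (x i)\<rfloor>)) {..<e}"
    have int: "of_int \<lfloor>Re (x i)\<rfloor> = Re (x i)" "of_int \<lfloor>Im (x i)\<rfloor> = Im (x i)" for i
      using x by (auto simp: B_def Z_def elim!: Ints_cases)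
    have "x = ?F q"
    proof
      fix i show "x i = ?F q i"
        using x by (cases "i < e") (auto simp: q_def int B_def Z_def V_iff complex_eq_iff)
    qed
    moreover have "q \<in> ?P"
    proof -
      have "\<lfloor>Re (x i)\<rfloor> \<in> ?I \<and> \<lfloor>Im (x i)\<rfloor> \<in> ?I" for i
      proof -
        have "cmod (x i) \<le> real n" using ell2_coord_le[of x "{..<e}" i] x by (simp add: B_def Z_def)
        then have "\<bar>Re (x i)\<bar> \<le> real n" "\<bar>Im (x i)\<bar> \<le> real n"
          using abs_Re_le_cmod[of "x i"] abs_Im_le_cmod[of "x i"] by linarith+
        then have "\<bar>real_of_int \<lfloor>Re (x i)\<rfloor>\<bar> \<le> real n" "\<bar>real_of_int \<lfloor>Im (x i)\<rfloor>\<bar> \<le> real n" by (simp_all only: int)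
        then have "\<bar>\<lfloor>Re (x i)\<rfloor>\<bar> \<le> int n" "\<bar>\<lfloor>Im (x i)\<rfloor>\<bar> \<le> int n" by linarith+
        then show ?thesis by (simp add: abs_le_iff)
      qed
      then show ?thesis by (auto simp: q_def restrict_PiE_iff)
    qed
    ultimately show "x \<in> ?F ` ?P" by blast
  qed
  have finP: "finite ?P" by (intro finite_PiE) auto
  show "finite (B n)" by (rule finite_subset[OF sub finite_imageI[OF finP]])
  have "card (B n) \<le> card ?P"
    using card_mono[OF finite_imageI[OF finP] sub] card_image_le[OF finP, of ?F] by linarith
  also have "card ?P = (card ?I * card ?I) ^ e"
    by (simp add: card_PiE card_cartesian_product del: card_atLeastAtMost_int)
  also have "card ?I = 2 * n + 1" unfolding card_atLeastAtMost_int by linarith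
  finally have "real (card (B n)) \<le> real (((2 * n + 1) * (2 * n + 1)) ^ e)" by (rule of_nat_mono)
  also have "\<dots> = (2 * real n + 1) ^ (2 * e)"
  proof -
    have "real ((2 * n + 1) * (2 * n + 1)) = (2 * real n + 1)\<^sup>2" by (simp add: power2_eq_square algebra_simps)
    then show ?thesis by (simp only: of_nat_power power_mult)
  qed
  also have "\<dots> \<le> (2 * (real n + 1)) ^ (2 * e)" by (intro power_mono) auto
  finally show "real (card (B n)) \<le> 2 ^ (2 * e) * (real n + 1) ^ (2 * e)"
    by (simp only: power_mult_distrib)
qed

lemma cover:
  assumes v: "v \<in> V"
  shows "\<exists>z\<in>Z. N (\<lambda>i. v i - z i) \<le> 2 * real e"
proof
  define z where "z i = Complex (of_int \<lfloor>Re (v i)\<rfloor>) (of_int \<lfloor>Im (v i)\<rfloor>)" for i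
  have zV: "z \<in> V" using v by (auto simp: V_iff z_def complex_eq_iff)
  then show "z \<in> Z" by (simp add: Z_def z_def)
  have c: "cmod (v i - z i) \<le> 2" for i
  proof -
    have "cmod (v i - z i) \<le> \<bar>Re (v i - z i)\<bar> + \<bar>Im (v i - z i)\<bar>" by (rule cmod_le)
    also have "\<bar>Re (v i - z i)\<bar> \<le> 1" by (simp add: z_def) linarith
    also have "\<bar>Im (v i - z i)\<bar> \<le> 1" by (simp add: z_def) linarith
    finally show ?thesis by simp
  qed
  have "N (\<lambda>i. v i - z i) = L2_set (\<lambda>i. cmod (v i - z i)) {..<e}"
    by (simp add: L2_set_def ell2_norm_def)
  also have "\<dots> \<le> (\<Sum>i<e. cmod (v i - z i))" by (rule L2_set_le_sum) simp
  also have "\<dots> \<le> (\<Sum>i<e. 2)" by (rule sum_mono) (rule c)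
  finally show "N (\<lambda>i. v i - z i) \<le> 2 * real e" by simp
qed

definition near :: "nat \<Rightarrow> (nat \<Rightarrow> complex) \<Rightarrow> (nat \<Rightarrow> complex) set" where
  "near r v = {y \<in> Z. N (\<lambda>i. y i - v i) \<le> real r}"

text \<open>Some lattice point lies within 2e of \<open>v\<close>; translating by it compares the
  ball about \<open>v\<close> with balls about 0. Hence the number of lattice points hardly depends
  on the centre.\<close>

lemma near_card:
  assumes v: "v \<in> V"
  shows "finite (near (n + 2 * e) v)" "card (B n) \<le> card (near (n + 2 * e) v)"
    "card (near (n + 2 * e) v) \<le> card (B (n + 4 * e))"
proof -
  obtain z where z: "z \<in> Z" "N (\<lambda>i. v i - z i) \<le> 2 * real e" using cover[OF v] by blast
  have zv: "N (\<lambda>i. z i - v i) \<le> 2 * real e" using z(2) ell2_norm_minus_commute[of "{..<e}" v z] by simp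
  have inj: "inj_on (\<lambda>y i. y i - z i) A" for A by (auto simp: inj_on_def fun_eq_iff)
  have inj2: "inj_on (\<lambda>y i. y i + z i) A" for A by (auto simp: inj_on_def fun_eq_iff)
  have 1: "(\<lambda>y i. y i - z i) ` near (n + 2 * e) v \<subseteq> B (n + 4 * e)"
  proof (rule image_subsetI)
    fix y assume y: "y \<in> near (n + 2 * e) v"
    then have "N (\<lambda>i. y i - z i) \<le> N (\<lambda>i. y i - v i) + N (\<lambda>i. v i - z i)"
      by (intro N_tri) (use v z in \<open>auto simp: near_def Z_V\<close>)
    then show "(\<lambda>i. y i - z i) \<in> B (n + 4 * e)"
      using y z by (simp add: near_def B_def Z_diff)
  qed
  show f: "finite (near (n + 2 * e) v)"
    by (rule finite_imageD[OF finite_subset[OF 1 B_finite_card(1)] inj])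
  show "card (near (n + 2 * e) v) \<le> card (B (n + 4 * e))"
    by (rule card_inj_on_le[OF inj 1 B_finite_card(1)])
  have 2: "(\<lambda>y i. y i + z i) ` B n \<subseteq> near (n + 2 * e) v"
  proof (rule image_subsetI)
    fix y assume y: "y \<in> B n"
    have "N (\<lambda>i. y i + (z i - v i)) \<le> N y + N (\<lambda>i. z i - v i)"
      by (intro ell2_add(2) ell2_diff(1)) (use y v z in \<open>auto simp: B_def Z_V\<close>)
    then show "(\<lambda>i. y i + z i) \<in> near (n + 2 * e) v"
      using y z zv by (simp add: near_def B_def Z_add algebra_simps)
  qed
  show "card (B n) \<le> card (near (n + 2 * e) v)"
    by (rule card_inj_on_le[OF inj2 2 f])
qed

section \<open>Tight frames formed by the lattice points of a ball\<close>

definition F :: "nat \<Rightarrow> real" where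
  "F n = (\<Sum>x\<in>B n. (N x)\<^sup>2)"

lemma B_mono: "n \<le> m \<Longrightarrow> B n \<subseteq> B m"
  by (auto simp: B_def)

lemma F_bound: "F n \<le> 2 ^ (2 * e) * (real n + 1) ^ (2 * e + 2)"
proof -
  have "F n \<le> (\<Sum>x\<in>B n. (real n + 1)\<^sup>2)"
    unfolding F_def by (intro sum_mono power_mono) (auto simp: B_def)
  also have "\<dots> = real (card (B n)) * (real n + 1)\<^sup>2" by simp
  also have "\<dots> \<le> (2 ^ (2 * e) * (real n + 1) ^ (2 * e)) * (real n + 1)\<^sup>2"
    by (intro mult_right_mono B_finite_card(2)) simp
  finally show ?thesis by (simp only: power_add mult.assoc)
qed

lemma F_ge: "(real n)\<^sup>2 \<le> F n"
proof -
  define x where "x i = (if i = 0 then of_nat n else 0 :: complex)" for i :: nat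
  have xV: "x \<in> V" using e by (auto simp: V_iff x_def)
  have "(N x)\<^sup>2 = (\<Sum>i<e. if i = 0 then (real n)\<^sup>2 else 0)" unfolding N_sq by (rule sum.cong) (auto simp: x_def)
  also have "\<dots> = (real n)\<^sup>2" using e by simp
  finally have Nx: "(N x)\<^sup>2 = (real n)\<^sup>2" .
  then have "N x = real n" by (simp add: power2_eq_iff_nonneg)
  then have xB: "x \<in> B n" using xV by (auto simp: B_def Z_def x_def)
  have "(N x)\<^sup>2 \<le> F n" unfolding F_def by (rule member_le_sum[OF xB]) (simp_all add: B_finite_card)
  then show ?thesis using Nx by simp
qed

text \<open>Changing the sign of one coordinate preserves the ball and reverses the sign of the
  sum.\<close>

lemma frame_offdiag:
  assumes ij: "i < e" "j < e" "i \<noteq> j"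
  shows "(\<Sum>x\<in>B n. cnj (x i) * x j) = 0"
proof -
  let ?f = "\<lambda>x :: nat \<Rightarrow> complex. x(i := - x i)"
  have N: "N (?f x) = N x" for x
  proof -
    have "(N (?f x))\<^sup>2 = (N x)\<^sup>2" unfolding N_sq by (rule sum.cong) auto
    then show ?thesis by (simp add: power2_eq_iff_nonneg)
  qed
  have fB: "?f x \<in> B n" if "x \<in> B n" for x
    using that ij N[of x] by (auto simp: B_def Z_def V_iff)
  have "(\<Sum>x\<in>B n. cnj (x i) * x j) = (\<Sum>x\<in>B n. cnj (?f x i) * ?f x j)"
    by (rule sum.reindex_bij_witness[of _ ?f ?f]) (use fB ij in auto)
  also have "\<dots> = - (\<Sum>x\<in>B n. cnj (x i) * x j)" using ij by (simp add: sum_negf)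
  finally show ?thesis by simp
qed

text \<open>Transpositions of coordinates preserve the ball, so all diagonal entries agree, and
  their sum, the trace of the frame operator, is \<open>F n\<close>.\<close>

lemma frame_diag:
  assumes i: "i < e"
  shows "(\<Sum>x\<in>B n. cnj (x i) * x i) = of_real (F n / real e)"
proof -
  define g where "g i = (\<Sum>x\<in>B n. (cmod (x i))\<^sup>2)" for i
  have g0: "g k = g 0" if "k < e" for k
    proof -
      let ?t = "Transposition.transpose k 0"
      let ?f = "\<lambda>x :: nat \<Rightarrow> complex. x \<circ> ?t"
      have t: "?t l < e \<longleftrightarrow> l < e" for l using that e by (auto simp: Transposition.transpose_def)
      have N: "N (?f x) = N x" for x
      proof -
        have "(N (?f x))\<^sup>2 = (N x)\<^sup>2" unfolding N_sq
          by (rule sum.reindex_bij_witness[of _ ?t ?t]) (auto simp: t)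
        then show ?thesis by (simp add: power2_eq_iff_nonneg)
      qed
      have fB: "?f x \<in> B n" if "x \<in> B n" for x
        using that N[of x] t by (auto simp: B_def Z_def V_iff not_less[symmetric])
      show ?thesis unfolding g_def
        by (rule sum.reindex_bij_witness[of _ ?f ?f]) (use fB in \<open>auto simp: fun_eq_iff\<close>)
    qed
  have gi: "g k = g i" if "k < e" for k using g0[OF that] g0[OF i] by simp
  have "F n = (\<Sum>k<e. g k)" unfolding F_def g_def N_sq by (rule sum.swap)
  also have "\<dots> = real e * g i" using gi by simp
  finally have "g i = F n / real e" using e by simp
  moreover have "(\<Sum>x\<in>B n. cnj (x i) * x i) = of_real (g i)"
    unfolding g_def of_real_sum by (rule sum.cong) (simp_all only: complex_norm_square mult.commute)
  ultimately show ?thesis by simp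
qed

text \<open>By these two symmetries the frame operator is a scalar: the ball is a tight frame, so
  inner products can be computed exactly from its points.\<close>

lemma frame:
  assumes "\<xi> \<in> V" "\<eta> \<in> V"
  shows "(\<Sum>x\<in>B n. ell2_inner {..<e} \<xi> x * ell2_inner {..<e} x \<eta>) = of_real (F n / real e) * ell2_inner {..<e} \<xi> \<eta>"
proof -
  have "(\<Sum>x\<in>B n. ell2_inner {..<e} \<xi> x * ell2_inner {..<e} x \<eta>)
    = (\<Sum>x\<in>B n. \<Sum>i<e. \<Sum>j<e. \<xi> i * cnj (\<eta> j) * (cnj (x i) * x j))"
    unfolding ell2_inner_def infsum_finite[OF finite_lessThan] sum_product
    by (intro sum.cong refl) (simp add: mult_ac)
  also have "\<dots> = (\<Sum>i<e. \<Sum>j<e. \<Sum>x\<in>B n. \<xi> i * cnj (\<eta> j) * (cnj (x i) * x j))"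
    by (subst sum.swap, rule sum.cong[OF refl], rule sum.swap)
  also have "\<dots> = (\<Sum>i<e. \<Sum>j<e. \<xi> i * cnj (\<eta> j) * (\<Sum>x\<in>B n. cnj (x i) * x j))"
    by (simp only: sum_distrib_left)
  also have "\<dots> = (\<Sum>i<e. \<Sum>j<e. if j = i then \<xi> i * cnj (\<eta> i) * of_real (F n / real e) else 0)"
    by (intro sum.cong refl) (auto simp: frame_offdiag frame_diag)
  also have "\<dots> = of_real (F n / real e) * ell2_inner {..<e} \<xi> \<eta>"
    by (simp add: ell2_inner_def sum_distrib_left mult_ac)
  finally show ?thesis .
qed

end


text \<open>Every point receives D slots. For related x and y the slot that x reserves for y is
  exchanged with the slot that y reserves for x; idle slots stay fixed. So a symmetric relation of
  degree at most D becomes an honest involution.\<close>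

lemma slot_involution:
  assumes X: "finite X" and sym: "\<And>x y. x \<in> X \<Longrightarrow> y \<in> X \<Longrightarrow> E x y \<Longrightarrow> E y x"
    and D: "\<And>x. x \<in> X \<Longrightarrow> card {y \<in> X. E x y} \<le> D"
  shows "\<exists>\<tau>. \<forall>x\<in>X. \<exists>M\<subseteq>{..<D}. card M = card {y \<in> X. E x y} \<and>
    (\<forall>i\<in>M. E x (fst (\<tau> (x, i)))) \<and> (\<forall>i\<in>{..<D} - M. \<tau> (x, i) = (x, i)) \<and>
    (\<forall>i<D. \<tau> (x, i) \<in> X \<times> {..<D} \<and> \<tau> (\<tau> (x, i)) = (x, i))"
proof -
  define Nb where "Nb x = {y \<in> X. E x y}" for x
  have finNb: "finite (Nb x)" for x using X by (simp add: Nb_def)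
  have "\<exists>f. f ` Nb x \<subseteq> {..<D} \<and> inj_on f (Nb x)" if "x \<in> X" for x
    by (rule card_le_inj) (use D[OF that] finNb in \<open>auto simp: Nb_def\<close>)
  then obtain slot where slot: "\<And>x. x \<in> X \<Longrightarrow> slot x ` Nb x \<subseteq> {..<D}" "\<And>x. x \<in> X \<Longrightarrow> inj_on (slot x) (Nb x)"
    by metis
  define nb where "nb x i = inv_into (Nb x) (slot x) i" for x i
  define \<tau> where "\<tau> p = (case p of (x, i) \<Rightarrow> if i \<in> slot x ` Nb x then (nb x i, slot (nb x i) x) else (x, i))" for p
  have nb: "nb x i \<in> Nb x" "slot x (nb x i) = i" if "i \<in> slot x ` Nb x" for x i
    using that by (auto simp: nb_def inv_into_into f_inv_into_f)
  have nb2: "nb x (slot x y) = y" if "x \<in> X" "y \<in> Nb x" for x y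
    unfolding nb_def by (rule inv_into_f_f[OF slot(2)[OF that(1)] that(2)])
  have symN: "x \<in> Nb y" if "x \<in> X" "y \<in> Nb x" for x y using that sym by (auto simp: Nb_def)
  show ?thesis
  proof (intro exI ballI conjI allI impI)
    fix x assume x: "x \<in> X"
    show "slot x ` Nb x \<subseteq> {..<D}" by (rule slot(1)[OF x])
    show "card (slot x ` Nb x) = card {y \<in> X. E x y}"
      using card_image[OF slot(2)[OF x]] by (simp add: Nb_def)
    show "E x (fst (\<tau> (x, i)))" if "i \<in> slot x ` Nb x" for i
      using that nb(1)[OF that] by (simp add: \<tau>_def Nb_def)
    show "\<tau> (x, i) = (x, i)" if "i \<in> {..<D} - slot x ` Nb x" for i
      using that by (simp add: \<tau>_def)
    fix i assume i: "i < D"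
    have "\<tau> (x, i) \<in> X \<times> {..<D} \<and> \<tau> (\<tau> (x, i)) = (x, i)"
    proof (cases "i \<in> slot x ` Nb x")
      case True
      let ?y = "nb x i"
      have y: "?y \<in> Nb x" "slot x ?y = i" using nb[OF True] by auto
      have yX: "?y \<in> X" using y by (simp add: Nb_def)
      have xy: "x \<in> Nb ?y" by (rule symN[OF x y(1)])
      then have "slot ?y x \<in> slot ?y ` Nb ?y" by blast
      moreover have "nb ?y (slot ?y x) = x" by (rule nb2[OF yX xy])
      ultimately show ?thesis using True y yX slot(1)[OF yX] by (auto simp: \<tau>_def)
    qed (use x i in \<open>simp add: \<tau>_def\<close>)
    then show "\<tau> (x, i) \<in> X \<times> {..<D}" "\<tau> (\<tau> (x, i)) = (x, i)" by auto
  qed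
qed

context lattice
begin

text \<open>Relate x to the lattice points y near T x; since T is an isometric involution, this
  relation is symmetric. Away from the boundary of the ball all degrees are almost equal, so few
  slots stay idle. Errors are weighed against the total squared norm, for which both the boundary
  shell and a bounded displacement are negligible.\<close>

theorem approx_involutions:
  fixes T :: "nat \<Rightarrow> (nat \<Rightarrow> complex) \<Rightarrow> (nat \<Rightarrow> complex)"
  assumes TV: "\<And>s x. s < 5 \<Longrightarrow> x \<in> V \<Longrightarrow> T s x \<in> V"
    and TT: "\<And>s x. s < 5 \<Longrightarrow> x \<in> V \<Longrightarrow> T s (T s x) = x"
    and iso: "\<And>s x y. s < 5 \<Longrightarrow> x \<in> V \<Longrightarrow> y \<in> V \<Longrightarrow> N (\<lambda>i. T s x i - T s y i) = N (\<lambda>i. x i - y i)"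
    and NT: "\<And>s x. s < 5 \<Longrightarrow> x \<in> V \<Longrightarrow> N (T s x) = N x"
    and \<epsilon>: "\<epsilon> > 0"
  shows "\<exists>n \<sigma> p \<Phi>. \<sigma> \<in> Sig n \<and> (\<forall>y<n. p y \<in> V) \<and> \<Phi> > 0 \<and>
    (\<forall>s<5. (\<Sum>y<n. (N (\<lambda>i. p (\<sigma> s y) i - T s (p y) i))\<^sup>2) \<le> \<epsilon> * \<Phi>) \<and>
    (\<forall>\<xi>\<in>V. \<forall>\<eta>\<in>V. (\<Sum>y<n. ell2_inner {..<e} \<xi> (p y) * ell2_inner {..<e} (p y) \<eta>)
        = of_real (\<Phi> / real e) * ell2_inner {..<e} \<xi> \<eta>)"
proof -
  \<comment> \<open>The final error consists of \<delta> from the displacements, 4\<delta> from the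
    boundary shell and 4\<delta> from idle slots inside.\<close>
  define \<delta> where "\<delta> = \<epsilon> / 9"
  have \<delta>: "0 < \<delta>" using \<epsilon> by (simp add: \<delta>_def)
  have cardB: "0 < real (card (B n))" for n
  proof -
    have "(\<lambda>i. 0) \<in> B n" by (simp add: B_def Z_def)
    then have "B n \<noteq> {}" by blast
    then show ?thesis using B_finite_card(1)[of n] by (simp add: card_gt_0_iff)
  qed
  \<comment> \<open>With r = m + 2e, every ball of radius r contains between (1 - \<delta>) D and D
    lattice points, whatever its centre.\<close>
  obtain m where m: "real (card (B (m + 4 * e))) \<le> (1 + \<delta>) * real (card (B m))"
    using polynomial_growth_step[of "\<lambda>n. real (card (B n))" "2 ^ (2 * e)" "2 * e" 0 \<delta> 0 "4 * e"]
      B_finite_card(2) cardB \<delta> by auto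
  define D where "D = card (B (m + 4 * e))"
  define r where "r = m + 2 * e"
  have Dpos: "0 < real D" using cardB by (simp add: D_def)
  have near_le: "card (near r v) \<le> D" if "v \<in> V" for v
    using near_card(3)[OF that, of m] by (simp add: r_def D_def)
  have near_ge: "(1 - \<delta>) * real D \<le> real (card (near r v))" if "v \<in> V" for v
  proof -
    have "(1 - \<delta>) * real D \<le> (1 - \<delta>) * ((1 + \<delta>) * real (card (B m)))" if "\<delta> \<le> 1"
      using m that by (intro mult_left_mono) (auto simp: D_def)
    also have "\<dots> = real (card (B m)) - \<delta>\<^sup>2 * real (card (B m))" by (simp add: algebra_simps power2_eq_square)
    also have "\<dots> \<le> real (card (B m))" by simp
    finally have "(1 - \<delta>) * real D \<le> real (card (B m))" if "\<delta> \<le> 1" using that by simp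
    moreover have "(1 - \<delta>) * real D \<le> 0" if "\<not> \<delta> \<le> 1" using that by (simp add: mult_nonpos_nonneg)
    ultimately show ?thesis using near_card(2)[OF that, of m] unfolding r_def
      by (cases "\<delta> \<le> 1") (force intro: order_trans)+
  qed
  \<comment> \<open>\<open>K\<close> and \<open>n1\<close> make displacements of size r negligible:
    outside \<open>B K\<close> the squared norm of a point exceeds K, while \<open>n1\<close> makes
    the total squared norm large compared with the number of points of \<open>B K\<close>.\<close>
  obtain K :: nat where K: "2 * real r ^ 2 / \<delta> < real K" using reals_Archimedean2 by blast
  obtain n1 :: nat where n1: "2 * real r ^ 2 * real (card (B K)) / \<delta> < real n1" using reals_Archimedean2 by blast
  have Fpos: "0 < F n" if "1 \<le> n" for n
  proof -
    have "0 < (real n)\<^sup>2" using that by simp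
    then show ?thesis using F_ge[of n] by linarith
  qed
  \<comment> \<open>The shell between the radii R and R + r carries at most a fraction \<delta> of
    the squared norm.\<close>
  obtain R where R: "n1 + 1 \<le> R" "F (R + r) \<le> (1 + \<delta>) * F R"
    using polynomial_growth_step[of F "2 ^ (2 * e)" "2 * e + 2" 1 \<delta> "n1 + 1" r] F_bound Fpos \<delta> by auto
  define X where "X = B (R + r)"
  have finX: "finite X" by (simp add: X_def B_finite_card)
  have XV: "x \<in> V" if "x \<in> X" for x using that by (simp add: X_def B_def Z_V)
  have XZ: "x \<in> Z" if "x \<in> X" for x using that by (simp add: X_def B_def)
  have FX: "(\<Sum>x\<in>X. (N x)\<^sup>2) = F (R + r)" by (simp add: X_def F_def)
  have FRpos: "0 < F (R + r)" using Fpos[of "R + r"] R(1) by simp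
  have small: "real r ^ 2 * real (card X) \<le> \<delta> * F (R + r)"
  proof -
    have Kpos: "0 \<le> 2 * real r ^ 2 / \<delta>" using \<delta> by simp
    then have K0: "0 < real K" using K by linarith
    have card: "real (card X) \<le> real (card (B K)) + F (R + r) / real K"
    proof -
      have "real (card X) = (\<Sum>x\<in>X. 1)" by simp
      also have "\<dots> \<le> (\<Sum>x\<in>X. (if x \<in> B K then 1 else 0) + (N x)\<^sup>2 / real K)"
      proof (rule sum_mono)
        fix x assume x: "x \<in> X"
        show "1 \<le> (if x \<in> B K then 1 else 0) + (N x)\<^sup>2 / real K"
        proof (cases "x \<in> B K")
          case False
          then have "real K < N x" using XZ[OF x] by (simp add: B_def)
          then have "real K * real K \<le> N x * N x" by (intro mult_mono) auto
          moreover have "real K * 1 \<le> real K * real K" using K0 by (intro mult_left_mono) auto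
          ultimately have "real K \<le> (N x)\<^sup>2" by (simp add: power2_eq_square)
          then show ?thesis using False K0 by (simp add: le_divide_eq)
        qed (use K0 in simp)
      qed
      also have "\<dots> = real (card (X \<inter> B K)) + F (R + r) / real K"
        using finX by (simp add: sum.distrib sum.If_cases FX sum_divide_distrib[symmetric])
      also have "card (X \<inter> B K) \<le> card (B K)" by (rule card_mono[OF B_finite_card(1)]) simp
      finally show ?thesis by simp
    qed
    have "real n1 \<le> F (R + r)"
    proof -
      have "real n1 \<le> real (R + r)" using R(1) by simp
      also have "\<dots> \<le> (real (R + r))\<^sup>2" using R(1) by (simp add: power2_eq_square)
      finally show ?thesis using F_ge[of "R + r"] by linarith
    qed
    then have "\<delta> * real n1 \<le> \<delta> * F (R + r)" using \<delta> by simp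
    moreover have "2 * real r ^ 2 * real (card (B K)) < real n1 * \<delta>"
      using n1 \<delta> by (simp only: pos_divide_less_eq)
    ultimately have a: "2 * (real r ^ 2 * real (card (B K))) \<le> \<delta> * F (R + r)"
      by (simp only: mult.commute[of _ \<delta>] mult.assoc) 
    have "2 * real r ^ 2 < real K * \<delta>" using K \<delta> by (simp only: pos_divide_less_eq)
    then have "2 * real r ^ 2 \<le> \<delta> * real K" by (simp only: mult.commute[of _ \<delta>])
    then have "2 * real r ^ 2 * (F (R + r) / real K) \<le> \<delta> * real K * (F (R + r) / real K)"
      using FRpos by (intro mult_right_mono) auto
    then have b: "2 * (real r ^ 2 * (F (R + r) / real K)) \<le> \<delta> * F (R + r)" using K0 by simp
    have "real r ^ 2 * real (card X) \<le> real r ^ 2 * (real (card (B K)) + F (R + r) / real K)"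
      using card by (intro mult_left_mono) auto
    with a b show ?thesis by (simp add: distrib_left)
  qed
  define E where "E s x y \<longleftrightarrow> N (\<lambda>i. y i - T s x i) \<le> real r" for s and x y :: "nat \<Rightarrow> complex"
  have symE: "E s y x" if s: "s < 5" and "x \<in> X" "y \<in> X" "E s x y" for s x y
  proof -
    have "N (\<lambda>i. x i - T s y i) = N (\<lambda>i. T s (T s x) i - T s y i)" using TT[OF s XV] that by simp
    also have "\<dots> = N (\<lambda>i. T s x i - y i)" using that XV TV by (intro iso) auto
    also have "\<dots> = N (\<lambda>i. y i - T s x i)" by (rule ell2_norm_minus_commute)
    finally show ?thesis using that by (simp add: E_def)
  qed
  have Enear: "{y \<in> X. E s x y} \<subseteq> near r (T s x)" for s x
    using XZ by (auto simp: E_def near_def)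
  have degE: "card {y \<in> X. E s x y} \<le> D" if "s < 5" "x \<in> X" for s x
  proof -
    have "finite (near r (T s x))" unfolding r_def by (rule near_card(1)) (use that TV XV in auto)
    from card_mono[OF this Enear] near_le[OF TV[OF that(1) XV[OF that(2)]]] show ?thesis by linarith
  qed
  \<comment> \<open>The operators preserve norms, so a point of \<open>B R\<close> has all lattice
    points near its image inside X.\<close>
  have degE2: "(1 - \<delta>) * real D \<le> real (card {y \<in> X. E s x y})" if s: "s < 5" and x: "x \<in> B R" for s x
  proof -
    have xV: "x \<in> V" using x by (simp add: B_def Z_V)
    have "near r (T s x) \<subseteq> {y \<in> X. E s x y}"
    proof
      fix y assume y: "y \<in> near r (T s x)"
      then have yZ: "y \<in> Z" and d: "N (\<lambda>i. y i - T s x i) \<le> real r" by (auto simp: near_def)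
      have "N y = N (\<lambda>i. (y i - T s x i) + T s x i)" by simp
      also have "\<dots> \<le> N (\<lambda>i. y i - T s x i) + N (T s x)"
        by (intro ell2_add(2) ell2_diff(1)) (use yZ Z_V TV[OF s xV] in auto)
      also have "\<dots> \<le> real r + real R" using d NT[OF s xV] x by (simp add: B_def)
      finally show "y \<in> {y \<in> X. E s x y}" using yZ d by (simp add: X_def B_def E_def)
    qed
    then have "card (near r (T s x)) \<le> card {y \<in> X. E s x y}" by (intro card_mono) (use finX in auto)
    then show ?thesis using near_ge[OF TV[OF s xV]] by linarith
  qed
  define Q where "Q s \<tau> \<longleftrightarrow> (\<forall>x\<in>X. \<exists>M\<subseteq>{..<D}. card M = card {y \<in> X. E s x y} \<and>
    (\<forall>i\<in>M. E s x (fst (\<tau> (x, i)))) \<and> (\<forall>i\<in>{..<D} - M. \<tau> (x, i) = (x, i)) \<and>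
    (\<forall>i<D. \<tau> (x, i) \<in> X \<times> {..<D} \<and> \<tau> (\<tau> (x, i)) = (x, i)))" for s \<tau>
  have "\<exists>\<tau>. Q s \<tau>" if "s < 5" for s
    unfolding Q_def by (rule slot_involution[OF finX symE[OF that] degE[OF that]])
  then have "\<forall>s. \<exists>\<tau>. s < 5 \<longrightarrow> Q s \<tau>" by blast
  from choice[OF this] obtain \<tau> where "\<forall>s. s < 5 \<longrightarrow> Q s (\<tau> s)" ..
  then have \<tau>: "\<exists>M\<subseteq>{..<D}. card M = card {y \<in> X. E s x y} \<and>
    (\<forall>i\<in>M. E s x (fst (\<tau> s (x, i)))) \<and> (\<forall>i\<in>{..<D} - M. \<tau> s (x, i) = (x, i)) \<and>
    (\<forall>i<D. \<tau> s (x, i) \<in> X \<times> {..<D} \<and> \<tau> s (\<tau> s (x, i)) = (x, i))" if "s < 5" "x \<in> X" for s x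
    using that unfolding Q_def by simp
  \<comment> \<open>A used slot moves x to within r of T x; an idle slot stays at x, whose distance
    from T x is at most twice the norm of x.\<close>
  have err: "(\<Sum>i<D. (N (\<lambda>j. fst (\<tau> s (x, i)) j - T s x j))\<^sup>2)
      \<le> real D * real r ^ 2 + (real D - real (card {y \<in> X. E s x y})) * (4 * (N x)\<^sup>2)"
    if s: "s < 5" and x: "x \<in> X" for s x
  proof -
    obtain M where M: "M \<subseteq> {..<D}" "card M = card {y \<in> X. E s x y}"
      "\<And>i. i \<in> M \<Longrightarrow> E s x (fst (\<tau> s (x, i)))" "\<And>i. i \<in> {..<D} - M \<Longrightarrow> \<tau> s (x, i) = (x, i)"
      using \<tau>[OF s x] by blast
    have finM: "finite M" using M(1) finite_subset by blast
    let ?f = "\<lambda>i. (N (\<lambda>j. fst (\<tau> s (x, i)) j - T s x j))\<^sup>2"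
    have "(\<Sum>i<D. ?f i) = (\<Sum>i\<in>{..<D} - M. ?f i) + (\<Sum>i\<in>M. ?f i)"
      by (rule sum.subset_diff[OF M(1)]) simp
    also have "(\<Sum>i\<in>M. ?f i) \<le> (\<Sum>i\<in>M. real r ^ 2)"
      by (intro sum_mono power_mono) (use M(3) in \<open>auto simp: E_def\<close>)
    also have "(\<Sum>i\<in>M. real r ^ 2) \<le> real D * real r ^ 2"
      using card_mono[OF _ M(1)] by (simp add: mult_right_mono)
    also have "(\<Sum>i\<in>{..<D} - M. ?f i) \<le> (\<Sum>i\<in>{..<D} - M. 4 * (N x)\<^sup>2)"
    proof (rule sum_mono)
      fix i assume i: "i \<in> {..<D} - M"
      have "N (\<lambda>j. x j - T s x j) \<le> N x + N (T s x)"
        by (rule ell2_diff(2)) (use XV[OF x] TV[OF s] in auto)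
      then have "N (\<lambda>j. x j - T s x j) \<le> 2 * N x" using NT[OF s XV[OF x]] by simp
      then have "(N (\<lambda>j. x j - T s x j))\<^sup>2 \<le> (2 * N x)\<^sup>2" by (rule power_mono) simp
      then show "?f i \<le> 4 * (N x)\<^sup>2" using M(4)[OF i] by (simp add: power_mult_distrib)
    qed
    also have "(\<Sum>i\<in>{..<D} - M. 4 * (N x)\<^sup>2) = (real D - real (card {y \<in> X. E s x y})) * (4 * (N x)\<^sup>2)"
    proof -
      have "real (card ({..<D} - M)) = real D - real (card {y \<in> X. E s x y})"
        using card_Diff_subset[OF finM M(1)] card_mono[OF _ M(1)] M(2) by (simp add: of_nat_diff)
      then show ?thesis by simp
    qed
    finally show ?thesis by simp
  qed
  have total: "(\<Sum>x\<in>X. \<Sum>i<D. (N (\<lambda>j. fst (\<tau> s (x, i)) j - T s x j))\<^sup>2) \<le> \<epsilon> * (real D * F (R + r))"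
    if s: "s < 5" for s
  proof -
    let ?c = "\<lambda>x. real D - real (card {y \<in> X. E s x y})"
    have BX: "B R \<subseteq> X" unfolding X_def by (rule B_mono) simp
    have "(\<Sum>x\<in>X. \<Sum>i<D. (N (\<lambda>j. fst (\<tau> s (x, i)) j - T s x j))\<^sup>2) \<le> (\<Sum>x\<in>X. real D * real r ^ 2 + ?c x * (4 * (N x)\<^sup>2))"
      by (rule sum_mono) (rule err[OF s])
    also have "\<dots> = real D * (real r ^ 2 * real (card X)) + (\<Sum>x\<in>X. ?c x * (4 * (N x)\<^sup>2))"
      by (simp add: sum.distrib)
    also have "(\<Sum>x\<in>X. ?c x * (4 * (N x)\<^sup>2)) = (\<Sum>x\<in>X - B R. ?c x * (4 * (N x)\<^sup>2)) + (\<Sum>x\<in>B R. ?c x * (4 * (N x)\<^sup>2))"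
      by (rule sum.subset_diff[OF BX finX])
    also have "(\<Sum>x\<in>B R. ?c x * (4 * (N x)\<^sup>2)) \<le> (\<Sum>x\<in>B R. (\<delta> * real D) * (4 * (N x)\<^sup>2))"
      by (intro sum_mono mult_right_mono) (use degE2[OF s] in \<open>auto simp: algebra_simps\<close>)
    also have "\<dots> = 4 * \<delta> * real D * F R" by (simp add: F_def sum_distrib_left mult_ac)
    also have "(\<Sum>x\<in>X - B R. ?c x * (4 * (N x)\<^sup>2)) \<le> (\<Sum>x\<in>X - B R. real D * (4 * (N x)\<^sup>2))"
      by (intro sum_mono mult_right_mono) auto
    also have "\<dots> = 4 * real D * (F (R + r) - F R)"
    proof -
      have "(\<Sum>x\<in>X - B R. (N x)\<^sup>2) = F (R + r) - F R"
        unfolding sum_diff[OF finX BX] by (simp add: F_def X_def)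
      then show ?thesis by (simp add: sum_distrib_left[symmetric] mult_ac)
    qed
    finally have "(\<Sum>x\<in>X. \<Sum>i<D. (N (\<lambda>j. fst (\<tau> s (x, i)) j - T s x j))\<^sup>2)
      \<le> real D * (real r ^ 2 * real (card X)) + (4 * real D * (F (R + r) - F R) + 4 * \<delta> * real D * F R)" by simp
    also have "\<dots> \<le> real D * (\<delta> * F (R + r)) + (4 * real D * (\<delta> * F (R + r)) + 4 * \<delta> * real D * F (R + r))"
    proof -
      have FRle: "F R \<le> F (R + r)" unfolding F_def
        by (rule sum_mono2) (use B_finite_card(1) B_mono[of R "R + r"] in auto)
      have "F (R + r) - F R \<le> \<delta> * F R" using R(2) by (simp add: algebra_simps)
      also have "\<dots> \<le> \<delta> * F (R + r)" using FRle \<delta> by simp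
      finally show ?thesis using small FRle \<delta> Dpos
        by (intro add_mono mult_left_mono) auto
    qed
    also have "\<dots> = \<epsilon> * (real D * F (R + r))" by (simp add: \<delta>_def algebra_simps)
    finally show ?thesis .
  qed
  define Y where "Y = X \<times> {..<D}"
  have finY: "finite Y" using finX by (simp add: Y_def)
  define n where "n = card Y"
  \<comment> \<open>Numbering the slots turns the involutions into an element of
    \<open>Sig n\<close>.\<close>
  obtain h where h: "bij_betw h {..<n} Y"
    using ex_bij_betw_nat_finite[OF finY] by (auto simp: n_def atLeast0LessThan)
  define hi where "hi = inv_into {..<n} h"
  have hi: "hi y < n" "h (hi y) = y" if "y \<in> Y" for y
    using that h bij_betw_inv_into_right[OF h that] inv_into_into[of y h "{..<n}"]
    by (auto simp: hi_def bij_betw_def)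
  have hh: "h k \<in> Y" "hi (h k) = k" if "k < n" for k
    using that h bij_betw_inv_into_left[OF h, of k] by (auto simp: hi_def bij_betw_def)
  define \<sigma> where "\<sigma> s k = (if s < 5 \<and> k < n then hi (\<tau> s (h k)) else k)" for s k
  define p where "p k = fst (h k)" for k
  have \<tau>Y: "\<tau> s y \<in> Y" "\<tau> s (\<tau> s y) = y" if s: "s < 5" and y: "y \<in> Y" for s y
  proof -
    obtain x i where "y = (x, i)" "x \<in> X" "i < D" using y by (auto simp: Y_def)
    then show "\<tau> s y \<in> Y" "\<tau> s (\<tau> s y) = y" using \<tau>[OF s, of x] by (auto simp: Y_def)
  qed
  have "\<sigma> \<in> Sig n"
  proof -
    have "\<sigma> s (\<sigma> s k) = k" for s k
      using \<tau>Y[of s "h k"] hh[of k] hi[of "\<tau> s (h k)"] by (auto simp: \<sigma>_def)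
    then show ?thesis by (auto simp: Sig_def \<sigma>_def)
  qed
  moreover have "p y \<in> V" if "y < n" for y
    using hh(1)[OF that] XV by (auto simp: p_def Y_def)
  moreover have "0 < real D * F (R + r)" using Dpos FRpos by simp
  moreover have "(\<Sum>y<n. (N (\<lambda>i. p (\<sigma> s y) i - T s (p y) i))\<^sup>2) \<le> \<epsilon> * (real D * F (R + r))" if s: "s < 5" for s
  proof -
    have "(\<Sum>y<n. (N (\<lambda>i. p (\<sigma> s y) i - T s (p y) i))\<^sup>2) = (\<Sum>y<n. (N (\<lambda>j. fst (\<tau> s (h y)) j - T s (fst (h y)) j))\<^sup>2)"
    proof (rule sum.cong[OF refl])
      fix y assume "y \<in> {..<n}"
      then have "p (\<sigma> s y) = fst (\<tau> s (h y))"
        using hi(2)[OF \<tau>Y(1)[OF s hh(1)]] s by (simp add: p_def \<sigma>_def)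
      then show "(N (\<lambda>i. p (\<sigma> s y) i - T s (p y) i))\<^sup>2 = (N (\<lambda>j. fst (\<tau> s (h y)) j - T s (fst (h y)) j))\<^sup>2"
        by (simp add: p_def)
    qed
    also have "\<dots> = (\<Sum>y\<in>Y. (N (\<lambda>j. fst (\<tau> s y) j - T s (fst y) j))\<^sup>2)"
      by (rule sum.reindex_bij_betw[OF h])
    also have "\<dots> = (\<Sum>x\<in>X. \<Sum>i<D. (N (\<lambda>j. fst (\<tau> s (x, i)) j - T s x j))\<^sup>2)"
      unfolding Y_def by (simp add: sum.cartesian_product case_prod_unfold)
    finally show ?thesis using total[OF s] by simp
  qed
  moreover have "(\<Sum>y<n. ell2_inner {..<e} \<xi> (p y) * ell2_inner {..<e} (p y) \<eta>)
        = of_real (real D * F (R + r) / real e) * ell2_inner {..<e} \<xi> \<eta>" if "\<xi> \<in> V" "\<eta> \<in> V" for \<xi> \<eta>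
  proof -
    let ?f = "\<lambda>x. ell2_inner {..<e} \<xi> x * ell2_inner {..<e} x \<eta>"
    have "(\<Sum>y<n. ?f (p y)) = (\<Sum>y\<in>Y. ?f (fst y))"
      unfolding p_def by (rule sum.reindex_bij_betw[OF h])
    also have "\<dots> = (\<Sum>x\<in>X. \<Sum>i<D. ?f x)"
      unfolding Y_def sum.cartesian_product by (simp add: case_prod_unfold)
    also have "\<dots> = of_nat D * (\<Sum>x\<in>X. ?f x)" by (simp add: sum_distrib_left)
    also have "\<dots> = of_nat D * (of_real (F (R + r) / real e) * ell2_inner {..<e} \<xi> \<eta>)"
      unfolding X_def by (simp only: frame[OF that])
    finally show ?thesis by simp
  qed
  ultimately show ?thesis by blast
qed

end


section \<open>Finite permutation representations approximate all representations\<close>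

text \<open>Gram-Schmidt, where a vector depending on the earlier ones adds no new basis
  vector.\<close>

lemma orthonormal_expansion:
  assumes "finite K" "\<And>k. k \<in> K \<Longrightarrow> x k \<in> ell2 I"
  shows "\<exists>(e::nat) b c. (\<forall>i<e. b i \<in> ell2 I) \<and>
    (\<forall>i<e. \<forall>j<e. ell2_inner I (b i) (b j) = (if i = j then 1 else 0)) \<and>
    (\<forall>k\<in>K. x k = (\<lambda>v. \<Sum>i<e. c k i * b i v))"
  using assms
proof (induction K rule: finite_induct)
  case empty
  show ?case by (rule exI[of _ 0]) simp
next
  case (insert a K)
  have pr: "x k \<in> ell2 I" if "k \<in> K" for k using insert.prems[of k] that by simp
  have "\<exists>(e::nat) b c. (\<forall>i<e. b i \<in> ell2 I) \<and>
    (\<forall>i<e. \<forall>j<e. ell2_inner I (b i) (b j) = (if i = j then 1 else 0)) \<and>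
    (\<forall>k\<in>K. x k = (\<lambda>v. \<Sum>i<e. c k i * b i v))"
    by (rule insert.IH) (rule pr)
  then obtain e :: nat and b c where A: "(\<forall>i<e. b i \<in> ell2 I) \<and>
    (\<forall>i<e. \<forall>j<e. ell2_inner I (b i) (b j) = (if i = j then 1 else 0)) \<and>
    (\<forall>k\<in>K. x k = (\<lambda>v. \<Sum>i<e. c k i * b i v))" by (elim exE)
  from A have b: "\<And>i. i < e \<Longrightarrow> b i \<in> ell2 I" by blast
  from A have on: "\<And>i j. i < e \<Longrightarrow> j < e \<Longrightarrow> ell2_inner I (b i) (b j) = (if i = j then 1 else 0)" by blast
  from A have ex: "\<And>k. k \<in> K \<Longrightarrow> x k = (\<lambda>v. \<Sum>i<e. c k i * b i v)" by blast
  have xa: "x a \<in> ell2 I" using insert by simp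
  define d where "d i = ell2_inner I (x a) (b i)" for i
  define P where "P = (\<lambda>v. \<Sum>i<e. d i * b i v)"
  have db: "(\<lambda>v. d i * b i v) \<in> ell2 I" if "i \<in> {..<e}" for i using b that by (auto intro!: ell2_scale(1))
  have P: "P \<in> ell2 I" unfolding P_def by (rule ell2_sum(1)[OF db])
  define u where "u = (\<lambda>v. x a v - P v)"
  have u: "u \<in> ell2 I" unfolding u_def by (rule ell2_diff(1)[OF xa P])
  have ub: "ell2_inner I u (b j) = 0" if j: "j < e" for j
  proof -
    have "ell2_inner I P (b j) = (\<Sum>i<e. d i * ell2_inner I (b i) (b j))"
      unfolding P_def by (subst ell2_inner_sum_left[OF db b[OF j]]) (simp_all add: ell2_inner_scale_left)
    also have "\<dots> = (\<Sum>i<e. if i = j then d i else 0)" by (rule sum.cong) (simp_all add: on j)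
    also have "\<dots> = d j" using j by simp
    finally show ?thesis unfolding u_def by (simp add: ell2_inner_diff_left[OF xa P b[OF j]] d_def)
  qed
  have notK: "k \<noteq> a" if "k \<in> K" for k using insert(2) that by auto
  show ?case
  proof (cases "u = (\<lambda>v. 0)")
    case True
    then have "x a = P" by (auto simp: u_def fun_eq_iff)
    then show ?thesis
      by (intro exI[of _ e] exI[of _ b] exI[of _ "\<lambda>k. if k = a then d else c k"])
        (use b on ex notK in \<open>auto simp: P_def\<close>)
  next
    case False
    define n where "n = ell2_norm I u"
    have n: "n \<noteq> 0" using False ell2_norm_eq_0[OF u] by (simp add: n_def)
    define b' where "b' i = (if i = e then (\<lambda>v. of_real (1 / n) * u v) else b i)" for i
    define c' where "c' k i = (if k = a then (if i = e then of_real n else d i) else if i = e then 0 else c k i)" for k i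
    have b'e: "b' i \<in> ell2 I" if "i < Suc e" for i
    proof (cases "i = e")
      case True
      show ?thesis unfolding b'_def if_P[OF True] by (rule ell2_scale(1)[OF u])
    next
      case False
      then show ?thesis using that b by (simp add: b'_def)
    qed
    have onb': "ell2_inner I (b' i) (b' j) = (if i = j then 1 else 0)" if ij: "i < Suc e" "j < Suc e" for i j
    proof -
      have bu: "ell2_inner I (b j) u = 0" if "j < e" for j
        using ub[OF that] ell2_inner_cnj[of I "b j" u] by simp
      have b'e_eq: "b' e = (\<lambda>v. of_real (1 / n) * u v)" unfolding b'_def if_P[OF refl] ..
      then have "ell2_inner I (b' e) (b' e) = of_real (1 / n) * (cnj (of_real (1 / n)) * of_real (n\<^sup>2))"
        by (simp only: ell2_inner_scale_left ell2_inner_scale_right ell2_inner_self[OF u] n_def)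
      also have "\<dots> = 1" using n by (simp add: power2_eq_square)
      finally have ee: "ell2_inner I (b' e) (b' e) = 1" .
      consider "i = e" "j = e" | "i = e" "j < e" | "i < e" "j = e" | "i < e" "j < e" using ij by linarith
      then show ?thesis
      proof cases
        case 1
        then show ?thesis using ee by simp
      next
        case 2
        have "ell2_inner I (b' e) (b j) = 0"
          unfolding b'e_eq ell2_inner_scale_left ub[OF 2(2)] by simp
        then show ?thesis using 2 by (simp add: b'_def)
      next
        case 3
        have "ell2_inner I (b i) (b' e) = 0"
          unfolding b'e_eq ell2_inner_scale_right bu[OF 3(1)] by simp
        then show ?thesis using 3 by (simp add: b'_def)
      next
        case 4
        then show ?thesis by (simp add: b'_def on)
      qed
    qed
    have exb': "x k = (\<lambda>v. \<Sum>i<Suc e. c' k i * b' i v)" if "k \<in> insert a K" for k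
    proof (cases "k = a")
      case True
      have "(\<Sum>i<Suc e. c' a i * b' i v) = P v + u v" for v
        using n by (simp add: c'_def b'_def P_def)
      then show ?thesis using True by (simp add: u_def)
    next
      case False
      then have "k \<in> K" using that by simp
      have "(\<Sum>i<Suc e. c' k i * b' i v) = (\<Sum>i<e. c k i * b i v)" for v
        using False by (simp add: c'_def b'_def)
      then show ?thesis using ex[OF \<open>k \<in> K\<close>] by simp
    qed
    show ?thesis
      by (intro exI[of _ "Suc e"] exI[of _ b'] exI[of _ c'] conjI allI impI ballI b'e onb' exb')
  qed
qed

text \<open>Moves a finite family into a space of finite dimension without changing its Gram matrix,
  the only information about it that is needed later.\<close>

lemma Gram_coordinates:
  assumes K: "finite K" "\<And>k. k \<in> K \<Longrightarrow> x k \<in> ell2 I"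
  shows "\<exists>e X. 0 < e \<and> (\<forall>k\<in>K. X k \<in> ell2 {..<e}) \<and>
    (\<forall>k\<in>K. \<forall>h\<in>K. ell2_inner {..<e::nat} (X k) (X h) = ell2_inner I (x k) (x h))"
proof -
  have "\<exists>(e::nat) b c. (\<forall>i<e. b i \<in> ell2 I) \<and>
    (\<forall>i<e. \<forall>j<e. ell2_inner I (b i) (b j) = (if i = j then 1 else 0)) \<and>
    (\<forall>k\<in>K. x k = (\<lambda>v. \<Sum>i<e. c k i * b i v))"
    by (rule orthonormal_expansion) (use K in auto)
  then obtain e :: nat and b c where A: "(\<forall>i<e. b i \<in> ell2 I) \<and>
    (\<forall>i<e. \<forall>j<e. ell2_inner I (b i) (b j) = (if i = j then 1 else 0)) \<and>
    (\<forall>k\<in>K. x k = (\<lambda>v. \<Sum>i<e. c k i * b i v))" by (elim exE)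
  from A have b: "\<And>i. i < e \<Longrightarrow> b i \<in> ell2 I" by blast
  from A have on: "\<And>i j. i < e \<Longrightarrow> j < e \<Longrightarrow> ell2_inner I (b i) (b j) = (if i = j then 1 else 0)" by blast
  from A have ex: "\<And>k. k \<in> K \<Longrightarrow> x k = (\<lambda>v. \<Sum>i<e. c k i * b i v)" by blast
  \<comment> \<open>The coordinates will be placed in dimension \<open>Suc e\<close>: the idle
    coordinate makes the dimension positive, as \<open>lattice\<close> requires.\<close>
  define X where "X k i = (if i < e then c k i else 0)" for k i
  have XV: "X k \<in> ell2 {..<Suc e}" for k
    by (rule ell2_finite(1)[of "{..<e}"]) (auto simp: X_def)
  have "ell2_inner {..<Suc e} (X k) (X h) = ell2_inner I (x k) (x h)" if "k \<in> K" "h \<in> K" for k h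
  proof -
    have cb: "(\<lambda>v. c k i * b i v) \<in> ell2 I" if "i \<in> {..<e}" for k i
      using b that by (auto intro!: ell2_scale(1))
    have "ell2_inner I (x k) (x h) = (\<Sum>i<e. \<Sum>j<e. ell2_inner I (\<lambda>v. c k i * b i v) (\<lambda>v. c h j * b j v))"
    proof -
      have s: "(\<lambda>v. \<Sum>i<e. c h i * b i v) \<in> ell2 I" by (rule ell2_sum(1)) (rule cb)
      have "ell2_inner I (\<lambda>v. \<Sum>i<e. c k i * b i v) (\<lambda>v. \<Sum>i<e. c h i * b i v)
        = (\<Sum>i<e. ell2_inner I (\<lambda>v. c k i * b i v) (\<lambda>v. \<Sum>i<e. c h i * b i v))"
        by (rule ell2_inner_sum_left) (rule cb, assumption, rule s)
      also have "\<dots> = (\<Sum>i<e. \<Sum>j<e. ell2_inner I (\<lambda>v. c k i * b i v) (\<lambda>v. c h j * b j v))"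
        by (rule sum.cong[OF refl], rule ell2_inner_sum_right) (rule cb, assumption)+
      finally show ?thesis using ex[OF that(1)] ex[OF that(2)] by simp
    qed
    also have "\<dots> = (\<Sum>i<e. \<Sum>j<e. if j = i then c k i * cnj (c h i) else 0)"
      by (intro sum.cong refl) (simp add: ell2_inner_scale_left ell2_inner_scale_right on)
    also have "\<dots> = (\<Sum>i<e. c k i * cnj (c h i))" by simp
    also have "\<dots> = ell2_inner {..<Suc e} (X k) (X h)"
      by (simp add: ell2_inner_def X_def)
    finally show ?thesis by simp
  qed
  then show ?thesis using XV by (intro exI[of _ "Suc e"] exI[of _ X]) auto
qed

section \<open>Self-adjoint involutions with prescribed values\<close>

definition reflection :: "'i set \<Rightarrow> 'i oper \<Rightarrow> bool" where
  "reflection I T \<longleftrightarrow> (\<forall>x\<in>ell2 I. T x \<in> ell2 I \<and> T (T x) = x) \<and>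
     (\<forall>x\<in>ell2 I. \<forall>y\<in>ell2 I. T (\<lambda>i. x i + y i) = (\<lambda>i. T x i + T y i)) \<and>
     (\<forall>x\<in>ell2 I. \<forall>c. T (\<lambda>i. c * x i) = (\<lambda>i. c * T x i)) \<and>
     (\<forall>x\<in>ell2 I. \<forall>y\<in>ell2 I. ell2_inner I (T x) y = ell2_inner I x (T y))"

text \<open>The reflection is built one vector at a time, without projections. If T is -1 on the
  span of W and 1 on its complement, then u = w + T w is twice the part of w orthogonal to W, and T
  is composed with the reflection in u.\<close>

lemma reflection_in_span:
  assumes "finite W" "W \<subseteq> ell2 I"
  shows "\<exists>T. reflection I T \<and> (\<forall>w\<in>W. T w = (\<lambda>i. - w i)) \<and>
    (\<forall>u\<in>ell2 I. (\<forall>w\<in>W. ell2_inner I u w = 0) \<longrightarrow> T u = u)"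
  using assms
proof (induction W rule: finite_induct)
  case empty
  show ?case by (rule exI[of _ "\<lambda>x. x"]) (simp add: reflection_def)
next
  case (insert w W)
  then have "W \<subseteq> ell2 I" by blast
  from insert.IH[OF this] obtain T where A: "reflection I T \<and> (\<forall>w\<in>W. T w = (\<lambda>i. - w i)) \<and>
    (\<forall>u\<in>ell2 I. (\<forall>w\<in>W. ell2_inner I u w = 0) \<longrightarrow> T u = u)" by (elim exE)
  from A have R: "reflection I T" by blast
  from A have TW: "\<And>w. w \<in> W \<Longrightarrow> T w = (\<lambda>i. - w i)" by blast
  from A have Tu: "\<And>u. u \<in> ell2 I \<Longrightarrow> (\<And>w. w \<in> W \<Longrightarrow> ell2_inner I u w = 0) \<Longrightarrow> T u = u" by blast
  have T: "\<And>x. x \<in> ell2 I \<Longrightarrow> T x \<in> ell2 I" "\<And>x. x \<in> ell2 I \<Longrightarrow> T (T x) = x"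
    "\<And>x y. x \<in> ell2 I \<Longrightarrow> y \<in> ell2 I \<Longrightarrow> T (\<lambda>i. x i + y i) = (\<lambda>i. T x i + T y i)"
    "\<And>x c. x \<in> ell2 I \<Longrightarrow> T (\<lambda>i. c * x i) = (\<lambda>i. c * T x i)"
    "\<And>x y. x \<in> ell2 I \<Longrightarrow> y \<in> ell2 I \<Longrightarrow> ell2_inner I (T x) y = ell2_inner I x (T y)"
    using R by (simp_all add: reflection_def)
  have w: "w \<in> ell2 I" and WV: "W \<subseteq> ell2 I" using insert by auto
  define u where "u = (\<lambda>i. w i + T w i)"
  have u: "u \<in> ell2 I" unfolding u_def by (rule ell2_add(1)[OF w T(1)[OF w]])
  have Tu': "T u = u" unfolding u_def by (simp add: T(3)[OF w T(1)[OF w]] T(2)[OF w] add.commute)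
  show ?case
  proof (cases "u = (\<lambda>i. 0)")
    case True
    then have "T w i = - w i" for i using fun_cong[OF True[unfolded u_def], of i] by (simp add: eq_neg_iff_add_eq_0 add.commute)
    then have "T w = (\<lambda>i. - w i)" by auto
    with R TW Tu show ?thesis by (intro exI[of _ T] conjI ballI impI) (simp, blast, blast)
  next
    case False
    define n where "n = complex_of_real ((ell2_norm I u)\<^sup>2)"
    have n: "n \<noteq> 0" using False ell2_norm_eq_0[OF u] by (simp add: n_def)
    have uu: "ell2_inner I u u = n" unfolding n_def by (rule ell2_inner_self[OF u])
    define a where "a x = - 2 * ell2_inner I x u / n" for x
    define T' where "T' x = (\<lambda>i. T x i + a x * u i)" for x
    have au: "(\<lambda>i. c * u i) \<in> ell2 I" for c by (rule ell2_scale(1)[OF u])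
    have T'V: "T' x \<in> ell2 I" if "x \<in> ell2 I" for x
      unfolding T'_def by (rule ell2_add(1)[OF T(1)[OF that] au])
    have aT': "a (T' x) = - a x" if x: "x \<in> ell2 I" for x
    proof -
      have "ell2_inner I (T' x) u = ell2_inner I (T x) u + a x * n"
        unfolding T'_def ell2_inner_add_left[OF T(1)[OF x] au u] ell2_inner_scale_left uu ..
      also have "ell2_inner I (T x) u = ell2_inner I x u" using T(5)[OF x u] Tu' by simp
      finally show ?thesis using n by (simp add: a_def field_simps)
    qed
    have R': "reflection I T'"
      unfolding reflection_def
    proof (intro conjI ballI allI)
      fix x assume x: "x \<in> ell2 I"
      show "T' x \<in> ell2 I" by (rule T'V[OF x])
      have "T (T' x) = (\<lambda>i. x i + a x * u i)"
        unfolding T'_def T(3)[OF T(1)[OF x] au] T(2)[OF x] T(4)[OF u] Tu' ..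
      then show "T' (T' x) = x"
        unfolding T'_def[of "T' x"] aT'[OF x] by simp
      show "T' (\<lambda>i. c * x i) = (\<lambda>i. c * T' x i)" for c
        unfolding T'_def a_def T(4)[OF x] ell2_inner_scale_left by (simp add: algebra_simps)
      fix y assume y: "y \<in> ell2 I"
      show "T' (\<lambda>i. x i + y i) = (\<lambda>i. T' x i + T' y i)"
        unfolding T'_def a_def T(3)[OF x y] ell2_inner_add_left[OF x y u]
        by (simp add: fun_eq_iff algebra_simps add_divide_distrib diff_divide_distrib)
      have nr: "cnj n = n" by (simp add: n_def)
      have "ell2_inner I (T' x) y = ell2_inner I (T x) y + a x * ell2_inner I u y"
        unfolding T'_def ell2_inner_add_left[OF T(1)[OF x] au y] ell2_inner_scale_left ..
      also have "\<dots> = ell2_inner I x (T y) + cnj (a y) * ell2_inner I x u"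
        using T(5)[OF x y] ell2_inner_cnj[of I u y] by (simp add: a_def nr)
      also have "\<dots> = ell2_inner I x (T' y)"
        unfolding T'_def ell2_inner_add_right[OF T(1)[OF y] au x] ell2_inner_scale_right ..
      finally show "ell2_inner I (T' x) y = ell2_inner I x (T' y)" .
    qed
    have W': "T' v = (\<lambda>i. - v i)" if "v \<in> insert w W" for v
    proof (cases "v = w")
      case True
      have "ell2_inner I (T w) u = ell2_inner I w u" using T(5)[OF w u] Tu' by simp
      moreover have "n = ell2_inner I w u + ell2_inner I (T w) u"
        using ell2_inner_add_left[OF w T(1)[OF w] u] uu by (simp add: u_def)
      ultimately have "n = 2 * ell2_inner I w u" by simp
      then have "a w = -1" using n by (simp add: a_def)
      then show ?thesis unfolding True T'_def by (simp add: u_def)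
    next
      case False
      then have vW: "v \<in> W" using that by simp
      then have v: "v \<in> ell2 I" using WV by auto
      have "ell2_inner I v u = ell2_inner I (\<lambda>i. -1 * v i) u"
        using T(5)[OF v u] Tu' TW[OF vW] by simp
      also have "\<dots> = - ell2_inner I v u" unfolding ell2_inner_scale_left by simp
      finally have "ell2_inner I v u = 0" by simp
      then show ?thesis unfolding T'_def a_def TW[OF vW] by simp
    qed
    have P': "T' y = y" if y: "y \<in> ell2 I" and yw: "\<And>v. v \<in> insert w W \<Longrightarrow> ell2_inner I y v = 0" for y
    proof -
      have Ty: "T y = y" by (rule Tu[OF y]) (use yw in simp)
      have "ell2_inner I y u = ell2_inner I y w + ell2_inner I (T y) w"
        unfolding u_def using ell2_inner_add_right[OF w T(1)[OF w] y] T(5)[OF y w] by simp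
      also have "\<dots> = 0" using Ty yw[of w] by simp
      finally show ?thesis unfolding T'_def a_def Ty by simp
    qed
    show ?thesis by (intro exI[of _ T'] conjI ballI impI R' W' P') blast+
  qed
qed


lemma reflectionD:
  assumes "reflection I T" "x \<in> ell2 I"
  shows "T x \<in> ell2 I" "T (T x) = x" "T (\<lambda>i. c * x i) = (\<lambda>i. c * T x i)"
    and "y \<in> ell2 I \<Longrightarrow> T (\<lambda>i. x i + y i) = (\<lambda>i. T x i + T y i)"
    and "y \<in> ell2 I \<Longrightarrow> ell2_inner I (T x) y = ell2_inner I x (T y)"
  using assms by (simp_all add: reflection_def)

lemma reflection_norm:
  assumes "reflection I T" "x \<in> ell2 I"
  shows "ell2_norm I (T x) = ell2_norm I x"
proof -
  have TV: "T x \<in> ell2 I" and TT: "T (T x) = x" using assms by (simp_all add: reflection_def)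
  have "ell2_inner I (T x) (T x) = ell2_inner I x (T (T x))"
    using assms TV by (simp add: reflection_def)
  then have "(ell2_norm I (T x))\<^sup>2 = (ell2_norm I x)\<^sup>2"
    unfolding TT ell2_inner_self[OF TV] ell2_inner_self[OF assms(2)] of_real_eq_iff .
  then show ?thesis by simp
qed

lemma ell2_norm_sum_sq:
  assumes z: "\<And>k. k \<in> K \<Longrightarrow> z k \<in> ell2 H"
  shows "of_real ((ell2_norm H (\<lambda>v. \<Sum>k\<in>K. f k * z k v))\<^sup>2)
      = (\<Sum>k\<in>K. \<Sum>h\<in>K. f k * (cnj (f h) * ell2_inner H (z k) (z h)))"
proof -
  have fz: "(\<lambda>v. f k * z k v) \<in> ell2 H" if "k \<in> K" for k by (rule ell2_scale(1)[OF z[OF that]])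
  have s: "(\<lambda>v. \<Sum>k\<in>K. f k * z k v) \<in> ell2 H" by (rule ell2_sum(1)[OF fz])
  have "ell2_inner H (\<lambda>v. \<Sum>k\<in>K. f k * z k v) (\<lambda>v. \<Sum>k\<in>K. f k * z k v)
      = (\<Sum>k\<in>K. ell2_inner H (\<lambda>v. f k * z k v) (\<lambda>v. \<Sum>k\<in>K. f k * z k v))"
    by (rule ell2_inner_sum_left[OF fz s])
  also have "\<dots> = (\<Sum>k\<in>K. \<Sum>h\<in>K. ell2_inner H (\<lambda>v. f k * z k v) (\<lambda>v. f h * z h v))"
    by (rule sum.cong[OF refl], rule ell2_inner_sum_right) (rule fz, assumption)+
  finally show ?thesis
    unfolding ell2_inner_self[OF s] ell2_inner_scale_left ell2_inner_scale_right .
qed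

lemma ell2_norm_Gram:
  assumes "\<And>k. k \<in> K \<Longrightarrow> x k \<in> ell2 I" "\<And>k. k \<in> K \<Longrightarrow> y k \<in> ell2 J"
    and "\<And>k h. k \<in> K \<Longrightarrow> h \<in> K \<Longrightarrow> ell2_inner I (x k) (x h) = ell2_inner J (y k) (y h)"
  shows "ell2_norm I (\<lambda>v. \<Sum>k\<in>K. f k * x k v) = ell2_norm J (\<lambda>v. \<Sum>k\<in>K. f k * y k v)"
proof -
  have "complex_of_real ((ell2_norm I (\<lambda>v. \<Sum>k\<in>K. f k * x k v))\<^sup>2)
      = (\<Sum>k\<in>K. \<Sum>h\<in>K. f k * (cnj (f h) * ell2_inner I (x k) (x h)))"
    by (rule ell2_norm_sum_sq) (rule assms(1))
  also have "\<dots> = (\<Sum>k\<in>K. \<Sum>h\<in>K. f k * (cnj (f h) * ell2_inner J (y k) (y h)))"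
    by (intro sum.cong refl) (simp add: assms(3))
  also have "\<dots> = of_real ((ell2_norm J (\<lambda>v. \<Sum>k\<in>K. f k * y k v))\<^sup>2)"
    by (rule ell2_norm_sum_sq[symmetric]) (rule assms(2))
  finally have "complex_of_real ((ell2_norm I (\<lambda>v. \<Sum>k\<in>K. f k * x k v))\<^sup>2)
      = of_real ((ell2_norm J (\<lambda>v. \<Sum>k\<in>K. f k * y k v))\<^sup>2)" .
  then show ?thesis unfolding of_real_eq_iff by simp
qed

lemma ell2_norm_lessThan: "ell2_norm {..<n::nat} h = sqrt (\<Sum>y<n. (cmod (h y))\<^sup>2)"
  by (simp add: ell2_norm_def)

lemma ell2_norm_Sig:
  assumes "\<sigma> \<in> Sig n"
  shows "ell2_norm {..<n} (\<lambda>y. h (\<sigma> s y)) = ell2_norm {..<n} h"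
proof -
  have "(\<Sum>y<n. (cmod (h (\<sigma> s y)))\<^sup>2) = (\<Sum>y<n. (cmod (h y))\<^sup>2)"
    by (rule sum.reindex_bij_witness[of _ "\<sigma> s" "\<sigma> s"])
      (use assms Sig_less[OF assms] in \<open>auto simp: Sig_def\<close>)
  then show ?thesis by (simp add: ell2_norm_lessThan)
qed

lemma finite_Red_length: "finite {w \<in> Red. length w \<le> L}"
  by (rule finite_subset[OF _ finite_lists_length_le[of "{..<5}" L]]) (auto dest: Red_set)

text \<open>By the invariance of the Gram matrix the differences of X w and X (s w) are orthogonal
  to all their sums. The reflection that negates the differences fixes the sums, and so exchanges X
  w with X (s w).\<close>

lemma push_equivariant_reflections:
  assumes ne: "finite Bl" "Bl \<subseteq> Red" "\<And>w. w \<in> Bl \<Longrightarrow> X w \<in> ell2 I"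
    and inv: "\<And>g h. g \<in> Bl \<Longrightarrow> h \<in> Bl \<Longrightarrow> push s g \<in> Bl \<Longrightarrow> push s h \<in> Bl \<Longrightarrow>
      ell2_inner I (X (push s g)) (X (push s h)) = ell2_inner I (X g) (X h)"
  shows "\<exists>T. reflection I T \<and> (\<forall>w\<in>Bl. push s w \<in> Bl \<longrightarrow> T (X w) = X (push s w))"
proof -
  define W where "W = (\<lambda>w i. X w i - X (push s w) i) ` {w \<in> Bl. push s w \<in> Bl}"
  have W: "finite W" "W \<subseteq> ell2 I" using ne by (auto simp: W_def intro!: ell2_diff(1))
  obtain T where A: "reflection I T \<and> (\<forall>w\<in>W. T w = (\<lambda>i. - w i)) \<and>
    (\<forall>u\<in>ell2 I. (\<forall>w\<in>W. ell2_inner I u w = 0) \<longrightarrow> T u = u)"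
    using reflection_in_span[OF W] by (elim exE)
  then have R: "reflection I T" by blast
  have "T (X w) = X (push s w)" if w: "w \<in> Bl" and sw: "push s w \<in> Bl" for w
  proof -
    define m where "m = (\<lambda>i. X w i - X (push s w) i)"
    define p where "p = (\<lambda>i. X w i + X (push s w) i)"
    note Xw = ne(3)[OF w] and Xs = ne(3)[OF sw]
    have mV: "m \<in> ell2 I" unfolding m_def by (rule ell2_diff(1)[OF Xw Xs])
    have pV: "p \<in> ell2 I" unfolding p_def by (rule ell2_add(1)[OF Xw Xs])
    have "m \<in> W" using w sw by (auto simp: W_def m_def)
    then have Tm: "T m = (\<lambda>i. - m i)" using A by blast
    have "ell2_inner I p v = 0" if "v \<in> W" for v
    proof -
      obtain h where h: "h \<in> Bl" "push s h \<in> Bl" and v: "v = (\<lambda>i. X h i - X (push s h) i)"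
        using \<open>v \<in> W\<close> by (auto simp: W_def)
      note Xh = ne(3)[OF h(1)] and Xsh = ne(3)[OF h(2)]
      have hR: "h \<in> Red" using h ne by auto
      have "ell2_inner I (X (push s w)) (X h) = ell2_inner I (X w) (X (push s h))"
        using inv[OF w h(2) sw] h(1) by (simp add: push_push[OF hR])
      moreover have "ell2_inner I (X (push s w)) (X (push s h)) = ell2_inner I (X w) (X h)"
        by (rule inv[OF w h(1) sw h(2)])
      ultimately show ?thesis
        unfolding p_def v ell2_inner_add_left[OF Xw Xs ell2_diff(1)[OF Xh Xsh]]
          ell2_inner_diff_right[OF Xh Xsh Xw] ell2_inner_diff_right[OF Xh Xsh Xs] by simp
    qed
    then have Tp: "T p = p" using A pV by blast
    have "T (\<lambda>i. (1/2) * (p i + m i)) = (\<lambda>i. (1/2) * T (\<lambda>i. p i + m i) i)"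
      by (rule reflectionD(3)[OF R ell2_add(1)[OF pV mV]])
    moreover have "T (\<lambda>i. p i + m i) = (\<lambda>i. T p i + T m i)"
      by (rule reflectionD(4)[OF R pV mV])
    moreover have "(\<lambda>i. (1/2) * (p i + m i)) = X w" by (simp add: p_def m_def fun_eq_iff)
    ultimately have "T (X w) = (\<lambda>i. (1/2) * (T p i + T m i))" by simp
    also have "\<dots> = X (push s w)" unfolding Tp Tm by (simp add: p_def m_def fun_eq_iff)
    finally show ?thesis .
  qed
  with R show ?thesis by blast
qed

text \<open>Cut the orbit \<open>\<xi>\<close> down to a ball of words, realise the generators by reflections of a
  finite-dimensional space, and transport the orbit to \<open>\<ell>\<^sup>2\<close> of a finite set along an
  almost equivariant tight frame.\<close>

theorem finite_approximation:
  fixes \<xi> :: "nat list \<Rightarrow> 'i \<Rightarrow> complex" and f :: "nat list \<Rightarrow> complex"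
  assumes A: "finite A" "A \<subseteq> Red"
    and \<xi>: "\<And>g. g \<in> Red \<Longrightarrow> \<xi> g \<in> ell2 I"
    and inv: "\<And>s g h. s < 5 \<Longrightarrow> g \<in> Red \<Longrightarrow> h \<in> Red \<Longrightarrow>
      ell2_inner I (\<xi> (push s g)) (\<xi> (push s h)) = ell2_inner I (\<xi> g) (\<xi> h)"
    and perm: "\<And>n \<sigma> \<zeta>. \<sigma> \<in> Sig n \<Longrightarrow> \<zeta> \<in> ell2 {..<n} \<Longrightarrow>
      ell2_norm {..<n} (\<lambda>y. \<Sum>g\<in>A. f g * \<zeta> (foldr \<sigma> (rev g) y)) \<le> r * ell2_norm {..<n} \<zeta>"
  shows "ell2_norm I (\<lambda>v. \<Sum>g\<in>A. f g * \<xi> g v) \<le> r * ell2_norm I (\<xi> [])"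
proof (rule field_le_epsilon)
  fix \<delta> :: real assume \<delta>: "0 < \<delta>"
  define L where "L = (\<Sum>g\<in>A. length g)"
  have AL: "length g \<le> L" if "g \<in> A" for g
    unfolding L_def by (rule member_le_sum[OF that]) (use A in auto)
  \<comment> \<open>A ball of reduced words contains the suffixes of its members, so building up a
    word of \<open>A\<close> letter by letter never leaves it.\<close>
  define Bl where "Bl = {w \<in> Red. length w \<le> L}"
  have Bl: "finite Bl" "Bl \<subseteq> Red" "A \<subseteq> Bl" "[] \<in> Bl"
    using A AL finite_Red_length[of L] by (auto simp: Bl_def)
  have \<xi>B: "\<xi> k \<in> ell2 I" if "k \<in> Bl" for k using \<xi> that Bl by auto
  obtain e X where A0: "0 < e \<and> (\<forall>k\<in>Bl. X k \<in> ell2 {..<e}) \<and>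
    (\<forall>k\<in>Bl. \<forall>h\<in>Bl. ell2_inner {..<e::nat} (X k) (X h) = ell2_inner I (\<xi> k) (\<xi> h))"
    using Gram_coordinates[of Bl \<xi> I] Bl(1) \<xi>B by blast
  then have e: "0 < e" and X: "\<And>k. k \<in> Bl \<Longrightarrow> X k \<in> ell2 {..<e}" by auto
  have XX: "ell2_inner {..<e} (X k) (X h) = ell2_inner I (\<xi> k) (\<xi> h)" if "k \<in> Bl" "h \<in> Bl" for k h
    using A0 that by blast
  interpret lattice e by unfold_locales (rule e)
  define b where "b = ell2_norm I (\<xi> [])"
  have \<xi>b: "ell2_norm I (\<xi> g) = b" if "g \<in> Red" for g
    using that
  proof (induction g)
    case Nil
    then show ?case by (simp add: b_def)
  next
    case (Cons s g)
    then have s: "s < 5" and g: "g \<in> Red" by (simp_all add: Red_Cons)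
    have "complex_of_real ((ell2_norm I (\<xi> (s # g)))\<^sup>2) = of_real ((ell2_norm I (\<xi> g))\<^sup>2)"
      using inv[OF s g g] unfolding push_hd[OF Cons.prems] ell2_inner_self[OF \<xi>[OF Cons.prems]]
        ell2_inner_self[OF \<xi>[OF g]] .
    then have "ell2_norm I (\<xi> (s # g)) = ell2_norm I (\<xi> g)" unfolding of_real_eq_iff by simp
    then show ?case using Cons.IH[OF g] by simp
  qed
  have Xb: "N (X g) = b" if "g \<in> Bl" for g
  proof -
    have "complex_of_real ((N (X g))\<^sup>2) = of_real ((ell2_norm I (\<xi> g))\<^sup>2)"
      using XX[OF that that] unfolding ell2_inner_self[OF X[OF that]] ell2_inner_self[OF \<xi>B[OF that]] .
    then have "N (X g) = ell2_norm I (\<xi> g)" unfolding of_real_eq_iff by simp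
    moreover have "g \<in> Red" using that Bl by auto
    ultimately show ?thesis using \<xi>b by simp
  qed
  have b0: "0 \<le> b" by (simp add: b_def)
  have "\<forall>s. \<exists>T. s < 5 \<longrightarrow> reflection {..<e} T \<and> (\<forall>w\<in>Bl. push s w \<in> Bl \<longrightarrow> T (X w) = X (push s w))"
  proof
    fix s :: nat
    have "\<exists>T. reflection {..<e} T \<and> (\<forall>w\<in>Bl. push s w \<in> Bl \<longrightarrow> T (X w) = X (push s w))" if s: "s < 5"
    proof (rule push_equivariant_reflections[OF Bl(1,2) X])
      fix g h assume gh: "g \<in> Bl" "h \<in> Bl" "push s g \<in> Bl" "push s h \<in> Bl"
      then have "g \<in> Red" "h \<in> Red" using Bl(2) by auto
      then show "ell2_inner {..<e} (X (push s g)) (X (push s h)) = ell2_inner {..<e} (X g) (X h)"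
        using gh inv[OF s] by (simp add: XX)
    qed
    then show "\<exists>T. s < 5 \<longrightarrow> reflection {..<e} T \<and> (\<forall>w\<in>Bl. push s w \<in> Bl \<longrightarrow> T (X w) = X (push s w))"
      by blast
  qed
  from choice[OF this] obtain T where T: "\<forall>s. s < 5 \<longrightarrow> reflection {..<e} (T s) \<and>
    (\<forall>w\<in>Bl. push s w \<in> Bl \<longrightarrow> T s (X w) = X (push s w))" by (elim exE)
  have R: "reflection {..<e} (T s)" if "s < 5" for s using T that by blast
  have TX: "T s (X w) = X (push s w)" if "s < 5" "w \<in> Bl" "push s w \<in> Bl" for s w using T that by blast
  have TV: "T s x \<in> V" and TT: "T s (T s x) = x" if "s < 5" "x \<in> V" for s x
    by (rule reflectionD(1)[OF R[OF that(1)] that(2)], rule reflectionD(2)[OF R[OF that(1)] that(2)])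
  have Td: "T s (\<lambda>i. x i - y i) = (\<lambda>i. T s x i - T s y i)" if s: "s < 5" and x: "x \<in> V" and y: "y \<in> V" for s x y
  proof -
    have y': "(\<lambda>i. - 1 * y i) \<in> V" by (rule ell2_scale(1)[OF y])
    have "T s (\<lambda>i. x i + - 1 * y i) = (\<lambda>i. T s x i + T s (\<lambda>i. - 1 * y i) i)"
      by (rule reflectionD(4)[OF R[OF s] x y'])
    moreover have "T s (\<lambda>i. - 1 * y i) = (\<lambda>i. - 1 * T s y i)"
      by (rule reflectionD(3)[OF R[OF s] y])
    ultimately show ?thesis by simp
  qed
  define C where "C = (\<Sum>g\<in>A. cmod (f g)) * (real L * b) + 1"
  have C: "0 < C" using b0 by (simp add: C_def sum_nonneg add_nonneg_pos)
  \<comment> \<open>Makes sqrt(\<epsilon> \<Phi>) equal to q \<delta> / C, where q is the scale of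
    the frame below and C bounds the number of accumulated errors with their weights.\<close>
  define \<epsilon> where "\<epsilon> = (\<delta> / C)\<^sup>2 / e"
  have \<epsilon>: "0 < \<epsilon>" using \<delta> C e by (simp add: \<epsilon>_def)
  obtain n \<sigma> p \<Phi> where A1: "\<sigma> \<in> Sig n \<and> (\<forall>y<n. p y \<in> V) \<and> \<Phi> > 0 \<and>
    (\<forall>s<5. (\<Sum>y<n. (N (\<lambda>i. p (\<sigma> s y) i - T s (p y) i))\<^sup>2) \<le> \<epsilon> * \<Phi>) \<and>
    (\<forall>\<xi>\<in>V. \<forall>\<eta>\<in>V. (\<Sum>y<n. ell2_inner {..<e} \<xi> (p y) * ell2_inner {..<e} (p y) \<eta>)
        = of_real (\<Phi> / real e) * ell2_inner {..<e} \<xi> \<eta>)"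
  proof -
    have "\<exists>n \<sigma> p \<Phi>. \<sigma> \<in> Sig n \<and> (\<forall>y<n. p y \<in> V) \<and> \<Phi> > 0 \<and>
    (\<forall>s<5. (\<Sum>y<n. (N (\<lambda>i. p (\<sigma> s y) i - T s (p y) i))\<^sup>2) \<le> \<epsilon> * \<Phi>) \<and>
    (\<forall>\<xi>\<in>V. \<forall>\<eta>\<in>V. (\<Sum>y<n. ell2_inner {..<e} \<xi> (p y) * ell2_inner {..<e} (p y) \<eta>)
        = of_real (\<Phi> / real e) * ell2_inner {..<e} \<xi> \<eta>)"
    proof (rule approx_involutions[OF TV TT _ _ \<epsilon>])
      show "N (T s x) = N x" if "s < 5" "x \<in> V" for s x by (rule reflection_norm[OF R[OF that(1)] that(2)])
      show "N (\<lambda>i. T s x i - T s y i) = N (\<lambda>i. x i - y i)" if "s < 5" "x \<in> V" "y \<in> V" for s x y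
        unfolding Td[OF that, symmetric] by (rule reflection_norm[OF R[OF that(1)] ell2_diff(1)[OF that(2,3)]])
    qed
    then show thesis using that by (elim exE)
  qed
  from A1 have \<sigma>: "\<sigma> \<in> Sig n" and p: "\<And>y. y < n \<Longrightarrow> p y \<in> V" and \<Phi>: "\<Phi> > 0"
    and near: "\<And>s. s < 5 \<Longrightarrow> (\<Sum>y<n. (N (\<lambda>i. p (\<sigma> s y) i - T s (p y) i))\<^sup>2) \<le> \<epsilon> * \<Phi>" by auto
  from A1 have frame: "(\<Sum>y<n. ell2_inner {..<e} x (p y) * ell2_inner {..<e} (p y) z)
        = of_real (\<Phi> / real e) * ell2_inner {..<e} x z" if "x \<in> V" "z \<in> V" for x z using that by blast
  define q where "q = sqrt (\<Phi> / real e)"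
  have q: "0 < q" using \<Phi> e by (simp add: q_def)
  \<comment> \<open>The analysis map of the frame, which is \<open>q\<close> times an isometry into
    l2 of the finite set.\<close>
  define c where "c x y = (if y < n then ell2_inner {..<e} x (p y) else 0)" for x y
  let ?M = "ell2_norm {..<n}"
  have mem: "h \<in> ell2 {..<n}" if "\<And>y. n \<le> y \<Longrightarrow> h y = 0" for h
    by (rule ell2_finite(1)[of "{..<n}"]) (use that in auto)
  have c0: "c x y = 0" if "n \<le> y" for x y using that by (simp add: c_def)
  have cnorm: "?M (c x) = q * N x" if x: "x \<in> V" for x
  proof -
    have "complex_of_real (\<Sum>y<n. (cmod (c x y))\<^sup>2)
      = (\<Sum>y<n. ell2_inner {..<e} x (p y) * ell2_inner {..<e} (p y) x)"
      unfolding of_real_sum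
    proof (rule sum.cong[OF refl])
      fix y assume y: "y \<in> {..<n}"
      have "ell2_inner {..<e} (p y) x = cnj (ell2_inner {..<e} x (p y))" by (rule ell2_inner_cnj)
      then show "complex_of_real ((cmod (c x y))\<^sup>2) = ell2_inner {..<e} x (p y) * ell2_inner {..<e} (p y) x"
        unfolding complex_norm_square using y by (simp add: c_def)
    qed
    also have "\<dots> = of_real (\<Phi> / real e * (N x)\<^sup>2)"
      unfolding frame[OF x x] ell2_inner_self[OF x] of_real_mult ..
    finally have "(\<Sum>y<n. (cmod (c x y))\<^sup>2) = \<Phi> / real e * (N x)\<^sup>2" unfolding of_real_eq_iff .
    then have "?M (c x) = sqrt (\<Phi> / real e * (N x)\<^sup>2)" unfolding ell2_norm_lessThan[of n] by (simp only:)
    then show ?thesis by (simp only: real_sqrt_mult real_sqrt_abs abs_of_nonneg[OF ell2_norm_nonneg] q_def)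
  qed
  have step: "?M (\<lambda>y. c (X w) (\<sigma> s y) - c (X (push s w)) y) \<le> b * sqrt (\<epsilon> * \<Phi>)"
    if s: "s < 5" and w: "w \<in> Bl" "push s w \<in> Bl" for s w
  proof -
    have "(\<Sum>y<n. (cmod (c (X w) (\<sigma> s y) - c (X (push s w)) y))\<^sup>2)
        \<le> (\<Sum>y<n. b\<^sup>2 * (N (\<lambda>i. p (\<sigma> s y) i - T s (p y) i))\<^sup>2)"
    proof (rule sum_mono)
      fix y assume "y \<in> {..<n}"
      then have y: "y < n" by simp
      have y': "\<sigma> s y < n" by (rule Sig_less[OF \<sigma> y])
      have "ell2_inner {..<e} (X (push s w)) (p y) = ell2_inner {..<e} (X w) (T s (p y))"
        unfolding TX[OF s w, symmetric] by (rule reflectionD(5)[OF R[OF s] X[OF w(1)] p[OF y]])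
      then have "c (X w) (\<sigma> s y) - c (X (push s w)) y
          = ell2_inner {..<e} (X w) (\<lambda>i. p (\<sigma> s y) i - T s (p y) i)"
        unfolding ell2_inner_diff_right[OF p[OF y'] TV[OF s p[OF y]] X[OF w(1)]]
        using y y' by (simp add: c_def)
      then have "cmod (c (X w) (\<sigma> s y) - c (X (push s w)) y) \<le> b * N (\<lambda>i. p (\<sigma> s y) i - T s (p y) i)"
        using ell2_cauchy_schwarz[OF X[OF w(1)] ell2_diff(1)[OF p[OF y'] TV[OF s p[OF y]]]] Xb[OF w(1)] by simp
      then show "(cmod (c (X w) (\<sigma> s y) - c (X (push s w)) y))\<^sup>2 \<le> b\<^sup>2 * (N (\<lambda>i. p (\<sigma> s y) i - T s (p y) i))\<^sup>2"
        unfolding power_mult_distrib[symmetric] by (rule power_mono) simp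
    qed
    also have "\<dots> \<le> b\<^sup>2 * (\<epsilon> * \<Phi>)"
      unfolding sum_distrib_left[symmetric] by (rule mult_left_mono[OF near[OF s]]) simp
    finally have "sqrt (\<Sum>y<n. (cmod (c (X w) (\<sigma> s y) - c (X (push s w)) y))\<^sup>2) \<le> sqrt (b\<^sup>2 * (\<epsilon> * \<Phi>))"
      by (rule real_sqrt_le_mono)
    then show ?thesis unfolding ell2_norm_lessThan real_sqrt_mult[of "b\<^sup>2"] using b0 by simp
  qed
  \<comment> \<open>The true orbit of the image of X [] under the permutations. The reversed word
    appears because functions are pulled back along the inverse.\<close>
  define w0 where "w0 g y = c (X []) (foldr \<sigma> (rev g) y)" for g y
  have w00: "w0 g y = 0" if "n \<le> y" for g y
    unfolding w0_def foldr_Sig_ge[OF \<sigma> that] by (rule c0[OF that])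
  \<comment> \<open>Permutations preserve the norm, so each letter adds only one error of the size
    in \<open>step\<close>.\<close>
  have err: "?M (\<lambda>y. w0 g y - c (X g) y) \<le> real (length g) * (b * sqrt (\<epsilon> * \<Phi>))" if "g \<in> Bl" for g
    using that
  proof (induction g)
    case Nil
    then show ?case by (simp add: w0_def)
  next
    case (Cons s g)
    then have g: "g \<in> Bl" and s: "s < 5" and ps: "push s g = s # g"
      by (auto simp: Bl_def Red_Cons intro!: push_hd)
    define h where "h y = w0 g y - c (X g) y" for y
    have h0: "h y = 0" if "n \<le> y" for y using that by (simp add: h_def w00 c0)
    have \<sigma>y: "\<sigma> s y = y" if "n \<le> y" for y using \<sigma> that by (simp add: Sig_def)
    have "(\<lambda>y. w0 (s # g) y - c (X (s # g)) y)
      = (\<lambda>y. h (\<sigma> s y) + (c (X g) (\<sigma> s y) - c (X (push s g)) y))"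
      by (simp add: h_def w0_def ps fun_eq_iff)
    then have "?M (\<lambda>y. w0 (s # g) y - c (X (s # g)) y)
        \<le> ?M (\<lambda>y. h (\<sigma> s y)) + ?M (\<lambda>y. c (X g) (\<sigma> s y) - c (X (push s g)) y)"
      by (simp only:) (rule ell2_add(2); rule mem; simp add: h0 \<sigma>y c0)
    also have "?M (\<lambda>y. h (\<sigma> s y)) = ?M h" by (rule ell2_norm_Sig[OF \<sigma>])
    also have "?M h \<le> real (length g) * (b * sqrt (\<epsilon> * \<Phi>))" using Cons.IH[OF g] by (simp add: h_def[abs_def])
    also have "?M (\<lambda>y. c (X g) (\<sigma> s y) - c (X (push s g)) y) \<le> b * sqrt (\<epsilon> * \<Phi>)"
      using step[OF s g] Cons.prems by (simp add: ps)
    finally show ?case by (simp add: algebra_simps)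
  qed
  define Y where "Y = (\<lambda>v. \<Sum>g\<in>A. f g * X g v)"
  have fX: "(\<lambda>v. f g * X g v) \<in> V" if "g \<in> A" for g using X that Bl by (auto intro!: ell2_scale(1))
  have YV: "Y \<in> V" unfolding Y_def by (rule ell2_sum(1)[OF fX])
  have cY: "c Y y = (\<Sum>g\<in>A. f g * c (X g) y)" for y
  proof (cases "y < n")
    case True
    then have "c Y y = (\<Sum>g\<in>A. ell2_inner {..<e} (\<lambda>v. f g * X g v) (p y))"
      unfolding Y_def using ell2_inner_sum_left[OF fX p[OF True]] by (simp add: c_def)
    then show ?thesis using True by (simp add: ell2_inner_scale_left c_def)
  qed (simp add: c_def)
  have "c Y = (\<lambda>y. (\<Sum>g\<in>A. f g * w0 g y) + (\<Sum>g\<in>A. - f g * (w0 g y - c (X g) y)))"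
    unfolding fun_eq_iff cY sum.distrib[symmetric] by (simp add: algebra_simps)
  then have "?M (c Y) \<le> ?M (\<lambda>y. \<Sum>g\<in>A. f g * w0 g y) + ?M (\<lambda>y. \<Sum>g\<in>A. - f g * (w0 g y - c (X g) y))"
    by (simp only:) (rule ell2_add(2); rule mem; simp add: w00 c0)
  also have "?M (\<lambda>y. \<Sum>g\<in>A. f g * w0 g y) \<le> r * ?M (c (X []))"
    unfolding w0_def by (rule perm[OF \<sigma> mem]) (rule c0)
  also have "?M (\<lambda>y. \<Sum>g\<in>A. - f g * (w0 g y - c (X g) y)) \<le> (\<Sum>g\<in>A. ?M (\<lambda>y. - f g * (w0 g y - c (X g) y)))"
    by (rule ell2_sum(2)) (rule mem, simp add: w00 c0)
  also have "\<dots> \<le> (\<Sum>g\<in>A. cmod (f g) * (real L * (b * sqrt (\<epsilon> * \<Phi>))))"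
  proof (rule sum_mono)
    fix g assume g: "g \<in> A"
    have "(\<lambda>y. w0 g y - c (X g) y) \<in> ell2 {..<n}" by (rule mem) (simp add: w00 c0)
    then have "?M (\<lambda>y. - f g * (w0 g y - c (X g) y)) = cmod (f g) * ?M (\<lambda>y. w0 g y - c (X g) y)"
      using ell2_scale(2)[of "\<lambda>y. w0 g y - c (X g) y" _ "- f g"] by simp
    also have "\<dots> \<le> cmod (f g) * (real (length g) * (b * sqrt (\<epsilon> * \<Phi>)))"
      by (rule mult_left_mono[OF err]) (use g Bl in auto)
    also have "\<dots> \<le> cmod (f g) * (real L * (b * sqrt (\<epsilon> * \<Phi>)))"
      using AL[OF g] b0 \<epsilon> \<Phi> by (intro mult_left_mono mult_right_mono) auto
    finally show "?M (\<lambda>y. - f g * (w0 g y - c (X g) y)) \<le> cmod (f g) * (real L * (b * sqrt (\<epsilon> * \<Phi>)))" .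
  qed
  also have "\<dots> = (C - 1) * sqrt (\<epsilon> * \<Phi>)" by (simp add: C_def sum_distrib_right mult.assoc)
  also have "sqrt (\<epsilon> * \<Phi>) = q * (\<delta> / C)"
  proof -
    have "\<epsilon> * \<Phi> = (\<Phi> / real e) * (\<delta> / C)\<^sup>2" by (simp add: \<epsilon>_def)
    then have "sqrt (\<epsilon> * \<Phi>) = sqrt (\<Phi> / real e) * sqrt ((\<delta> / C)\<^sup>2)" by (simp only: real_sqrt_mult)
    moreover have "sqrt ((\<delta> / C)\<^sup>2) = \<delta> / C" using \<delta> C by (simp only: real_sqrt_abs) simp
    ultimately show ?thesis by (simp only: q_def)
  qed
  finally have "q * N Y \<le> r * (q * b) + (C - 1) * (q * (\<delta> / C))"
    unfolding cnorm[OF YV] cnorm[OF X[OF Bl(4)]] Xb[OF Bl(4)] by simp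
  then have "q * N Y \<le> q * (r * b + (C - 1) * (\<delta> / C))" by (simp only: algebra_simps)
  then have "N Y \<le> r * b + (C - 1) * (\<delta> / C)" using q by (simp only: mult_le_cancel_left_pos)
  also have "(C - 1) * (\<delta> / C) \<le> \<delta>" using C \<delta> by (simp add: field_simps)
  finally have "N Y \<le> r * b + \<delta>" by simp
  moreover have "N Y = ell2_norm I (\<lambda>v. \<Sum>g\<in>A. f g * \<xi> g v)"
    unfolding Y_def
  proof (rule ell2_norm_Gram)
    fix k h assume "k \<in> A" "h \<in> A"
    then have kh: "k \<in> Bl" "h \<in> Bl" using Bl by auto
    show "X k \<in> V" by (rule X[OF kh(1)])
    show "\<xi> k \<in> ell2 I" by (rule \<xi>B[OF kh(1)])
    show "ell2_inner {..<e} (X k) (X h) = ell2_inner I (\<xi> k) (\<xi> h)" by (rule XX[OF kh])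
  qed
  ultimately show "ell2_norm I (\<lambda>v. \<Sum>g\<in>A. f g * \<xi> g v) \<le> r * ell2_norm I (\<xi> []) + \<delta>"
    by (simp add: b_def)
qed


section \<open>Weak containment for the chain of finite quotients\<close>

lemma ell2_norm_sq_sum:
  assumes "finite K" "\<And>k. k \<in> K \<Longrightarrow> x k \<in> ell2 J"
  shows "((\<lambda>i. \<Sum>k\<in>K. (cmod (x k i))\<^sup>2) has_sum (\<Sum>k\<in>K. (ell2_norm J (x k))\<^sup>2)) J"
  using assms
proof (induction K rule: finite_induct)
  case (insert k K)
  have "((\<lambda>i. (cmod (x k i))\<^sup>2) has_sum (ell2_norm J (x k))\<^sup>2) J"
    unfolding ell2_norm_sq by (rule has_sum_infsum) (use insert.prems[of k] in \<open>simp add: ell2_def\<close>)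
  from has_sum_add[OF this insert.IH] insert show ?case by simp
qed simp

context
  fixes A :: "nat set" and f :: "nat \<Rightarrow> complex"
  assumes A: "finite A" "A \<subseteq> fq.S" "\<And>s. s \<notin> A \<Longrightarrow> f s = 0"
begin

lemma red_finite_bound:
  assumes "x \<in> ell2 fq.S"
  shows "ell2_norm fq.S (\<lambda>v. \<Sum>s\<in>A. f s * fq.ppop s x v) \<le> fq.red f * ell2_norm fq.S x"
proof -
  have f: "f \<in> ell1 fq.S" by (rule ell1_finite[OF A])
  have "fq.pp f x v = (\<Sum>s\<in>A. f s * fq.ppop s x v)" for v
    unfolding fq.pp_def by (rule infsumI, rule has_sum_finite_neutralI[of A]) (use A in auto)
  then have "fq.pp f x = (\<lambda>v. \<Sum>s\<in>A. f s * fq.ppop s x v)" by blast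
  then show ?thesis
    using op_norm_bound[OF fq.lreg_bop[OF f] assms] by (simp add: fq.lreg_ell1_eq)
qed

text \<open>For each coordinate \<open>i\<close>, the values \<open>\<eta> w i\<close> along the finite group at level \<open>M\<close> form a
  vector of the regular representation; sum its norm estimate over \<open>i\<close>.\<close>

lemma finite_level_bound:
  fixes \<eta> :: "nat list \<Rightarrow> 'j \<Rightarrow> complex"
  assumes M: "M \<noteq> 0"
    and \<eta>: "\<And>w. w \<in> Red \<Longrightarrow> \<eta> w \<in> ell2 J"
    and cong: "\<And>v w. v \<in> Red \<Longrightarrow> w \<in> Red \<Longrightarrow> qrep M v = qrep M w \<Longrightarrow> \<eta> v = \<eta> w"
    and b: "\<And>w. w \<in> Red \<Longrightarrow> ell2_norm J (\<eta> w) = b"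
    and t: "\<And>a. a \<in> Red \<Longrightarrow>
      ell2_norm J (\<lambda>i. \<Sum>s\<in>{s \<in> A. lle M (fq.lv s)}. f s * \<eta> (wmul a (fq.wd s)) i) = t"
  shows "t \<le> fq.red f * b"
proof -
  define B where "B = {s \<in> A. lle M (fq.lv s)}"
  define \<theta> where "\<theta> a i = (\<Sum>s\<in>B. f s * \<eta> (wmul a (fq.wd s)) i)" for a i
  define K where "K = qrep M ` Red"
  have K: "finite K" unfolding K_def by (rule finite_quotient[OF M])
  have KR: "c \<in> Red" if "c \<in> K" for c using that qrep_props(1) by (auto simp: K_def)
  have KK: "qrep M c = c" if "c \<in> K" for c using that fq.rp_rp_same by (auto simp: K_def)
  have SM: "s \<in> fq.S \<Longrightarrow> fq.wd s \<in> Red" for s by (auto elim!: fq.S_cases simp: fq.wd_en qrep_props(1))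
  have \<theta>V: "\<theta> a \<in> ell2 J" if "a \<in> Red" for a
  proof -
    have "(\<lambda>i. f s * \<eta> (wmul a (fq.wd s)) i) \<in> ell2 J" if "s \<in> B" for s
      by (rule ell2_scale(1)[OF \<eta>]) (use that A SM \<open>a \<in> Red\<close> in \<open>auto simp: B_def\<close>)
    then show ?thesis unfolding \<theta>_def[abs_def] by (rule ell2_sum(1))
  qed
  \<comment> \<open>Inverting the word turns right multiplication in the index of \<eta> into the
    left multiplication of the regular representation.\<close>
  define X where "X i v = (if v \<in> fq.en M ` K then \<eta> (rev (fq.wd v)) i else 0)" for i v
  have EK: "fq.en M ` K \<subseteq> fq.S" using KR by auto
  have inj: "inj_on (fq.en M) K" using KK by (auto simp: inj_on_def fq.en_eq)
  have enK: "fq.en M z \<in> fq.en M ` K" if "z \<in> Red" for z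
    by (rule image_eqI[of _ _ "qrep M z"]) (use that in \<open>auto simp: fq.en_eq K_def fq.rp_rp_same\<close>)
  have X: "X i \<in> ell2 fq.S" "(ell2_norm fq.S (X i))\<^sup>2 = (\<Sum>c\<in>K. (cmod (\<eta> (rev c) i))\<^sup>2)" for i
  proof -
    note fin = ell2_finite[of "fq.en M ` K" fq.S "X i", OF finite_imageI[OF K] EK]
    show "X i \<in> ell2 fq.S" by (rule fin) (simp add: X_def)
    have "(ell2_norm fq.S (X i))\<^sup>2 = (\<Sum>v\<in>fq.en M ` K. (cmod (X i v))\<^sup>2)" by (rule fin) (simp add: X_def)
    also have "\<dots> = (\<Sum>c\<in>K. (cmod (\<eta> (rev c) i))\<^sup>2)"
      unfolding sum.reindex[OF inj] o_def by (intro sum.cong refl) (auto simp: X_def fq.wd_en KK)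
    finally show "(ell2_norm fq.S (X i))\<^sup>2 = (\<Sum>c\<in>K. (cmod (\<eta> (rev c) i))\<^sup>2)" .
  qed
  have pX: "fq.ppop s (X i) (fq.en M c) = (if lle M (fq.lv s) then \<eta> (wmul (rev c) (fq.wd s)) i else 0)"
    if s: "s \<in> fq.S" and c: "c \<in> K" for s i c
  proof -
    obtain n w where n: "w \<in> Red" "s = fq.en n w" using s by (rule fq.S_cases)
    note cR = KR[OF c]
    have ww: "qrep M (qrep n w) = qrep M w" if "lle M n" using fq.rp_rp[OF _ _ that n(1)] by simp
    have "\<eta> (rev (qrep M (wmul (rev w) c))) = \<eta> (wmul (rev c) (qrep n w))" if "lle M n"
    proof (rule cong)
      have "qrep M (rev (qrep M (wmul (rev w) c))) = qrep M (rev (wmul (rev w) c))"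
        by (rule fq.rp_rev) (use n cR in \<open>auto simp: qrep_props(1) fq.rp_rp_same\<close>)
      also have "\<dots> = qrep M (wmul (rev c) w)" using n cR by (simp add: rev_wmul)
      also have "\<dots> = qrep M (wmul (rev c) (qrep n w))"
        by (rule fq.rp_cong) (use n cR ww[OF that] in \<open>auto simp: qrep_props(1)\<close>)
      finally show "qrep M (rev (qrep M (wmul (rev w) c))) = qrep M (wmul (rev c) (qrep n w))" .
    qed (use n cR in \<open>auto simp: qrep_props(1)\<close>)
    then show ?thesis using n cR X(1)[of i] enK[of "wmul (rev w) c"]
      by (simp add: fq.ppop_def fq.\<beta>_en fq.wd_en X_def fq.pv_def)
  qed
  have level: "(\<Sum>c\<in>K. (cmod (\<theta> (rev c) i))\<^sup>2) \<le> (fq.red f)\<^sup>2 * (\<Sum>c\<in>K. (cmod (\<eta> (rev c) i))\<^sup>2)" for i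
  proof -
    let ?Y = "\<lambda>v. \<Sum>s\<in>A. f s * fq.ppop s (X i) v"
    have YV: "?Y \<in> ell2 fq.S"
      by (rule ell2_sum(1), rule ell2_scale(1), rule fq.ppop_ell2(1)) (use A X in auto)
    have "?Y (fq.en M c) = \<theta> (rev c) i" if c: "c \<in> K" for c
    proof -
      have "?Y (fq.en M c) = (\<Sum>s\<in>A. if lle M (fq.lv s) then f s * \<eta> (wmul (rev c) (fq.wd s)) i else 0)"
        by (rule sum.cong[OF refl]) (use pX[OF _ c] A in auto)
      then show ?thesis unfolding \<theta>_def B_def using A(1) by (simp add: sum.inter_filter)
    qed
    then have "(\<Sum>c\<in>K. (cmod (\<theta> (rev c) i))\<^sup>2) = (\<Sum>v\<in>fq.en M ` K. (cmod (?Y v))\<^sup>2)"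
      unfolding sum.reindex[OF inj] o_def by (intro sum.cong refl) simp
    also have "\<dots> \<le> (ell2_norm fq.S ?Y)\<^sup>2" by (rule ell2_finite_sq_le[OF YV finite_imageI[OF K] EK])
    also have "\<dots> \<le> (fq.red f * ell2_norm fq.S (X i))\<^sup>2"
      by (rule power_mono[OF red_finite_bound[OF X(1)]]) simp
    finally show ?thesis by (simp add: power_mult_distrib X(2))
  qed
  \<comment> \<open>After summing over the coordinates, all group elements contribute the same norm
    on either side, so the order of the group cancels.\<close>
  have "((\<lambda>i. \<Sum>c\<in>K. (cmod (\<theta> (rev c) i))\<^sup>2) has_sum (\<Sum>c\<in>K. (ell2_norm J (\<theta> (rev c)))\<^sup>2)) J"
    by (rule ell2_norm_sq_sum[OF K]) (simp add: \<theta>V KR)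
  moreover have "((\<lambda>i. (fq.red f)\<^sup>2 * (\<Sum>c\<in>K. (cmod (\<eta> (rev c) i))\<^sup>2)) has_sum
      (fq.red f)\<^sup>2 * (\<Sum>c\<in>K. (ell2_norm J (\<eta> (rev c)))\<^sup>2)) J"
    by (rule has_sum_cmult_right, rule ell2_norm_sq_sum[OF K]) (simp add: \<eta> KR)
  ultimately have "(\<Sum>c\<in>K. (ell2_norm J (\<theta> (rev c)))\<^sup>2) \<le> (fq.red f)\<^sup>2 * (\<Sum>c\<in>K. (ell2_norm J (\<eta> (rev c)))\<^sup>2)"
    by (rule has_sum_mono) (rule level)
  also have "(\<Sum>c\<in>K. (ell2_norm J (\<theta> (rev c)))\<^sup>2) = real (card K) * t\<^sup>2"
    using t by (simp add: \<theta>_def[abs_def] B_def KR)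
  also have "(\<Sum>c\<in>K. (ell2_norm J (\<eta> (rev c)))\<^sup>2) = real (card K) * b\<^sup>2" by (simp add: b KR)
  finally have "real (card K) * t\<^sup>2 \<le> real (card K) * (fq.red f * b)\<^sup>2"
    by (simp add: power_mult_distrib mult.assoc mult.left_commute)
  moreover have "0 < real (card K)"
    using K by (simp add: card_gt_0_iff K_def) (use Red_Nil in blast)
  ultimately have "t\<^sup>2 \<le> (fq.red f * b)\<^sup>2" by (simp only: mult_le_cancel_left_pos)
  moreover have "0 \<le> fq.red f * b"
    using b[OF Red_Nil] by (intro mult_nonneg_nonneg op_norm_nonneg fq.lreg_bop ell1_finite[OF A]) auto
  ultimately show ?thesis by (rule power2_le_imp_le)
qed

text \<open>Choose a level M above \<open>n\<close> and above all levels occurring in A. There only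
  the top elements of A act, and \<sigma> is one of the actions defining the quotient, so its
  permutation representation factors through it.\<close>

lemma permutation_bound:
  assumes lvA: "\<And>s. s \<in> A \<Longrightarrow> fq.lv s \<le> N" and \<sigma>: "\<sigma> \<in> Sig n" and \<zeta>: "\<zeta> \<in> ell2 {..<n}"
  shows "ell2_norm {..<n} (\<lambda>y. \<Sum>s\<in>{s \<in> A. fq.lv s = 0}. f s * \<zeta> (foldr \<sigma> (rev (fq.wd s)) y))
    \<le> fq.red f * ell2_norm {..<n} \<zeta>"
proof -
  define M where "M = Suc (max n N)"
  have "n \<le> M" by (simp add: M_def)
  then have \<sigma>M: "\<sigma> \<in> Sig M" using \<sigma> Sig_mono[of n M] by blast
  have inv: "\<sigma> s (\<sigma> s k) = k" for s k using \<sigma> by (simp add: Sig_def)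
  define \<eta> where "\<eta> w y = \<zeta> (foldr \<sigma> (rev w) y)" for w y
  have shift: "ell2_norm {..<n} (\<lambda>y. h (foldr \<sigma> w y)) = ell2_norm {..<n} h" for h w
  proof (induction w arbitrary: h)
    case (Cons s w)
    show ?case using Cons.IH[of "\<lambda>y. h (\<sigma> s y)"] ell2_norm_Sig[OF \<sigma>, of h s] by simp
  qed simp
  have level: "{s \<in> A. lle M (fq.lv s)} = {s \<in> A. fq.lv s = 0}"
    using lvA by (fastforce simp: lle_def M_def)
  have SM: "s \<in> A \<Longrightarrow> fq.wd s \<in> Red" for s
    using A(2) by (force elim!: fq.S_cases simp: fq.wd_en qrep_props(1))
  have "ell2_norm {..<n} (\<lambda>y. \<Sum>s\<in>{s \<in> A. fq.lv s = 0}. f s * \<eta> (fq.wd s) y) \<le> fq.red f * ell2_norm {..<n} \<zeta>"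
  proof (rule finite_level_bound[where M = M and \<eta> = \<eta>])
    show "M \<noteq> 0" by (simp add: M_def)
    show "\<eta> w \<in> ell2 {..<n}" if "w \<in> Red" for w
      by (rule ell2_finite(1)[of "{..<n}"]) (use foldr_Sig_ge[OF \<sigma>] \<zeta> in \<open>auto simp: \<eta>_def ell2_def\<close>)
    show "\<eta> v = \<eta> w" if "v \<in> Red" "w \<in> Red" "qrep M v = qrep M w" for v w
    proof -
      have "qrep M (rev v) = qrep M (rev w)" by (rule fq.rp_rev) (use that in auto)
      then have "eqv M (rev v) (rev w)" using that by (simp add: qrep_eq M_def)
      then have "foldr \<sigma> (rev v) = foldr \<sigma> (rev w)" using \<sigma>M by (simp add: eqv_def)
      then show ?thesis by (simp add: \<eta>_def fun_eq_iff)
    qed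
    show "ell2_norm {..<n} (\<eta> w) = ell2_norm {..<n} \<zeta>" if "w \<in> Red" for w
      unfolding \<eta>_def[abs_def] by (rule shift)
    show "ell2_norm {..<n} (\<lambda>i. \<Sum>s\<in>{s \<in> A. lle M (fq.lv s)}. f s * \<eta> (wmul a (fq.wd s)) i)
      = ell2_norm {..<n} (\<lambda>y. \<Sum>s\<in>{s \<in> A. fq.lv s = 0}. f s * \<eta> (fq.wd s) y)" if a: "a \<in> Red" for a
    proof -
      have "\<eta> (wmul a (fq.wd s)) y = \<eta> (fq.wd s) (foldr \<sigma> (rev a) y)" if "s \<in> A" for s y
        using rev_wmul[OF a SM[OF that]] foldr_wmul[of \<sigma>, OF inv] by (simp add: \<eta>_def)
      then have "(\<lambda>i. \<Sum>s\<in>{s \<in> A. lle M (fq.lv s)}. f s * \<eta> (wmul a (fq.wd s)) i)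
        = (\<lambda>i. \<Sum>s\<in>{s \<in> A. fq.lv s = 0}. f s * \<eta> (fq.wd s) (foldr \<sigma> (rev a) i))"
        unfolding level by (intro ext sum.cong refl) simp
      then show ?thesis by (simp only: shift[of "\<lambda>y. \<Sum>s\<in>{s \<in> A. fq.lv s = 0}. f s * \<eta> (fq.wd s) y"])
    qed
  qed
  then show ?thesis by (simp add: \<eta>_def)
qed

section \<open>Splitting a representation along the chain of idempotents\<close>

context
  fixes J :: "'j set" and \<pi> :: "(nat \<Rightarrow> complex) \<Rightarrow> 'j oper"
  assumes \<pi>: "star_rep fq.S fq.mul J \<pi>"
begin

definition U :: "nat \<Rightarrow> nat list \<Rightarrow> 'j oper" where
  "U n w = \<pi> (delta (fq.en n w))"

lemma U_ell2: "w \<in> Red \<Longrightarrow> x \<in> ell2 J \<Longrightarrow> U n w x \<in> ell2 J"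
  unfolding U_def by (rule fq.rep_ell2[OF \<pi>]) auto

lemma U_bop: "w \<in> Red \<Longrightarrow> U n w \<in> bop J"
  unfolding U_def by (rule fq.rep_bop[OF \<pi>]) auto

lemma U_U: "w \<in> Red \<Longrightarrow> v \<in> Red \<Longrightarrow> U n w (U m v x) = U (lmeet n m) (wmul w v) x"
  unfolding U_def using fq.rep_mul[OF \<pi>, of "fq.en n w" "fq.en m v"] by (simp add: fq.mul_en)

lemma U_adjoint: "w \<in> Red \<Longrightarrow> x \<in> ell2 J \<Longrightarrow> y \<in> ell2 J \<Longrightarrow>
    ell2_inner J (U n w x) y = ell2_inner J x (U n (rev w) y)"
  unfolding U_def using fq.rep_adjoint[OF \<pi>, of "fq.en n w"] by (simp add: fq.star_en)

lemma U_cong: "qrep n v = qrep n w \<Longrightarrow> U n v = U n w"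
  unfolding U_def using fq.en_eq[of n v n w] by simp

lemma U_norm:
  assumes w: "w \<in> Red" and x: "x \<in> ell2 J" and fx: "U n [] x = x"
  shows "ell2_norm J (U n w x) = ell2_norm J x"
proof (rule antisym)
  have contr: "ell2_norm J (U n v y) \<le> ell2_norm J y" if "v \<in> Red" "y \<in> ell2 J" for v y
    unfolding U_def by (rule fq.rep_contr[OF \<pi>]) (use that in auto)
  show "ell2_norm J (U n w x) \<le> ell2_norm J x" by (rule contr[OF w x])
  have "U n (rev w) (U n w x) = x" using w fx by (simp add: U_U)
  then show "ell2_norm J x \<le> ell2_norm J (U n w x)"
    using contr[of "rev w" "U n w x"] w x by (simp add: U_ell2)
qed

lemma pi_f: "\<pi> f x = (\<lambda>i. \<Sum>s\<in>A. f s * U (fq.lv s) (fq.wd s) x i)"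
proof -
  have "fq.en (fq.lv s) (fq.wd s) = s" if "s \<in> A" for s
    using A(2) that by (auto elim!: fq.S_cases simp: fq.wd_en fq.en_eq fq.rp_rp_same)
  moreover have "\<pi> f x = (\<lambda>i. \<Sum>s\<in>A. f s * \<pi> (delta s) x i)"
    by (rule star_rep_finite[OF \<pi> A(1,2)]) (rule A(3))
  ultimately show ?thesis by (simp add: U_def)
qed

lemma wdA: "s \<in> A \<Longrightarrow> fq.wd s \<in> Red"
  using A(2) by (force elim!: fq.S_cases simp: fq.wd_en qrep_props(1))

lemma pi_bop: "\<pi> f \<in> bop J"
  by (rule star_repD(1)[OF \<pi> ell1_finite(1)[OF A]])

lemma U_pi_f:
  assumes "w \<in> Red" "x \<in> ell2 J"
  shows "U n w (\<pi> f x) = (\<lambda>i. \<Sum>s\<in>A. f s * U (lmeet n (fq.lv s)) (wmul w (fq.wd s)) x i)"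
proof -
  have V: "U (fq.lv s) (fq.wd s) x \<in> ell2 J" if "s \<in> A" for s by (rule U_ell2[OF wdA[OF that] assms(2)])
  have "U n w (\<pi> f x) = (\<lambda>i. \<Sum>s\<in>A. U n w (\<lambda>i. f s * U (fq.lv s) (fq.wd s) x i) i)"
    unfolding pi_f by (rule bop_sum[OF U_bop[OF assms(1)]]) (rule ell2_scale(1)[OF V])
  also have "\<dots> = (\<lambda>i. \<Sum>s\<in>A. f s * U (lmeet n (fq.lv s)) (wmul w (fq.wd s)) x i)"
    by (intro ext sum.cong refl) (simp add: bop_scale[OF U_bop[OF assms(1)] V] U_U[OF assms(1) wdA])
  finally show ?thesis .
qed

lemma pi_U_central:
  assumes "x \<in> ell2 J" shows "U n [] (\<pi> f x) = \<pi> f (U n [] x)"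
  unfolding U_pi_f[OF Red_Nil assms] pi_f[of "U n [] x"]
  by (intro ext sum.cong refl) (simp add: U_U wdA lmeet_comm)

definition good :: "('j \<Rightarrow> complex) \<Rightarrow> bool" where
  "good x \<longleftrightarrow> x \<in> ell2 J \<and> ell2_norm J (\<pi> f x) \<le> fq.red f * ell2_norm J x"

text \<open>The idempotent of level k acts as a projection commuting with \<open>\<pi> f\<close>, so
  the two summands are orthogonal and remain so after \<open>\<pi> f\<close>.\<close>

lemma good_add:
  assumes x: "good x" "U k [] x = x" and y: "good y" "U k [] y = (\<lambda>i. 0)"
  shows "good (\<lambda>i. x i + y i)"
proof -
  have orth: "(ell2_norm J (\<lambda>i. u i + v i))\<^sup>2 = (ell2_norm J u)\<^sup>2 + (ell2_norm J v)\<^sup>2"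
    if "u \<in> ell2 J" "v \<in> ell2 J" "U k [] u = u" "U k [] v = (\<lambda>i. 0)" for u v
    using U_adjoint[OF Red_Nil that(1,2), of k] that by (intro ell2_pythagoras) auto
  have xV: "x \<in> ell2 J" and yV: "y \<in> ell2 J" using assms by (simp_all add: good_def)
  note V = bop_ell2[OF pi_bop xV] bop_ell2[OF pi_bop yV]
  have "(ell2_norm J (\<lambda>i. \<pi> f x i + \<pi> f y i))\<^sup>2 = (ell2_norm J (\<pi> f x))\<^sup>2 + (ell2_norm J (\<pi> f y))\<^sup>2"
    by (rule orth[OF V]) (simp_all add: pi_U_central xV yV x(2) y(2) bop_zero[OF pi_bop])
  also have "\<dots> \<le> (fq.red f * ell2_norm J x)\<^sup>2 + (fq.red f * ell2_norm J y)\<^sup>2"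
    using x(1) y(1) by (intro add_mono power_mono) (simp_all add: good_def)
  also have "\<dots> = (fq.red f * ell2_norm J (\<lambda>i. x i + y i))\<^sup>2"
    by (simp add: power_mult_distrib orth[OF xV yV x(2) y(2)] distrib_left)
  finally have "ell2_norm J (\<lambda>i. \<pi> f x i + \<pi> f y i) \<le> fq.red f * ell2_norm J (\<lambda>i. x i + y i)"
    by (rule power2_le_imp_le)
      (intro mult_nonneg_nonneg op_norm_nonneg fq.lreg_bop ell1_finite[OF A] ell2_norm_nonneg)
  then show ?thesis using ell2_add(1)[OF xV yV] by (simp add: good_def bop_add[OF pi_bop xV yV])
qed

text \<open>Such an x belongs to level j alone: elements of lower positive levels annihilate it, all
  others act through the finite group at level j, and \<open>finite_level_bound\<close> applies to
  its orbit.\<close>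

lemma good_finite_level:
  assumes j: "j \<noteq> 0" and x: "x \<in> ell2 J" and fx: "U j [] x = x"
    and kill: "\<And>n w. w \<in> Red \<Longrightarrow> 0 < n \<Longrightarrow> n < j \<Longrightarrow> U n w x = (\<lambda>i. 0)"
  shows "good x"
proof -
  have pf: "\<pi> f x = (\<lambda>i. \<Sum>s\<in>{s \<in> A. lle j (fq.lv s)}. f s * U j (fq.wd s) x i)"
  proof
    fix i
    have "U (fq.lv s) (fq.wd s) x i = (if lle j (fq.lv s) then U j (fq.wd s) x i else 0)" if s: "s \<in> A" for s
    proof (cases "lle j (fq.lv s)")
      case True
      have "U (fq.lv s) (fq.wd s) x = U (fq.lv s) (fq.wd s) (U j [] x)" by (simp add: fx)
      also have "\<dots> = U j (fq.wd s) x"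
        using True by (simp only: U_U[OF wdA[OF s] Red_Nil] lmeet_eq_iff[THEN iffD2] wmul_Nil2[OF wdA[OF s]])
      finally show ?thesis using True by simp
    next
      case False
      then have "0 < fq.lv s" "fq.lv s < j" using j by (auto simp: lle_def)
      then show ?thesis using False kill[OF wdA[OF s]] by simp
    qed
    then have "\<pi> f x i = (\<Sum>s\<in>A. if lle j (fq.lv s) then f s * U j (fq.wd s) x i else 0)"
      unfolding pi_f by (intro sum.cong refl) simp
    then show "\<pi> f x i = (\<Sum>s\<in>{s \<in> A. lle j (fq.lv s)}. f s * U j (fq.wd s) x i)"
      using A(1) by (simp add: sum.inter_filter)
  qed
  have "ell2_norm J (\<pi> f x) \<le> fq.red f * ell2_norm J x"
  proof (rule finite_level_bound[where M = j and \<eta> = "\<lambda>w. U j w x", OF j])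
    show "U j w x \<in> ell2 J" "ell2_norm J (U j w x) = ell2_norm J x" if "w \<in> Red" for w
      by (rule U_ell2[OF that x], rule U_norm[OF that x fx])
    show "U j v x = U j w x" if "qrep j v = qrep j w" for v w by (simp only: U_cong[OF that])
    show "ell2_norm J (\<lambda>i. \<Sum>s\<in>{s \<in> A. lle j (fq.lv s)}. f s * U j (wmul a (fq.wd s)) x i)
      = ell2_norm J (\<pi> f x)" if a: "a \<in> Red" for a
    proof -
      have V: "U j (fq.wd s) x \<in> ell2 J" if "s \<in> A" for s by (rule U_ell2[OF wdA[OF that] x])
      have "U j a (\<pi> f x) = (\<lambda>i. \<Sum>s\<in>{s \<in> A. lle j (fq.lv s)}. U j a (\<lambda>i. f s * U j (fq.wd s) x i) i)"
        unfolding pf by (rule bop_sum[OF U_bop[OF a]]) (use V in \<open>auto intro!: ell2_scale(1)\<close>)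
      also have "\<dots> = (\<lambda>i. \<Sum>s\<in>{s \<in> A. lle j (fq.lv s)}. f s * U j (wmul a (fq.wd s)) x i)"
        by (intro ext sum.cong refl) (simp add: bop_scale[OF U_bop[OF a] V] U_U[OF a wdA])
      finally show ?thesis
        using U_norm[OF a bop_ell2[OF pi_bop x], of j] by (simp add: pi_U_central x fx)
    qed
  qed
  then show ?thesis using x by (simp add: good_def)
qed

text \<open>The idempotent of level N dominates all positive levels met by A, so only top elements
  act on x. The free product acts on x unitarily, and \<open>finite_approximation\<close> reduces
  the bound to \<open>permutation_bound\<close>.\<close>

lemma good_top:
  assumes lvA: "\<And>s. s \<in> A \<Longrightarrow> fq.lv s \<le> N" and x: "x \<in> ell2 J"
    and fx: "U 0 [] x = x" and kill: "U N [] x = (\<lambda>i. 0)"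
  shows "good x"
proof -
  define A0 where "A0 = {s \<in> A. fq.lv s = 0}"
  have A0: "finite A0" "\<And>s. s \<in> A0 \<Longrightarrow> s \<in> A" "\<And>s. s \<in> A0 \<Longrightarrow> fq.lv s = 0" using A(1) by (auto simp: A0_def)
  have en0: "fq.en 0 (fq.wd s) = s" if "s \<in> A0" for s
    using subsetD[OF A(2) A0(2)[OF that]] A0(3)[OF that]
    by (auto elim!: fq.S_cases simp: fq.wd_en fq.en_eq fq.rp_rp_same)
  have inj: "inj_on fq.wd A0" by (rule inj_on_inverseI[of _ "fq.en 0"]) (rule en0)
  have pf: "\<pi> f x = (\<lambda>i. \<Sum>g\<in>fq.wd ` A0. f (fq.en 0 g) * U 0 g x i)"
  proof
    fix i
    have "U (fq.lv s) (fq.wd s) x i = (if fq.lv s = 0 then U 0 (fq.wd s) x i else 0)" if s: "s \<in> A" for s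
    proof (cases "fq.lv s = 0")
      case False
      then have "lmeet (fq.lv s) N = fq.lv s" using lvA[OF s] by (auto simp: lmeet_def)
      then have "U (fq.lv s) (fq.wd s) x = U (fq.lv s) (fq.wd s) (U N [] x)"
        by (simp add: U_U[OF wdA[OF s]] wmul_Nil2[OF wdA[OF s]])
      also have "\<dots> = (\<lambda>i. 0)" unfolding kill by (rule bop_zero[OF U_bop[OF wdA[OF s]]])
      finally show ?thesis using False by simp
    qed simp
    then have "\<pi> f x i = (\<Sum>s\<in>A. if fq.lv s = 0 then f s * U 0 (fq.wd s) x i else 0)"
      unfolding pi_f by (intro sum.cong refl) simp
    also have "\<dots> = (\<Sum>s\<in>A0. f s * U 0 (fq.wd s) x i)"
      using A(1) by (simp add: sum.inter_filter A0_def)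
    also have "\<dots> = (\<Sum>g\<in>fq.wd ` A0. f (fq.en 0 g) * U 0 g x i)"
      unfolding sum.reindex[OF inj] o_def by (intro sum.cong refl) (simp add: en0)
    finally show "\<pi> f x i = (\<Sum>g\<in>fq.wd ` A0. f (fq.en 0 g) * U 0 g x i)" .
  qed
  have "ell2_norm J (\<lambda>i. \<Sum>g\<in>fq.wd ` A0. f (fq.en 0 g) * U 0 g x i) \<le> fq.red f * ell2_norm J (U 0 [] x)"
  proof (rule finite_approximation)
    show "finite (fq.wd ` A0)" "fq.wd ` A0 \<subseteq> Red" using A0 wdA by auto
    show "U 0 g x \<in> ell2 J" if "g \<in> Red" for g by (rule U_ell2[OF that x])
    show "ell2_inner J (U 0 (push s g) x) (U 0 (push s h) x) = ell2_inner J (U 0 g x) (U 0 h x)"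
      if s: "s < 5" and g: "g \<in> Red" and h: "h \<in> Red" for s g h
    proof -
      have sR: "[s] \<in> Red" using s by (simp add: Red_Cons)
      have ps: "U 0 (push s k) x = U 0 [s] (U 0 k x)" if "k \<in> Red" for k
        using sR that by (simp add: U_U wmul_def)
      have "U 0 [s] (U 0 [s] (U 0 h x)) = U 0 h x"
        using sR h push_push[OF h, of s] by (simp add: U_U[OF _ push_Red[OF s h]] ps[OF h, symmetric] wmul_def)
      then show ?thesis
        unfolding ps[OF g] ps[OF h]
        using U_adjoint[OF sR U_ell2[OF g x] U_ell2[OF sR U_ell2[OF h x]], of 0 0 0] by simp
    qed
    show "ell2_norm {..<n} (\<lambda>y. \<Sum>g\<in>fq.wd ` A0. f (fq.en 0 g) * \<zeta> (foldr \<sigma> (rev g) y))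
      \<le> fq.red f * ell2_norm {..<n} \<zeta>" if \<sigma>: "\<sigma> \<in> Sig n" and \<zeta>: "\<zeta> \<in> ell2 {..<n}" for n \<sigma> \<zeta>
    proof -
      have "(\<lambda>y. \<Sum>g\<in>fq.wd ` A0. f (fq.en 0 g) * \<zeta> (foldr \<sigma> (rev g) y))
        = (\<lambda>y. \<Sum>s\<in>A0. f s * \<zeta> (foldr \<sigma> (rev (fq.wd s)) y))"
        unfolding sum.reindex[OF inj] o_def by (intro ext sum.cong refl) (simp add: en0)
      then show ?thesis using permutation_bound[OF lvA \<sigma> \<zeta>] by (simp add: A0_def)
    qed
  qed
  then show ?thesis using x fx pf by (simp add: good_def)
qed

text \<open>Telescoping: the difference of consecutive idempotents yields a vector of level j + 1
  alone, orthogonal to the part already treated.\<close>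

lemma good_level:
  assumes x: "x \<in> ell2 J" and "0 < j"
  shows "good (U j [] x)"
  using assms(2)
proof (induction j rule: nat_induct_non_zero)
  case 1
  show ?case by (rule good_finite_level[of 1]) (auto simp: U_U U_ell2 x)
next
  case (Suc j)
  define y where "y = (\<lambda>i. U (Suc j) [] x i - U j [] x i)"
  have m: "lmeet j (Suc j) = j" "lmeet (Suc j) j = j" using Suc.hyps by (simp_all add: lmeet_def)
  have V: "U (Suc j) [] x \<in> ell2 J" "U j [] x \<in> ell2 J" by (auto simp: U_ell2 x)
  have Uy: "U n w y = (\<lambda>i. U (lmeet n (Suc j)) w x i - U (lmeet n j) w x i)" if "w \<in> Red" for n w
    unfolding y_def using that by (simp add: bop_diff[OF U_bop V] U_U)
  have gy: "good y"
  proof (rule good_finite_level[of "Suc j"])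
    show "y \<in> ell2 J" unfolding y_def by (rule ell2_diff(1)[OF V])
    show "U (Suc j) [] y = y" by (simp add: Uy m) (simp add: y_def)
    show "U n w y = (\<lambda>i. 0)" if "w \<in> Red" "0 < n" "n < Suc j" for n w
    proof -
      have "lmeet n (Suc j) = n" "lmeet n j = n" using that Suc.hyps by (auto simp: lmeet_def)
      then show ?thesis using that by (simp add: Uy)
    qed
  qed simp
  have "good (\<lambda>i. U j [] x i + y i)"
    by (rule good_add[OF Suc.IH _ gy, of j]) (simp_all add: Uy U_U m)
  then show ?case by (simp add: y_def)
qed

text \<open>With e_n for the idempotent of level n, x is the sum of e_N x, (e_0 - e_N) x and (1 -
  e_0) x. The last part is the degenerate one, on which \<open>\<pi> f\<close> vanishes.\<close>

lemma pi_f_le_red: "op_norm J (\<pi> f) \<le> fq.red f"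
proof (rule op_norm_le)
  show "0 \<le> fq.red f" by (intro op_norm_nonneg fq.lreg_bop ell1_finite[OF A])
  fix x assume x: "x \<in> ell2 J"
  \<comment> \<open>\<open>Suc\<close> keeps N away from 0, which denotes the top level.\<close>
  define N where "N = Suc (\<Sum>s\<in>A. fq.lv s)"
  have N: "fq.lv s \<le> N" if "s \<in> A" for s
    unfolding N_def by (rule le_SucI, rule member_le_sum[OF that]) (use A in auto)
  have V: "U 0 [] x \<in> ell2 J" "U N [] x \<in> ell2 J" by (auto simp: U_ell2 x)
  define y where "y = (\<lambda>i. U 0 [] x i - U N [] x i)"
  have Uy: "U n [] y = (\<lambda>i. U n [] x i - U (lmeet n N) [] x i)" for n
    unfolding y_def by (simp add: bop_diff[OF U_bop V] U_U)
  have "good y"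
    by (rule good_top[OF N]) (simp_all add: Uy, simp_all add: y_def ell2_diff(1)[OF V])
  then have "good (\<lambda>i. U N [] x i + y i)"
    by (intro good_add[of _ N] good_level x) (simp_all add: Uy U_U N_def)
  then have g0: "good (U 0 [] x)" by (simp add: y_def)
  define z where "z = (\<lambda>i. x i - U 0 [] x i)"
  have zV: "z \<in> ell2 J" unfolding z_def by (rule ell2_diff(1)[OF x V(1)])
  have Uz: "U n w z = (\<lambda>i. 0)" if "w \<in> Red" for n w
    unfolding z_def using that by (simp add: bop_diff[OF U_bop x V(1)] U_U)
  have "\<pi> f z = (\<lambda>i. 0)" unfolding pi_f by (simp add: Uz wdA)
  then have "good z"
    using zV by (simp add: good_def op_norm_nonneg fq.lreg_bop ell1_finite[OF A])
  then have "good (\<lambda>i. U 0 [] x i + z i)" by (intro good_add[OF g0]) (simp_all add: Uz U_U)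
  then show "ell2_norm J (\<pi> f x) \<le> fq.red f * ell2_norm J x" by (simp add: z_def good_def)
qed

end

end

theorem fq_weak_containment: "weak_containment fq.S fq.mul"
proof (rule fq.weak_containmentI_finite)
  fix f :: "nat \<Rightarrow> complex" and A
  assume "finite A" "A \<subseteq> fq.S" "\<And>s. s \<notin> A \<Longrightarrow> f s = 0"
  then show "full_norm fq.S fq.mul f \<le> fq.red f" by (intro full_norm_le pi_f_le_red)
qed


theorem mainTheorem1:
  shows "(\<exists>(S :: nat set) mul G.
            clifford_inverse_semigroup S mul G \<and>
            weak_containment S mul \<and>
            \<not> nuclear S (reduced_cstar S mul) \<and>
            \<not> (\<forall>e\<in>idempotents S mul. left_amenable (G e) mul)) \<and>
         (\<exists>(S :: nat set) mul.
            inverse_semigroup S mul \<and>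
            \<not> has_zero S mul \<and>
            left_amenable S mul \<and>
            \<not> weak_containment S mul)"
proof (intro conjI)
  show "\<exists>(S :: nat set) mul G.
            clifford_inverse_semigroup S mul G \<and>
            weak_containment S mul \<and>
            \<not> nuclear S (reduced_cstar S mul) \<and>
            \<not> (\<forall>e\<in>idempotents S mul. left_amenable (G e) mul)"
  proof (intro exI conjI)
    show "clifford_inverse_semigroup fq.S fq.mul fq.G" by (rule fq.clifford)
    show "weak_containment fq.S fq.mul" by (rule fq_weak_containment)
    show "\<not> nuclear fq.S (reduced_cstar fq.S fq.mul)" by (rule fq.not_nuclear)
    have "fq.en 0 [] \<in> idempotents fq.S fq.mul" unfolding fq.idempotents_eq by blast
    then show "\<not> (\<forall>e\<in>idempotents fq.S fq.mul. left_amenable (fq.G e) fq.mul)"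
      using fq_top_not_amenable by blast
  qed
qed (rule left_amenable_not_weak_containment)

end
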